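(* Let $M\in C([0,T],V_1)$, $M(t,x,\xi)=\chi(\xi,u(t,x))$, satisfy the kinetic formulation $$\partial_t M+a(\xi)\cdot\nabla_x M=\partial_\xi m,\qquad M(0,x,\xi)=\chi(\xi,u_0(x)),$$ with $u_0\in L^1(\mathbb{R}^d)$, for some nonnegative bounded measure $m(t,x,\xi)$. Let $\lambda>0$ and let $f\in C(\mathbb{R}^+;V_1)$ satisfy $$\partial_t f+a(\xi)\cdot\nabla_x f=\lambda\,(M-f),\qquad f(0,x,\xi)=f_0(x,\xi),$$ with $f_0\in V_1$. Put $f_{\lambda,0}(x,\xi)=\chi(\xi,u_0(x))$. Then, for some modulus of continuity $\omega(T,\cdot)$, $$\|f(T)-M(T)\|_{V_1}\le\|f_0-f_{\lambda,0}\|_{V_1}e^{-\lambda T}+\omega\!\left(T,\tfrac1\lambda\right).$$ Moreover, if $u_0\in L^\infty\cap L^1\cap BV(\mathbb{R}^d)$, the dependency in $\lambda$ can be improved as follows: with $K=\|u_0\|_{L^\infty}$ and a constant $C(d)$, $$\|f(T)-M(T)\|_{V_1}\le\|f_0-f_{\lambda,0}\|_{V_1}e^{-\lambda T}+C(d)\,\|a\|_{L^\infty(-K,K)}\sqrt{\frac{T\,\|u_0\|_{BV(\mathbb{R}^d)}}{\lambda}}.$$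
   Context: $V_1=L^1(\mathbb{R}^d_x\times\mathbb{R}_\xi)$. For $\xi,u\in\mathbb{R}$, $\chi(\xi,u)=+1$ if $0<\xi<u$, $-1$ if $u<\xi<0$, and $0$ otherwise; hence $u(t,x)=\int_{\mathbb{R}}\chi(\xi,u(t,x))\,d\xi$. The function $a=(A_1',\dots,A_d')$ is the velocity associated with the scalar conservation law $\partial_t u+\sum_{i=1}^d\partial_{x_i}A_i(u)=0$ with initial datum $u_0$; the kinetic formulation for $M$ is equivalent to this conservation law together with its family of entropy inequalities. $\|\cdot\|_{BV(\mathbb{R}^d)}$ is the $BV$ norm. Equations are understood in the sense of distributions.
   Formalization: In the second estimate the constant C(d) is replaced by one depending on d and on an upper bound R for the BV norm of u_0; with C(d) alone the printed estimate fails under the scaling u → κu, a(ξ) → a(ξ/κ), κ → ∞ (e.g. Burgers with a shock). *)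

theory Defs
  imports "HOL-Probability.Essential_Supremum"
begin

section \<open>The space \<open>V\<^sub>1 = L\<^sup>1(\<real>\<^sup>d \<times> \<real>)\<close>\<close>

text \<open>The type variable \<open>'n\<close> indexes the space coordinates, so that \<open>d = CARD('n)\<close>. Elements of
  \<open>L\<^sup>1\<close> are represented by Borel functions; wherever two of them are identified, the identification
  is almost everywhere.\<close>

definition V1 :: "((real^'n::finite) \<times> real \<Rightarrow> real) set"
  where "V1 = {g. integrable lborel g}"

definition V1_norm :: "((real^'n::finite) \<times> real \<Rightarrow> real) \<Rightarrow> real"
  where "V1_norm g = (LINT z|lborel. \<bar>g z\<bar>)"

definition continuous_V1 :: "real set \<Rightarrow> (real \<Rightarrow> (real^'n::finite) \<times> real \<Rightarrow> real) \<Rightarrow> bool"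
  where "continuous_V1 I F \<longleftrightarrow> (\<forall>t\<in>I. F t \<in> V1) \<and>
    (\<forall>t\<in>I. ((\<lambda>s. V1_norm (\<lambda>z. F s z - F t z)) \<longlongrightarrow> 0) (at t within I))"

definition chi :: "real \<Rightarrow> real \<Rightarrow> real"
  where "chi \<xi> u = (if 0 < \<xi> \<and> \<xi> < u then 1 else if u < \<xi> \<and> \<xi> < 0 then -1 else 0)"

section \<open>Norms of the data\<close>

definition Linf_norm :: "'a measure \<Rightarrow> ('a \<Rightarrow> 'b::real_normed_vector) \<Rightarrow> ennreal"
  where "Linf_norm N g = esssup N (\<lambda>x. ennreal (norm (g x)))"

definition C1c :: "('a::euclidean_space \<Rightarrow> 'b::euclidean_space) set"
  where "C1c = {\<phi>. (\<forall>x. \<phi> differentiable (at x)) \<and>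
    (\<forall>v. continuous_on UNIV (\<lambda>x. frechet_derivative \<phi> (at x) v)) \<and>
    compact (closure {x. \<phi> x \<noteq> 0})}"

definition divergence :: "(real^'n::finite \<Rightarrow> real^'n) \<Rightarrow> real^'n \<Rightarrow> real"
  where "divergence \<phi> x = (\<Sum>i\<in>UNIV. frechet_derivative \<phi> (at x) (axis i 1) $ i)"

definition total_variation :: "(real^'n::finite \<Rightarrow> real) \<Rightarrow> ennreal"
  where "total_variation u =
    (SUP \<phi>\<in>{\<phi>\<in>C1c. \<forall>x. norm (\<phi> x) \<le> 1}. ennreal (LINT x|lborel. u x * divergence \<phi> x))"

definition BV :: "(real^'n::finite \<Rightarrow> real) set"
  where "BV = {u. integrable lborel u \<and> total_variation u < \<infinity>}"

definition BV_norm :: "(real^'n::finite \<Rightarrow> real) \<Rightarrow> real"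
  where "BV_norm u = (LINT x|lborel. \<bar>u x\<bar>) + enn2real (total_variation u)"

section \<open>Test functions\<close>

fun iterated_derivative :: "'a::euclidean_space list \<Rightarrow> ('a \<Rightarrow> real) \<Rightarrow> 'a \<Rightarrow> real" where
  "iterated_derivative [] \<phi> = \<phi>"
| "iterated_derivative (v # vs) \<phi> =
    (\<lambda>x. frechet_derivative (iterated_derivative vs \<phi>) (at x) v)"

definition test_function :: "'a::euclidean_space set \<Rightarrow> ('a \<Rightarrow> real) \<Rightarrow> bool"
  where "test_function U \<phi> \<longleftrightarrow> (\<forall>vs x. iterated_derivative vs \<phi> differentiable (at x)) \<and>
    compact (closure {x. \<phi> x \<noteq> 0}) \<and> closure {x. \<phi> x \<noteq> 0} \<subseteq> U"

section \<open>The equations\<close>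

text \<open>The fluxes are only assumed locally Lipschitz, so that \<open>a = (A\<^sub>1', \<dots>, A\<^sub>d')\<close> holds almost
  everywhere and \<open>a\<close> is locally (essentially) bounded. The case of \<open>C\<^sup>1\<close> fluxes is included.\<close>

definition flux_velocity :: "(real \<Rightarrow> real^'n::finite) \<Rightarrow> (real \<Rightarrow> real^'n) \<Rightarrow> bool"
  where "flux_velocity A a \<longleftrightarrow> (\<forall>R. \<exists>L. L-lipschitz_on {-R..R} A) \<and> a \<in> borel_measurable borel \<and>
    (AE \<xi> in lborel. (A has_vector_derivative a \<xi>) (at \<xi>))"

text \<open>The pairing of \<open>\<partial>\<^sub>t g + a(\<xi>) \<cdot> \<nabla>\<^sub>x g\<close> with \<open>\<phi>\<close>, where \<open>g\<close> is continuous into \<open>V\<^sub>1\<close> and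
  \<open>\<phi>\<close> is a test function on \<open>(0,T) \<times> \<real>\<^sup>d \<times> \<real>\<close>. Points of space-time are triples \<open>(t, x, \<xi>)\<close>.\<close>

definition transport_pairing ::
  "real \<Rightarrow> (real \<Rightarrow> real^'n::finite) \<Rightarrow> (real \<Rightarrow> (real^'n) \<times> real \<Rightarrow> real) \<Rightarrow>
    (real \<times> (real^'n) \<times> real \<Rightarrow> real) \<Rightarrow> real"
  where "transport_pairing T a g \<phi> =
    - (LINT t:{0..T}|lborel. (LINT (x, \<xi>)|lborel. g t (x, \<xi>) *
        (frechet_derivative \<phi> (at (t, x, \<xi>)) (1, 0, 0)
         + frechet_derivative \<phi> (at (t, x, \<xi>)) (0, a \<xi>, 0))))"

text \<open>The measure \<open>m\<close> lives on the whole space-time, but only its restriction to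
  \<open>(0,T) \<times> \<real>\<^sup>d \<times> \<real>\<close> is seen by the equation.\<close>

definition kinetic_solution ::
  "real \<Rightarrow> (real \<Rightarrow> real^'n::finite) \<Rightarrow> (real^'n \<Rightarrow> real) \<Rightarrow>
    (real \<Rightarrow> (real^'n) \<times> real \<Rightarrow> real) \<Rightarrow> (real \<Rightarrow> real^'n \<Rightarrow> real) \<Rightarrow>
    (real \<times> (real^'n) \<times> real) measure \<Rightarrow> bool"
  where "kinetic_solution T a u0 M u m \<longleftrightarrow>
    continuous_V1 {0..T} M \<and>
    (\<forall>t\<in>{0..T}. AE (x, \<xi>) in lborel. M t (x, \<xi>) = chi \<xi> (u t x)) \<and>
    sets m = sets borel \<and> finite_measure m \<and>
    (\<forall>\<phi>. test_function ({0<..<T} \<times> UNIV \<times> UNIV) \<phi> \<longrightarrow>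
      transport_pairing T a M \<phi> = - (LINT p|m. frechet_derivative \<phi> (at p) (0, 0, 1))) \<and>
    (AE (x, \<xi>) in lborel. M 0 (x, \<xi>) = chi \<xi> (u0 x))"

text \<open>The function \<open>M\<close> is only given on \<open>[0,T]\<close>, so the equation for \<open>f\<close> is posed on \<open>(0,T)\<close>.\<close>

definition relaxation_solution ::
  "real \<Rightarrow> (real \<Rightarrow> real^'n::finite) \<Rightarrow> real \<Rightarrow> (real \<Rightarrow> (real^'n) \<times> real \<Rightarrow> real) \<Rightarrow>
    ((real^'n) \<times> real \<Rightarrow> real) \<Rightarrow> (real \<Rightarrow> (real^'n) \<times> real \<Rightarrow> real) \<Rightarrow> bool"
  where "relaxation_solution T a lam M f0 f \<longleftrightarrow>
    continuous_V1 {0..} f \<and> f0 \<in> V1 \<and>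
    (\<forall>\<phi>. test_function ({0<..<T} \<times> UNIV \<times> UNIV) \<phi> \<longrightarrow>
      transport_pairing T a f \<phi> =
        (LINT t:{0..T}|lborel. (LINT z|lborel. lam * (M t z - f t z) * \<phi> (t, z)))) \<and>
    (AE z in lborel. f 0 z = f0 z)"

definition modulus_of_continuity :: "(real \<Rightarrow> real) \<Rightarrow> bool"
  where "modulus_of_continuity w \<longleftrightarrow> mono_on {0..} w \<and> w 0 = 0 \<and> (w \<longlongrightarrow> 0) (at_right 0)"

end

theory Submission
 imports Defs "HOL-Probability.Probability"
begin

text \<open>Solutions of the kinetic formulation are compared by doubling the variables \<open>(t, x)\<close>, with \<open>\<xi>\<close> fixed:
 the nonnegativity of \<open>m\<close> makes the \<open>L\<^sup>1\<close> distance of two solutions, one of them shifted in \<open>x\<close>,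
 nonincreasing in time. Hence \<open>M\<close> is determined by \<open>u\<^sub>0\<close>, and the total variation and the \<open>L\<^sup>\<infinity>\<close>
 bound of \<open>u\<^sub>0\<close> are propagated. For almost every \<open>\<xi>\<close> the equation for \<open>f\<close> is an ordinary differential
 equation along characteristics, so \<open>f(T) - M(T)\<close> is bounded by averages with weight \<open>\<lambda> exp (- \<lambda> s)\<close> of
 \<open>M(T - s, x - s a(\<xi>), \<xi>) - M(T, x, \<xi>)\<close> over \<open>0 \<le> s \<le> T\<close>. The \<open>L\<^sup>1\<close> norm of this difference tends to
 \<open>0\<close> with \<open>s\<close> by continuity of translations, which gives the modulus. If \<open>u\<^sub>0\<close> has bounded variation, it is at
 most \<open>C(d) \<bar>a\<bar> s TV(u\<^sub>0)\<close>; the shift depends on \<open>\<xi>\<close>, which is dealt with by averaging over all shifts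
 of comparable length. This yields the rate \<open>TV(u\<^sub>0) min(T, 1/\<lambda>)\<close>, and the constant may depend on
 the bound \<open>R\<close> for the \<open>BV\<close> norm.\<close>

text \<open>The hypotheses give little regularity: \<open>a\<close> is only locally essentially
  bounded, and \<open>u\<close>, \<open>M\<close>, \<open>f\<close> come with no measurability
  jointly in time and space. So jointly measurable representatives replace them before any estimate.
  \<xi> can stay undoubled because \<open>kchi\<close> takes values in {-1, 0, 1}: the distance of
  two values is linear up to a single product, so one entropy inequality for each solution, at the
  level of the other, suffices. Cutting off in \<xi> costs the mass of \<open>m\<close> times the
  sup of the derivative of the cutoff, which tends to 0 since \<open>m\<close> is finite. At a
  single \<xi> the shift modulus of the level is not controlled by the variation of u; only its
  integral over \<xi> is, and only for a shift independent of \<xi>. This is the obstacle that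
  averaging removes, at the price of 2^(d+2). The factor enters once for the shift in space and once
  for the change in time, whence 2^(d+3). The resulting rate is linear in the variation V, while the
  statement has a square root: V is at most sqrt R times the root of the BV norm, and this is where
  R enters the constant.\<close>

abbreviation NINT :: "('a::euclidean_space \<Rightarrow> ennreal) \<Rightarrow> ennreal" (binder "NINT " 10)
 where "NINT x. f x \<equiv> integral\<^sup>N lborel f"

abbreviation nabs :: "real \<Rightarrow> ennreal"
 where "nabs x \<equiv> ennreal \<bar>x\<bar>"

abbreviation Bor :: "('a::topological_space \<Rightarrow> 'b::topological_space) set"
 where "Bor \<equiv> borel_measurable borel"

abbreviation Fd :: "('a::real_normed_vector \<Rightarrow> 'b::real_normed_vector) \<Rightarrow> 'a \<Rightarrow> 'a \<Rightarrow> 'b"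
 where "Fd f x \<equiv> frechet_derivative f (at x)"

abbreviation BorL :: "('a::euclidean_space \<Rightarrow> 'b::topological_space) set"
 where "BorL \<equiv> borel_measurable lborel"

abbreviation lintegrable :: "('a::euclidean_space \<Rightarrow> 'b::{banach, second_countable_topology}) \<Rightarrow> bool"
 where "lintegrable \<equiv> integrable lborel"

abbreviation AEL :: "('a::euclidean_space \<Rightarrow> bool) \<Rightarrow> bool" (binder "AEL " 10)
 where "AEL x. P x \<equiv> almost_everywhere lborel P"

lemmas LBINT_cong = Bochner_Integration.integral_cong

subsection \<open>Smooth functions\<close>

definition smooth_fun :: "('a::euclidean_space \<Rightarrow> real) \<Rightarrow> bool"
 where "smooth_fun \<phi> \<longleftrightarrow> (\<forall>vs x. iterated_derivative vs \<phi> differentiable (at x))"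

lemma smooth_fun_coinduct:
 assumes "\<phi> \<in> S"
  and S: "\<And>f. f \<in> S \<Longrightarrow> (\<forall>x. f differentiable (at x)) \<and>
   (\<forall>v. (\<lambda>x. Fd f x v) \<in> S)"
 shows "smooth_fun \<phi>"
proof -
 have "iterated_derivative vs \<phi> \<in> S" for vs
  by (induction vs) (use assms in auto)
 then show ?thesis
  unfolding smooth_fun_def using S by blast
qed

lemma smooth_fun_differentiable: "smooth_fun f \<Longrightarrow> f differentiable (at x)"
 unfolding smooth_fun_def by (metis iterated_derivative.simps(1))

lemma smooth_fun_has_derivative:
 "smooth_fun f \<Longrightarrow> (f has_derivative Fd f x) (at x)"
 using smooth_fun_differentiable frechet_derivative_works by blast

lemma smooth_fun_linear: "smooth_fun f \<Longrightarrow> bounded_linear (Fd f x)"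
 using smooth_fun_has_derivative has_derivative_bounded_linear by blast

lemma smooth_fun_derivative:
 assumes "smooth_fun f"
 shows "smooth_fun (\<lambda>x. Fd f x v)"
proof -
 have "iterated_derivative vs (\<lambda>x. Fd f x v) = iterated_derivative (vs @ [v]) f" for vs
  by (induction vs) auto
 then show ?thesis
  using assms unfolding smooth_fun_def by simp
qed

lemma smooth_fun_continuous_on: "smooth_fun f \<Longrightarrow> continuous_on A f"
 by (meson continuous_at_imp_continuous_on differentiable_imp_continuous_within smooth_fun_differentiable)

lemma smooth_fun_borel [measurable_dest]: "smooth_fun f \<Longrightarrow> f \<in> Bor"
 using borel_measurable_continuous_onI smooth_fun_continuous_on by blast

lemma smooth_fun_real_has_derivative:
 fixes f :: "real \<Rightarrow> real"
 assumes "smooth_fun f"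
 shows "(f has_real_derivative deriv f x) (at x)"
 using smooth_fun_differentiable[OF assms, of x]
 by (simp add: DERIV_deriv_iff_real_differentiable)

lemma smooth_fun_real_frechet:
 fixes f :: "real \<Rightarrow> real"
 assumes "smooth_fun f"
 shows "Fd f x v = deriv f x * v"
 using frechet_derivative_at[OF smooth_fun_real_has_derivative[OF assms, THEN has_field_derivative_imp_has_derivative]]
 by metis

lemma smooth_fun_deriv:
 fixes f :: "real \<Rightarrow> real"
 assumes "smooth_fun f"
 shows "smooth_fun (deriv f)"
 using smooth_fun_derivative[OF assms, of 1] smooth_fun_real_frechet[OF assms] by simp

text \<open>The product and chain rules leave the class of plain products or composites, so the
  coinduction needs a set closed under all operations at once. This inductive closure is such a set,
  and it collapses to \<open>smooth_fun\<close> afterwards.\<close>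

inductive smooth_alg :: "('a::euclidean_space \<Rightarrow> real) \<Rightarrow> bool" where
 base: "smooth_fun f \<Longrightarrow> smooth_alg f"
| const: "smooth_alg (\<lambda>x. c)"
| linear: "bounded_linear f \<Longrightarrow> smooth_alg f"
| add: "smooth_alg f \<Longrightarrow> smooth_alg g \<Longrightarrow> smooth_alg (\<lambda>x. f x + g x)"
| mult: "smooth_alg f \<Longrightarrow> smooth_alg g \<Longrightarrow> smooth_alg (\<lambda>x. f x * g x)"
| inverse: "smooth_alg f \<Longrightarrow> (\<And>x. f x \<noteq> 0) \<Longrightarrow> smooth_alg (\<lambda>x. inverse (f x))"
| compose: "smooth_fun g \<Longrightarrow> smooth_alg f \<Longrightarrow> smooth_alg (\<lambda>x. g (f x :: real))"

lemma smooth_alg_derivative: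
 "smooth_alg f \<Longrightarrow> (\<exists>f'. (\<forall>x. (f has_derivative f' x) (at x)) \<and> (\<forall>v. smooth_alg (\<lambda>x. f' x v)))"
proof (induction rule: smooth_alg.induct)
 case (base f)
 then show ?case
  using smooth_fun_has_derivative[OF base] smooth_alg.base[OF smooth_fun_derivative[OF base]] by meson
next
 case (const c)
 show ?case
  by (intro exI[of _ "\<lambda>x v. 0"] conjI allI has_derivative_const smooth_alg.const)
next
 case (linear f)
 show ?case
  by (intro exI[of _ "\<lambda>x. f"] conjI allI bounded_linear_imp_has_derivative smooth_alg.const linear)
next
 case (add f g)
 then obtain f' g' where *: "\<And>x. (f has_derivative f' x) (at x)" "\<And>v. smooth_alg (\<lambda>x. f' x v)"
  "\<And>x. (g has_derivative g' x) (at x)" "\<And>v. smooth_alg (\<lambda>x. g' x v)" by blast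
 show ?case
  using has_derivative_add[OF *(1,3)] smooth_alg.add[OF *(2,4)]
  by (intro exI[of _ "\<lambda>x v. f' x v + g' x v"] conjI allI)
next
 case (mult f g)
 then obtain f' g' where *: "\<And>x. (f has_derivative f' x) (at x)" "\<And>v. smooth_alg (\<lambda>x. f' x v)"
  "\<And>x. (g has_derivative g' x) (at x)" "\<And>v. smooth_alg (\<lambda>x. g' x v)" by blast
 show ?case
  using has_derivative_mult[OF *(1,3)]
   smooth_alg.add[OF smooth_alg.mult[OF mult.hyps(1) *(4)] smooth_alg.mult[OF *(2) mult.hyps(2)]]
  by (intro exI[of _ "\<lambda>x v. f x * g' x v + f' x v * g x"] conjI allI)
next
 case (inverse f)
 then obtain f' where f': "\<And>x. (f has_derivative f' x) (at x)" "\<And>v. smooth_alg (\<lambda>x. f' x v)"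
  by blast
 have i: "smooth_alg (\<lambda>x. inverse (f x))"
  by (rule smooth_alg.inverse[OF inverse.hyps])
 have "smooth_alg (\<lambda>x. (-1) * (inverse (f x) * f' x v * inverse (f x)))" for v
  by (rule smooth_alg.mult[OF smooth_alg.const smooth_alg.mult[OF smooth_alg.mult[OF i f'(2)] i]])
 then have "smooth_alg (\<lambda>x. - (inverse (f x) * f' x v * inverse (f x)))" for v
  by simp
 moreover have "((\<lambda>x. inverse (f x)) has_derivative (\<lambda>v. - (inverse (f x) * f' x v * inverse (f x)))) (at x)" for x
  by (rule Deriv.has_derivative_inverse[OF inverse.hyps(2) f'(1)])
 ultimately show ?case
  by (intro exI[of _ "\<lambda>x v. - (inverse (f x) * f' x v * inverse (f x))"] conjI allI)
next
 case (compose g f)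
 then obtain f' where f': "\<And>x. (f has_derivative f' x) (at x)" "\<And>v. smooth_alg (\<lambda>x. f' x v)"
  by blast
 have "((\<lambda>x. g (f x)) has_derivative (\<lambda>v. deriv g (f x) * f' x v)) (at x)" for x
  using has_derivative_compose[OF f'(1) smooth_fun_real_has_derivative[OF compose.hyps(1), THEN has_field_derivative_imp_has_derivative]]
  by simp
 moreover have "smooth_alg (\<lambda>x. deriv g (f x) * f' x v)" for v
  by (rule smooth_alg.mult[OF smooth_alg.compose[OF smooth_fun_deriv[OF compose.hyps(1)] compose.hyps(2)] f'(2)])
 ultimately show ?case
  by (intro exI[of _ "\<lambda>x v. deriv g (f x) * f' x v"] conjI allI)
qed

lemma smooth_alg_imp_smooth_fun:
 assumes "smooth_alg f" shows "smooth_fun f"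
proof (rule smooth_fun_coinduct[where S="Collect smooth_alg"])
 fix f :: "'a \<Rightarrow> real" assume "f \<in> Collect smooth_alg"
 then obtain f' where f': "\<And>x. (f has_derivative f' x) (at x)" "\<And>v. smooth_alg (\<lambda>x. f' x v)"
  using smooth_alg_derivative by blast
 have "Fd f x = f' x" for x
  using f'(1) frechet_derivative_at by metis
 moreover have "f differentiable at x" for x
  using f'(1) by (rule differentiableI)
 ultimately show "(\<forall>x. f differentiable at x) \<and>
  (\<forall>v. (\<lambda>x. Fd f x v) \<in> Collect smooth_alg)"
  using f'(2) by simp
qed (use assms in auto)

lemma smooth_fun_const [intro]: "smooth_fun (\<lambda>x. c)"
 by (rule smooth_alg_imp_smooth_fun[OF smooth_alg.const])

lemma smooth_fun_bounded_linear: "bounded_linear f \<Longrightarrow> smooth_fun f"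
 by (rule smooth_alg_imp_smooth_fun[OF smooth_alg.linear])

lemma smooth_fun_add [intro]: "smooth_fun f \<Longrightarrow> smooth_fun g \<Longrightarrow> smooth_fun (\<lambda>x. f x + g x)"
 by (rule smooth_alg_imp_smooth_fun[OF smooth_alg.add[OF smooth_alg.base smooth_alg.base]])

lemma smooth_fun_mult [intro]: "smooth_fun f \<Longrightarrow> smooth_fun g \<Longrightarrow> smooth_fun (\<lambda>x. f x * g x)"
 by (rule smooth_alg_imp_smooth_fun[OF smooth_alg.mult[OF smooth_alg.base smooth_alg.base]])

lemma smooth_fun_inverse: "smooth_fun f \<Longrightarrow> (\<And>x. f x \<noteq> 0) \<Longrightarrow> smooth_fun (\<lambda>x. inverse (f x))"
 by (rule smooth_alg_imp_smooth_fun[OF smooth_alg.inverse[OF smooth_alg.base]])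

lemma smooth_fun_compose_real:
 assumes "smooth_fun g" "smooth_fun f" shows "smooth_fun (\<lambda>x. g (f x :: real))"
 by (rule smooth_alg_imp_smooth_fun[OF smooth_alg.compose[OF assms(1) smooth_alg.base[OF assms(2)]]])

lemma smooth_fun_diff [intro]:
 assumes "smooth_fun f" "smooth_fun g" shows "smooth_fun (\<lambda>x. f x - g x)"
 using smooth_fun_add[OF assms(1) smooth_fun_mult[OF smooth_fun_const[of "-1"] assms(2)]] by simp

lemma smooth_fun_sum:
 assumes "\<And>i. i \<in> I \<Longrightarrow> smooth_fun (f i)"
 shows "smooth_fun (\<lambda>x. \<Sum>i\<in>I. f i x)"
 using assms
proof (induction I rule: infinite_finite_induct)
 case (insert i F)
 then have "smooth_fun (\<lambda>x. f i x + (\<Sum>i\<in>F. f i x))"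
  by (intro smooth_fun_add) auto
 with insert show ?case by simp
qed (auto intro: smooth_fun_const)

lemma smooth_fun_affine:
 fixes L :: "'b::euclidean_space \<Rightarrow> 'a::euclidean_space"
 assumes f: "smooth_fun f" and L: "bounded_linear L"
 shows "smooth_fun (\<lambda>x. f (L x + c))"
proof (rule smooth_fun_coinduct[where S="{\<lambda>x. g (L x + c) | g. smooth_fun g}"])
 fix h assume "h \<in> {\<lambda>x. g (L x + c) | g. smooth_fun g}"
 then obtain g where g: "h = (\<lambda>x. g (L x + c))" "smooth_fun g" by blast
 have 1: "((\<lambda>x. L x + c) has_derivative L) (at x)" for x
  using has_derivative_add[OF bounded_linear_imp_has_derivative[OF L] has_derivative_const[of c]] by simp
 have "(h has_derivative (\<lambda>v. Fd g (L x + c) (L v))) (at x)" for x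
  unfolding g(1) by (rule has_derivative_compose[OF 1 smooth_fun_has_derivative[OF g(2)]])
 moreover from this have "Fd h x = (\<lambda>v. Fd g (L x + c) (L v))" for x
  using frechet_derivative_at by metis
 moreover have "h differentiable at x" for x
  using calculation(1) by (rule differentiableI)
 ultimately show "(\<forall>x. h differentiable at x) \<and>
  (\<forall>v. (\<lambda>x. Fd h x v) \<in> {\<lambda>x. g (L x + c) | g. smooth_fun g})"
  using smooth_fun_derivative[OF g(2)] by auto
qed (use f in auto)

lemma smooth_fun_inner_self: "smooth_fun (\<lambda>x::'a::euclidean_space. x \<bullet> x)"
proof -
 have "smooth_fun (\<lambda>x::'a. \<Sum>i\<in>Basis. (x \<bullet> i) * (x \<bullet> i))"
  by (rule smooth_fun_sum, rule smooth_fun_mult; rule smooth_fun_bounded_linear, rule bounded_linear_inner_left)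
 then show ?thesis by (simp add: euclidean_inner[symmetric])
qed

subsection \<open>Cutoff functions\<close>

text \<open>Differentiating exp (-1/x) produces powers of 1/x as factors. With the exponent as a
  parameter the linear span is closed under differentiation, as \<open>smooth_fun_coinduct\<close>
  asks.\<close>

definition flat_exp :: "nat \<Rightarrow> real \<Rightarrow> real"
 where "flat_exp k x = (if x > 0 then inverse x ^ k * exp (- inverse x) else 0)"

text \<open>With y = 1/h the quotient on the right is y^(k+1) / exp y, which tends to 0 at infinity.
  The limit is the derivative at the junction 0.\<close>

lemma flat_exp_tendsto: "((\<lambda>h. flat_exp k h / h) \<longlongrightarrow> 0) (at 0)"
proof -
 have "((\<lambda>h. inverse h ^ (k + 1) / exp (inverse h)) \<longlongrightarrow> 0) (at_right (0::real))"
  by (rule filterlim_compose[OF tendsto_power_div_exp_0 filterlim_inverse_at_top_right])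
 then have "((\<lambda>h. flat_exp k h / h) \<longlongrightarrow> 0) (at_right 0)"
  by (rule Lim_transform_eventually)
   (auto simp: eventually_at_filter flat_exp_def exp_minus field_simps)
 moreover have "((\<lambda>h. flat_exp k h / h) \<longlongrightarrow> 0) (at_left 0)"
  by (rule Lim_transform_eventually[OF tendsto_const])
   (auto simp: eventually_at_filter flat_exp_def)
 ultimately show ?thesis
  by (simp add: filterlim_at_split)
qed

lemma flat_exp_has_derivative:
 "(flat_exp k has_real_derivative flat_exp (k + 2) x - real k * flat_exp (k + 1) x) (at x)"
proof -
 consider "x > 0" | "x < 0" | "x = 0" by linarith
 then show ?thesis
 proof cases
  case 1
  have "((\<lambda>x. inverse x ^ k * exp (- inverse x)) has_real_derivative
    flat_exp (k + 2) x - real k * flat_exp (k + 1) x) (at x)"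
   using 1 by (auto intro!: derivative_eq_intros simp: flat_exp_def power2_eq_square field_simps power_Suc
    split: nat_diff_split)
  then show ?thesis
   by (rule has_field_derivative_transform_within_open[where S="{0<..}"])
    (use 1 in \<open>auto simp: flat_exp_def\<close>)
 next
  case 2
  have "((\<lambda>x. 0) has_real_derivative flat_exp (k + 2) x - real k * flat_exp (k + 1) x) (at x)"
   using 2 by (simp add: flat_exp_def)
  then show ?thesis
   by (rule has_field_derivative_transform_within_open[where S="{..<0}"])
    (use 2 in \<open>auto simp: flat_exp_def\<close>)
 next
  case 3
  then show ?thesis
   using flat_exp_tendsto[of k] by (simp add: has_field_derivative_iff flat_exp_def[of _ 0])
 qed
qed

inductive flat_exp_span :: "(real \<Rightarrow> real) \<Rightarrow> bool" where
 base: "flat_exp_span (\<lambda>x. c * flat_exp k x)"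
| add: "flat_exp_span f \<Longrightarrow> flat_exp_span g \<Longrightarrow> flat_exp_span (\<lambda>x. f x + g x)"

lemma flat_exp_span_derivative:
 "flat_exp_span f \<Longrightarrow>
  \<exists>f'. (\<forall>x. (f has_real_derivative f' x) (at x)) \<and> (\<forall>v. flat_exp_span (\<lambda>x. f' x * v))"
proof (induction rule: flat_exp_span.induct)
 case (base c k)
 have "((\<lambda>x. c * flat_exp k x) has_real_derivative
  c * flat_exp (k + 2) x + (- c * real k) * flat_exp (k + 1) x) (at x)" for x
  using DERIV_cmult[OF flat_exp_has_derivative, of c k x] by (simp add: algebra_simps)
 moreover have "flat_exp_span (\<lambda>x. (v * c) * flat_exp (k + 2) x + (v * (- c * real k)) * flat_exp (k + 1) x)" for v
  by (intro flat_exp_span.intros)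
 ultimately show ?case
  by (intro exI[of _ "\<lambda>x. c * flat_exp (k + 2) x + (- c * real k) * flat_exp (k + 1) x"])
   (auto simp: algebra_simps)
next
 case (add f g)
 then obtain f' g' where "\<And>x. (f has_real_derivative f' x) (at x)" "\<And>v. flat_exp_span (\<lambda>x. f' x * v)"
  "\<And>x. (g has_real_derivative g' x) (at x)" "\<And>v. flat_exp_span (\<lambda>x. g' x * v)" by blast
 then show ?case
  by (intro exI[of _ "\<lambda>x. f' x + g' x"]) (auto intro: flat_exp_span.add DERIV_add simp: distrib_right)
qed

lemma smooth_fun_flat_exp: "smooth_fun (flat_exp k)"
proof (rule smooth_fun_coinduct[where S="Collect flat_exp_span"])
 show "flat_exp k \<in> Collect flat_exp_span"
  using flat_exp_span.base[of 1 k] by simp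
 fix f assume "f \<in> Collect flat_exp_span"
 then obtain f' where f': "\<And>x. (f has_real_derivative f' x) (at x)" "\<And>v. flat_exp_span (\<lambda>x. f' x * v)"
  using flat_exp_span_derivative by blast
 have "Fd f x = (*) (f' x)" for x
  using frechet_derivative_at[OF f'(1)[THEN has_field_derivative_imp_has_derivative]] by metis
 then show "(\<forall>x. f differentiable at x) \<and>
  (\<forall>v. (\<lambda>x. Fd f x v) \<in> Collect flat_exp_span)"
  using f' by (auto simp: real_differentiable_def)
qed

definition smooth_step :: "real \<Rightarrow> real"
 where "smooth_step x = flat_exp 0 x * inverse (flat_exp 0 x + flat_exp 0 (1 - x))"

lemma flat_exp_0_nonneg: "0 \<le> flat_exp 0 x"
 and flat_exp_0_pos: "0 < x \<Longrightarrow> 0 < flat_exp 0 x"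
 and flat_exp_0_mono: "x \<le> y \<Longrightarrow> flat_exp 0 x \<le> flat_exp 0 y"
 by (auto simp: flat_exp_def)

lemma smooth_step_denominator: "0 < flat_exp 0 x + flat_exp 0 (1 - x)"
 using flat_exp_0_nonneg[of x] flat_exp_0_nonneg[of "1 - x"] flat_exp_0_pos[of x] flat_exp_0_pos[of "1 - x"]
 by (cases "x > 0") auto

lemma smooth_fun_smooth_step: "smooth_fun smooth_step"
proof -
 have "smooth_fun (\<lambda>x. flat_exp 0 (- x + 1))"
  by (rule smooth_fun_affine[OF smooth_fun_flat_exp bounded_linear_minus[OF bounded_linear_ident]])
 then have "smooth_fun (\<lambda>x. flat_exp 0 x * inverse (flat_exp 0 x + flat_exp 0 (1 - x)))"
  using smooth_step_denominator
  by (intro smooth_fun_mult smooth_fun_inverse smooth_fun_add smooth_fun_flat_exp) (auto simp: less_le)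
 then show ?thesis by (simp add: smooth_step_def[abs_def])
qed

lemma smooth_step_0: "x \<le> 0 \<Longrightarrow> smooth_step x = 0"
 and smooth_step_1: "x \<ge> 1 \<Longrightarrow> smooth_step x = 1"
 by (auto simp: smooth_step_def flat_exp_def)

lemma smooth_step_nonneg: "0 \<le> smooth_step x"
 using flat_exp_0_nonneg[of x] smooth_step_denominator[of x] by (simp add: smooth_step_def)

lemma smooth_step_mono: "x \<le> y \<Longrightarrow> smooth_step x \<le> smooth_step y"
proof -
 assume "x \<le> y"
 have *: "smooth_step z = flat_exp 0 z / (flat_exp 0 z + flat_exp 0 (1 - z))" for z
  by (simp add: smooth_step_def divide_inverse)
 have "flat_exp 0 x * flat_exp 0 (1 - y) \<le> flat_exp 0 y * flat_exp 0 (1 - x)"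
  by (intro mult_mono flat_exp_0_mono flat_exp_0_nonneg) (use \<open>x \<le> y\<close> in auto)
 then show ?thesis
  unfolding * using smooth_step_denominator[of x] smooth_step_denominator[of y]
  by (simp add: divide_simps algebra_simps)
qed

lemma smooth_step_le_1: "smooth_step x \<le> 1"
 using smooth_step_mono[of x "max x 1"] smooth_step_1[of "max x 1"] by simp

lemma deriv_smooth_step_nonneg: "0 \<le> deriv smooth_step x"
 by (rule mono_on_imp_deriv_nonneg[of UNIV smooth_step])
  (auto intro!: mono_onI smooth_step_mono smooth_fun_real_has_derivative smooth_fun_smooth_step)

lemma test_function_iff:
 "test_function U \<phi> \<longleftrightarrow> smooth_fun \<phi> \<and> compact (closure {x. \<phi> x \<noteq> 0}) \<and> closure {x. \<phi> x \<noteq> 0} \<subseteq> U"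
 by (simp add: test_function_def smooth_fun_def)

lemma test_functionI:
 assumes "smooth_fun \<phi>" "compact K" "K \<subseteq> U" "\<And>x. x \<notin> K \<Longrightarrow> \<phi> x = 0"
 shows "test_function U \<phi>"
proof -
 have "closure {x. \<phi> x \<noteq> 0} \<subseteq> K"
  using assms by (intro closure_minimal compact_imp_closed) auto
 then show ?thesis
  unfolding test_function_iff using assms closed_Int_compact[OF closed_closure, of K "{x. \<phi> x \<noteq> 0}"]
  by (auto simp: Int_absorb2)
qed

lemma test_function_smooth: "test_function U \<phi> \<Longrightarrow> smooth_fun \<phi>"
 by (simp add: test_function_iff)

lemma frechet_derivative_zero_outside:
 assumes "x \<notin> closure {x. \<phi> x \<noteq> 0}"
 shows "Fd \<phi> x v = 0"
proof -
 have "((\<lambda>x. 0) has_derivative (\<lambda>v. 0)) (at x)" by simp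
 then have "(\<phi> has_derivative (\<lambda>v. 0)) (at x)"
  by (rule has_derivative_transform_within_open[where s="- closure {x. \<phi> x \<noteq> 0}"])
   (use assms closure_subset[of "{x. \<phi> x \<noteq> 0}"] in auto)
 then show ?thesis using frechet_derivative_at by metis
qed

lemma test_function_bounds:
 assumes "test_function U (\<phi> :: 'a::euclidean_space \<Rightarrow> real)"
 obtains C R where "C > 0" "R > 0" "\<And>x. \<bar>\<phi> x\<bar> \<le> C"
  "\<And>x v. \<bar>Fd \<phi> x v\<bar> \<le> C * norm v"
  "\<And>x. norm x > R \<Longrightarrow> \<phi> x = 0" "\<And>x v. norm x > R \<Longrightarrow> Fd \<phi> x v = 0"
  "\<And>x. \<phi> x \<noteq> 0 \<Longrightarrow> x \<in> U"
proof -
 define K where "K = closure {x. \<phi> x \<noteq> 0}"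
 have s: "smooth_fun \<phi>" and K: "compact K" and KU: "K \<subseteq> U"
  using assms by (auto simp: test_function_iff K_def)
 obtain R where R: "R > 0" "\<And>x. x \<in> K \<Longrightarrow> norm x \<le> R"
  using compact_imp_bounded[OF K] bounded_pos by metis
 have out: "\<phi> x = 0" "Fd \<phi> x v = 0" if "x \<notin> K" for x v
  using that closure_subset[of "{x. \<phi> x \<noteq> 0}"] frechet_derivative_zero_outside[of x \<phi> v]
  by (auto simp: K_def)
 have bd: "\<exists>C>0. \<forall>x. \<bar>f x\<bar> \<le> C" if f: "smooth_fun f" "\<And>x. x \<notin> K \<Longrightarrow> f x = 0" for f :: "'a \<Rightarrow> real"
 proof -
  have "bounded (f ` K)"
   by (intro compact_imp_bounded compact_continuous_image smooth_fun_continuous_on f K)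
  then obtain C where "C > 0" "\<And>x. x \<in> K \<Longrightarrow> \<bar>f x\<bar> \<le> C"
   by (force simp: bounded_pos)
  then show ?thesis using f(2) by (metis abs_zero less_imp_le)
 qed
 obtain C0 where C0: "C0 > 0" "\<And>x. \<bar>\<phi> x\<bar> \<le> C0"
  using bd[OF s out(1)] by blast
 have "\<forall>i\<in>Basis. \<exists>C>0. \<forall>x. \<bar>Fd \<phi> x i\<bar> \<le> C"
  using bd[OF smooth_fun_derivative[OF s] out(2)] by blast
 then obtain C1 where C1: "\<And>i. i \<in> Basis \<Longrightarrow> C1 i > 0"
   "\<And>i x. i \<in> Basis \<Longrightarrow> \<bar>Fd \<phi> x i\<bar> \<le> C1 i"
  by metis
 have le: "\<bar>Fd \<phi> x v\<bar> \<le> (\<Sum>i\<in>Basis. C1 i) * norm v" for x v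
 proof -
  interpret bounded_linear "Fd \<phi> x"
   by (rule smooth_fun_linear[OF s])
  have "Fd \<phi> x v = (\<Sum>i\<in>Basis. (v \<bullet> i) * Fd \<phi> x i)"
   by (subst euclidean_representation[of v, symmetric]) (simp add: sum scaleR)
  also have "\<bar>\<dots>\<bar> \<le> (\<Sum>i\<in>Basis. norm v * C1 i)"
   by (rule order_trans[OF sum_abs], rule sum_mono)
    (auto simp: abs_mult intro!: mult_mono C1 Basis_le_norm)
  finally show ?thesis by (simp add: sum_distrib_left mult.commute)
 qed
 show ?thesis
 proof (rule that[of "C0 + (\<Sum>i\<in>Basis. C1 i)" R])
  have nn: "0 \<le> (\<Sum>i\<in>Basis. C1 i)" using C1(1) by (intro sum_nonneg) (auto intro: less_imp_le)
  then show "0 < C0 + (\<Sum>i\<in>Basis. C1 i)" using C0 by simp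
  show "\<bar>\<phi> x\<bar> \<le> C0 + (\<Sum>i\<in>Basis. C1 i)" for x using C0(2)[of x] nn by linarith
  show "\<bar>Fd \<phi> x v\<bar> \<le> (C0 + (\<Sum>i\<in>Basis. C1 i)) * norm v" for x v
   using le[of x v] C0 by (simp add: distrib_right) (smt (verit) mult_nonneg_nonneg norm_ge_zero)
  show "\<phi> x = 0" if "norm x > R" for x using that R(2)[of x] out by force
  show "Fd \<phi> x v = 0" if "norm x > R" for x v using that R(2)[of x] out by force
  show "x \<in> U" if "\<phi> x \<noteq> 0" for x using that out KU by blast
 qed (use R in auto)
qed

lemma frechet_derivative_mult_smooth:
 assumes "smooth_fun f" "smooth_fun g"
 shows "Fd (\<lambda>x. f x * g x) x v =
  f x * Fd g x v + Fd f x v * g x"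
 using frechet_derivative_at[OF has_derivative_mult[OF assms[THEN smooth_fun_has_derivative]], of x]
 by metis

lemma frechet_derivative_affine_smooth:
 assumes "smooth_fun f" "bounded_linear L"
 shows "Fd (\<lambda>x. f (L x + c)) x v = Fd f (L x + c) (L v)"
proof -
 have "((\<lambda>x. L x + c) has_derivative L) (at x)"
  using has_derivative_add[OF bounded_linear_imp_has_derivative[OF assms(2)] has_derivative_const[of c]] by simp
 from has_derivative_compose[OF this smooth_fun_has_derivative[OF assms(1)]]
 show ?thesis using frechet_derivative_at by metis
qed

lemma borel_measurable_frechet_smooth:
 assumes "smooth_fun \<phi>" and [measurable]: "f \<in> measurable M borel" "g \<in> measurable M borel"
 shows "(\<lambda>x. Fd \<phi> (f x) (g x)) \<in> borel_measurable M"
proof -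
 have eq: "Fd \<phi> x v = (\<Sum>i\<in>Basis. (v \<bullet> i) * Fd \<phi> x i)" for x v
 proof -
  interpret bounded_linear "Fd \<phi> x"
   by (rule smooth_fun_linear[OF assms(1)])
  show ?thesis
   by (subst euclidean_representation[of v, symmetric]) (simp add: sum scaleR)
 qed
 have [measurable]: "(\<lambda>x. Fd \<phi> x i) \<in> Bor" for i
  by (intro smooth_fun_borel smooth_fun_derivative assms)
 show ?thesis
  by (subst eq) measurable
qed

text \<open>Composing with x \<bullet> x in place of the norm keeps smoothness at the origin. For R
  > 0 the argument of \<open>smooth_step\<close> is at least 1 when norm x \<le> R and at most 0
  when norm x \<ge> sqrt 2 * R.\<close>

definition cutoff :: "real \<Rightarrow> 'a::euclidean_space \<Rightarrow> real"
 where "cutoff R x = smooth_step (- (inverse (R\<^sup>2) * (x \<bullet> x)) + 2)"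

lemma smooth_fun_cutoff: "smooth_fun (cutoff R :: 'a::euclidean_space \<Rightarrow> real)"
proof -
 have "smooth_fun (\<lambda>x::'a. (\<lambda>y. smooth_step (- y + 2)) (inverse (R\<^sup>2) * (x \<bullet> x)))"
  by (rule smooth_fun_compose_real[OF smooth_fun_affine[OF smooth_fun_smooth_step
    bounded_linear_minus[OF bounded_linear_ident]] smooth_fun_mult[OF smooth_fun_const smooth_fun_inner_self]])
 then show ?thesis by (simp add: cutoff_def[abs_def])
qed

lemma cutoff_nonneg: "0 \<le> cutoff R x" and cutoff_le_1: "cutoff R x \<le> 1"
 by (simp_all add: cutoff_def smooth_step_nonneg smooth_step_le_1)

lemma cutoff_eq_1:
 assumes "R > 0" "norm x \<le> R" shows "cutoff R x = 1"
proof -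
 have "x \<bullet> x \<le> R\<^sup>2" using assms by (simp add: power2_norm_eq_inner[symmetric] power_mono)
 then have "inverse (R\<^sup>2) * (x \<bullet> x) \<le> 1" using assms by (simp add: field_simps)
 then show ?thesis by (simp add: cutoff_def smooth_step_1)
qed

lemma cutoff_eq_0:
 assumes "R > 0" "norm x \<ge> 2 * R" shows "cutoff R x = 0"
proof -
 have "(2 * R)\<^sup>2 \<le> x \<bullet> x" unfolding power2_norm_eq_inner[symmetric] using assms by (intro power_mono) auto
 then have "2 * R\<^sup>2 \<le> x \<bullet> x" using assms by (simp add: power_mult_distrib) (smt (verit) zero_le_power2)
 then have "inverse (R\<^sup>2) * (x \<bullet> x) \<ge> 2" using assms by (simp add: field_simps)
 then show ?thesis by (simp add: cutoff_def smooth_step_0)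
qed

lemma test_function_cutoff: "R > 0 \<Longrightarrow> test_function UNIV (cutoff R)"
 by (rule test_functionI[OF smooth_fun_cutoff, of "cball 0 (2 * R)"]) (auto intro: cutoff_eq_0)

text \<open>By scaling from R = 1, so that the constant does not depend on R. The factor 1 / R is
  what makes truncation errors vanish in the limits below.\<close>

lemma cutoff_derivative_bound:
 obtains C where "C > 0"
  "\<And>R (x::'a::euclidean_space) v. R > 0 \<Longrightarrow> \<bar>Fd (cutoff R) x v\<bar> \<le> C / R * norm v"
proof -
 obtain C1 where C1: "C1 > 0"
  "\<And>x v. \<bar>Fd (cutoff 1 :: 'a \<Rightarrow> real) x v\<bar> \<le> C1 * norm v"
  using test_function_bounds[OF test_function_cutoff[of 1]] by (metis zero_less_one)
 have "\<bar>Fd (cutoff R) x v\<bar> \<le> C1 / R * norm v" if "R > 0" for R and x v :: 'a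
 proof -
  have "cutoff R = (\<lambda>x::'a. cutoff 1 (inverse R *\<^sub>R x + 0))"
   by (simp add: cutoff_def fun_eq_iff power2_eq_square mult.assoc)
  then have "Fd (cutoff R) x v = Fd (cutoff 1) (inverse R *\<^sub>R x + 0) (inverse R *\<^sub>R v)"
   using frechet_derivative_affine_smooth[OF smooth_fun_cutoff bounded_linear_scaleR_right, of 1 "inverse R" 0 x v]
   by metis
  also have "\<bar>\<dots>\<bar> \<le> C1 * norm (inverse R *\<^sub>R v)" by (rule C1)
  finally show ?thesis using that by (simp add: field_simps)
 qed
 with C1(1) that show ?thesis by blast
qed

subsection \<open>Integrals over Euclidean space\<close>

lemma integrable_bounded_support:
 fixes f :: "'a::euclidean_space \<Rightarrow> real"
 assumes "f \<in> Bor" "AEL x. \<bar>f x\<bar> \<le> C" "\<And>x. norm x > R \<Longrightarrow> f x = 0"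
 shows "lintegrable f"
proof (rule Bochner_Integration.integrable_bound)
 show "lintegrable (\<lambda>x::'a. C * indicator (cball 0 R) x)"
  by (intro integrable_mult_right integrable_real_indicator) (use emeasure_lborel_cball_finite[of "0::'a" R] in auto)
 show "AEL x. norm (f x) \<le> norm (C * indicator (cball 0 R) x)"
  using assms(2) by eventually_elim (use assms(3) in \<open>auto simp: indicator_def\<close>)
qed (use assms in auto)

lemma nn_integral_shift:
 fixes f :: "'a::euclidean_space \<Rightarrow> ennreal"
 assumes [measurable]: "f \<in> Bor"
 shows "(NINT x. f (x + h)) = (NINT x. f x)"
 by (subst (2) lborel_distr_plus[of h, symmetric]) (simp add: nn_integral_distr add.commute)

lemma integrable_shift:
 fixes f :: "'a::euclidean_space \<Rightarrow> real"
 assumes "lintegrable f"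
 shows "lintegrable (\<lambda>x. f (x + h))"
 using assms
 by (subst (asm) lborel_distr_plus[of h, symmetric], subst (asm) integrable_distr_eq)
  (auto simp: add.commute)

lemma integral_shift:
 fixes f :: "'a::euclidean_space \<Rightarrow> real"
 assumes [measurable]: "f \<in> Bor"
 shows "(LBINT x. f (x + h)) = (LBINT x. f x)"
 by (subst (2) lborel_distr_plus[of h, symmetric]) (simp add: integral_distr add.commute)

lemma nn_integral_diff_triangle:
 fixes f g h :: "'a \<Rightarrow> real"
 assumes [measurable]: "f \<in> borel_measurable M" "g \<in> borel_measurable M" "h \<in> borel_measurable M"
 shows "(\<integral>\<^sup>+x. nabs (f x - h x) \<partial>M) \<le> (\<integral>\<^sup>+x. nabs (f x - g x) \<partial>M) + (\<integral>\<^sup>+x. nabs (g x - h x) \<partial>M)"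
 by (subst nn_integral_add[symmetric])
  (auto intro!: nn_integral_mono simp: ennreal_plus[symmetric] simp del: ennreal_plus)

definition L1_shift_continuous :: "('a::euclidean_space \<Rightarrow> real) \<Rightarrow> bool"
 where "L1_shift_continuous f \<longleftrightarrow>
  (\<forall>e>0. \<exists>d>0. \<forall>h. norm h < d \<longrightarrow> (NINT x. nabs (f (x + h) - f x)) \<le> ennreal e)"

text \<open>A three-epsilon argument: shifting does not change the L^1 distance between
  \<open>f\<close> and an approximant, and dominated convergence supplies the approximant.\<close>

lemma L1_shift_continuous_limit:
 fixes f :: "'a::euclidean_space \<Rightarrow> real"
 assumes s: "\<And>i. lintegrable (s i)" "\<And>i. L1_shift_continuous (s i)"
  "\<And>x. (\<lambda>i. s i x) \<longlonglongrightarrow> f x" "\<And>i x. \<bar>s i x\<bar> \<le> 2 * \<bar>f x\<bar>" and f: "lintegrable f"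
 shows "L1_shift_continuous f"
 unfolding L1_shift_continuous_def
proof (intro allI impI)
 fix e :: real assume "e > 0"
 have [measurable]: "f \<in> Bor" "\<And>i. s i \<in> Bor"
  using f s(1) by auto
 have "(\<lambda>i. LBINT x. \<bar>s i x - f x\<bar>) \<longlonglongrightarrow> (LINT x::'a|lborel. 0)"
 proof (rule integral_dominated_convergence[where w="\<lambda>x. 3 * \<bar>f x\<bar>"])
  show "AEL x. (\<lambda>i. \<bar>s i x - f x\<bar>) \<longlonglongrightarrow> 0"
   using s(3) by (auto intro!: AE_I2 tendsto_eq_intros simp: LIM_zero_iff tendsto_rabs_zero)
  show "AEL x. norm \<bar>s i x - f x\<bar> \<le> 3 * \<bar>f x\<bar>" for i
  proof (rule AE_I2)
   fix x show "norm \<bar>s i x - f x\<bar> \<le> 3 * \<bar>f x\<bar>" using s(4)[of i x] by simp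
  qed
 qed (use f in auto)
 then have "eventually (\<lambda>i. (LBINT x. \<bar>s i x - f x\<bar>) < e / 3) sequentially"
  using \<open>e > 0\<close> by (auto intro!: order_tendstoD)
 then obtain i where i: "(LBINT x. \<bar>s i x - f x\<bar>) < e / 3"
  by (auto simp: eventually_sequentially)
 have i': "(NINT x. nabs (s i x - f x)) \<le> ennreal (e / 3)"
  by (subst nn_integral_eq_integral) (use i s(1) f in \<open>auto intro!: ennreal_leI\<close>)
 obtain d where d: "d > 0" "\<And>h. norm h < d \<Longrightarrow> (NINT x. nabs (s i (x + h) - s i x)) \<le> ennreal (e / 3)"
  using s(2)[of i] \<open>e > 0\<close> unfolding L1_shift_continuous_def by (metis zero_less_divide_iff zero_less_numeral)
 show "\<exists>d>0. \<forall>h. norm h < d \<longrightarrow> (NINT x. nabs (f (x + h) - f x)) \<le> ennreal e"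
 proof (intro exI conjI allI impI)
  fix h :: 'a assume h: "norm h < d"
  have "(NINT x. nabs (f (x + h) - f x)) \<le>
   (NINT x. nabs (f (x + h) - s i (x + h))) + (NINT x. nabs (s i (x + h) - f x))"
   by (rule nn_integral_diff_triangle) auto
  also have "(NINT x. nabs (s i (x + h) - f x)) \<le>
   (NINT x. nabs (s i (x + h) - s i x)) + (NINT x. nabs (s i x - f x))"
   by (rule nn_integral_diff_triangle) auto
  also have "(NINT x. nabs (f (x + h) - s i (x + h))) = (NINT x. nabs (s i x - f x))"
   by (subst nn_integral_shift[where f="\<lambda>x. nabs (f x - s i x)"]) (auto simp: abs_minus_commute)
  also have "(NINT x. nabs (s i x - f x)) + ((NINT x. nabs (s i (x + h) - s i x)) + (NINT x. nabs (s i x - f x)))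
   \<le> ennreal (e / 3) + (ennreal (e / 3) + ennreal (e / 3))"
   by (intro add_mono i' d(2) h)
  also have "\<dots> = ennreal e" using \<open>e > 0\<close> by (simp add: ennreal_plus[symmetric] del: ennreal_plus)
  finally show "(NINT x. nabs (f (x + h) - f x)) \<le> ennreal e"
   by (auto simp: add_left_mono)
 qed (rule d)
qed

text \<open>\<open>A\<close> is squeezed between a compact \<open>K\<close> and an open
  \<open>U\<close> with U - K small. A shift by less than the distance from K to the complement of U
  changes the indicator only at points x for which x or x + h lies in U - K.\<close>

lemma L1_shift_continuous_indicator_bounded:
 fixes A :: "'a::euclidean_space set"
 assumes A[measurable]: "A \<in> sets borel" and bA: "bounded A"
 shows "L1_shift_continuous (\<lambda>x. indicator A x *\<^sub>R c)"
 unfolding L1_shift_continuous_def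
proof (intro allI impI)
 fix e :: real assume "e > 0"
 define e' where "e' = e / (4 * (\<bar>c\<bar> + 1))"
 have e': "e' > 0" using \<open>e > 0\<close> by (simp add: e'_def)
 have Al: "A \<in> sets lebesgue" by (rule sets_completionI_sets) (use A in simp)
 obtain U where U: "open U" "A \<subseteq> U" "emeasure lebesgue (U - A) < ennreal e'"
  by (rule sets_lebesgue_outer_open[OF Al e'])
 obtain K where K: "closed K" "K \<subseteq> A" "emeasure lebesgue (A - K) < ennreal e'"
  by (rule sets_lebesgue_inner_closed[OF Al e'])
 have "compact K" using K bA bounded_subset by (auto simp: compact_eq_bounded_closed)
 have [measurable]: "U \<in> sets borel" "K \<in> sets borel" using U K by auto
 have UK: "emeasure lborel (U - K) \<le> ennreal (2 * e')"
 proof -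
  have "emeasure lborel (U - K) \<le> emeasure lborel ((U - A) \<union> (A - K))"
   using U K by (intro emeasure_mono) auto
  also have "\<dots> \<le> emeasure lborel (U - A) + emeasure lborel (A - K)"
   by (rule emeasure_subadditive) auto
  also have "\<dots> \<le> ennreal e' + ennreal e'"
  proof (intro add_mono)
   have "U - A \<in> sets lborel" "A - K \<in> sets lborel" by simp_all
   then show "emeasure lborel (U - A) \<le> ennreal e'" "emeasure lborel (A - K) \<le> ennreal e'"
    using U(3) K(3) by (simp_all add: emeasure_completion less_imp_le)
  qed
  finally show ?thesis using e' by (simp add: ennreal_plus[symmetric] del: ennreal_plus)
 qed
 have "\<exists>d>0. \<forall>x\<in>K. \<forall>y\<in>- U. d \<le> dist x y"
  using separate_compact_closed[OF \<open>compact K\<close>, of "- U"] U K by blast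
 then obtain d where d: "d > 0" "\<And>x y. x \<in> K \<Longrightarrow> y \<notin> U \<Longrightarrow> d \<le> dist x y" by auto
 show "\<exists>d>0. \<forall>h. norm h < d \<longrightarrow>
  (NINT x. nabs (indicator A (x + h) *\<^sub>R c - indicator A x *\<^sub>R c)) \<le> ennreal e"
 proof (intro exI conjI allI impI)
  fix h :: 'a assume h: "norm h < d"
  have "nabs (indicator A (x + h) *\<^sub>R c - indicator A x *\<^sub>R c) \<le>
   nabs c * (indicator (U - K) (x + h) + indicator (U - K) x)" for x
  proof -
   have "x + h \<in> U" if "x \<in> K" using d(2)[OF that, of "x + h"] h by (auto simp: dist_norm)
   moreover have "x \<in> U" if "x + h \<in> K" using d(2)[OF that, of x] h by (auto simp: dist_norm)
   moreover have "nabs c \<le> nabs c * 2"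
    using mult_left_mono[of 1 2 "nabs c"] by simp
   ultimately show ?thesis using U(2) K(2) by (auto simp: indicator_def)
  qed
  then have "(NINT x. nabs (indicator A (x + h) *\<^sub>R c - indicator A x *\<^sub>R c)) \<le>
   (NINT x. nabs c * (indicator (U - K) (x + h) + indicator (U - K) x))"
   by (intro nn_integral_mono)
  also have "\<dots> = nabs c * ((NINT x. indicator (U - K) (x + h)) + (NINT x. indicator (U - K) x))"
   by (simp add: nn_integral_cmult nn_integral_add)
  also have "(NINT x. indicator (U - K) (x + h)) = (NINT x. indicator (U - K) x)"
   by (rule nn_integral_shift) auto
  also have "(NINT x. indicator (U - K) x) = emeasure lborel (U - K)" by simp
  also have "nabs c * (emeasure lborel (U - K) + emeasure lborel (U - K)) \<le>
   nabs c * (ennreal (2 * e') + ennreal (2 * e'))"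
   by (intro mult_left_mono add_mono UK) auto
  also have "\<dots> = ennreal (\<bar>c\<bar> * (4 * e'))"
   using e' by (simp add: ennreal_plus[symmetric] ennreal_mult[symmetric] del: ennreal_plus)
  also have "\<dots> \<le> ennreal e"
   using \<open>e > 0\<close> by (intro ennreal_leI) (simp add: e'_def field_simps)
  finally show "(NINT x. nabs (indicator A (x + h) *\<^sub>R c - indicator A x *\<^sub>R c)) \<le> ennreal e" .
 qed (rule d)
qed

lemma L1_shift_continuous:
 fixes f :: "'a::euclidean_space \<Rightarrow> real"
 assumes "lintegrable f"
 shows "L1_shift_continuous f"
 using assms
proof (induction rule: integrable_induct)
 case (base A c)
 show ?case
 \<comment> \<open>\<open>A\<close> has finite measure but may be unbounded; intersecting with balls
   reduces it to the bounded case.\<close>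
 proof (rule L1_shift_continuous_limit)
  fix i :: nat
  have "A \<inter> cball 0 (real i) \<in> sets borel" using base by auto
  then show "L1_shift_continuous (\<lambda>x. indicator (A \<inter> cball 0 (real i)) x *\<^sub>R c)"
   by (rule L1_shift_continuous_indicator_bounded) (simp add: bounded_Int)
  show "lintegrable (\<lambda>x. indicator (A \<inter> cball 0 (real i)) x *\<^sub>R c)"
   using base by (intro integrable_scaleR_left integrable_real_indicator)
    (auto intro: le_less_trans[OF emeasure_mono])
  show "\<bar>indicator (A \<inter> cball 0 (real i)) x *\<^sub>R c\<bar> \<le> 2 * \<bar>indicator A x *\<^sub>R c\<bar>" for x
   by (auto simp: indicator_def)
 next
  fix x :: 'a
  obtain N where N: "norm x \<le> real N" using real_arch_simple by blast
  have "eventually (\<lambda>i. indicator (A \<inter> cball 0 (real i)) x *\<^sub>R c = indicator A x *\<^sub>R c) sequentially"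
   using eventually_ge_at_top[of N] by eventually_elim (use N in \<open>auto simp: indicator_def\<close>)
  then show "(\<lambda>i. indicator (A \<inter> cball 0 (real i)) x *\<^sub>R c) \<longlonglongrightarrow> indicator A x *\<^sub>R c"
   by (rule tendsto_eventually)
 qed (use base in auto)
next
 case (add f g)
 have [measurable]: "f \<in> Bor" "g \<in> Bor"
  using add by auto
 show ?case unfolding L1_shift_continuous_def
 proof (intro allI impI)
  fix e :: real assume e: "e > 0"
  obtain d1 where d1: "d1 > 0" "\<And>h. norm h < d1 \<Longrightarrow> (NINT x. nabs (f (x + h) - f x)) \<le> ennreal (e / 2)"
   using add(3) e unfolding L1_shift_continuous_def by (meson half_gt_zero)
  obtain d2 where d2: "d2 > 0" "\<And>h. norm h < d2 \<Longrightarrow> (NINT x. nabs (g (x + h) - g x)) \<le> ennreal (e / 2)"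
   using add(4) e unfolding L1_shift_continuous_def by (meson half_gt_zero)
  show "\<exists>d>0. \<forall>h. norm h < d \<longrightarrow> (NINT x. nabs (f (x + h) + g (x + h) - (f x + g x))) \<le> ennreal e"
  proof (intro exI[of _ "min d1 d2"] conjI allI impI)
   fix h :: 'a assume h: "norm h < min d1 d2"
   have "(NINT x. nabs (f (x + h) + g (x + h) - (f x + g x))) \<le>
    (NINT x. nabs (f (x + h) - f x) + nabs (g (x + h) - g x))"
    by (intro nn_integral_mono) (auto simp: ennreal_plus[symmetric] simp del: ennreal_plus)
   also have "\<dots> = (NINT x. nabs (f (x + h) - f x)) + (NINT x. nabs (g (x + h) - g x))"
    by (rule nn_integral_add) auto
   also have "\<dots> \<le> ennreal (e / 2) + ennreal (e / 2)"
    by (intro add_mono d1 d2) (use h in auto)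
   also have "\<dots> = ennreal e" using e by (simp add: ennreal_plus[symmetric] del: ennreal_plus)
   finally show "(NINT x. nabs (f (x + h) + g (x + h) - (f x + g x))) \<le> ennreal e" .
  qed (use d1 d2 in auto)
 qed
next
 case (lim f s)
 then show ?case by (intro L1_shift_continuous_limit[of s f]) auto
qed

subsection \<open>Mollifiers\<close>

lemma measurable_fst_borel [measurable (raw)]:
 fixes f :: "'m \<Rightarrow> 'a::second_countable_topology \<times> 'b::second_countable_topology"
 assumes "f \<in> measurable M borel" shows "(\<lambda>x. fst (f x)) \<in> measurable M borel"
 using assms unfolding borel_prod[symmetric] by measurable

lemma measurable_snd_borel [measurable (raw)]:
 fixes f :: "'m \<Rightarrow> 'a::second_countable_topology \<times> 'b::second_countable_topology"
 assumes "f \<in> measurable M borel" shows "(\<lambda>x. snd (f x)) \<in> measurable M borel"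
 using assms unfolding borel_prod[symmetric] by measurable

text \<open>\<open>cutoff (e / 2)\<close> vanishes outside the ball of radius e, hence so does the
  mollifier. It is radial, so that reflecting the argument costs nothing.\<close>

definition mollifier :: "real \<Rightarrow> 'a::euclidean_space \<Rightarrow> real"
 where "mollifier e z = cutoff (e / 2) z / (LBINT w. cutoff (e / 2) (w::'a))"

lemma integrable_test_function:
 assumes "test_function U (\<phi> :: 'a::euclidean_space \<Rightarrow> real)"
 shows "lintegrable \<phi>"
proof -
 obtain C R where "\<And>x. \<bar>\<phi> x\<bar> \<le> C" "\<And>x. norm x > R \<Longrightarrow> \<phi> x = 0"
  using test_function_bounds[OF assms] by metis
 then show ?thesis
  by (intro integrable_bounded_support[of \<phi> C R] smooth_fun_borel test_function_smooth[OF assms] AE_I2)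
qed

lemma integral_cutoff_pos:
 assumes "R > 0" shows "0 < (LBINT w. cutoff R (w::'a::euclidean_space))"
proof -
 have "0 < measure lborel (cball (0::'a) R)"
  using content_cball_pos[of R 0] assms by simp
 also have "\<dots> = (LBINT w. indicator (cball (0::'a) R) w)" by simp
 also have "\<dots> \<le> (LBINT w. cutoff R (w::'a))"
 proof (rule integral_mono)
  show "lintegrable (indicat_real (cball (0::'a) R))"
   using emeasure_lborel_cball_finite[of "0::'a" R] by (intro integrable_real_indicator) auto
  show "lintegrable (cutoff R :: 'a \<Rightarrow> real)"
   by (rule integrable_test_function[OF test_function_cutoff[OF assms]])
  show "indicator (cball 0 R) w \<le> cutoff R w" for w :: 'a
   using cutoff_eq_1[OF assms, of w] cutoff_nonneg[of R w] by (auto simp: indicator_def)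
 qed
 finally show ?thesis .
qed

lemma test_function_mollifier:
 assumes "e > 0" shows "test_function UNIV (mollifier e :: 'a::euclidean_space \<Rightarrow> real)"
proof (rule test_functionI[of _ "cball 0 e"])
 show "smooth_fun (mollifier e :: 'a \<Rightarrow> real)"
  unfolding mollifier_def[abs_def] divide_inverse
  by (rule smooth_fun_mult[OF smooth_fun_cutoff smooth_fun_const])
 show "mollifier e x = 0" if "x \<notin> cball 0 e" for x :: 'a
  using that assms cutoff_eq_0[of "e / 2" x] by (simp add: mollifier_def)
qed auto

lemma smooth_fun_mollifier: "e > 0 \<Longrightarrow> smooth_fun (mollifier e)"
 by (rule test_function_smooth[OF test_function_mollifier])

lemma integral_mollifier: "e > 0 \<Longrightarrow> (LBINT z. mollifier e (z::'a::euclidean_space)) = 1"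
 using integral_cutoff_pos[of "e / 2", where 'a='a] by (simp add: mollifier_def)

lemma integrable_mollifier: "e > 0 \<Longrightarrow> lintegrable (mollifier e)"
 by (rule integrable_test_function[OF test_function_mollifier])

lemma mollifier_nonneg: "e > 0 \<Longrightarrow> 0 \<le> mollifier e (z::'a::euclidean_space)"
 using integral_cutoff_pos[of "e / 2", where 'a='a] cutoff_nonneg[of "e / 2" z] by (simp add: mollifier_def)

lemma mollifier_minus: "mollifier e (- z) = mollifier e z"
 by (simp add: mollifier_def cutoff_def)

lemma mollifier_eq_0: "e > 0 \<Longrightarrow> norm z \<ge> e \<Longrightarrow> mollifier e z = 0"
 using cutoff_eq_0[of "e / 2" z] by (simp add: mollifier_def)

lemma nn_integral_mollifier: "e > 0 \<Longrightarrow> (NINT z. ennreal (mollifier e (z::'a::euclidean_space))) = 1"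
 by (subst nn_integral_eq_integral) (auto simp: integrable_mollifier mollifier_nonneg integral_mollifier)

lemma mollifier_borel [measurable]: "e > 0 \<Longrightarrow> mollifier e \<in> Bor"
 by (rule smooth_fun_borel[OF smooth_fun_mollifier])

text \<open>Stated as a double integral because it bounds two errors: the L^1 error of mollifying
  \<open>f\<close>, and the error of replacing U2 (q') by U2 (q + h) after the doubling.\<close>

lemma mollifier_L1_small:
 fixes f :: "'a::euclidean_space \<Rightarrow> real"
 assumes f: "lintegrable f" and r: "r > 0"
 obtains d where "d > 0" "\<And>e. 0 < e \<Longrightarrow> e < d \<Longrightarrow>
  (NINT w. NINT x. ennreal (mollifier e w) * nabs (f (x + w) - f x)) \<le> ennreal r"
proof -
 have [measurable]: "f \<in> Bor" using f by auto
 obtain d where d: "d > 0" "\<And>h. norm h < d \<Longrightarrow> (NINT x. nabs (f (x + h) - f x)) \<le> ennreal r"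
  using L1_shift_continuous[OF f] r unfolding L1_shift_continuous_def by metis
 show ?thesis
 proof (rule that[OF d(1)])
  fix e :: real assume e: "0 < e" "e < d"
  note [measurable] = mollifier_borel[OF e(1)]
  have "(NINT w. NINT x. ennreal (mollifier e w) * nabs (f (x + w) - f x)) =
    (NINT w. ennreal (mollifier e w) * (NINT x. nabs (f (x + w) - f x)))"
   by (intro nn_integral_cong nn_integral_cmult) auto
  also have "\<dots> \<le> (\<integral>\<^sup>+w. ennreal (mollifier e w) * ennreal r \<partial>(lborel :: 'a measure))"
  proof (rule nn_integral_mono)
   fix w :: 'a
   show "ennreal (mollifier e w) * (NINT x. nabs (f (x + w) - f x)) \<le> ennreal (mollifier e w) * ennreal r"
    using mollifier_eq_0[OF e(1), of w] d(2)[of w] e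
    by (cases "norm w < e") (auto intro!: mult_left_mono)
  qed
  also have "\<dots> = ennreal r"
   using nn_integral_mollifier[OF e(1), where 'a='a] by (simp add: nn_integral_multc)
  finally show "(NINT w. NINT x. ennreal (mollifier e w) * nabs (f (x + w) - f x)) \<le> ennreal r" .
 qed
qed

section \<open>Convolution with mollifiers and the fundamental lemma of the calculus of
  variations\<close>

definition convolve :: "('a::euclidean_space \<Rightarrow> real) \<Rightarrow> ('a \<Rightarrow> real) \<Rightarrow> 'a \<Rightarrow> real"
 where "convolve f \<phi> p = (LBINT q. f q * \<phi> (p - q))"

lemma lborel_distr_minus: "distr lborel borel (\<lambda>x::'a::euclidean_space. - x) = lborel"
 using lborel_affine[of "-1" "0::'a"] by (simp add: density_1)

lemma integrable_reflect_shift: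
 fixes f :: "'a::euclidean_space \<Rightarrow> real"
 assumes "lintegrable f"
 shows "lintegrable (\<lambda>q. f (p - q))"
proof -
 have "integrable (distr lborel borel (\<lambda>x::'a. -x)) f"
  using assms by (simp add: lborel_distr_minus)
 then have "lintegrable (\<lambda>q. f (- q))"
  using assms by (subst (asm) integrable_distr_eq) auto
 from integrable_shift[OF this, of "-p"] show ?thesis by simp
qed

lemma integral_reflect_shift:
 fixes f :: "'a::euclidean_space \<Rightarrow> real"
 assumes [measurable]: "f \<in> Bor"
 shows "(LBINT q. f (p - q)) = (LBINT q. f q)"
proof -
 have "(LBINT q. f (p - q)) = (LBINT q. f (- (q + (- p))))" by simp
 also have "\<dots> = (LBINT q. f (- q))"
  by (rule integral_shift[where f="\<lambda>q. f (- q)"]) auto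
 also have "\<dots> = (LINT q|distr lborel borel (\<lambda>x::'a. -x). f q)"
  by (subst integral_distr) auto
 finally show ?thesis by (simp add: lborel_distr_minus)
qed

lemma nn_integral_reflect_shift:
 fixes f :: "'a::euclidean_space \<Rightarrow> ennreal"
 assumes [measurable]: "f \<in> Bor"
 shows "(NINT q. f (p - q)) = (NINT q. f q)"
proof -
 have "(NINT q. f (p - q)) = (NINT q. f (- (q + (- p))))" by simp
 also have "\<dots> = (NINT q. f (- q))"
  by (rule nn_integral_shift[where f="\<lambda>q. f (- q)"]) auto
 also have "\<dots> = (\<integral>\<^sup>+q. f q \<partial>distr lborel borel (\<lambda>x::'a. -x))"
  by (subst nn_integral_distr) auto
 finally show ?thesis by (simp add: lborel_distr_minus)
qed

lemma integrable_mult_test_function: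
 fixes f :: "'a::euclidean_space \<Rightarrow> real"
 assumes f: "lintegrable f" and \<phi>: "\<phi> \<in> Bor" "\<And>x. \<bar>\<phi> x\<bar> \<le> C"
 shows "lintegrable (\<lambda>q. f q * \<phi> q)"
proof (rule Bochner_Integration.integrable_bound)
 show "lintegrable (\<lambda>q. C * f q)" using f by simp
 show "AEL x. norm (f x * \<phi> x) \<le> norm (C * f x)"
 proof (rule AE_I2)
  fix x
  have "\<bar>f x\<bar> * \<bar>\<phi> x\<bar> \<le> \<bar>f x\<bar> * \<bar>C\<bar>" using \<phi>(2)[of x] by (intro mult_left_mono) auto
  then show "norm (f x * \<phi> x) \<le> norm (C * f x)" by (simp add: abs_mult mult.commute)
 qed
 show "(\<lambda>q. f q * \<phi> q) \<in> BorL"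
  using f \<phi>(1) by measurable
qed

lemma borel_measurable_convolve [measurable]:
 fixes f :: "'a::euclidean_space \<Rightarrow> real"
 assumes [measurable]: "f \<in> Bor" "\<phi> \<in> Bor"
 shows "convolve f \<phi> \<in> Bor"
proof -
 have "(\<lambda>p. LBINT q. f q * \<phi> (p - q)) \<in> Bor"
  by (rule lborel.borel_measurable_lebesgue_integral) measurable
 then show ?thesis unfolding convolve_def[abs_def] .
qed

lemma convolve_mollifier_bound:
 fixes f :: "'a::euclidean_space \<Rightarrow> real"
 assumes f: "lintegrable f" and e: "e > 0"
 shows "(NINT p. nabs (convolve f (mollifier e) p - f p)) \<le>
  (NINT w. NINT x. ennreal (mollifier e w) * nabs (f (x + w) - f x))"
proof -
 note [measurable] = mollifier_borel[OF e]
 have [measurable]: "f \<in> Bor" using f by auto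
 obtain C where C: "\<And>x::'a. \<bar>mollifier e x\<bar> \<le> C"
  using test_function_bounds[OF test_function_mollifier[OF e]] by metis
 have 1: "nabs (convolve f (mollifier e) p - f p) \<le> (NINT q. ennreal (mollifier e (p - q)) * nabs (f q - f p))" for p
 proof -
  have i1: "lintegrable (\<lambda>q. f q * mollifier e (p - q))"
   by (rule integrable_mult_test_function[OF f _ C]) measurable
  have i2: "lintegrable (\<lambda>q. f p * mollifier e (p - q))"
   by (intro integrable_mult_right integrable_reflect_shift integrable_mollifier e)
  have "convolve f (mollifier e) p - f p = (LBINT q. f q * mollifier e (p - q)) - (LBINT q. f p * mollifier e (p - q))"
   using integral_reflect_shift[of "mollifier e" p] integral_mollifier[OF e, where 'a='a]
   by (simp add: convolve_def)
  also have "\<dots> = (LBINT q. mollifier e (p - q) * (f q - f p))"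
   using i1 i2 by (simp add: Bochner_Integration.integral_diff[symmetric] algebra_simps)
  finally have "nabs (convolve f (mollifier e) p - f p) = ennreal (norm (LBINT q. mollifier e (p - q) * (f q - f p)))"
   by simp
  also have "\<dots> \<le> (NINT q. ennreal (norm (mollifier e (p - q) * (f q - f p))))"
   by (rule integral_norm_bound_ennreal) (use Bochner_Integration.integrable_diff[OF i1 i2] in \<open>simp add: algebra_simps\<close>)
  also have "\<dots> = (NINT q. ennreal (mollifier e (p - q)) * nabs (f q - f p))"
   by (intro nn_integral_cong) (simp add: abs_mult ennreal_mult mollifier_nonneg[OF e])
  finally show ?thesis .
 qed
 have 2: "(NINT q. ennreal (mollifier e (p - q)) * nabs (f q - f p)) =
  (NINT w. ennreal (mollifier e w) * nabs (f (p + w) - f p))" for p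
  by (subst nn_integral_shift[where h=p, symmetric]) (simp_all add: mollifier_minus add.commute)
 have "(NINT p. nabs (convolve f (mollifier e) p - f p)) \<le>
  (NINT p. NINT w. ennreal (mollifier e w) * nabs (f (p + w) - f p))"
  using 1 by (intro nn_integral_mono) (simp add: 2)
 also have "\<dots> = (NINT w. NINT x. ennreal (mollifier e w) * nabs (f (x + w) - f x))"
  by (rule lborel_pair.Fubini'[symmetric]) measurable
 finally show ?thesis .
qed

lemma convolve_mollifier_L1:
 fixes f :: "'a::euclidean_space \<Rightarrow> real"
 assumes "lintegrable f" "r > 0"
 obtains d where "d > 0" "\<And>e. 0 < e \<Longrightarrow> e < d \<Longrightarrow>
  (NINT p. nabs (convolve f (mollifier e) p - f p)) \<le> ennreal r"
 by (rule mollifier_L1_small[OF assms], rule that, assumption)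
  (rule order_trans[OF convolve_mollifier_bound[OF assms(1)]])

lemma test_function_mollifier_reflect:
 assumes "e > 0" shows "test_function UNIV (\<lambda>q. mollifier e (p - q :: 'a::euclidean_space))"
proof (rule test_functionI[of _ "cball p e"])
 show "smooth_fun (\<lambda>q. mollifier e (p - q))"
  using smooth_fun_affine[OF smooth_fun_mollifier[OF assms] bounded_linear_minus[OF bounded_linear_ident], of p]
  by simp
 show "mollifier e (p - q) = 0" if "q \<notin> cball p e" for q
  using that by (intro mollifier_eq_0[OF assms]) (simp add: dist_norm)
qed auto

text \<open>Mollifying at p is testing with a reflected mollifier, so the mollifications of
  \<open>H\<close> vanish, and they converge to \<open>H\<close> in L^1. Since \<open>H\<close> is
  only locally integrable, this is done ball by ball.\<close>

lemma fundamental_lemma_variations: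
 fixes H :: "'a::euclidean_space \<Rightarrow> real"
 assumes [measurable]: "H \<in> Bor"
  and int: "\<And>R. lintegrable (\<lambda>x. indicator (cball 0 R) x * H x)"
  and test: "\<And>\<eta>. test_function UNIV \<eta> \<Longrightarrow> (LBINT x. H x * \<eta> x) = 0"
 shows "AEL x. H x = 0"
proof -
 have "AEL x. norm x \<le> real n \<longrightarrow> H x = 0" for n :: nat
 proof -
  \<comment> \<open>The extra radius 1 leaves room for mollifiers of radius below 1, so that cutting
    off does not change the convolution on the ball of radius n.\<close>
  define f where "f x = indicator (cball 0 (real n + 1)) x * H x" for x
  have f: "lintegrable f" unfolding f_def by (rule int)
  have [measurable]: "f \<in> Bor" using f by auto
  have small: "(NINT x. indicator (cball 0 n) x * nabs (H x)) \<le> ennreal r" if r: "r > 0" for r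
  proof -
   obtain d where d: "d > 0" "\<And>e. 0 < e \<Longrightarrow> e < d \<Longrightarrow>
    (NINT p. nabs (convolve f (mollifier e) p - f p)) \<le> ennreal r"
    by (rule convolve_mollifier_L1[OF f r]) blast
   define e where "e = min 1 d / 2"
   have e: "0 < e" "e < d" "e < 1" using d(1) by (auto simp: e_def)
   have "convolve f (mollifier e) p = 0" if p: "p \<in> cball 0 n" for p
   proof -
    have "convolve f (mollifier e) p = (LBINT q. H q * mollifier e (p - q))"
     unfolding convolve_def
    proof (rule LBINT_cong[OF refl])
     fix q
     have "norm q \<le> norm p + norm (p - q)" by (metis norm_minus_commute norm_triangle_sub)
     then show "f q * mollifier e (p - q) = H q * mollifier e (p - q)"
      using p e mollifier_eq_0[OF e(1), of "p - q"]
      by (cases "norm (p - q) < e") (auto simp: f_def indicator_def)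
    qed
    also have "\<dots> = 0" by (rule test[OF test_function_mollifier_reflect[OF e(1)]])
    finally show ?thesis .
   qed
   then have "indicator (cball 0 n) x * nabs (H x) \<le> nabs (convolve f (mollifier e) x - f x)" for x
    by (auto simp: indicator_def f_def)
   then have "(NINT x. indicator (cball 0 n) x * nabs (H x)) \<le>
    (NINT p. nabs (convolve f (mollifier e) p - f p))"
    by (intro nn_integral_mono)
   with d(2)[OF e(1,2)] show ?thesis by (rule order_trans[rotated])
  qed
  have "(NINT x. indicator (cball 0 n) x * nabs (H x)) \<le> 0"
  proof (rule ennreal_le_epsilon)
   fix r :: real assume "0 < r"
   from small[OF this] show "(NINT x. indicator (cball 0 n) x * nabs (H x)) \<le> 0 + ennreal r"
    by simp
  qed
  then have "(NINT x. indicator (cball 0 n) x * nabs (H x)) = 0" by simp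
  moreover have [measurable]: "cball (0::'a) (real n) \<in> sets borel" by simp
  have "(\<lambda>x. indicator (cball 0 n) x * nabs (H x)) \<in> BorL"
   by measurable
  ultimately have "AEL x. indicator (cball 0 n) x * nabs (H x) = 0"
   using nn_integral_0_iff_AE by blast
  then show ?thesis
   by eventually_elim (auto simp: indicator_def)
 qed
 then have "AEL x. \<forall>n::nat. norm x \<le> real n \<longrightarrow> H x = 0"
  by (subst AE_all_countable) auto
 then show ?thesis
 proof eventually_elim
  case (elim x)
  obtain n where "norm x \<le> real n" using real_arch_simple by blast
  with elim show ?case by blast
 qed
qed

section \<open>Curves continuous into L^1\<close>

lemma L1_uniformly_continuous:
 fixes g :: "real \<Rightarrow> 'z \<Rightarrow> real"
 assumes int: "\<And>t. t \<in> {a..b} \<Longrightarrow> integrable M (g t)"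
  and cont: "\<And>t. t \<in> {a..b} \<Longrightarrow> ((\<lambda>s. LINT z|M. \<bar>g s z - g t z\<bar>) \<longlongrightarrow> 0) (at t within {a..b})"
  and e: "e > 0"
 obtains d where "d > 0" "\<And>s t. s \<in> {a..b} \<Longrightarrow> t \<in> {a..b} \<Longrightarrow> \<bar>s - t\<bar> < d \<Longrightarrow> (LINT z|M. \<bar>g s z - g t z\<bar>) < e"
proof -
 define D where "D s t = (LINT z|M. \<bar>g s z - g t z\<bar>)" for s t
 have D0: "D t t = 0" for t by (simp add: D_def)
 have "\<exists>d>0. \<forall>s\<in>{a..b}. \<bar>s - t\<bar> < d \<longrightarrow> D s t < e / 2" if t: "t \<in> {a..b}" for t
 proof -
  have "\<exists>d>0. \<forall>s\<in>{a..b}. 0 < dist s t \<and> dist s t < d \<longrightarrow> dist (D s t) 0 < e / 2"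
   using cont[OF t] e unfolding D_def[symmetric] Lim_within by (meson half_gt_zero)
  then obtain d where d: "d > 0" "\<forall>s\<in>{a..b}. 0 < dist s t \<and> dist s t < d \<longrightarrow> dist (D s t) 0 < e / 2"
   by blast
  have "D s t < e / 2" if "s \<in> {a..b}" "\<bar>s - t\<bar> < d" for s
   using d(2) that D0[of t] e by (cases "s = t") (auto simp: dist_real_def dest!: bspec[of _ _ s])
  with d(1) show ?thesis by blast
 qed
 then obtain d where d: "\<And>t. t \<in> {a..b} \<Longrightarrow> d t > 0"
  "\<And>t s. t \<in> {a..b} \<Longrightarrow> s \<in> {a..b} \<Longrightarrow> \<bar>s - t\<bar> < d t \<Longrightarrow> D s t < e / 2"
  by metis
 have tri: "D s t \<le> D s r + D t r" if "s \<in> {a..b}" "t \<in> {a..b}" "r \<in> {a..b}" for s t r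
 proof -
  have "D s t \<le> (LINT z|M. \<bar>g s z - g r z\<bar> + \<bar>g t z - g r z\<bar>)"
   unfolding D_def by (rule integral_mono) (use int that in auto)
  also have "\<dots> = D s r + D t r"
   unfolding D_def by (rule Bochner_Integration.integral_add) (use int that in auto)
  finally show ?thesis .
 qed
 obtain \<epsilon> where \<epsilon>: "\<epsilon> > 0" "\<forall>x\<in>{a..b}. \<exists>G\<in>(\<lambda>t. ball t (d t)) ` {a..b}. ball x \<epsilon> \<subseteq> G"
  by (rule Heine_Borel_lemma[of "{a..b}" "(\<lambda>t. ball t (d t)) ` {a..b}"]) (use d(1) in force)+
 show ?thesis
 proof (rule that[OF \<epsilon>(1)])
  fix s t assume st: "s \<in> {a..b}" "t \<in> {a..b}" "\<bar>s - t\<bar> < \<epsilon>"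
  obtain r where r: "r \<in> {a..b}" "ball s \<epsilon> \<subseteq> ball r (d r)"
   using \<epsilon>(2) st(1) by blast
  have "s \<in> ball r (d r)" "t \<in> ball r (d r)"
   by (rule subsetD[OF r(2)], use \<epsilon>(1) st(3) in \<open>simp add: dist_real_def\<close>)+
  then have "\<bar>s - r\<bar> < d r" "\<bar>t - r\<bar> < d r" by (simp_all add: dist_real_def abs_minus_commute)
  then have "D s r < e / 2" "D t r < e / 2" using d(2) r(1) st by auto
  then show "(LINT z|M. \<bar>g s z - g t z\<bar>) < e"
   using tri[OF st(1,2) r(1)] by (simp add: D_def)
 qed
qed

text \<open>Continuity into L^1 says nothing about measurability in (t, z), which Fubini needs.
  Sampling the curve on grids of mesh \<open>d k\<close> with L^1 error at most 2^-k gives jointly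
  measurable functions; since the errors are summable, they converge almost everywhere for each
  single t.\<close>

lemma joint_modification:
 fixes g :: "real \<Rightarrow> 'z::euclidean_space \<Rightarrow> real"
 assumes int: "\<And>t. t \<in> {0..T} \<Longrightarrow> lintegrable (g t)"
  and cont: "\<And>t. t \<in> {0..T} \<Longrightarrow> ((\<lambda>s. LBINT z. \<bar>g s z - g t z\<bar>) \<longlongrightarrow> 0) (at t within {0..T})"
 obtains G :: "real \<times> 'z \<Rightarrow> real" where "G \<in> Bor"
  "\<And>t. t \<in> {0..T} \<Longrightarrow> AEL z. G (t, z) = g t z" "\<And>t z. t \<notin> {0..T} \<Longrightarrow> G (t, z) = 0"
proof -
 have "\<exists>d>0. \<forall>s\<in>{0..T}. \<forall>t\<in>{0..T}. \<bar>s - t\<bar> < d \<longrightarrow> (LBINT z. \<bar>g s z - g t z\<bar>) < (1/2)^k" for k :: nat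
  by (rule L1_uniformly_continuous[of 0 T lborel g "(1/2)^k"]) (use int cont in auto)
 then obtain d where d: "\<And>k. d k > 0" "\<And>k s t. s \<in> {0..T} \<Longrightarrow> t \<in> {0..T} \<Longrightarrow> \<bar>s - t\<bar> < d k \<Longrightarrow>
   (LBINT z. \<bar>g s z - g t z\<bar>) < (1/2)^k" for k :: nat
  by metis
 \<comment> \<open>For t in [0,T] the grid point just below t lies in [0,T] as well, so the default
   0 is never sampled there.\<close>
 define c where "c k i z = (if d k * real_of_int i \<in> {0..T} then g (d k * real_of_int i) z else 0)" for k :: nat and i z
 have [measurable]: "c k i \<in> Bor" for k i
  using int[of "d k * real_of_int i"] unfolding c_def[abs_def] by (cases "d k * real_of_int i \<in> {0..T}") auto
 define G where "G p = (if fst p \<in> {0..T} then lim (\<lambda>k. c k \<lfloor>fst p / d k\<rfloor> (snd p)) else 0)" for p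
 have "(\<lambda>p::real \<times> 'z. c k \<lfloor>fst p / d k\<rfloor> (snd p)) \<in> Bor" for k
  by (rule measurable_compose_countable[where f="\<lambda>i p. c k i (snd p)" and g="\<lambda>p. \<lfloor>fst p / d k\<rfloor>"]) measurable
 then have [measurable]: "(\<lambda>p::real \<times> 'z. lim (\<lambda>k. c k \<lfloor>fst p / d k\<rfloor> (snd p))) \<in> Bor"
  by (rule borel_measurable_lim_metric)
 have G: "G \<in> Bor"
  unfolding G_def[abs_def] by measurable
 have ae: "AEL z. G (t, z) = g t z" if t: "t \<in> {0..T}" for t
 proof -
  define u where "u k z = c k \<lfloor>t / d k\<rfloor> z" for k z
  have [measurable]: "g t \<in> Bor" using int[OF t] by auto
  have u: "lintegrable (u k) \<and> (LBINT z. \<bar>u k z - g t z\<bar>) \<le> (1/2)^k" for k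
  proof -
   have le: "d k * real_of_int \<lfloor>t / d k\<rfloor> \<le> t"
    using mult_left_mono[OF of_int_floor_le[of "t / d k"], of "d k"] d(1)[of k] by simp
   have ge: "t < d k * real_of_int \<lfloor>t / d k\<rfloor> + d k"
    using mult_strict_left_mono[OF real_of_int_floor_add_one_gt[of "t / d k"] d(1)[of k]] d(1)[of k]
    by (simp add: algebra_simps)
   have "0 \<le> \<lfloor>t / d k\<rfloor>" using t d(1)[of k] by simp
   then have pos: "0 \<le> d k * real_of_int \<lfloor>t / d k\<rfloor>" using d(1)[of k] by simp
   have mem: "d k * real_of_int \<lfloor>t / d k\<rfloor> \<in> {0..T}" using le pos t by auto
   then have "u k = g (d k * real_of_int \<lfloor>t / d k\<rfloor>)" by (auto simp: u_def c_def)
   then show ?thesis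
    using int[OF mem] d(2)[OF mem t, of k] le ge by auto
  qed
  have [measurable]: "u k \<in> Bor" for k
   using borel_measurable_integrable[of lborel "u k"] u[of k] by simp
  have "(NINT z. (\<Sum>k. nabs (u k z - g t z))) = (\<Sum>k. NINT z. nabs (u k z - g t z))"
   by (rule nn_integral_suminf) auto
  also have "\<dots> \<le> (\<Sum>k. ennreal ((1/2)^k))"
  proof (rule suminf_le)
   fix k
   show "(NINT z. nabs (u k z - g t z)) \<le> ennreal ((1/2)^k)"
    using u[of k] int[OF t] by (subst nn_integral_eq_integral) (auto intro!: ennreal_leI)
  qed auto
  also have "\<dots> < \<infinity>"
   by (subst suminf_ennreal2) (auto intro: summable_geometric)
  finally have "AEL z. (\<Sum>k. nabs (u k z - g t z)) \<noteq> \<infinity>"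
   by (intro nn_integral_PInf_AE) auto
  then show ?thesis
  proof eventually_elim
   case (elim z)
   then have "summable (\<lambda>k. \<bar>u k z - g t z\<bar>)"
    by (intro summable_suminf_not_top) auto
   then have "(\<lambda>k. u k z) \<longlonglongrightarrow> g t z"
    using summable_LIMSEQ_zero tendsto_rabs_zero_iff LIM_zero_iff by metis
   then show ?case using t by (simp add: G_def u_def limI)
  qed
 qed
 show ?thesis
  by (rule that[OF G ae]) (auto simp: G_def)
qed

subsection \<open>Kinetic formulations and entropy inequalities\<close>

definition step :: "real \<Rightarrow> real \<Rightarrow> real"
 where "step k \<xi> = (if \<xi> < k then -1 else 1)"

text \<open>Agrees with \<open>chi\<close> except possibly at \<xi> = 0 and \<xi> = u. The half-open
  convention makes it a difference of two steps, so that the algebra of \<open>abs_kchi_diff\<close>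
  holds for every \<xi> without exceptional points.\<close>

definition kchi :: "real \<Rightarrow> real \<Rightarrow> real"
 where "kchi \<xi> u = (step 0 \<xi> - step u \<xi>) / 2"

abbreviation kp :: "('a \<Rightarrow> real) \<Rightarrow> 'a \<times> real \<Rightarrow> real"
 where "kp u z \<equiv> kchi (snd z) (u (fst z))"

definition locally_bounded :: "(real \<Rightarrow> 'a::euclidean_space) \<Rightarrow> bool"
 where "locally_bounded b \<longleftrightarrow> b \<in> Bor \<and> (\<forall>R. \<exists>L. \<forall>\<xi>. \<bar>\<xi>\<bar> \<le> R \<longrightarrow> norm (b \<xi>) \<le> L)"

definition flux :: "(real \<Rightarrow> 'a::euclidean_space) \<Rightarrow> (real \<Rightarrow> real) \<Rightarrow> ('a \<Rightarrow> real) \<Rightarrow> 'a \<times> real \<Rightarrow> real"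
 where "flux b \<psi> \<Phi> p = \<psi> (snd p) * Fd \<Phi> (fst p) (b (snd p))"

text \<open>Time is one of the coordinates of q: for b \<xi> = (1, a \<xi>) the derivative along b
  is the whole transport operator, and the doubling treats t and x alike. The tests are products, so
  that the weight in \<xi> can be chosen on its own.\<close>

definition weak_kinetic ::
 "'a::euclidean_space set \<Rightarrow> (real \<Rightarrow> 'a) \<Rightarrow> ('a \<Rightarrow> real) \<Rightarrow> ('a \<times> real) measure \<Rightarrow> bool"
 where "weak_kinetic \<Omega> b U \<mu> \<longleftrightarrow> U \<in> Bor \<and> finite_measure \<mu> \<and> sets \<mu> = sets borel \<and>
  (\<forall>\<Phi> \<eta>. test_function \<Omega> \<Phi> \<longrightarrow> test_function UNIV \<eta> \<longrightarrow>
   (LBINT p. kp U p * flux b \<eta> \<Phi> p) = (LINT p|\<mu>. \<Phi> (fst p) * deriv \<eta> (snd p)))"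

lemma step_borel [measurable (raw)]:
 assumes [measurable]: "f \<in> borel_measurable M" "g \<in> borel_measurable M"
 shows "(\<lambda>x. step (f x) (g x)) \<in> borel_measurable M"
 unfolding step_def by measurable

lemma kchi_borel [measurable (raw)]:
 assumes [measurable]: "f \<in> borel_measurable M" "g \<in> borel_measurable M"
 shows "(\<lambda>x. kchi (f x) (g x)) \<in> borel_measurable M"
 unfolding kchi_def by measurable

lemma abs_step [simp]: "\<bar>step k \<xi>\<bar> = 1"
 by (simp add: step_def)

lemma abs_kchi_le: "\<bar>kchi \<xi> u\<bar> \<le> 1"
 by (simp add: kchi_def step_def)

text \<open>Both values are 0 or have the sign of \<open>step 0 \<xi>\<close>, so their difference
  lies in {-1, 0, 1} and its modulus equals its square. Expand, and use that the square of
  \<open>kchi\<close> is \<open>step 0\<close> times it. The product is the only term coupling u and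
  v.\<close>

lemma abs_kchi_diff:
 "\<bar>kchi \<xi> u - kchi \<xi> v\<bar> = step 0 \<xi> * kchi \<xi> u + step 0 \<xi> * kchi \<xi> v - 2 * (kchi \<xi> u * kchi \<xi> v)"
 by (simp add: kchi_def step_def)

lemma abs_kchi_diff_le: "\<bar>kchi \<xi> u - kchi \<xi> v\<bar> \<le> 1"
 by (simp add: kchi_def step_def)

lemma abs_kchi_diff_indicator: "\<bar>kchi \<xi> u - kchi \<xi> v\<bar> = indicator {min u v..<max u v} \<xi>"
 by (auto simp: kchi_def step_def indicator_def min_def max_def)

lemma nn_integral_kchi_diff: "(NINT \<xi>. nabs (kchi \<xi> u - kchi \<xi> v)) = nabs (u - v)"
proof -
 have "(NINT \<xi>. nabs (kchi \<xi> u - kchi \<xi> v)) = (NINT \<xi>. indicator {min u v..<max u v} \<xi>)"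
  by (intro nn_integral_cong) (simp add: abs_kchi_diff_indicator ennreal_indicator)
 also have "\<dots> = nabs (u - v)"
  by (simp add: emeasure_lborel_Ico min_def max_def abs_if)
 finally show ?thesis .
qed

lemma kchi_0 [simp]: "kchi \<xi> 0 = 0"
 by (simp add: kchi_def)

lemma kchi_eq_chi: "\<xi> \<noteq> 0 \<Longrightarrow> \<xi> \<noteq> u \<Longrightarrow> kchi \<xi> u = chi \<xi> u"
 by (auto simp: kchi_def chi_def step_def)

lemma AE_kchi_eq_chi: "AEL \<xi>. kchi \<xi> u = chi \<xi> u"
 using AE_lborel_singleton[of 0] AE_lborel_singleton[of u]
 by eventually_elim (rule kchi_eq_chi)

lemma norm_Pair_gt_cases:
 assumes "norm (p :: 'a::real_normed_vector \<times> 'b::real_normed_vector) > A + B"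
 shows "norm (fst p) > A \<or> norm (snd p) > B"
 using assms norm_Pair_le[of "fst p" "snd p"] by auto

lemma flux_borel [measurable (raw)]:
 assumes "locally_bounded b" "smooth_fun \<psi>" "smooth_fun \<Phi>" "f \<in> measurable M borel"
 shows "(\<lambda>x. flux b \<psi> \<Phi> (f x)) \<in> borel_measurable M"
proof -
 have [measurable]: "b \<in> Bor" "\<psi> \<in> Bor" "f \<in> measurable M borel"
  using assms smooth_fun_borel by (auto simp: locally_bounded_def)
 show ?thesis unfolding flux_def
  by (intro borel_measurable_times borel_measurable_frechet_smooth assms) measurable
qed

lemma flux_bounds:
 assumes b: "locally_bounded b" and \<psi>: "test_function UNIV \<psi>" and \<Phi>: "test_function \<Omega> \<Phi>"
 obtains C R where "C > 0" "R > 0" "\<And>p. \<bar>flux b \<psi> \<Phi> p\<bar> \<le> C"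
  "\<And>p. norm (fst p) > R \<Longrightarrow> flux b \<psi> \<Phi> p = 0" "\<And>p. norm (snd p) > R \<Longrightarrow> flux b \<psi> \<Phi> p = 0"
proof -
 obtain C1 R1 where 1: "C1 > 0" "R1 > 0" "\<And>x. \<bar>\<psi> x\<bar> \<le> C1" "\<And>x. norm x > R1 \<Longrightarrow> \<psi> x = 0"
  using test_function_bounds[OF \<psi>] by metis
 obtain C2 R2 where 2: "C2 > 0" "R2 > 0" "\<And>x v. \<bar>Fd \<Phi> x v\<bar> \<le> C2 * norm v"
  "\<And>x v. norm x > R2 \<Longrightarrow> Fd \<Phi> x v = 0"
  using test_function_bounds[OF \<Phi>] by metis
 obtain L where L: "\<And>\<xi>. \<bar>\<xi>\<bar> \<le> R1 \<Longrightarrow> norm (b \<xi>) \<le> L"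
  using b unfolding locally_bounded_def by blast
 have L0: "0 \<le> L" using L[of 0] 1(2) norm_ge_zero[of "b 0"] by linarith
 show ?thesis
 proof (rule that[of "C1 * (C2 * L) + 1" "max R1 R2"])
  show "0 < C1 * (C2 * L) + 1" using 1 2 L0 by (simp add: add_nonneg_pos)
  show "\<bar>flux b \<psi> \<Phi> p\<bar> \<le> C1 * (C2 * L) + 1" for p
  proof (cases "norm (snd p) > R1")
   case True
   then show ?thesis using 1 2 L0 by (simp add: flux_def)
  next
   case False
   have "\<bar>flux b \<psi> \<Phi> p\<bar> \<le> C1 * (C2 * norm (b (snd p)))"
    unfolding flux_def abs_mult by (intro mult_mono 1 2) (use 1 in auto)
   also have "\<dots> \<le> C1 * (C2 * L)"
    using False 1 2 by (intro mult_left_mono L) auto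
   finally show ?thesis by simp
  qed
 qed (use 1 2 in \<open>auto simp: flux_def\<close>)
qed

lemma integrable_flux:
 assumes b: "locally_bounded b" and \<psi>: "test_function UNIV \<psi>" and \<Phi>: "test_function \<Omega> \<Phi>"
  and [measurable]: "k \<in> Bor" and k: "\<And>p. \<bar>k p\<bar> \<le> B"
 shows "lintegrable (\<lambda>p. k p * flux b \<psi> \<Phi> p)"
proof -
 obtain C R where C: "C > 0" "R > 0" "\<And>p. \<bar>flux b \<psi> \<Phi> p\<bar> \<le> C"
  "\<And>p. norm (fst p) > R \<Longrightarrow> flux b \<psi> \<Phi> p = 0" "\<And>p. norm (snd p) > R \<Longrightarrow> flux b \<psi> \<Phi> p = 0"
  using flux_bounds[OF b \<psi> \<Phi>] by metis
 note [measurable] = flux_borel[OF b \<psi>[THEN test_function_smooth] \<Phi>[THEN test_function_smooth]]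
 have B: "0 \<le> B" using k[of undefined] by linarith
 show ?thesis
 proof (rule integrable_bounded_support[of _ "B * C" "R + R"])
  show "(\<lambda>p. k p * flux b \<psi> \<Phi> p) \<in> Bor"
   using flux_borel[OF b \<psi>[THEN test_function_smooth] \<Phi>[THEN test_function_smooth], of "\<lambda>p. p" borel]
   by (intro borel_measurable_times) auto
  show "AEL p. \<bar>k p * flux b \<psi> \<Phi> p\<bar> \<le> B * C"
   unfolding abs_mult by (intro AE_I2 mult_mono k C) (use B in auto)
  show "k p * flux b \<psi> \<Phi> p = 0" if "norm p > R + R" for p
   using norm_Pair_gt_cases[OF that] C(4,5)[of p] by auto
 qed
qed

lemma test_function_mult_smooth:
 assumes "test_function U f" "smooth_fun g"
 shows "test_function U (\<lambda>x. f x * g x)"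
proof (rule test_functionI[of _ "closure {x. f x \<noteq> 0}"])
 show "f x * g x = 0" if "x \<notin> closure {x. f x \<noteq> 0}" for x
  using that closure_subset[of "{x. f x \<noteq> 0}"] by auto
qed (use assms in \<open>auto simp: test_function_iff\<close>)

lemma integrable_finite_measure_bounded:
 assumes "finite_measure \<mu>" "f \<in> borel_measurable \<mu>" "\<And>x. \<bar>f x\<bar> \<le> (C::real)"
 shows "integrable \<mu> f"
 using finite_measure.integrable_const_bound[OF assms(1), of f C] assms(2,3) by auto

text \<open>The test function \<open>\<eta>\<close> is \<open>\<psi>\<close> times a smooth nondecreasing approximation of the step at \<open>k\<close>, whose
 derivative only contributes with a sign.\<close>

lemma kinetic_entropy_inequality:
 assumes kin: "weak_kinetic \<Omega> b U \<mu>" and b: "locally_bounded b"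
  and \<Phi>: "test_function \<Omega> \<Phi>" "\<And>q. 0 \<le> \<Phi> q" and \<psi>: "test_function UNIV \<psi>" "\<And>\<xi>. 0 \<le> \<psi> \<xi>"
 shows "- (LINT p|\<mu>. \<Phi> (fst p) * \<bar>deriv \<psi> (snd p)\<bar>) \<le>
  (LBINT p. kp U p * step k (snd p) * flux b \<psi> \<Phi> p)"
proof -
 have [measurable]: "U \<in> Bor" and fin: "finite_measure \<mu>" and sets: "sets \<mu> = sets borel"
  using kin by (auto simp: weak_kinetic_def)
 note [measurable_cong] = sets
 have sm: "smooth_fun \<psi>" "smooth_fun \<Phi>" using \<psi> \<Phi> test_function_smooth by auto
 have [measurable]: "\<psi> \<in> Bor" "\<Phi> \<in> Bor" "deriv \<psi> \<in> Bor"
  using sm smooth_fun_deriv smooth_fun_borel by auto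
 obtain C\<psi> where C\<psi>: "C\<psi> > 0" "\<And>x. \<bar>\<psi> x\<bar> \<le> C\<psi>" "\<And>x. \<bar>deriv \<psi> x\<bar> \<le> C\<psi>"
 proof -
  obtain C where C: "C > 0" "\<And>x. \<bar>\<psi> x\<bar> \<le> C" "\<And>x v. \<bar>Fd \<psi> x v\<bar> \<le> C * norm v"
   using test_function_bounds[OF \<psi>(1)] by metis
  have "\<bar>deriv \<psi> x\<bar> \<le> C" for x
   using C(3)[of x 1] by (simp add: smooth_fun_real_frechet[OF sm(1)])
  with C that show ?thesis by blast
 qed
 obtain C\<Phi> where C\<Phi>: "C\<Phi> > 0" "\<And>x. \<bar>\<Phi> x\<bar> \<le> C\<Phi>"
  using test_function_bounds[OF \<Phi>(1)] by metis
 \<comment> \<open>The argument of \<open>smooth_step\<close> is 1 at \<xi> = k, so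
   \<open>s j\<close> equals 1 from k on, in agreement with \<open>step k k = 1\<close>; the
   convergence then holds at every point, including k.\<close>
 define s where "s j \<xi> = 2 * smooth_step (real j * \<xi> + (1 - real j * k)) - 1" for j :: nat and \<xi>
 have s_smooth: "smooth_fun (s j)" for j
 proof -
  have "smooth_fun (\<lambda>\<xi>. smooth_step (real j * \<xi> + (1 - real j * k)))"
   by (rule smooth_fun_affine[OF smooth_fun_smooth_step bounded_linear_mult_right])
  then show ?thesis unfolding s_def[abs_def]
   by (intro smooth_fun_diff smooth_fun_mult smooth_fun_const)
 qed
 have s_le: "\<bar>s j \<xi>\<bar> \<le> 1" for j \<xi>
  using smooth_step_nonneg[of "real j * \<xi> + (1 - real j * k)"] smooth_step_le_1[of "real j * \<xi> + (1 - real j * k)"]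
  by (simp add: s_def abs_le_iff)
 have s_deriv: "0 \<le> deriv (s j) \<xi>" for j \<xi>
 proof -
  have "mono_on UNIV (s j)"
   by (intro mono_onI) (simp add: s_def smooth_step_mono mult_left_mono)
  then show ?thesis
   by (rule mono_on_imp_deriv_nonneg[OF _ smooth_fun_real_has_derivative[OF s_smooth]]) auto
 qed
 have s_lim: "(\<lambda>j. s j \<xi>) \<longlonglongrightarrow> step k \<xi>" for \<xi>
 proof (cases "\<xi> < k")
  case True
  obtain N where N: "1 / (k - \<xi>) \<le> real N" using real_arch_simple by blast
  have "eventually (\<lambda>j. s j \<xi> = step k \<xi>) sequentially"
   using eventually_ge_at_top[of N]
  proof eventually_elim
   case (elim j)
   then have "1 / (k - \<xi>) \<le> real j" using N by linarith
   then have "1 \<le> real j * (k - \<xi>)" using True by (simp add: field_simps)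
   then have "smooth_step (real j * \<xi> + (1 - real j * k)) = 0"
    by (intro smooth_step_0) (simp add: algebra_simps)
   then show ?case using True by (simp add: s_def step_def)
  qed
  then show ?thesis by (rule tendsto_eventually)
 next
  case False
  then have "smooth_step (real j * \<xi> + (1 - real j * k)) = 1" for j
   by (intro smooth_step_1) (simp add: mult_left_mono)
  then show ?thesis using False by (simp add: s_def step_def)
 qed
 have [measurable]: "s j \<in> Bor" for j by (rule smooth_fun_borel[OF s_smooth])
 have ineq: "- (LINT p|\<mu>. \<Phi> (fst p) * \<bar>deriv \<psi> (snd p)\<bar>) \<le>
  (LBINT p. kp U p * s j (snd p) * flux b \<psi> \<Phi> p)" for j
 proof -
  define \<eta> where "\<eta> \<xi> = \<psi> \<xi> * s j \<xi>" for \<xi>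
  have \<eta>: "test_function UNIV \<eta>" unfolding \<eta>_def[abs_def]
   by (rule test_function_mult_smooth[OF \<psi>(1) s_smooth])
  have d\<eta>: "deriv \<eta> \<xi> = deriv \<psi> \<xi> * s j \<xi> + deriv (s j) \<xi> * \<psi> \<xi>" for \<xi>
   unfolding \<eta>_def[abs_def]
   by (rule DERIV_imp_deriv, rule DERIV_mult[OF smooth_fun_real_has_derivative[OF sm(1)] smooth_fun_real_has_derivative[OF s_smooth], THEN DERIV_cong])
    simp
  have ge: "- \<bar>deriv \<psi> \<xi>\<bar> \<le> deriv \<eta> \<xi>" for \<xi>
  proof -
   have "\<bar>deriv \<psi> \<xi> * s j \<xi>\<bar> \<le> \<bar>deriv \<psi> \<xi>\<bar> * 1"
    unfolding abs_mult by (intro mult_left_mono s_le) auto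
   moreover have "0 \<le> deriv (s j) \<xi> * \<psi> \<xi>" by (intro mult_nonneg_nonneg s_deriv \<psi>)
   ultimately show ?thesis unfolding d\<eta> by linarith
  qed
  obtain C\<eta> where C\<eta>: "C\<eta> > 0" "\<And>x v. \<bar>Fd \<eta> x v\<bar> \<le> C\<eta> * norm v"
   using test_function_bounds[OF \<eta>] by metis
  have C\<eta>': "\<bar>deriv \<eta> x\<bar> \<le> C\<eta>" for x
   using C\<eta>(2)[of x 1] by (simp add: smooth_fun_real_frechet[OF test_function_smooth[OF \<eta>]])
  have [measurable]: "deriv \<eta> \<in> Bor"
   using smooth_fun_borel[OF smooth_fun_deriv[OF test_function_smooth[OF \<eta>]]] .
  have "- (LINT p|\<mu>. \<Phi> (fst p) * \<bar>deriv \<psi> (snd p)\<bar>) = (LINT p|\<mu>. \<Phi> (fst p) * - \<bar>deriv \<psi> (snd p)\<bar>)"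
   by simp
  \<comment> \<open>Monotonicity of the integral: here the nonnegativity of the measure
    enters.\<close>
  also have "\<dots> \<le> (LINT p|\<mu>. \<Phi> (fst p) * deriv \<eta> (snd p))"
  proof (rule integral_mono)
   show "integrable \<mu> (\<lambda>p. \<Phi> (fst p) * - \<bar>deriv \<psi> (snd p)\<bar>)"
    by (rule integrable_finite_measure_bounded[OF fin, of _ "C\<Phi> * C\<psi>"], measurable)
     (auto simp: abs_mult intro!: mult_mono C\<Phi> C\<psi> less_imp_le[OF C\<Phi>(1)])
   show "integrable \<mu> (\<lambda>p. \<Phi> (fst p) * deriv \<eta> (snd p))"
    by (rule integrable_finite_measure_bounded[OF fin, of _ "C\<Phi> * C\<eta>"], measurable)
     (auto simp: abs_mult intro!: mult_mono C\<Phi> C\<eta>' less_imp_le[OF C\<Phi>(1)])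
  qed (intro mult_left_mono ge \<Phi>)
  also have "\<dots> = (LBINT p. kp U p * flux b \<eta> \<Phi> p)"
   using kin \<Phi>(1) \<eta> by (auto simp: weak_kinetic_def)
  also have "\<dots> = (LBINT p. kp U p * s j (snd p) * flux b \<psi> \<Phi> p)"
   by (intro LBINT_cong) (auto simp: flux_def \<eta>_def)
  finally show ?thesis .
 qed
 have m: "(\<lambda>p. kp U p * g (snd p)) \<in> Bor"
  if [measurable]: "g \<in> Bor" for g
  by measurable
 have "(\<lambda>j. LBINT p. kp U p * s j (snd p) * flux b \<psi> \<Phi> p) \<longlonglongrightarrow>
  (LBINT p. kp U p * step k (snd p) * flux b \<psi> \<Phi> p)"
 proof (rule integral_dominated_convergence[where w="\<lambda>p. \<bar>1 * flux b \<psi> \<Phi> p\<bar>"])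
  show "lintegrable (\<lambda>p. \<bar>1 * flux b \<psi> \<Phi> p\<bar>)"
   by (intro integrable_abs integrable_flux[OF b \<psi>(1) \<Phi>(1), of "\<lambda>_. 1" 1]) auto
  show "(\<lambda>p. kp U p * step k (snd p) * flux b \<psi> \<Phi> p) \<in> BorL"
   by (intro borel_measurable_times flux_borel b sm) measurable
  show "(\<lambda>p. kp U p * s j (snd p) * flux b \<psi> \<Phi> p) \<in> BorL" for j
   by (intro borel_measurable_times flux_borel b sm) measurable
  show "AEL p. (\<lambda>j. kp U p * s j (snd p) * flux b \<psi> \<Phi> p)
    \<longlonglongrightarrow> kp U p * step k (snd p) * flux b \<psi> \<Phi> p"
   by (intro AE_I2 tendsto_intros s_lim)
  show "AEL p. norm (kp U p * s j (snd p) * flux b \<psi> \<Phi> p) \<le> \<bar>1 * flux b \<psi> \<Phi> p\<bar>" for j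
  proof (rule AE_I2)
   fix p
   have "\<bar>kp U p\<bar> * \<bar>s j (snd p)\<bar> \<le> 1 * 1"
    by (intro mult_mono abs_kchi_le s_le) auto
   then have "\<bar>kp U p\<bar> * \<bar>s j (snd p)\<bar> * \<bar>flux b \<psi> \<Phi> p\<bar> \<le> 1 * \<bar>flux b \<psi> \<Phi> p\<bar>"
    by (intro mult_right_mono) auto
   then show "norm (kp U p * s j (snd p) * flux b \<psi> \<Phi> p) \<le> \<bar>1 * flux b \<psi> \<Phi> p\<bar>"
    by (simp add: abs_mult)
  qed
 qed
 then show ?thesis
  by (rule LIMSEQ_le_const) (use ineq in blast)
qed

section \<open>Difference quotients of test functions\<close>

lemma smooth_fun_difference_quotient:
 assumes sm: "smooth_fun \<Phi>"
 shows "(\<lambda>n. real (Suc n) * (\<Phi> (q + inverse (real (Suc n)) *\<^sub>R v) - \<Phi> q)) \<longlonglongrightarrow> Fd \<Phi> q v"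
proof -
 have "((\<lambda>t. \<Phi> (q + t *\<^sub>R v)) has_derivative (\<lambda>t. Fd \<Phi> (q + 0 *\<^sub>R v) (t *\<^sub>R v))) (at 0)"
  by (rule has_derivative_compose[where f="\<lambda>t. q + t *\<^sub>R v", OF _ smooth_fun_has_derivative[OF sm]])
   (auto intro!: derivative_eq_intros)
 then have "((\<lambda>t. \<Phi> (q + t *\<^sub>R v)) has_real_derivative Fd \<Phi> q v) (at 0)"
  using smooth_fun_linear[OF sm, of q] fun_eq_iff[of "\<lambda>t. t * Fd \<Phi> q v" "(*) (Fd \<Phi> q v)"]
  by (simp add: has_field_derivative_def linear_scale bounded_linear.linear mult.commute)
 then have "((\<lambda>t. (\<Phi> (q + t *\<^sub>R v) - \<Phi> q) / t) \<longlongrightarrow> Fd \<Phi> q v) (at 0)"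
  by (simp add: has_field_derivative_iff)
 moreover have "filterlim (\<lambda>n. inverse (real (Suc n))) (at 0) sequentially"
  using LIMSEQ_inverse_real_of_nat by (auto simp: filterlim_at)
 ultimately have "(\<lambda>n. (\<Phi> (q + inverse (real (Suc n)) *\<^sub>R v) - \<Phi> q) / inverse (real (Suc n))) \<longlonglongrightarrow> Fd \<Phi> q v"
  by (rule filterlim_compose)
 then show ?thesis by (simp add: divide_inverse mult.commute)
qed

lemma test_function_lipschitz:
 assumes "test_function U (\<phi> :: 'a::euclidean_space \<Rightarrow> real)"
 obtains C where "C > 0" "\<And>x y. \<bar>\<phi> y - \<phi> x\<bar> \<le> C * norm (y - x)"
proof -
 obtain C where C: "C > 0" "\<And>x v. \<bar>Fd \<phi> x v\<bar> \<le> C * norm v"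
  using test_function_bounds[OF assms] by metis
 have sm: "smooth_fun \<phi>" using assms by (rule test_function_smooth)
 have "\<bar>\<phi> y - \<phi> x\<bar> \<le> C * norm (y - x)" for x y
 proof -
  have "norm (\<phi> y - \<phi> x) \<le> C * norm (y - x)"
  proof (rule differentiable_bound[where S=UNIV and f'="\<lambda>x. Fd \<phi> x"])
   show "onorm (Fd \<phi> x) \<le> C" for x
    using C(1,2) by (intro onorm_bound) auto
  qed (auto intro: smooth_fun_has_derivative[OF sm])
  then show ?thesis by simp
 qed
 with C(1) that show ?thesis by blast
qed

text \<open>Difference quotients have integral 0 by translation invariance. They are dominated by
  the Lipschitz bound on a ball enlarged by norm v, which covers all the shifts at once since the
  steps are at most 1.\<close>

lemma integral_frechet_derivative_test_function:
 fixes \<Phi> :: "'a::euclidean_space \<Rightarrow> real"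
 assumes \<Phi>: "test_function U \<Phi>"
 shows "(LBINT q. Fd \<Phi> q v) = 0"
proof -
 obtain R where C: "\<And>x. norm x > R \<Longrightarrow> \<Phi> x = 0"
  using test_function_bounds[OF \<Phi>] by metis
 have sm: "smooth_fun \<Phi>" using \<Phi> by (rule test_function_smooth)
 have [measurable]: "\<Phi> \<in> Bor" by (rule smooth_fun_borel[OF sm])
 have int: "lintegrable \<Phi>" by (rule integrable_test_function[OF \<Phi>])
 obtain L where L: "L > 0" and lip: "\<And>x y. \<bar>\<Phi> y - \<Phi> x\<bar> \<le> L * norm (y - x)"
  by (rule test_function_lipschitz[OF \<Phi>]) blast
 define g where "g n q = real (Suc n) * (\<Phi> (q + inverse (real (Suc n)) *\<^sub>R v) - \<Phi> q)" for n q
 have "(\<lambda>n. LBINT q. g n q) \<longlonglongrightarrow> (LBINT q. Fd \<Phi> q v)"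
 proof (rule integral_dominated_convergence[where w="\<lambda>q. L * norm v * indicator (cball 0 (R + norm v)) q"])
  show "lintegrable (\<lambda>q::'a. L * norm v * indicator (cball 0 (R + norm v)) q)"
   using emeasure_lborel_cball_finite[of "0::'a" "R + norm v"]
   by (intro integrable_mult_right integrable_real_indicator) auto
  show "(\<lambda>q. Fd \<Phi> q v) \<in> BorL"
   using borel_measurable_frechet_smooth[OF sm, of "\<lambda>q. q" lborel "\<lambda>q. v"] by simp
  show "g n \<in> BorL" for n unfolding g_def[abs_def] by measurable
  show "AEL q. (\<lambda>n. g n q) \<longlonglongrightarrow> Fd \<Phi> q v"
   unfolding g_def by (intro AE_I2 smooth_fun_difference_quotient[OF sm])
  show "AEL q. norm (g n q) \<le> L * norm v * indicator (cball 0 (R + norm v)) q" for n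
  proof (rule AE_I2)
   fix q
   let ?t = "inverse (real (Suc n))"
   have t: "0 < ?t" "?t \<le> 1" by (auto simp: field_simps)
   show "norm (g n q) \<le> L * norm v * indicator (cball 0 (R + norm v)) q"
   proof (cases "norm q \<le> R + norm v")
    case True
    have "norm (g n q) = real (Suc n) * \<bar>\<Phi> (q + ?t *\<^sub>R v) - \<Phi> q\<bar>" by (simp add: g_def abs_mult)
    also have "\<dots> \<le> real (Suc n) * (L * norm (q + ?t *\<^sub>R v - q))"
     by (intro mult_left_mono lip) auto
    also have "\<dots> = L * norm v" by (simp add: field_simps)
    finally show ?thesis using True by simp
   next
    case False
    have "norm q \<le> norm (q + ?t *\<^sub>R v) + norm (?t *\<^sub>R v)"
     using norm_triangle_ineq4[of "q + ?t *\<^sub>R v" "?t *\<^sub>R v"] by simp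
    moreover have "norm (?t *\<^sub>R v) \<le> 1 * norm v"
     unfolding norm_scaleR using t by (intro mult_right_mono) auto
    ultimately have "norm (q + ?t *\<^sub>R v) > R" "norm q > R" using False norm_ge_zero[of v] by linarith+
    then show ?thesis using C L by (simp add: g_def)
   qed
  qed
 qed
 moreover have "(LBINT q. g n q) = 0" for n
  unfolding g_def using integrable_shift[OF int] int
  by (simp add: integral_shift)
 ultimately have "(\<lambda>n. 0) \<longlonglongrightarrow> (LBINT q. Fd \<Phi> q v)" by simp
 then show ?thesis using LIMSEQ_unique tendsto_const by metis
qed

subsection \<open>Doubling of variables\<close>

lemma lborel_integral_prod_fst:
 fixes f :: "'a::euclidean_space \<times> 'b::euclidean_space \<Rightarrow> real"
 assumes "lintegrable f"
 shows "(LBINT x. LBINT y. f (x, y)) = (LBINT p. f p)"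
 using lborel_pair.integral_fst'[of f] assms by (simp add: lborel_prod)

lemma lborel_integral_prod_snd:
 fixes f :: "'a::euclidean_space \<times> 'b::euclidean_space \<Rightarrow> real"
 assumes "lintegrable f"
 shows "(LBINT y. LBINT x. f (x, y)) = (LBINT p. f p)"
 using lborel_pair.integral_snd[of "\<lambda>x y. f (x, y)"] assms by (simp add: lborel_prod)

lemma lborel_integral_swap:
 fixes f :: "'a::euclidean_space \<times> 'b::euclidean_space \<Rightarrow> real"
 assumes "lintegrable f"
 shows "(LBINT y. LBINT x. f (x, y)) = (LBINT x. LBINT y. f (x, y))"
 using lborel_integral_prod_fst[OF assms] lborel_integral_prod_snd[OF assms] by simp

lemma lborel_integrable_fst:
 fixes f :: "'a::euclidean_space \<times> 'b::euclidean_space \<Rightarrow> real"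
 assumes "lintegrable f"
 shows "lintegrable (\<lambda>x. LBINT y. f (x, y))"
 using lborel_pair.integrable_fst'[of f] assms by (simp add: lborel_prod)

lemma lborel_integrable_snd:
 fixes f :: "'a::euclidean_space \<times> 'b::euclidean_space \<Rightarrow> real"
 assumes "lintegrable f"
 shows "lintegrable (\<lambda>y. LBINT x. f (x, y))"
 using lborel_pair.integrable_snd[of "\<lambda>x y. f (x, y)"] assms by (simp add: lborel_prod)

text \<open>All kernels of the doubling fall into this class, which is stable under bounded Borel
  factors and sums; membership alone then justifies the Fubini arguments in three variables.\<close>

definition bounded_support :: "('a::euclidean_space \<Rightarrow> real) \<Rightarrow> bool"
 where "bounded_support f \<longleftrightarrow> f \<in> Bor \<and> (\<exists>C R. \<forall>x. \<bar>f x\<bar> \<le> C \<and> (norm x > R \<longrightarrow> f x = 0))"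

lemma bounded_supportI:
 "f \<in> Bor \<Longrightarrow> (\<And>x. \<bar>f x\<bar> \<le> C) \<Longrightarrow> (\<And>x. norm x > R \<Longrightarrow> f x = 0) \<Longrightarrow> bounded_support f"
 unfolding bounded_support_def by blast

lemma bounded_support_integrable: "bounded_support f \<Longrightarrow> lintegrable f"
 unfolding bounded_support_def by (metis AE_I2 integrable_bounded_support)

lemma bounded_support_Pair:
 assumes "bounded_support (f :: 'a::euclidean_space \<times> 'b::euclidean_space \<Rightarrow> real)"
 shows "bounded_support (\<lambda>y. f (x, y))" "bounded_support (\<lambda>x. f (x, y))"
proof -
 have [measurable]: "f \<in> Bor" using assms by (simp add: bounded_support_def)
 obtain C R where *: "\<And>p. \<bar>f p\<bar> \<le> C" "\<And>p. norm p > R \<Longrightarrow> f p = 0"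
  using assms unfolding bounded_support_def by blast
 have 1: "norm (x, y) > R" if "norm y > R" for x :: 'a and y :: 'b
  using that norm_snd_le[of y x] by simp
 have 2: "norm (x, y) > R" if "norm x > R" for x :: 'a and y :: 'b
  using that norm_fst_le[of x y] by simp
 show "bounded_support (\<lambda>y. f (x, y))"
  by (rule bounded_supportI[of _ C R]) (measurable, rule *, rule *(2)[OF 1])
 show "bounded_support (\<lambda>x. f (x, y))"
  by (rule bounded_supportI[of _ C R]) (measurable, rule *, rule *(2)[OF 2])
qed

lemma bounded_support_mult:
 assumes f: "bounded_support f" and g: "g \<in> Bor" "\<And>x. \<bar>g x\<bar> \<le> B"
 shows "bounded_support (\<lambda>x. g x * f x)"
proof -
 obtain C R where *: "\<And>p. \<bar>f p\<bar> \<le> C" "\<And>p. norm p > R \<Longrightarrow> f p = 0"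
  using f unfolding bounded_support_def by blast
 have "\<bar>g x * f x\<bar> \<le> B * C" for x
  unfolding abs_mult using g(2)[of x] *(1)[of x] by (intro mult_mono) auto
 then show ?thesis
  using f g(1) *(2) unfolding bounded_support_def
  by (intro conjI exI[of _ "B * C"] exI[of _ R]) auto
qed

text \<open>The triple is (q, q', \<xi>). Each solution is integrated over its own position and
  \<xi> with the other position frozen, and the terms that cancel are integrated over q' or q alone;
  all these orders give the same value.\<close>

lemma triple_integrals:
 fixes G :: "'a::euclidean_space \<times> 'a \<times> real \<Rightarrow> real"
 assumes G: "bounded_support G"
 shows "(LBINT q'. LBINT p. G (fst p, q', snd p)) = (LBINT z. G z)"
  and "lintegrable (\<lambda>q'. LBINT p. G (fst p, q', snd p))"
  and "(LBINT q. LBINT p. G (q, p)) = (LBINT z. G z)"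
  and "lintegrable (\<lambda>q. LBINT p. G (q, p))"
  and "(LBINT p. LBINT q'. G (fst p, q', snd p)) = (LBINT z. G z)"
  and "(LBINT p. LBINT q. G (q, p)) = (LBINT z. G z)"
proof -
 have [measurable]: "G \<in> Bor" using G by (simp add: bounded_support_def)
 obtain C R where *: "\<And>p. \<bar>G p\<bar> \<le> C" "\<And>p. norm p > R \<Longrightarrow> G p = 0"
  using G unfolding bounded_support_def by blast
 have iG: "lintegrable G" by (rule bounded_support_integrable[OF G])
 have bH: "bounded_support (\<lambda>z. G (fst (snd z), fst z, snd (snd z)))"
 proof -
  have "norm (fst (snd z), fst z, snd (snd z)) = norm z" for z :: "'a \<times> 'a \<times> real"
   by (cases z) (auto simp: norm_Pair algebra_simps)
  moreover have "(\<lambda>z. G (fst (snd z), fst z, snd (snd z))) \<in> Bor"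
   by (rule measurable_compose[OF borel_measurable_continuous_onI \<open>G \<in> Bor\<close>])
    (intro continuous_intros)
  ultimately show ?thesis
   by (intro bounded_supportI[of _ C R]) (auto intro!: *)
 qed
 then have iH: "lintegrable (\<lambda>z. G (fst (snd z), fst z, snd (snd z)))"
  by (rule bounded_support_integrable)
 show i: "lintegrable (\<lambda>q'. LBINT p. G (fst p, q', snd p))"
  using lborel_integrable_fst[OF iH] by simp
 show g1: "(LBINT q. LBINT p. G (q, p)) = (LBINT z. G z)"
  by (rule lborel_integral_prod_fst[OF iG])
 show "lintegrable (\<lambda>q. LBINT p. G (q, p))"
  by (rule lborel_integrable_fst[OF iG])
 show "(LBINT p. LBINT q. G (q, p)) = (LBINT z. G z)"
  by (rule lborel_integral_prod_snd[OF iG])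
 have bW: "bounded_support (\<lambda>w. (LBINT \<xi>. G (fst w, snd w, \<xi>)))"
 proof -
  have "\<bar>LBINT \<xi>. G (fst w, snd w, \<xi>)\<bar> \<le> (LBINT \<xi>. \<bar>C\<bar> * indicator (cball 0 R) (\<xi>::real))" for w
  proof -
   have b: "bounded_support (\<lambda>\<xi>. G (fst w, snd w, \<xi>))"
    using bounded_support_Pair(1)[OF bounded_support_Pair(1)[OF G, of "fst w"], of "snd w"] .
   have "\<bar>LBINT \<xi>. G (fst w, snd w, \<xi>)\<bar> \<le> (LBINT \<xi>. \<bar>G (fst w, snd w, \<xi>)\<bar>)"
    by (rule integral_abs_bound)
   also have "\<dots> \<le> (LBINT \<xi>. \<bar>C\<bar> * indicator (cball 0 R) (\<xi>::real))"
   proof (rule integral_mono)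
    show "lintegrable (\<lambda>\<xi>. \<bar>G (fst w, snd w, \<xi>)\<bar>)"
     using bounded_support_integrable[OF b] by simp
    show "lintegrable (\<lambda>\<xi>::real. \<bar>C\<bar> * indicator (cball 0 R) \<xi>)"
     using emeasure_lborel_cball_finite[of "0::real" R]
     by (intro integrable_mult_right integrable_real_indicator) auto
    show "\<bar>G (fst w, snd w, \<xi>)\<bar> \<le> \<bar>C\<bar> * indicator (cball 0 R) \<xi>" for \<xi>
    proof (cases "norm \<xi> > R")
     case True
     then have "norm (fst w, snd w, \<xi>) > R"
      using norm_snd_le[of "(snd w, \<xi>)" "fst w"] norm_snd_le[of \<xi> "snd w"] by simp
     then show ?thesis using *(2) by simp
    next
     case False
     then show ?thesis using *(1)[of "(fst w, snd w, \<xi>)"] by (auto simp: indicator_def)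
    qed
   qed
   finally show ?thesis .
  qed
  moreover have "(LBINT \<xi>. G (fst w, snd w, \<xi>)) = 0" if "norm w > R" for w
  proof -
   have "norm (fst w, snd w, \<xi>) > R" for \<xi>
   proof -
    have "norm w \<le> norm (fst w, snd w, \<xi>)"
     by (cases w) (auto simp: norm_Pair)
    then show ?thesis using that by simp
   qed
   then have "G (fst w, snd w, \<xi>) = 0" for \<xi> using *(2) by blast
   then show ?thesis by simp
  qed
  moreover have "(\<lambda>w. (LBINT \<xi>. G (fst w, snd w, \<xi>))) \<in> Bor"
   by (rule lborel.borel_measurable_lebesgue_integral) measurable
  ultimately show ?thesis unfolding bounded_support_def by blast
 qed
 have iW: "lintegrable (\<lambda>w. (LBINT \<xi>. G (fst w, snd w, \<xi>)))"
  by (rule bounded_support_integrable[OF bW])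
 have "(LBINT q'. LBINT p. G (fst p, q', snd p)) = (LBINT q'. LBINT q. LBINT \<xi>. G (q, q', \<xi>))"
 proof (rule LBINT_cong[OF refl])
  fix q'
  have "lintegrable (\<lambda>p. G (fst p, q', snd p))"
   using bounded_support_integrable[OF bounded_support_Pair(1)[OF bH, of q']] by simp
  from lborel_integral_prod_fst[OF this]
  show "(LBINT p. G (fst p, q', snd p)) = (LBINT q. LBINT \<xi>. G (q, q', \<xi>))" by simp
 qed
 also have "\<dots> = (LBINT q. LBINT q'. LBINT \<xi>. G (q, q', \<xi>))"
  using lborel_integral_swap[OF iW] by simp
 also have "\<dots> = (LBINT q. LBINT p. G (q, p))"
 proof (rule LBINT_cong[OF refl])
  fix q
  show "(LBINT q'. LBINT \<xi>. G (q, q', \<xi>)) = (LBINT p. G (q, p))"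
   using lborel_integral_prod_fst[OF bounded_support_integrable[OF bounded_support_Pair(1)[OF G, of q]]] .
 qed
 finally show e: "(LBINT q'. LBINT p. G (fst p, q', snd p)) = (LBINT z. G z)"
  using g1 by simp
 show "(LBINT p. LBINT q'. G (fst p, q', snd p)) = (LBINT z. G z)"
  using lborel_integral_swap[OF iH] e by simp
qed

lemma integral_mollifier_measure:
 fixes c :: "'a::euclidean_space"
 assumes fin: "finite_measure \<mu>" and sets: "sets \<mu> = sets borel" and e: "e > 0"
  and [measurable]: "g \<in> Bor" and g: "\<And>p. \<bar>g p\<bar> \<le> B"
 shows "lintegrable (\<lambda>q. LINT p|\<mu>. mollifier e (q - fst p - c) * g p)"
  "(LBINT q. LINT p|\<mu>. mollifier e (q - fst p - c) * g p) = (LINT p|\<mu>. g p)"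
  "lintegrable (\<lambda>q. LINT p|\<mu>. mollifier e (fst p - q - c) * g p)"
  "(LBINT q. LINT p|\<mu>. mollifier e (fst p - q - c) * g p) = (LINT (p :: 'a \<times> real)|\<mu>. g p)"
proof -
 interpret finite_measure \<mu> by (rule fin)
 interpret P: pair_sigma_finite lborel \<mu> by unfold_locales
 note [measurable_cong] = sets
 note [measurable] = mollifier_borel[OF e]
 have ig: "integrable \<mu> g" by (rule integrable_finite_measure_bounded[OF fin _ g]) simp
 define A where "A q p = mollifier e (q - fst p - c) * g p" for q and p :: "'a \<times> real"
 define A' where "A' q p = mollifier e (fst p - q - c) * g p" for q and p :: "'a \<times> real"
 have [measurable]: "case_prod A \<in> borel_measurable (lborel \<Otimes>\<^sub>M \<mu>)" "case_prod A' \<in> borel_measurable (lborel \<Otimes>\<^sub>M \<mu>)"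
  unfolding A_def[abs_def] A'_def[abs_def] case_prod_beta' by measurable
 have im: "lintegrable (mollifier e :: 'a \<Rightarrow> real)" by (rule integrable_mollifier[OF e])
 have AA: "lintegrable (\<lambda>q. A q p)" "(LBINT q. A q p) = g p" "(LBINT q. norm (A q p)) = \<bar>g p\<bar>" for p
 proof -
  have i: "lintegrable (\<lambda>q. mollifier e (q + (- fst p - c)))" by (rule integrable_shift[OF im])
  then show "lintegrable (\<lambda>q. A q p)" by (simp add: A_def algebra_simps)
  have m: "(LBINT q. mollifier e (q - fst p - c)) = 1"
   using integral_shift[of "mollifier e" "- fst p - c"] integral_mollifier[OF e, where 'a='a] by (simp add: algebra_simps)
  then show "(LBINT q. A q p) = g p" by (simp add: A_def)
  show "(LBINT q. norm (A q p)) = \<bar>g p\<bar>" using m by (simp add: A_def abs_mult mollifier_nonneg[OF e])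
 qed
 have AA': "lintegrable (\<lambda>q. A' q p)" "(LBINT q. A' q p) = g p" "(LBINT q. norm (A' q p)) = \<bar>g p\<bar>" for p
 proof -
  have i: "lintegrable (\<lambda>q. mollifier e ((fst p - c) - q))" by (rule integrable_reflect_shift[OF im])
  then show "lintegrable (\<lambda>q. A' q p)" by (simp add: A'_def algebra_simps)
  have m: "(LBINT q. mollifier e (fst p - q - c)) = 1"
   using integral_reflect_shift[of "mollifier e" "fst p - c"] integral_mollifier[OF e, where 'a='a] by (simp add: algebra_simps)
  then show "(LBINT q. A' q p) = g p" by (simp add: A'_def)
  show "(LBINT q. norm (A' q p)) = \<bar>g p\<bar>" using m by (simp add: A'_def abs_mult mollifier_nonneg[OF e])
 qed
 have swap: "integrable (lborel \<Otimes>\<^sub>M \<mu>) (case_prod F)"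
  if m[measurable]: "case_prod F \<in> borel_measurable (lborel \<Otimes>\<^sub>M \<mu>)"
  and F: "\<And>p. lintegrable (\<lambda>q. F q p)" "\<And>p. (LBINT q. norm (F q p)) = \<bar>g p\<bar>"
  for F :: "'a \<Rightarrow> 'a \<times> real \<Rightarrow> real"
 proof -
  interpret Q: pair_sigma_finite \<mu> "lborel :: 'a measure" by unfold_locales
  have "integrable (\<mu> \<Otimes>\<^sub>M lborel) (\<lambda>(p, q). F q p)"
  proof (rule Q.Fubini_integrable)
   show "(\<lambda>(p, q). F q p) \<in> borel_measurable (\<mu> \<Otimes>\<^sub>M lborel)"
    using measurable_pair_swap[OF m] by (simp add: case_prod_beta')
   show "integrable \<mu> (\<lambda>x. LBINT y. norm (case (x, y) of (p, q) \<Rightarrow> F q p))"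
    using ig F(2) by simp
  qed (use F(1) in auto)
  from Q.integrable_product_swap[OF this] show ?thesis by (simp add: case_prod_beta')
 qed
 note iA = swap[OF _ AA(1,3)] and iA' = swap[OF _ AA'(1,3)]
 show "lintegrable (\<lambda>q. LINT p|\<mu>. mollifier e (q - fst p - c) * g p)"
  using P.integrable_fst[OF iA] by (simp add: A_def)
 show "(LBINT q. LINT p|\<mu>. mollifier e (q - fst p - c) * g p) = (LINT p|\<mu>. g p)"
  using P.Fubini_integral[OF iA] by (simp add: A_def[symmetric] AA(2))
 show "lintegrable (\<lambda>q. LINT p|\<mu>. mollifier e (fst p - q - c) * g p)"
  using P.integrable_fst[OF iA'] by (simp add: A'_def)
 show "(LBINT q. LINT p|\<mu>. mollifier e (fst p - q - c) * g p) = (LINT p|\<mu>. g p)"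
  using P.Fubini_integral[OF iA'] by (simp add: A'_def[symmetric] AA'(2))
qed

lemma bounded_support_add:
 assumes "bounded_support f" "bounded_support g"
 shows "bounded_support (\<lambda>x. f x + g x)"
proof -
 obtain C R D S where *: "\<And>p. \<bar>f p\<bar> \<le> C" "\<And>p. norm p > R \<Longrightarrow> f p = 0"
  "\<And>p. \<bar>g p\<bar> \<le> D" "\<And>p. norm p > S \<Longrightarrow> g p = 0"
  using assms unfolding bounded_support_def by blast
 have [measurable]: "f \<in> Bor" "g \<in> Bor"
  using assms by (auto simp: bounded_support_def)
 show ?thesis
 proof (rule bounded_supportI[of _ "C + D" "max R S"])
  show "\<bar>f x + g x\<bar> \<le> C + D" for x using *(1,3)[of x] by linarith
 qed (use * in auto)
qed

lemma bounded_support_diff: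
 assumes "bounded_support f" "bounded_support g"
 shows "bounded_support (\<lambda>x. f x - g x)"
 using bounded_support_add[OF assms(1) bounded_support_mult[OF assms(2), of "\<lambda>_. -1" 1]] by simp

lemma smooth_fun_reflect:
 "smooth_fun f \<Longrightarrow> smooth_fun (\<lambda>q. f (c - q))"
 using smooth_fun_affine[of f "\<lambda>x. - x" c] bounded_linear_minus[OF bounded_linear_ident] by simp

lemma smooth_fun_shift:
 "smooth_fun f \<Longrightarrow> smooth_fun (\<lambda>q. f (q + c))"
 using smooth_fun_affine[of f "\<lambda>x. x" c] bounded_linear_ident by simp

lemma frechet_derivative_reflect:
 "smooth_fun f \<Longrightarrow> Fd (\<lambda>q. f (c - q)) q v = - Fd f (c - q) v"
 using frechet_derivative_affine_smooth[of f "\<lambda>x. - x" c q v] bounded_linear_minus[OF bounded_linear_ident]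
  linear_neg[OF bounded_linear.linear[OF smooth_fun_linear[of f "c - q"]]]
 by simp

lemma frechet_derivative_shift:
 "smooth_fun f \<Longrightarrow> Fd (\<lambda>q. f (q + c)) q v = Fd f (q + c) v"
 using frechet_derivative_affine_smooth[of f "\<lambda>x. x" c q v] bounded_linear_ident by simp

text \<open>U1 at q is compared with U2 at q + h; \<Theta> and \<psi> localise in q and in
  \<xi>.\<close>

locale kinetic_doubling =
 fixes \<Omega> :: "'a::euclidean_space set" and b :: "real \<Rightarrow> 'a" and U1 U2 :: "'a \<Rightarrow> real" and \<mu>1 \<mu>2
  and \<Theta> :: "'a \<Rightarrow> real" and \<psi> :: "real \<Rightarrow> real" and h :: 'a and C\<Theta> :: real
 assumes kin1: "weak_kinetic \<Omega> b U1 \<mu>1" and kin2: "weak_kinetic \<Omega> b U2 \<mu>2"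
  and b: "locally_bounded b"
  and \<Theta>: "test_function \<Omega> \<Theta>" "\<And>q. 0 \<le> \<Theta> q" "\<And>q. \<Theta> q \<le> C\<Theta>"
  and \<psi>: "test_function UNIV \<psi>" "\<And>\<xi>. 0 \<le> \<psi> \<xi>"
begin

lemma measurable_data [measurable]:
 "U1 \<in> Bor" "U2 \<in> Bor" "\<Theta> \<in> Bor"
 "\<psi> \<in> Bor" "deriv \<psi> \<in> Bor" "b \<in> Bor"
 using kin1 kin2 b smooth_fun_borel[OF test_function_smooth[OF \<Theta>(1)]]
  smooth_fun_borel[OF test_function_smooth[OF \<psi>(1)]]
  smooth_fun_borel[OF smooth_fun_deriv[OF test_function_smooth[OF \<psi>(1)]]]
 by (auto simp: weak_kinetic_def locally_bounded_def)

lemma C\<Theta>_nonneg: "0 \<le> C\<Theta>"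
 using \<Theta>(2,3) order_trans by blast

lemma deriv_\<psi>_bound: obtains B where "B > 0" "\<And>\<xi>. \<bar>deriv \<psi> \<xi>\<bar> \<le> B"
proof -
 obtain C where C: "C > 0" "\<And>x v. \<bar>Fd \<psi> x v\<bar> \<le> C * norm v"
  using test_function_bounds[OF \<psi>(1)] by metis
 have "\<bar>deriv \<psi> x\<bar> \<le> C" for x
  using C(2)[of x 1] by (simp add: smooth_fun_real_frechet[OF test_function_smooth[OF \<psi>(1)]])
 with C that show ?thesis by blast
qed

text \<open>The kernel \<Theta>(q) * mollifier e (q' - q - h) is differentiated along b: in
  \<open>K1\<close> the derivative falls on \<Theta>, in the singular part \<open>K2\<close> on the
  mollifier. The derivative in q is K1 - K2 and the one in q' is K2, so that the singular parts can
  cancel.\<close>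

definition K1 :: "real \<Rightarrow> 'a \<times> 'a \<times> real \<Rightarrow> real"
 where "K1 e z = flux b \<psi> \<Theta> (fst z, snd (snd z)) * mollifier e (fst (snd z) - fst z - h)"

definition K2 :: "real \<Rightarrow> 'a \<times> 'a \<times> real \<Rightarrow> real"
 where "K2 e z = \<psi> (snd (snd z)) * \<Theta> (fst z) *
  Fd (mollifier e) (fst (snd z) - fst z - h) (b (snd (snd z)))"

lemma norm_triple_gt:
 assumes "norm (z :: 'a \<times> 'a \<times> real) > R + (R + (R + norm h + e) + R)" "R > 0"
 shows "norm (fst z) > R \<or> norm (snd (snd z)) > R \<or> norm (fst (snd z) - fst z - h) > e"
proof -
 obtain q q' \<xi> where z: "z = (q, q', \<xi>)" by (cases z) auto
 have "norm q' \<le> norm (q' - q - h) + norm q + norm h"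
  using norm_triangle_ineq[of "q' - q - h" "q + h"] norm_triangle_ineq[of q h] by (simp add: algebra_simps)
 moreover have "norm z \<le> norm q + (norm q' + norm \<xi>)"
  unfolding z using norm_Pair_le[of q "(q', \<xi>)"] norm_Pair_le[of q' \<xi>] by linarith
 ultimately show ?thesis using assms unfolding z by (auto simp: not_less)
qed

lemma bounded_support_K1:
 assumes e: "e > 0" shows "bounded_support (K1 e)"
proof -
 note [measurable] = mollifier_borel[OF e]
 obtain C R where C: "C > 0" "R > 0" "\<And>p. \<bar>flux b \<psi> \<Theta> p\<bar> \<le> C"
  "\<And>p. norm (fst p) > R \<Longrightarrow> flux b \<psi> \<Theta> p = 0" "\<And>p. norm (snd p) > R \<Longrightarrow> flux b \<psi> \<Theta> p = 0"
  using flux_bounds[OF b \<psi>(1) \<Theta>(1)] by metis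
 obtain D where D: "D > 0" "\<And>x::'a. \<bar>mollifier e x\<bar> \<le> D"
  using test_function_bounds[OF test_function_mollifier[OF e]] by metis
 show ?thesis
 proof (rule bounded_supportI[of _ "C * D" "R + (R + (R + norm h + e) + R)"])
  show "K1 e \<in> Bor"
   unfolding K1_def[abs_def]
   by (intro borel_measurable_times flux_borel b test_function_smooth[OF \<psi>(1)] test_function_smooth[OF \<Theta>(1)]) measurable
  show "\<bar>K1 e z\<bar> \<le> C * D" for z
   unfolding K1_def abs_mult by (intro mult_mono C D) (use C in auto)
  show "K1 e z = 0" if "norm z > R + (R + (R + norm h + e) + R)" for z
   using norm_triple_gt[OF that C(2)] C(4)[of "(fst z, snd (snd z))"] C(5)[of "(fst z, snd (snd z))"]
    mollifier_eq_0[OF e, of "fst (snd z) - fst z - h"] by (auto simp: K1_def)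
 qed
qed

lemma bounded_support_K2:
 assumes e: "e > 0" shows "bounded_support (K2 e)"
proof -
 obtain C1 R1 where 1: "C1 > 0" "R1 > 0" "\<And>x. \<bar>\<psi> x\<bar> \<le> C1" "\<And>x. norm x > R1 \<Longrightarrow> \<psi> x = 0"
  using test_function_bounds[OF \<psi>(1)] by metis
 obtain C2 R2 where 2: "C2 > 0" "R2 > 0" "\<And>x. \<bar>\<Theta> x\<bar> \<le> C2" "\<And>x. norm x > R2 \<Longrightarrow> \<Theta> x = 0"
  using test_function_bounds[OF \<Theta>(1)] by metis
 obtain D where D: "D > 0" "\<And>(x::'a) v. \<bar>Fd (mollifier e) x v\<bar> \<le> D * norm v"
  using test_function_bounds[OF test_function_mollifier[OF e]] by metis
 have D0: "Fd (mollifier e) x v = 0" if "norm x > e" for x v :: 'a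
 proof (rule frechet_derivative_zero_outside)
  have "closure {x::'a. mollifier e x \<noteq> 0} \<subseteq> cball 0 e"
  proof (rule closure_minimal)
   show "{x::'a. mollifier e x \<noteq> 0} \<subseteq> cball 0 e"
   proof
    fix x :: 'a assume "x \<in> {x. mollifier e x \<noteq> 0}"
    then have "\<not> e \<le> norm x" using mollifier_eq_0[OF e, of x] by blast
    then show "x \<in> cball 0 e" by simp
   qed
  qed simp
  then show "x \<notin> closure {x. mollifier e x \<noteq> 0}" using that by auto
 qed
 obtain L where L: "\<And>\<xi>. \<bar>\<xi>\<bar> \<le> R1 \<Longrightarrow> norm (b \<xi>) \<le> L"
  using b unfolding locally_bounded_def by blast
 have L0: "0 \<le> L" using L[of 0] 1(2) norm_ge_zero[of "b 0"] by linarith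
 define R where "R = max R1 R2"
 show ?thesis
 proof (rule bounded_supportI[of _ "C1 * C2 * (D * L)" "R + (R + (R + norm h + e) + R)"])
  show "K2 e \<in> Bor"
   unfolding K2_def[abs_def]
   by (intro borel_measurable_times borel_measurable_frechet_smooth smooth_fun_mollifier e) measurable
  show "\<bar>K2 e z\<bar> \<le> C1 * C2 * (D * L)" for z
  proof (cases "\<bar>snd (snd z)\<bar> \<le> R1")
   case True
   have "\<bar>K2 e z\<bar> \<le> C1 * C2 * (D * norm (b (snd (snd z))))"
    unfolding K2_def abs_mult by (intro mult_mono 1 2 D) (use 1 2 in auto)
   also have "\<dots> \<le> C1 * C2 * (D * L)"
    using 1 2 D L[OF True] by (intro mult_left_mono) auto
   finally show ?thesis .
  next
   case False
   then have "K2 e z = 0" using 1(4) by (simp add: K2_def)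
   then show ?thesis using 1 2 D L0 by simp
  qed
  show "K2 e z = 0" if "norm z > R + (R + (R + norm h + e) + R)" for z
  proof -
   have "R > 0" using 1 by (simp add: R_def)
   from norm_triple_gt[OF that this] show ?thesis
    using 1(4) 2(4) D0 by (auto simp: K2_def R_def)
  qed
 qed
qed

lemma smooth_mollifier_kernel:
 assumes "e > 0"
 shows "smooth_fun (\<lambda>q. mollifier e (q' - q - h))" "smooth_fun (\<lambda>q'. mollifier e (q' - q - h))"
 using smooth_fun_reflect[OF smooth_fun_mollifier[OF assms], of "q' - h"]
  smooth_fun_shift[OF smooth_fun_mollifier[OF assms], of "- q - h"]
 by (simp_all add: algebra_simps)

lemma derivative_kernel:
 assumes "e > 0"
 shows "Fd (\<lambda>q. mollifier e (q' - q - h)) q v = - Fd (mollifier e) (q' - q - h) v"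
  "Fd (\<lambda>q'. mollifier e (q' - q - h)) q' v = Fd (mollifier e) (q' - q - h) v"
 using frechet_derivative_reflect[OF smooth_fun_mollifier[OF assms], of "q' - h" q v]
  frechet_derivative_shift[OF smooth_fun_mollifier[OF assms], of "- q - h" q' v]
 by (simp_all add: algebra_simps)

lemma test_kernel1:
 assumes "e > 0" shows "test_function \<Omega> (\<lambda>q. \<Theta> q * mollifier e (q' - q - h))"
 by (rule test_function_mult_smooth[OF \<Theta>(1) smooth_mollifier_kernel(1)[OF assms]])

lemma test_kernel2:
 assumes e: "e > 0" and supp: "\<And>q w. \<Theta> q \<noteq> 0 \<Longrightarrow> norm w \<le> e \<Longrightarrow> q + h + w \<in> \<Omega>"
 shows "test_function \<Omega> (\<lambda>q'. \<Theta> q * mollifier e (q' - q - h))"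
\<comment> \<open>When \<Theta> q = 0 the ball around q + h may leave \<Omega>, but then the
  function is 0 and the empty set serves as support.\<close>
proof (rule test_functionI[of _ "if \<Theta> q = 0 then {} else cball (q + h) e"])
 show "smooth_fun (\<lambda>q'. \<Theta> q * mollifier e (q' - q - h))"
  by (intro smooth_fun_mult smooth_fun_const smooth_mollifier_kernel e)
 show "(if \<Theta> q = 0 then {} else cball (q + h) e) \<subseteq> \<Omega>"
 proof (cases "\<Theta> q = 0")
  case False
  have "x \<in> \<Omega>" if "x \<in> cball (q + h) e" for x
   using supp[OF False, of "x - (q + h)"] that by (simp add: dist_norm norm_minus_commute)
  then show ?thesis using False by auto
 qed auto
 show "\<Theta> q * mollifier e (x - q - h) = 0" if "x \<notin> (if \<Theta> q = 0 then {} else cball (q + h) e)" for x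
  using that mollifier_eq_0[OF e, of "x - q - h"]
  by (auto simp: dist_norm norm_minus_commute algebra_simps split: if_splits)
qed auto

lemma flux_kernel1:
 assumes "e > 0"
 shows "flux b \<psi> (\<lambda>q. \<Theta> q * mollifier e (q' - q - h)) p = K1 e (fst p, q', snd p) - K2 e (fst p, q', snd p)"
 unfolding flux_def K1_def K2_def
  frechet_derivative_mult_smooth[OF test_function_smooth[OF \<Theta>(1)] smooth_mollifier_kernel(1)[OF assms]]
  derivative_kernel(1)[OF assms]
 by (simp add: algebra_simps)

lemma flux_kernel2:
 assumes "e > 0"
 shows "flux b \<psi> (\<lambda>q'. \<Theta> q * mollifier e (q' - q - h)) p = K2 e (q, p)"
 using assms frechet_derivative_mult_smooth[OF smooth_fun_const smooth_mollifier_kernel(2)[OF assms], of "\<Theta> q" q]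
 by (simp add: flux_def K2_def derivative_kernel)

lemma doubled_inequality:
 assumes e: "e > 0" and supp: "\<And>q w. \<Theta> q \<noteq> 0 \<Longrightarrow> norm w \<le> e \<Longrightarrow> q + h + w \<in> \<Omega>"
 shows "- (C\<Theta> * (LINT p|\<mu>1. \<bar>deriv \<psi> (snd p)\<bar>) + C\<Theta> * (LINT p|\<mu>2. \<bar>deriv \<psi> (snd p)\<bar>)) \<le>
  (LBINT z. \<bar>kchi (snd (snd z)) (U1 (fst z)) - kchi (snd (snd z)) (U2 (fst (snd z)))\<bar> * K1 e z)"
proof -
 define c1 where "c1 z = kchi (snd (snd z)) (U1 (fst z))" for z :: "'a \<times> 'a \<times> real"
 define c2 where "c2 z = kchi (snd (snd z)) (U2 (fst (snd z)))" for z :: "'a \<times> 'a \<times> real"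
 define s0 where "s0 z = step 0 (snd (snd z))" for z :: "'a \<times> 'a \<times> real"
 define F1 where "F1 z = (c1 z * (s0 z - 2 * c2 z)) * (K1 e z - K2 e z)" for z
 define F2 where "F2 z = (c2 z * (s0 z - 2 * c1 z)) * K2 e z" for z
 have [measurable]: "c1 \<in> Bor" "c2 \<in> Bor" "s0 \<in> Bor"
  unfolding c1_def[abs_def] c2_def[abs_def] s0_def[abs_def] by measurable
 \<comment> \<open>The step at the level of one solution is \<open>step 0\<close> minus twice its
   \<open>kchi\<close>; this rewrites both entropy tests in terms of \<open>s0\<close>,
   \<open>c1\<close> and \<open>c2\<close>.\<close>
 have st1: "s0 z - 2 * c1 z = step (U1 (fst z)) (snd (snd z))" and
  st2: "s0 z - 2 * c2 z = step (U2 (fst (snd z))) (snd (snd z))" for z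
  by (simp_all add: s0_def c1_def c2_def kchi_def diff_divide_distrib)
 have le: "\<bar>c1 z\<bar> \<le> 1" "\<bar>c2 z\<bar> \<le> 1" "\<bar>s0 z\<bar> \<le> 1" "\<bar>s0 z - 2 * c1 z\<bar> \<le> 1" "\<bar>s0 z - 2 * c2 z\<bar> \<le> 1" for z
  by (simp_all add: st1 st2) (simp_all add: c1_def c2_def s0_def abs_kchi_le)
 have le2: "\<bar>x * y\<bar> \<le> 1" if "\<bar>x\<bar> \<le> 1" "\<bar>y\<bar> \<le> 1" for x y :: real
  using mult_mono[OF that] by (simp add: abs_mult)
 note bK = bounded_support_K1[OF e] bounded_support_K2[OF e]
 have bF1: "bounded_support F1" unfolding F1_def[abs_def]
  by (rule bounded_support_mult[OF bounded_support_diff[OF bK], of _ 1]) (measurable, intro le le2)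
 have bF2: "bounded_support F2" unfolding F2_def[abs_def]
  by (rule bounded_support_mult[OF bK(2), of _ 1]) (measurable, intro le le2)
 obtain B where B: "B > 0" "\<And>\<xi>. \<bar>deriv \<psi> \<xi>\<bar> \<le> B" by (rule deriv_\<psi>_bound) blast
 have fin: "finite_measure \<mu>1" "finite_measure \<mu>2" and sets: "sets \<mu>1 = sets borel" "sets \<mu>2 = sets borel"
  using kin1 kin2 by (auto simp: weak_kinetic_def)
 define g where "g p = C\<Theta> * \<bar>deriv \<psi> (snd p)\<bar>" for p :: "'a \<times> real"
 have g: "g \<in> Bor" "\<And>p. \<bar>g p\<bar> \<le> C\<Theta> * B"
  unfolding g_def[abs_def] using B C\<Theta>_nonneg by (measurable, auto simp: abs_mult intro!: mult_left_mono)
 note [measurable] = g(1) mollifier_borel[OF e]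
 obtain Cm where Cm: "Cm > 0" "\<And>x::'a. \<bar>mollifier e x\<bar> \<le> Cm"
  using test_function_bounds[OF test_function_mollifier[OF e]] by metis
 note M1 = integral_mollifier_measure[OF fin(1) sets(1) e g, of h]
 note M2 = integral_mollifier_measure[OF fin(2) sets(2) e g, of h]
 have ib: "integrable \<mu> (\<lambda>p. f p * g p)"
  if "finite_measure \<mu>" "sets \<mu> = sets borel" and [measurable]: "f \<in> Bor"
   and f: "\<And>p. \<bar>f p\<bar> \<le> Cm" for \<mu> f
 proof -
  note [measurable_cong] = that(2)
  have fg: "\<bar>f p * g p\<bar> \<le> Cm * (C\<Theta> * B)" for p
   unfolding abs_mult using Cm by (intro mult_mono f g) auto
  show ?thesis
   by (rule integrable_finite_measure_bounded[OF that(1) _ fg]) measurable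
 qed
 have ib': "integrable \<mu> (\<lambda>p. f p * \<bar>deriv \<psi> (snd p)\<bar>)"
  if "finite_measure \<mu>" "sets \<mu> = sets borel" and [measurable]: "f \<in> Bor"
   and f: "\<And>p. \<bar>f p\<bar> \<le> C\<Theta> * Cm" for \<mu> and f :: "'a \<times> real \<Rightarrow> real"
 proof -
  note [measurable_cong] = that(2)
  have fg: "\<bar>f p * \<bar>deriv \<psi> (snd p)\<bar>\<bar> \<le> C\<Theta> * Cm * B" for p
   unfolding abs_mult abs_abs using Cm C\<Theta>_nonneg B by (intro mult_mono f B) auto
  show ?thesis
   by (rule integrable_finite_measure_bounded[OF that(1) _ fg]) measurable
 qed
 have \<Theta>m: "\<bar>\<Theta> q * mollifier e x\<bar> \<le> C\<Theta> * Cm" for q x :: 'a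
  unfolding abs_mult using \<Theta>(2,3)[of q] C\<Theta>_nonneg by (intro mult_mono Cm) auto
 \<comment> \<open>Bounding \<Theta> by C\<Theta> leaves the mollifier as the only factor depending
   on positions, as \<open>integral_mollifier_measure\<close> requires.\<close>
 have lower: "\<Theta> q * mollifier e x * \<bar>deriv \<psi> (snd p)\<bar> \<le> mollifier e x * g p" for q x :: 'a and p
 proof -
  have "\<Theta> q * (mollifier e x * \<bar>deriv \<psi> (snd p)\<bar>) \<le> C\<Theta> * (mollifier e x * \<bar>deriv \<psi> (snd p)\<bar>)"
   by (intro mult_right_mono \<Theta> mult_nonneg_nonneg mollifier_nonneg e) auto
  then show ?thesis by (simp add: g_def algebra_simps)
 qed
 have J1: "- (LINT p|\<mu>1. mollifier e (q' - fst p - h) * g p) \<le> (LBINT p. F1 (fst p, q', snd p))" for q'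
 proof -
  have "(LINT p|\<mu>1. \<Theta> (fst p) * mollifier e (q' - fst p - h) * \<bar>deriv \<psi> (snd p)\<bar>) \<le> (LINT p|\<mu>1. mollifier e (q' - fst p - h) * g p)"
  proof (rule integral_mono)
   show "integrable \<mu>1 (\<lambda>p. \<Theta> (fst p) * mollifier e (q' - fst p - h) * \<bar>deriv \<psi> (snd p)\<bar>)"
    by (rule ib'[OF fin(1) sets(1) _ \<Theta>m]) measurable
   show "integrable \<mu>1 (\<lambda>p. mollifier e (q' - fst p - h) * g p)"
    by (rule ib[OF fin(1) sets(1) _ Cm(2)]) measurable
  qed (rule lower)
  moreover have "- (LINT p|\<mu>1. \<Theta> (fst p) * mollifier e (q' - fst p - h) * \<bar>deriv \<psi> (snd p)\<bar>) \<le>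
   (LBINT p. kp U1 p * step (U2 q') (snd p) * flux b \<psi> (\<lambda>q. \<Theta> q * mollifier e (q' - q - h)) p)"
   by (rule kinetic_entropy_inequality[OF kin1 b test_kernel1[OF e] _ \<psi>])
    (intro mult_nonneg_nonneg \<Theta> mollifier_nonneg e)
  moreover have "(LBINT p. kp U1 p * step (U2 q') (snd p) * flux b \<psi> (\<lambda>q. \<Theta> q * mollifier e (q' - q - h)) p)
   = (LBINT p. F1 (fst p, q', snd p))"
   by (intro LBINT_cong) (simp_all add: F1_def st2 flux_kernel1[OF e], simp_all add: c1_def)
  ultimately show ?thesis by linarith
 qed
 have J2: "- (LINT p|\<mu>2. mollifier e (fst p - q - h) * g p) \<le> (LBINT p. F2 (q, p))" for q
 proof -
  have "(LINT p|\<mu>2. \<Theta> q * mollifier e (fst p - q - h) * \<bar>deriv \<psi> (snd p)\<bar>) \<le> (LINT p|\<mu>2. mollifier e (fst p - q - h) * g p)"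
  proof (rule integral_mono)
   show "integrable \<mu>2 (\<lambda>p. \<Theta> q * mollifier e (fst p - q - h) * \<bar>deriv \<psi> (snd p)\<bar>)"
    by (rule ib'[OF fin(2) sets(2) _ \<Theta>m]) measurable
   show "integrable \<mu>2 (\<lambda>p. mollifier e (fst p - q - h) * g p)"
    by (rule ib[OF fin(2) sets(2) _ Cm(2)]) measurable
  qed (rule lower)
  moreover have "- (LINT p|\<mu>2. \<Theta> q * mollifier e (fst p - q - h) * \<bar>deriv \<psi> (snd p)\<bar>) \<le>
   (LBINT p. kp U2 p * step (U1 q) (snd p) * flux b \<psi> (\<lambda>q'. \<Theta> q * mollifier e (q' - q - h)) p)"
   by (rule kinetic_entropy_inequality[OF kin2 b test_kernel2[OF e supp] _ \<psi>])
    (auto intro!: mult_nonneg_nonneg \<Theta> mollifier_nonneg e)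
  moreover have "(LBINT p. kp U2 p * step (U1 q) (snd p) * flux b \<psi> (\<lambda>q'. \<Theta> q * mollifier e (q' - q - h)) p)
   = (LBINT p. F2 (q, p))"
   by (intro LBINT_cong) (simp_all add: F2_def st1 flux_kernel2[OF e], simp_all add: c2_def)
  ultimately show ?thesis by linarith
 qed
 note T1 = triple_integrals[OF bF1] and T2 = triple_integrals[OF bF2]
 have "- (LINT p|\<mu>1. g p) = (LBINT q'. - (LINT p|\<mu>1. mollifier e (q' - fst p - h) * g p))"
  using M1(2) by simp
 also have "\<dots> \<le> (LBINT q'. LBINT p. F1 (fst p, q', snd p))"
  by (rule integral_mono) (use M1(1) T1(2) J1 in auto)
 also have "\<dots> = (LBINT z. F1 z)" by (rule T1)
 finally have I1: "- (LINT p|\<mu>1. g p) \<le> (LBINT z. F1 z)" .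
 have "- (LINT p|\<mu>2. g p) = (LBINT q. - (LINT p|\<mu>2. mollifier e (fst p - q - h) * g p))"
  using M2(4) by simp
 also have "\<dots> \<le> (LBINT q. LBINT p. F2 (q, p))"
  by (rule integral_mono) (use M2(3) T2(4) J2 in auto)
 also have "\<dots> = (LBINT z. F2 z)" by (rule T2)
 finally have I2: "- (LINT p|\<mu>2. g p) \<le> (LBINT z. F2 z)" .
 define G where "G z = \<bar>c1 z - c2 z\<bar> * K1 e z" for z
 define H1 where "H1 z = (s0 z * c1 z) * K2 e z" for z
 define H2 where "H2 z = (s0 z * c2 z) * (K1 e z - K2 e z)" for z
 have bG: "bounded_support G" unfolding G_def[abs_def]
  by (rule bounded_support_mult[OF bK(1), of _ 1]) (measurable, simp add: c1_def c2_def abs_kchi_diff_le)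
 have bH1: "bounded_support H1" unfolding H1_def[abs_def]
  by (rule bounded_support_mult[OF bK(2), of _ 1]) (measurable, intro le le2)
 have bH2: "bounded_support H2" unfolding H2_def[abs_def]
  by (rule bounded_support_mult[OF bounded_support_diff[OF bK], of _ 1]) (measurable, intro le le2)
 have sum: "F1 z + F2 z = G z - H1 z - H2 z" for z
 proof -
  have "\<bar>c1 z - c2 z\<bar> = s0 z * c1 z + s0 z * c2 z - 2 * (c1 z * c2 z)"
   unfolding c1_def c2_def s0_def by (rule abs_kchi_diff)
  then have "G z = (s0 z * c1 z + s0 z * c2 z - 2 * (c1 z * c2 z)) * K1 e z" by (simp add: G_def)
  then show ?thesis unfolding F1_def F2_def H1_def H2_def by (simp add: algebra_simps)
 qed
 \<comment> \<open>For fixed (q, \<xi>), \<open>H1\<close> is a constant times a derivative of the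
   mollifier in q'.\<close>
 have zero1: "(LBINT z. H1 z) = 0"
 proof -
  have "(LBINT q'. H1 (fst p, q', snd p)) = 0" for p
  proof -
   have "(LBINT q'. H1 (fst p, q', snd p)) = (LBINT q'. (step 0 (snd p) * kp U1 p * \<psi> (snd p) * \<Theta> (fst p)) *
     Fd (mollifier e) (q' + (- fst p - h)) (b (snd p)))"
    by (intro LBINT_cong) (auto simp: H1_def K2_def s0_def c1_def algebra_simps)
   also have "\<dots> = (step 0 (snd p) * kp U1 p * \<psi> (snd p) * \<Theta> (fst p)) *
    (LBINT q'. Fd (mollifier e) (q' + (- fst p - h)) (b (snd p)))"
    by (rule integral_mult_right_zero)
   also have "(LBINT q'. Fd (mollifier e) (q' + (- fst p - h)) (b (snd p))) =
    (LBINT q'. Fd (mollifier e) q' (b (snd p)))"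
    by (rule integral_shift) (rule smooth_fun_borel[OF smooth_fun_derivative[OF smooth_fun_mollifier[OF e]]])
   also have "\<dots> = 0" by (rule integral_frechet_derivative_test_function[OF test_function_mollifier[OF e]])
   finally show ?thesis by simp
  qed
  then show ?thesis using triple_integrals(5)[OF bH1] by simp
 qed
 \<comment> \<open>For fixed (q', \<xi>), \<open>H2\<close> is a constant times the derivative in q
   of the compactly supported kernel.\<close>
 have zero2: "(LBINT z. H2 z) = 0"
 proof -
  have "(LBINT q. H2 (q, p)) = 0" for p
  proof -
   have "H2 (q, p) = (step 0 (snd p) * kp U2 p * \<psi> (snd p)) *
    Fd (\<lambda>q. \<Theta> q * mollifier e (fst p - q - h)) q (b (snd p))" for q
    using flux_kernel1[OF e, of "fst p" "(q, snd p)"]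
    by (simp add: H2_def s0_def c2_def flux_def)
   then have "(LBINT q. H2 (q, p)) = (step 0 (snd p) * kp U2 p * \<psi> (snd p)) *
    (LBINT q. Fd (\<lambda>q. \<Theta> q * mollifier e (fst p - q - h)) q (b (snd p)))"
    by simp
   then show ?thesis using integral_frechet_derivative_test_function[OF test_kernel1[OF e]] by simp
  qed
  then show ?thesis using triple_integrals(6)[OF bH2] by simp
 qed
 note int = bF1[THEN bounded_support_integrable] bF2[THEN bounded_support_integrable] bG[THEN bounded_support_integrable]
  bH1[THEN bounded_support_integrable] bH2[THEN bounded_support_integrable]
 have "(LBINT z. F1 z) + (LBINT z. F2 z) = (LBINT z. F1 z + F2 z)"
  using int by (intro Bochner_Integration.integral_add[symmetric])
 also have "\<dots> = (LBINT z. G z) - (LBINT z. H1 z) - (LBINT z. H2 z)"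
  unfolding sum using int by simp
 finally have "(LBINT z. F1 z) + (LBINT z. F2 z) = (LBINT z. G z)"
  using zero1 zero2 by simp
 moreover have "(LINT p|\<mu>1. g p) = C\<Theta> * (LINT p|\<mu>1. \<bar>deriv \<psi> (snd p)\<bar>)" "(LINT p|\<mu>2. g p) = C\<Theta> * (LINT p|\<mu>2. \<bar>deriv \<psi> (snd p)\<bar>)"
  by (simp_all add: g_def)
 ultimately show ?thesis using I1 I2 unfolding G_def c1_def c2_def by linarith
qed

lemma integral_mollifier_shift:
 assumes "e > 0"
 shows "(LBINT q'. mollifier e (q' - q - h)) = 1"
 using integral_shift[of "mollifier e" "- q - h"] integral_mollifier[OF assms, where 'a='a] mollifier_borel[OF assms]
 by (simp add: algebra_simps)

text \<open>\<open>K1\<close> concentrates on q' = q + h. Since the \<open>kchi\<close> difference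
  integrates over \<xi> to the distance of the values, replacing U2 (q') by U2 (q + h) costs an L^1
  modulus of U2, whatever U1 is.\<close>

lemma limit_error:
 assumes e: "e > 0" and C: "\<And>p. \<bar>flux b \<psi> \<Theta> p\<bar> \<le> C"
  and small: "(NINT w. NINT x. ennreal (mollifier e w) * nabs (U2 (x + w) - U2 x)) \<le> ennreal r"
  and r: "0 \<le> r"
 shows "(LBINT z. \<bar>kchi (snd (snd z)) (U1 (fst z)) - kchi (snd (snd z)) (U2 (fst (snd z)))\<bar> * K1 e z) \<le>
  (LBINT p. \<bar>kp U1 p - kchi (snd p) (U2 (fst p + h))\<bar> * flux b \<psi> \<Theta> p) + C * r"
proof -
 note [measurable] = mollifier_borel[OF e]
 have C0: "0 \<le> C" using C[of undefined] by linarith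
 define G where "G z = \<bar>kchi (snd (snd z)) (U1 (fst z)) - kchi (snd (snd z)) (U2 (fst (snd z)))\<bar> * K1 e z" for z :: "'a \<times> 'a \<times> real"
 define G' where "G' z = \<bar>kchi (snd (snd z)) (U1 (fst z)) - kchi (snd (snd z)) (U2 (fst z + h))\<bar> * K1 e z" for z :: "'a \<times> 'a \<times> real"
 have bG: "bounded_support G" unfolding G_def[abs_def]
  by (rule bounded_support_mult[OF bounded_support_K1[OF e], of _ 1]) (measurable, simp add: abs_kchi_diff_le)
 have bG': "bounded_support G'" unfolding G'_def[abs_def]
  by (rule bounded_support_mult[OF bounded_support_K1[OF e], of _ 1]) (measurable, simp add: abs_kchi_diff_le)
 note int = bG[THEN bounded_support_integrable] bG'[THEN bounded_support_integrable]
 have [measurable]: "G \<in> Bor" "G' \<in> Bor"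
  using bG bG' by (auto simp: bounded_support_def)
 have "(LBINT z. G' z) = (LBINT p. LBINT q'. G' (fst p, q', snd p))"
  by (rule triple_integrals(5)[OF bG', symmetric])
 also have "\<dots> = (LBINT p. \<bar>kp U1 p - kchi (snd p) (U2 (fst p + h))\<bar> * flux b \<psi> \<Theta> p)"
  by (intro LBINT_cong) (simp_all add: G'_def K1_def integral_mollifier_shift[OF e] mult.assoc[symmetric])
 finally have eq: "(LBINT z. G' z) = (LBINT p. \<bar>kp U1 p - kchi (snd p) (U2 (fst p + h))\<bar> * flux b \<psi> \<Theta> p)" .
 define D where "D z = ennreal C * (ennreal (mollifier e (fst (snd z) - fst z - h)) *
   nabs (kchi (snd (snd z)) (U2 (fst (snd z))) - kchi (snd (snd z)) (U2 (fst z + h))))" for z :: "'a \<times> 'a \<times> real"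
 have [measurable]: "D \<in> Bor" unfolding D_def[abs_def] by measurable
 have "ennreal (LBINT z. \<bar>G z - G' z\<bar>) = (NINT z. nabs (G z - G' z))"
  by (rule nn_integral_eq_integral[symmetric]) (use int in auto)
 also have "\<dots> \<le> (NINT z. D z)"
 proof (rule nn_integral_mono)
  fix z
  have "\<bar>G z - G' z\<bar> = \<bar>\<bar>kchi (snd (snd z)) (U1 (fst z)) - kchi (snd (snd z)) (U2 (fst (snd z)))\<bar> - \<bar>kchi (snd (snd z)) (U1 (fst z)) - kchi (snd (snd z)) (U2 (fst z + h))\<bar>\<bar> * \<bar>K1 e z\<bar>"
   by (simp add: G_def G'_def left_diff_distrib[symmetric] abs_mult)
  also have "\<dots> \<le> \<bar>kchi (snd (snd z)) (U2 (fst (snd z))) - kchi (snd (snd z)) (U2 (fst z + h))\<bar> * (C * mollifier e (fst (snd z) - fst z - h))"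
   unfolding K1_def abs_mult using mollifier_nonneg[OF e] C0
   by (intro mult_mono C) (auto intro: C mult_right_mono)
  finally have le: "\<bar>G z - G' z\<bar> \<le> C * (mollifier e (fst (snd z) - fst z - h) *
   \<bar>kchi (snd (snd z)) (U2 (fst (snd z))) - kchi (snd (snd z)) (U2 (fst z + h))\<bar>)"
   by (simp add: algebra_simps)
  have em: "ennreal (C * (m * k)) = ennreal C * (ennreal m * ennreal k)" if "0 \<le> m" "0 \<le> k" for m k
   using C0 that by (simp add: ennreal_mult)
  have "D z = ennreal (C * (mollifier e (fst (snd z) - fst z - h) *
   \<bar>kchi (snd (snd z)) (U2 (fst (snd z))) - kchi (snd (snd z)) (U2 (fst z + h))\<bar>))"
   unfolding D_def by (rule em[OF mollifier_nonneg[OF e] abs_ge_zero, symmetric])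
  then show "nabs (G z - G' z) \<le> D z"
   using le by (simp add: ennreal_leI)
 qed
 also have "\<dots> = (NINT q. NINT q'. NINT \<xi>. D (q, q', \<xi>))"
 proof -
  have "(NINT z. D z) = (NINT q. NINT p. D (q, p))"
   by (subst lborel_prod[symmetric], rule lborel.nn_integral_fst[symmetric]) (simp add: lborel_prod)
  moreover have "(NINT p. D (q, p)) = (NINT q'. NINT \<xi>. D (q, q', \<xi>))" for q
   by (subst lborel_prod[symmetric], rule lborel.nn_integral_fst[symmetric, where f="\<lambda>p. D (q, p)"]) (simp add: lborel_prod)
  ultimately show ?thesis by simp
 qed
 also have "\<dots> = (NINT q. NINT q'. ennreal C * (ennreal (mollifier e (q' - q - h)) * nabs (U2 q' - U2 (q + h))))"
  unfolding D_def by (simp add: nn_integral_cmult nn_integral_kchi_diff)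
 also have "\<dots> = (NINT q. NINT w. ennreal C * (ennreal (mollifier e w) * nabs (U2 (q + h + w) - U2 (q + h))))"
 proof (rule nn_integral_cong)
  fix q
  show "(NINT q'. ennreal C * (ennreal (mollifier e (q' - q - h)) * nabs (U2 q' - U2 (q + h)))) =
   (NINT w. ennreal C * (ennreal (mollifier e w) * nabs (U2 (q + h + w) - U2 (q + h))))"
   using nn_integral_shift[of "\<lambda>q'. ennreal C * (ennreal (mollifier e (q' - q - h)) * nabs (U2 q' - U2 (q + h)))" "q + h"]
   by (simp add: algebra_simps)
 qed
 also have "\<dots> = (NINT q. NINT w. ennreal C * (ennreal (mollifier e w) * nabs (U2 (q + w) - U2 q)))"
  by (rule nn_integral_shift[where f="\<lambda>q. NINT w. ennreal C * (ennreal (mollifier e w) * nabs (U2 (q + w) - U2 q))"]) measurable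
 also have "\<dots> = (NINT w. NINT q. ennreal C * (ennreal (mollifier e w) * nabs (U2 (q + w) - U2 q)))"
  by (rule lborel_pair.Fubini'[symmetric]) measurable
 also have "\<dots> = ennreal C * (NINT w. NINT x. ennreal (mollifier e w) * nabs (U2 (x + w) - U2 x))"
  by (simp add: nn_integral_cmult)
 also have "\<dots> \<le> ennreal C * ennreal r" by (intro mult_left_mono small) simp
 also have "\<dots> = ennreal (C * r)" using C0 r by (simp add: ennreal_mult)
 finally have "(LBINT z. \<bar>G z - G' z\<bar>) \<le> C * r"
  using C0 r by (subst (asm) ennreal_le_iff) auto
 moreover have "(LBINT z. G z) - (LBINT z. G' z) \<le> (LBINT z. \<bar>G z - G' z\<bar>)"
  using int integral_abs_bound[of lborel "\<lambda>z. G z - G' z"] by (simp add: Bochner_Integration.integral_diff)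
 ultimately show ?thesis using eq unfolding G_def by linarith
qed

text \<open>The left-hand side of \<open>doubled_inequality\<close> does not depend on e, so e can
  tend to 0; the margin \<open>r0\<close> only keeps it small enough for the kernel to stay inside
  \<Omega>.\<close>

theorem kinetic_comparison:
 assumes int: "lintegrable U2" and r0: "r0 > 0"
  and supp: "\<And>q w. \<Theta> q \<noteq> 0 \<Longrightarrow> norm w \<le> r0 \<Longrightarrow> q + h + w \<in> \<Omega>"
 shows "- (C\<Theta> * (LINT p|\<mu>1. \<bar>deriv \<psi> (snd p)\<bar>) + C\<Theta> * (LINT p|\<mu>2. \<bar>deriv \<psi> (snd p)\<bar>)) \<le>
  (LBINT p. \<bar>kp U1 p - kchi (snd p) (U2 (fst p + h))\<bar> * flux b \<psi> \<Theta> p)"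
proof (rule field_le_epsilon)
 fix s :: real assume s: "s > 0"
 obtain C where C: "C > 0" "\<And>p. \<bar>flux b \<psi> \<Theta> p\<bar> \<le> C"
  using flux_bounds[OF b \<psi>(1) \<Theta>(1)] by metis
 have sC: "s / C > 0" using s C by simp
 obtain d where d: "d > 0" "\<And>e. 0 < e \<Longrightarrow> e < d \<Longrightarrow>
  (NINT w. NINT x. ennreal (mollifier e w) * nabs (U2 (x + w) - U2 x)) \<le> ennreal (s / C)"
  by (rule mollifier_L1_small[OF int sC]) blast
 define e where "e = min r0 d / 2"
 have e: "e > 0" "e < d" "e \<le> r0" using r0 d by (auto simp: e_def)
 have "C * (s / C) = s" using C by simp
 then have "(LBINT z. \<bar>kchi (snd (snd z)) (U1 (fst z)) - kchi (snd (snd z)) (U2 (fst (snd z)))\<bar> * K1 e z) \<le>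
   (LBINT p. \<bar>kp U1 p - kchi (snd p) (U2 (fst p + h))\<bar> * flux b \<psi> \<Theta> p) + s"
  using limit_error[OF e(1) C(2) d(2)[OF e(1,2)] less_imp_le[OF sC]] by simp
 moreover have "- (C\<Theta> * (LINT p|\<mu>1. \<bar>deriv \<psi> (snd p)\<bar>) + C\<Theta> * (LINT p|\<mu>2. \<bar>deriv \<psi> (snd p)\<bar>)) \<le>
   (LBINT z. \<bar>kchi (snd (snd z)) (U1 (fst z)) - kchi (snd (snd z)) (U2 (fst (snd z)))\<bar> * K1 e z)"
 proof (rule doubled_inequality[OF e(1)])
  show "q + h + w \<in> \<Omega>" if "\<Theta> q \<noteq> 0" "norm w \<le> e" for q w
   using supp[OF that(1), of w] that(2) e(3) by simp
 qed
 ultimately show "- (C\<Theta> * (LINT p|\<mu>1. \<bar>deriv \<psi> (snd p)\<bar>) + C\<Theta> * (LINT p|\<mu>2. \<bar>deriv \<psi> (snd p)\<bar>)) \<le>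
  (LBINT p. \<bar>kp U1 p - kchi (snd p) (U2 (fst p + h))\<bar> * flux b \<psi> \<Theta> p) + s"
  by (rule order_trans[rotated])
qed

end

subsection \<open>Flows on a time slab\<close>

lemma lipschitz_vector_derivative_bound:
 fixes A :: "real \<Rightarrow> 'a::euclidean_space"
 assumes L: "L-lipschitz_on {-R..R} A" and D: "(A has_vector_derivative D) (at \<xi>)" and \<xi>: "\<bar>\<xi>\<bar> < R"
 shows "norm D \<le> L"
proof (rule field_le_epsilon)
 fix e :: real assume e: "e > 0"
 have "(A has_derivative (\<lambda>h. h *\<^sub>R D)) (at \<xi>)"
  using D by (simp add: has_vector_derivative_def)
 then obtain d where d: "d > 0" "\<And>y. norm (y - \<xi>) < d \<Longrightarrow> norm (A y - A \<xi> - (y - \<xi>) *\<^sub>R D) \<le> e * norm (y - \<xi>)"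
  using e unfolding has_derivative_at_alt by blast
 define t where "t = min d (R - \<bar>\<xi>\<bar>) / 2"
 have "t > 0" "t < d" "t \<le> (R - \<bar>\<xi>\<bar>) / 2" using d \<xi> by (auto simp: t_def min_def)
 then have t: "t > 0" "t < d" "\<bar>\<xi> + t\<bar> \<le> R" using abs_triangle_ineq[of \<xi> t] \<xi> by auto
 have "norm (A (\<xi> + t) - A \<xi>) \<le> L * t"
  using lipschitz_onD[OF L, of "\<xi> + t" \<xi>] t \<xi> by (auto simp: dist_norm)
 moreover have "norm (A (\<xi> + t) - A \<xi> - t *\<^sub>R D) \<le> e * t"
  using d(2)[of "\<xi> + t"] t by simp
 moreover have "norm (t *\<^sub>R D) \<le> norm (A (\<xi> + t) - A \<xi>) + norm (A (\<xi> + t) - A \<xi> - t *\<^sub>R D)"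
  using norm_triangle_ineq4[of "A (\<xi> + t) - A \<xi>" "A (\<xi> + t) - A \<xi> - t *\<^sub>R D"] by simp
 ultimately have "t * norm D \<le> t * (L + e)" using t by (simp add: algebra_simps)
 then show "norm D \<le> L + e" using t by simp
qed

text \<open>Where the derivative exists it is bounded by the Lipschitz constant of any symmetric
  interval with the point in its interior, so setting \<open>a\<close> to 0 where it exceeds such a
  constant changes it on a null set only. \<open>N\<close> is an integer radius strictly above the
  modulus of \<xi>, which makes the bound a countable case distinction and hence measurable.\<close>

lemma flux_velocity_representative:
 fixes a :: "real \<Rightarrow> real^'n::finite"
 assumes "flux_velocity A a"
 obtains a' where "locally_bounded a'" "AEL \<xi>. a' \<xi> = a \<xi>"
proof -
 have [measurable]: "a \<in> Bor"
  and der: "AEL \<xi>. (A has_vector_derivative a \<xi>) (at \<xi>)"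
  using assms by (auto simp: flux_velocity_def)
 obtain L where L: "\<And>R. (L R)-lipschitz_on {-R..R} A"
  using assms unfolding flux_velocity_def by metis
 define N where "N \<xi> = nat \<lfloor>\<bar>\<xi>\<bar>\<rfloor> + 1" for \<xi> :: real
 define a' where "a' \<xi> = (if norm (a \<xi>) \<le> L (real (N \<xi>)) then a \<xi> else 0)" for \<xi>
 have N: "\<bar>\<xi>\<bar> < real (N \<xi>)" for \<xi> unfolding N_def by linarith
 have L0: "0 \<le> L R" for R using lipschitz_on_nonneg[OF L] .
 have [measurable]: "(\<lambda>\<xi>. L (real (N \<xi>))) \<in> Bor"
  unfolding N_def by (rule measurable_compose_countable[where f="\<lambda>i \<xi>. L (real (nat i + 1))" and g="\<lambda>\<xi>. \<lfloor>\<bar>\<xi>\<bar>\<rfloor>"]) measurable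
 have "locally_bounded a'"
  unfolding locally_bounded_def
 proof (intro conjI allI)
  show "a' \<in> Bor" unfolding a'_def[abs_def] by measurable
  fix R :: real
  show "\<exists>B. \<forall>\<xi>. \<bar>\<xi>\<bar> \<le> R \<longrightarrow> norm (a' \<xi>) \<le> B"
  proof (intro exI[of _ "\<Sum>k\<le>nat \<lfloor>R\<rfloor> + 1. L (real k)"] allI impI)
   fix \<xi> :: real assume "\<bar>\<xi>\<bar> \<le> R"
   then have "N \<xi> \<le> nat \<lfloor>R\<rfloor> + 1" unfolding N_def by (simp add: nat_mono floor_mono)
   then have "L (real (N \<xi>)) \<le> (\<Sum>k\<le>nat \<lfloor>R\<rfloor> + 1. L (real k))"
    by (intro member_le_sum[of "N \<xi>" _ "\<lambda>k. L (real k)"]) (auto simp: L0)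
   moreover have "norm (a' \<xi>) \<le> L (real (N \<xi>))" by (auto simp: a'_def L0)
   ultimately show "norm (a' \<xi>) \<le> (\<Sum>k\<le>nat \<lfloor>R\<rfloor> + 1. L (real k))" by linarith
  qed
 qed
 moreover have "AEL \<xi>. a' \<xi> = a \<xi>"
  using der
 proof eventually_elim
  case (elim \<xi>)
  then show ?case using lipschitz_vector_derivative_bound[OF L _ N] by (auto simp: a'_def)
 qed
 ultimately show ?thesis by (rule that)
qed

text \<open>The statement groups points as (t, (x, \<xi>)), the doubling as ((t, x), \<xi>);
  integrals have to pass from one grouping to the other.\<close>

lemma nn_integral_lborel_assoc:
 fixes f :: "'a::euclidean_space \<times> 'b::euclidean_space \<times> 'c::euclidean_space \<Rightarrow> ennreal"
 assumes [measurable]: "f \<in> Bor"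
 shows "(NINT p. f (fst (fst p), snd (fst p), snd p)) = (NINT z. f z)"
proof -
 have *: "(NINT p. g p) = (NINT x. NINT y. g (x, y))"
  if "g \<in> Bor" for g :: "'x::euclidean_space \<times> 'y::euclidean_space \<Rightarrow> ennreal"
  by (subst lborel_prod[symmetric], rule lborel.nn_integral_fst[symmetric]) (simp add: lborel_prod that)
 have m: "(\<lambda>p. f (fst (fst p), snd (fst p), snd p)) \<in> Bor"
  by (rule measurable_compose[OF borel_measurable_continuous_onI assms]) (intro continuous_intros)
 have m3: "(\<lambda>q. NINT \<xi>. f (fst q, snd q, \<xi>)) \<in> Bor"
  using lborel.borel_measurable_nn_integral_fst[of "\<lambda>p. f (fst (fst p), snd (fst p), snd p)" "borel :: ('a \<times> 'b) measure"] m
  by (simp add: lborel_prod borel_prod)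
 have "(NINT p. f (fst (fst p), snd (fst p), snd p)) = (NINT q. NINT \<xi>. f (fst q, snd q, \<xi>))"
  using *[OF m] by simp
 also have "\<dots> = (NINT x. NINT y. NINT \<xi>. f (x, y, \<xi>))"
  using *[OF m3] by simp
 also have "\<dots> = (NINT x. NINT z. f (x, z))"
  by (intro nn_integral_cong *[symmetric, where g="\<lambda>z. f (_, z)"]) simp
 also have "\<dots> = (NINT z. f z)"
  by (rule *[symmetric]) simp
 finally show ?thesis .
qed

lemma lborel_distr_assoc:
 "distr lborel borel (\<lambda>p. (fst (fst p), snd (fst p), snd p)) =
  (lborel :: ('a::euclidean_space \<times> 'b::euclidean_space \<times> 'c::euclidean_space) measure)"
proof (rule measure_eqI)
 have m: "(\<lambda>p. (fst (fst p), snd (fst p), snd p)) \<in> borel_measurable (borel :: (('a \<times> 'b) \<times> 'c) measure)"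
  by (intro borel_measurable_continuous_onI continuous_intros)
 fix A :: "('a \<times> 'b \<times> 'c) set" assume "A \<in> sets (distr lborel borel (\<lambda>p. (fst (fst p), snd (fst p), snd p)))"
 then have [measurable]: "A \<in> sets borel" by simp
 have "emeasure (distr lborel borel (\<lambda>p. (fst (fst p), snd (fst p), snd p))) A = (\<integral>\<^sup>+z. indicator A z \<partial>distr lborel borel (\<lambda>p. (fst (fst p), snd (fst p), snd p)))"
  by simp
 also have "\<dots> = (NINT p. indicator A (fst (fst p), snd (fst p), snd p))"
  using m by (intro nn_integral_distr) auto
 also have "\<dots> = (NINT z. indicator A z)"
  by (rule nn_integral_lborel_assoc) simp
 finally show "emeasure (distr lborel borel (\<lambda>p. (fst (fst p), snd (fst p), snd p))) A = emeasure lborel A"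
  by simp
qed simp

lemma integral_lborel_assoc:
 fixes f :: "'a::euclidean_space \<times> 'b::euclidean_space \<times> 'c::euclidean_space \<Rightarrow> real"
 assumes "f \<in> Bor"
 shows "(LBINT p. f (fst (fst p), snd (fst p), snd p)) = (LBINT z. f z)"
  and "lintegrable (\<lambda>p. f (fst (fst p), snd (fst p), snd p)) \<longleftrightarrow> lintegrable f"
proof -
 have m: "(\<lambda>p. (fst (fst p), snd (fst p), snd p)) \<in> borel_measurable (lborel :: (('a \<times> 'b) \<times> 'c) measure)"
  using borel_measurable_continuous_onI[of "\<lambda>p :: ('a \<times> 'b) \<times> 'c. (fst (fst p), snd (fst p), snd p)"]
  by (simp add: continuous_intros)
 show "(LBINT p. f (fst (fst p), snd (fst p), snd p)) = (LBINT z. f z)"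
  using integral_distr[OF m assms] by (simp add: lborel_distr_assoc)
 show "lintegrable (\<lambda>p. f (fst (fst p), snd (fst p), snd p)) \<longleftrightarrow> lintegrable f"
  using integrable_distr_eq[OF m assms] by (simp add: lborel_distr_assoc)
qed

lemma nn_integral_lborel_prod:
 fixes g :: "'x::euclidean_space \<times> 'y::euclidean_space \<Rightarrow> ennreal"
 assumes "g \<in> Bor"
 shows "(NINT p. g p) = (NINT x. NINT y. g (x, y))"
 by (subst lborel_prod[symmetric], rule lborel.nn_integral_fst[symmetric]) (simp add: lborel_prod assms)

lemma nn_integral_kchi_prod:
 fixes v w :: "'a::euclidean_space \<Rightarrow> real"
 assumes [measurable]: "v \<in> Bor" "w \<in> Bor"
 shows "(NINT z. nabs (kp v z - kp w z)) = (NINT x. nabs (v x - w x))"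
 by (subst nn_integral_lborel_prod) (auto simp: nn_integral_kchi_diff)

lemma integrable_iff_nn_abs:
 fixes f :: "'a \<Rightarrow> real"
 assumes "f \<in> borel_measurable M"
 shows "integrable M f \<longleftrightarrow> (\<integral>\<^sup>+x. nabs (f x) \<partial>M) < \<infinity>"
 using assms by (simp add: integrable_iff_bounded)

lemma kchi_prod_L1:
 fixes v w :: "'a::euclidean_space \<Rightarrow> real"
 assumes v: "lintegrable v" and w: "lintegrable w"
 shows "lintegrable (\<lambda>z. kp v z - kp w z)"
  and "(LBINT z. \<bar>kp v z - kp w z\<bar>) = (LBINT x. \<bar>v x - w x\<bar>)"
  and "lintegrable (\<lambda>z. kp v z)"
proof -
 have [measurable]: "v \<in> Bor" "w \<in> Bor" using v w by auto
 show i: "lintegrable (\<lambda>z. kp v z - kp w z)"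
  using Bochner_Integration.integrable_diff[OF v w]
  by (subst (asm) integrable_iff_nn_abs, simp, subst integrable_iff_nn_abs) (simp_all add: nn_integral_kchi_prod)
 have "ennreal (LBINT z. \<bar>kp v z - kp w z\<bar>) = ennreal (LBINT x. \<bar>v x - w x\<bar>)"
  using i v w by (subst (1 2) nn_integral_eq_integral[symmetric]) (auto simp: nn_integral_kchi_prod)
 then show "(LBINT z. \<bar>kp v z - kp w z\<bar>) = (LBINT x. \<bar>v x - w x\<bar>)"
  by (subst (asm) ennreal_inj) auto
 show "lintegrable (\<lambda>z. kp v z)"
  using nn_integral_kchi_prod[of v "\<lambda>_. 0"] v by (subst integrable_iff_nn_abs) (auto simp: integrable_iff_bounded)
qed

text \<open>Serves both for u, with x in space, and for f, with (x, \<xi>) in place of x. The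
  extension by 0 makes integrals over all times finite, so that Fubini applies without restricting
  the domain.\<close>

definition slab_flow :: "real \<Rightarrow> (real \<times> 'a::euclidean_space \<Rightarrow> real) \<Rightarrow> bool"
 where "slab_flow T U \<longleftrightarrow> 0 < T \<and> U \<in> Bor \<and> (\<forall>t x. t \<notin> {0..T} \<longrightarrow> U (t, x) = 0) \<and>
  (\<forall>t\<in>{0..T}. lintegrable (\<lambda>x. U (t, x))) \<and>
  (\<forall>t\<in>{0..T}. ((\<lambda>s. LBINT x. \<bar>U (s, x) - U (t, x)\<bar>) \<longlongrightarrow> 0) (at t within {0..T}))"

lemma L1_norm_continuous:
 fixes g :: "real \<Rightarrow> 'z \<Rightarrow> real"
 assumes int: "\<And>t. t \<in> {a..b} \<Longrightarrow> integrable M (g t)"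
  and cont: "\<And>t. t \<in> {a..b} \<Longrightarrow> ((\<lambda>s. LINT z|M. \<bar>g s z - g t z\<bar>) \<longlongrightarrow> 0) (at t within {a..b})"
  and F: "\<And>s t. s \<in> {a..b} \<Longrightarrow> t \<in> {a..b} \<Longrightarrow> \<bar>F s - F t\<bar> \<le> C * (LINT z|M. \<bar>g s z - g t z\<bar>)"
 shows "continuous_on {a..b} F"
 unfolding continuous_on_def
proof
 fix t assume t: "t \<in> {a..b}"
 have "((\<lambda>s. F s - F t) \<longlongrightarrow> 0) (at t within {a..b})"
 proof (rule Lim_null_comparison)
  show "eventually (\<lambda>s. norm (F s - F t) \<le> C * (LINT z|M. \<bar>g s z - g t z\<bar>)) (at t within {a..b})"
   using F t by (auto simp: eventually_at_filter)
  show "((\<lambda>s. C * (LINT z|M. \<bar>g s z - g t z\<bar>)) \<longlongrightarrow> 0) (at t within {a..b})"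
   using tendsto_mult_right_zero[OF cont[OF t]] .
 qed
 then show "(F \<longlongrightarrow> F t) (at t within {a..b})" by (simp add: LIM_zero_iff)
qed

lemma L1_diff_triangle:
 fixes f g h :: "'a \<Rightarrow> real"
 assumes "integrable M f" "integrable M g" "integrable M h"
 shows "(LINT x|M. \<bar>f x - h x\<bar>) \<le> (LINT x|M. \<bar>f x - g x\<bar>) + (LINT x|M. \<bar>g x - h x\<bar>)"
proof -
 have "(LINT x|M. \<bar>f x - h x\<bar>) \<le> (LINT x|M. \<bar>f x - g x\<bar> + \<bar>g x - h x\<bar>)"
  by (rule integral_mono) (use assms in auto)
 also have "\<dots> = (LINT x|M. \<bar>f x - g x\<bar>) + (LINT x|M. \<bar>g x - h x\<bar>)"
  using assms by (intro Bochner_Integration.integral_add) auto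
 finally show ?thesis .
qed

lemma abs_L1_dist_diff:
 fixes f g h k :: "'a \<Rightarrow> real"
 assumes "integrable M f" "integrable M g" "integrable M h" "integrable M k"
 shows "\<bar>(LINT x|M. \<bar>f x - g x\<bar>) - (LINT x|M. \<bar>h x - k x\<bar>)\<bar> \<le> (LINT x|M. \<bar>f x - h x\<bar>) + (LINT x|M. \<bar>g x - k x\<bar>)"
 using L1_diff_triangle[OF assms(1,3,2)] L1_diff_triangle[OF assms(3,4,2)]
  L1_diff_triangle[OF assms(3,1,4)] L1_diff_triangle[OF assms(1,2,4)]
 by (simp add: abs_minus_commute abs_le_iff)

lemma slab_flow_integrable:
 assumes U: "slab_flow T U"
 shows "lintegrable U" "\<And>t. lintegrable (\<lambda>x. U (t, x))" "\<exists>B. \<forall>t. (LBINT x. \<bar>U (t, x)\<bar>) \<le> B"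
proof -
 have T: "0 < T" and [measurable]: "U \<in> Bor" and out: "\<And>t x. t \<notin> {0..T} \<Longrightarrow> U (t, x) = 0"
  and int: "\<And>t. t \<in> {0..T} \<Longrightarrow> lintegrable (\<lambda>x. U (t, x))"
  and cont: "\<And>t. t \<in> {0..T} \<Longrightarrow> ((\<lambda>s. LBINT x. \<bar>U (s, x) - U (t, x)\<bar>) \<longlongrightarrow> 0) (at t within {0..T})"
  using U by (auto simp: slab_flow_def)
 show i: "lintegrable (\<lambda>x. U (t, x))" for t
  by (cases "t \<in> {0..T}") (auto simp: int out)
 have "continuous_on {0..T} (\<lambda>t. LBINT x. \<bar>U (t, x)\<bar>)"
 proof (rule L1_norm_continuous[where C=1 and g="\<lambda>t x. U (t, x)" and M=lborel])
  fix s t assume "s \<in> {0..T}" "t \<in> {0..T}"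
  then show "\<bar>(LBINT x. \<bar>U (s, x)\<bar>) - (LBINT x. \<bar>U (t, x)\<bar>)\<bar> \<le> 1 * (LBINT x. \<bar>U (s, x) - U (t, x)\<bar>)"
   using abs_L1_dist_diff[OF int _ int, of s "\<lambda>_. 0" t "\<lambda>_. 0"] by simp
 qed (use int cont in auto)
 then have "bounded ((\<lambda>t. LBINT x. \<bar>U (t, x)\<bar>) ` {0..T})"
  by (intro compact_imp_bounded compact_continuous_image) auto
 then obtain B where B: "B > 0" "\<And>t. t \<in> {0..T} \<Longrightarrow> (LBINT x. \<bar>U (t, x)\<bar>) \<le> B"
  by (force simp: bounded_pos)
 have B': "(LBINT x. \<bar>U (t, x)\<bar>) \<le> B" for t
  using B by (cases "t \<in> {0..T}") (auto simp: out)
 then show "\<exists>B. \<forall>t. (LBINT x. \<bar>U (t, x)\<bar>) \<le> B" by blast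
 have "(NINT q. nabs (U q)) = (NINT t. NINT x. nabs (U (t, x)))"
  by (rule nn_integral_lborel_prod) simp
 also have "\<dots> \<le> (NINT t. ennreal B * indicator {0..T} t)"
 proof (rule nn_integral_mono)
  fix t
  show "(NINT x. nabs (U (t, x))) \<le> ennreal B * indicator {0..T} t"
   using B(2)[of t] i[of t] out[of t] by (subst nn_integral_eq_integral) (auto simp: indicator_def intro: ennreal_leI)
 qed
 also have "\<dots> < \<infinity>"
  using T by (subst nn_integral_cmult) (auto simp: ennreal_mult_less_top)
 finally show "lintegrable U" by (subst integrable_iff_nn_abs) auto
qed

text \<open>Testing with \<open>\<theta>(t) = S((t - s) / d) - S((t - t') / d)\<close> for a smooth step \<open>S\<close> and letting \<open>d \<rightarrow> 0\<close>.\<close>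

lemma weak_derivative_bound:
 fixes D :: "real \<Rightarrow> real"
 assumes cont: "continuous_on {0..T} D" and B: "0 \<le> B"
  and weak: "\<And>\<theta>. test_function {0<..<T} \<theta> \<Longrightarrow> (\<And>t. 0 \<le> \<theta> t) \<Longrightarrow>
   - B * (LBINT t. \<theta> t) \<le> (LBINT t. deriv \<theta> t * D t)"
  and st: "0 \<le> s" "s \<le> t" "t \<le> T"
 shows "D t - D s \<le> B * (t - s)"
proof -
 \<comment> \<open>\<open>S c d\<close> rises from 0 at c to 1 at c + d, so for d > 0 its derivative
   is a nonnegative kernel of mass 1 on that interval.\<close>
 define S where "S c d r = smooth_step (inverse d * r + (- inverse d * c))" for c d r :: real
 have S_smooth: "smooth_fun (S c d)" for c d
  unfolding S_def[abs_def] by (rule smooth_fun_affine[OF smooth_fun_smooth_step bounded_linear_mult_right])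
 have S_deriv: "deriv (S c d) r = inverse d * deriv smooth_step (inverse d * r + (- inverse d * c))" for c d r
 proof -
  have "(S c d has_real_derivative deriv smooth_step (inverse d * r + (- inverse d * c)) * inverse d) (at r)"
   unfolding S_def[abs_def]
   by (rule DERIV_chain2[OF smooth_fun_real_has_derivative[OF smooth_fun_smooth_step]]) (auto intro!: derivative_eq_intros)
  then show ?thesis by (simp add: DERIV_imp_deriv)
 qed
 have arg: "inverse d * r + (- inverse d * c) = (r - c) / d" for d r c :: real
  by (simp add: divide_inverse algebra_simps)
 have S0: "S c d r = 0" if "d > 0" "r \<le> c" for c d r
  unfolding S_def arg using that by (intro smooth_step_0) (simp add: field_simps)
 have S1: "S c d r = 1" if "d > 0" "r \<ge> c + d" for c d r
  unfolding S_def arg using that by (intro smooth_step_1) (simp add: field_simps)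
 have S_nn: "0 \<le> deriv (S c d) r" if "d > 0" for c d r
  unfolding S_deriv using that by (intro mult_nonneg_nonneg deriv_smooth_step_nonneg) auto
 have S_out: "deriv (S c d) r = 0" if "d > 0" "r \<notin> {c..c+d}" for c d r
 proof -
  have "(S c d has_real_derivative 0) (at r)"
  proof (cases "r < c")
   case True
   have "((\<lambda>r. 0) has_real_derivative 0) (at r)" by simp
   then show ?thesis
    by (rule has_field_derivative_transform_within_open[where S="{..<c}"]) (use True that S0 in auto)
  next
   case False
   have "((\<lambda>r. 1) has_real_derivative 0) (at r)" by simp
   then show ?thesis
    by (rule has_field_derivative_transform_within_open[where S="{c+d<..}"]) (use False that S1 in auto)
  qed
  then show ?thesis by (rule DERIV_imp_deriv)
 qed
 have S_int: "has_bochner_integral lborel (\<lambda>r. deriv (S c d) r) 1" if d: "d > 0" for c d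
 proof -
  have "has_bochner_integral lborel (\<lambda>r. deriv (S c d) r * indicator {c..c+d} r) (S c d (c + d) - S c d c)"
  proof (rule has_bochner_integral_FTC_Icc_real)
   show "(S c d has_real_derivative deriv (S c d) x) (at x)" for x
    by (rule smooth_fun_real_has_derivative[OF S_smooth])
   show "isCont (deriv (S c d)) x" for x
    using smooth_fun_continuous_on[OF smooth_fun_deriv[OF S_smooth], of UNIV c d] continuous_on_eq_continuous_at by blast
  qed (use d in auto)
  moreover have "deriv (S c d) r * indicator {c..c+d} r = deriv (S c d) r" for r
   using S_out[OF d, of r c] by (auto simp: indicator_def)
  ultimately show ?thesis using S0[OF d, of c c] S1[OF d, of c "c + d"] by simp
 qed
 \<comment> \<open>The derivative of the ramp acts as an approximate unit mass at c.\<close>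
 have near: "\<bar>(LBINT r. deriv (S c d) r * D r) - D c\<bar> \<le> e \<and> lintegrable (\<lambda>r. deriv (S c d) r * D r)"
  if d: "d > 0" and sub: "{c..c+d} \<subseteq> {0..T}" and e: "\<And>r. r \<in> {c..c+d} \<Longrightarrow> \<bar>D r - D c\<bar> \<le> e" for c d e
 proof -
  have "continuous_on {c..c+d} (\<lambda>r. deriv (S c d) r * D r)"
   by (intro continuous_intros smooth_fun_continuous_on[OF smooth_fun_deriv[OF S_smooth]] continuous_on_subset[OF cont sub])
  then have "set_integrable lborel {c..c+d} (\<lambda>r. deriv (S c d) r * D r)"
   by (rule borel_integrable_atLeastAtMost')
  moreover have "(\<lambda>r. indicator {c..c+d} r *\<^sub>R (deriv (S c d) r * D r)) = (\<lambda>r. deriv (S c d) r * D r)"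
   using S_out[OF d, of _ c] by (fastforce simp: indicator_def)
  ultimately have i: "lintegrable (\<lambda>r. deriv (S c d) r * D r)" unfolding set_integrable_def by simp
  have i0: "lintegrable (deriv (S c d))" and i1: "(LBINT r. deriv (S c d) r) = 1"
   using S_int[OF d, of c] by (auto simp: has_bochner_integral_iff)
  have eq: "(LBINT r. deriv (S c d) r * D r) - D c = (LBINT r. deriv (S c d) r * D r - deriv (S c d) r * D c)"
   using Bochner_Integration.integral_diff[OF i integrable_mult_left[OF i0, of "D c"]] i1
   by (simp only: integral_mult_left_zero mult_1)
  have "\<bar>LBINT r. deriv (S c d) r * D r - deriv (S c d) r * D c\<bar> \<le> (LBINT r. \<bar>deriv (S c d) r * D r - deriv (S c d) r * D c\<bar>)"
   by (rule integral_abs_bound)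
  also have "\<dots> \<le> (LBINT r. deriv (S c d) r * e)"
  proof (rule integral_mono)
   show "\<bar>deriv (S c d) r * D r - deriv (S c d) r * D c\<bar> \<le> deriv (S c d) r * e" for r
   proof (cases "r \<in> {c..c+d}")
    case True
    have "\<bar>deriv (S c d) r * D r - deriv (S c d) r * D c\<bar> = deriv (S c d) r * \<bar>D r - D c\<bar>"
     using S_nn[OF d, of c r] by (simp add: right_diff_distrib[symmetric] abs_mult)
    then show ?thesis using mult_left_mono[OF e[OF True] S_nn[OF d, of c r]] by simp
   next
    case False
    then show ?thesis using S_out[OF d] by simp
   qed
  qed (intro integrable_abs Bochner_Integration.integrable_diff integrable_mult_left i i0)+
  also have "\<dots> = e" using i1 by (simp only: integral_mult_left_zero mult_1)
  finally show ?thesis using i unfolding eq by blast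
 qed
 have main: "D t - D s \<le> B * (t - s)" if st: "0 < s" "s < t" "t < T" for s t
 proof (rule field_le_epsilon)
  fix e :: real assume e: "e > 0"
  define e' where "e' = e / (2 + B)"
  have e': "e' > 0" using e B by (simp add: e'_def)
  have ex: "\<exists>d>0. \<forall>r\<in>{0..T}. \<bar>r - c\<bar> < d \<longrightarrow> \<bar>D r - D c\<bar> < e'" if "c \<in> {0..T}" for c
   using cont that e' unfolding continuous_on_iff dist_real_def by blast
  obtain d1 where d1: "d1 > 0" "\<And>r. r \<in> {0..T} \<Longrightarrow> \<bar>r - s\<bar> < d1 \<Longrightarrow> \<bar>D r - D s\<bar> < e'"
   using ex[of s] st by force
  obtain d2 where d2: "d2 > 0" "\<And>r. r \<in> {0..T} \<Longrightarrow> \<bar>r - t\<bar> < d2 \<Longrightarrow> \<bar>D r - D t\<bar> < e'"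
   using ex[of t] st by force
  \<comment> \<open>The last two entries keep the two ramps disjoint and inside (0,T); the factor
    1/2 makes all the inequalities strict.\<close>
  define d where "d = Min {d1, d2, e', T - t, t - s} / 2"
  have dm: "d > 0" "d < d1" "d < d2" "d < e'" "d < T - t" "d < t - s"
   using d1 d2 e' st by (auto simp: d_def)
  define \<theta> where "\<theta> r = S s d r - S t d r" for r
  have \<theta>_smooth: "smooth_fun \<theta>" unfolding \<theta>_def[abs_def] by (intro smooth_fun_diff S_smooth)
  have \<theta>_test: "test_function {0<..<T} \<theta>"
  proof (rule test_functionI[OF \<theta>_smooth, of "{s..t+d}"])
   show "\<theta> r = 0" if "r \<notin> {s..t+d}" for r
    using that S0[OF dm(1), of r] S1[OF dm(1), of _ r] st dm by (cases "r < s") (auto simp: \<theta>_def)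
  qed (use st dm in auto)
  have \<theta>_nn: "0 \<le> \<theta> r" for r
   using smooth_step_mono[of "(r - t) / d" "(r - s) / d"] dm st
   unfolding \<theta>_def S_def arg by (simp add: divide_right_mono)
  have \<theta>_le: "\<theta> r \<le> indicator {s..t+d} r" for r
  proof (cases "r \<in> {s..t+d}")
   case True
   have "\<theta> r \<le> 1" using smooth_step_le_1 smooth_step_nonneg
    unfolding \<theta>_def S_def by (smt (verit))
   then show ?thesis using True by simp
  next
   case False
   then have "\<theta> r = 0" using S0[OF dm(1), of r] S1[OF dm(1), of _ r] st dm by (cases "r < s") (auto simp: \<theta>_def)
   then show ?thesis by simp
  qed
  have "(LBINT r. \<theta> r) \<le> (LBINT r. indicator {s..t+d} r)"
   by (rule integral_mono) (use integrable_test_function[OF \<theta>_test] \<theta>_le in \<open>auto intro!: integrable_real_indicator simp: emeasure_lborel_Icc_eq\<close>)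
  also have "\<dots> = t + d - s" using st dm by simp
  finally have "B * (LBINT r. \<theta> r) \<le> B * (t + d - s)" using B by (intro mult_left_mono)
  moreover have "(LBINT r. deriv \<theta> r * D r) = (LBINT r. deriv (S s d) r * D r) - (LBINT r. deriv (S t d) r * D r)"
  proof -
   have "deriv \<theta> r = deriv (S s d) r - deriv (S t d) r" for r
    unfolding \<theta>_def[abs_def]
    by (rule DERIV_imp_deriv[OF DERIV_diff[OF smooth_fun_real_has_derivative[OF S_smooth] smooth_fun_real_has_derivative[OF S_smooth]]])
   then show ?thesis
    using near[OF dm(1), of s e'] near[OF dm(1), of t e'] d1(2) d2(2) dm st
    by (simp add: left_diff_distrib less_imp_le)
  qed
  moreover have "\<bar>(LBINT r. deriv (S s d) r * D r) - D s\<bar> \<le> e'"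
   using near[OF dm(1), of s e'] d1(2) dm st by (auto simp: less_imp_le)
  moreover have "\<bar>(LBINT r. deriv (S t d) r * D r) - D t\<bar> \<le> e'"
   using near[OF dm(1), of t e'] d2(2) dm st by (auto simp: less_imp_le)
  moreover have "- B * (LBINT r. \<theta> r) \<le> (LBINT r. deriv \<theta> r * D r)"
   by (rule weak[OF \<theta>_test \<theta>_nn])
  ultimately have "D t - D s \<le> B * (t + d - s) + 2 * e'" by (simp add: abs_le_iff)
  also have "\<dots> \<le> B * (t - s) + (B * e' + 2 * e')"
   using mult_left_mono[OF less_imp_le[OF dm(4)] B] by (simp add: algebra_simps)
  also have "B * e' + 2 * e' = e" using B by (simp add: e'_def field_simps add_divide_distrib[symmetric])
  finally show "D t - D s \<le> B * (t - s) + e" .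
 qed
 show ?thesis
 proof (cases "s = t")
  case False
  then have "s < t" using st by simp
  \<comment> \<open>The cases s = 0 and t = T are reached from the interior by continuity. The
    fractions 1/2 and 1/3 sum to less than 1, so that a n < c n.\<close>
  define a where "a n = s + (t - s) / 2 * inverse (real (Suc n))" for n
  define c where "c n = t - (t - s) / 3 * inverse (real (Suc n))" for n
  have "(\<lambda>n. s + (t - s) / 2 * inverse (real (Suc n))) \<longlonglongrightarrow> s + (t - s) / 2 * 0"
   "(\<lambda>n. t - (t - s) / 3 * inverse (real (Suc n))) \<longlonglongrightarrow> t - (t - s) / 3 * 0"
   by (intro tendsto_intros LIMSEQ_inverse_real_of_nat)+
  then have lim: "a \<longlonglongrightarrow> s" "c \<longlonglongrightarrow> t"
   unfolding a_def[abs_def] c_def[abs_def] by (simp_all del: of_nat_Suc)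
  have inv: "0 < inverse (real (Suc n))" "inverse (real (Suc n)) \<le> 1" for n by (auto simp: field_simps)
  have ac: "0 < a n" "a n < c n" "c n < T" "a n \<in> {0..T}" "c n \<in> {0..T}" for n
  proof -
   define x where "x = (t - s) / 2 * inverse (real (Suc n))"
   define y where "y = (t - s) / 3 * inverse (real (Suc n))"
   have "x \<le> (t - s) / 2" "y \<le> (t - s) / 3" unfolding x_def y_def
    using mult_left_mono[OF inv(2)[of n], of "(t - s) / 2"] mult_left_mono[OF inv(2)[of n], of "(t - s) / 3"] \<open>s < t\<close> by auto
   moreover have "0 < x" "0 < y" unfolding x_def y_def
    using inv(1)[of n] \<open>s < t\<close> by (auto intro!: mult_pos_pos)
   moreover have "a n = s + x" "c n = t - y" by (simp_all add: a_def c_def x_def y_def)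
   ultimately show "0 < a n" "a n < c n" "c n < T" "a n \<in> {0..T}" "c n \<in> {0..T}"
    using st \<open>s < t\<close> by auto
  qed
  have "(\<lambda>n. D (c n) - D (a n)) \<longlonglongrightarrow> D t - D s"
   using ac(4,5) st by (intro tendsto_diff continuous_on_tendsto_compose[OF cont] lim) auto
  moreover have "(\<lambda>n. B * (c n - a n)) \<longlonglongrightarrow> B * (t - s)"
   by (intro tendsto_intros lim)
  ultimately show ?thesis
   by (rule LIMSEQ_le) (use main ac in blast)
 qed simp
qed

subsection \<open>Contraction in the mean\<close>

lemma smooth_fun_linear_compose:
 assumes "smooth_fun f" "bounded_linear L"
 shows "smooth_fun (\<lambda>x. f (L x))"
  and "Fd (\<lambda>x. f (L x)) x v = Fd f (L x) (L v)"
 using smooth_fun_affine[OF assms, of 0] frechet_derivative_affine_smooth[OF assms, of 0 x v] by simp_all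

lemma test_function_deriv_bound:
 assumes "test_function U (f :: real \<Rightarrow> real)"
 obtains C where "C > 0" "\<And>x. \<bar>f x\<bar> \<le> C" "\<And>x. \<bar>deriv f x\<bar> \<le> C"
proof -
 obtain C where C: "C > 0" "\<And>x. \<bar>f x\<bar> \<le> C" "\<And>x v. \<bar>Fd f x v\<bar> \<le> C * norm v"
  using test_function_bounds[OF assms] by metis
 have "\<bar>deriv f x\<bar> \<le> C" for x
  using C(3)[of x 1] by (simp add: smooth_fun_real_frechet[OF test_function_smooth[OF assms]])
 with C that show ?thesis by blast
qed

lemma smooth_fun_tensor:
 fixes \<theta> :: "real \<Rightarrow> real" and g :: "'b::euclidean_space \<Rightarrow> real"
 assumes \<theta>: "smooth_fun \<theta>" and g: "smooth_fun g"
 shows "smooth_fun (\<lambda>q. \<theta> (fst q) * g (snd q))"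
  and "Fd (\<lambda>q. \<theta> (fst q) * g (snd q)) q v =
   \<theta> (fst q) * Fd g (snd q) (snd v) + deriv \<theta> (fst q) * fst v * g (snd q)"
 using frechet_derivative_mult_smooth[OF smooth_fun_linear_compose(1)[OF \<theta> bounded_linear_fst]
   smooth_fun_linear_compose(1)[OF g bounded_linear_snd], of q v]
 by (auto simp: smooth_fun_linear_compose[OF \<theta> bounded_linear_fst] smooth_fun_linear_compose[OF g bounded_linear_snd]
   smooth_fun_real_frechet[OF \<theta>])

lemma test_function_tensor:
 fixes \<theta> :: "real \<Rightarrow> real" and g :: "'b::euclidean_space \<Rightarrow> real"
 assumes \<theta>: "test_function I \<theta>" and g: "test_function UNIV g"
 shows "test_function (I \<times> UNIV) (\<lambda>q. \<theta> (fst q) * g (snd q))"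
proof (rule test_functionI[OF smooth_fun_tensor(1)[OF test_function_smooth[OF \<theta>] test_function_smooth[OF g]]])
 show "compact (closure {x. \<theta> x \<noteq> 0} \<times> closure {x. g x \<noteq> 0})"
  using \<theta> g by (auto simp: test_function_iff intro: compact_Times)
 show "closure {x. \<theta> x \<noteq> 0} \<times> closure {x. g x \<noteq> 0} \<subseteq> I \<times> UNIV"
  using \<theta> by (auto simp: test_function_iff)
 show "\<theta> (fst q) * g (snd q) = 0" if "q \<notin> closure {x. \<theta> x \<noteq> 0} \<times> closure {x. g x \<noteq> 0}" for q
  using that closure_subset[of "{x. \<theta> x \<noteq> 0}"] closure_subset[of "{x. g x \<noteq> 0}"]
  by (cases q) auto
qed

lemma flux_tensor:
 fixes a :: "real \<Rightarrow> 'b::euclidean_space"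
 assumes "smooth_fun \<theta>" "smooth_fun g"
 shows "flux (\<lambda>\<xi>. (1, a \<xi>)) \<psi> (\<lambda>q. \<theta> (fst q) * g (snd q)) p = \<psi> (snd p) *
  (\<theta> (fst (fst p)) * Fd g (snd (fst p)) (a (snd p)) + deriv \<theta> (fst (fst p)) * g (snd (fst p)))"
 by (simp add: flux_def smooth_fun_tensor[OF assms])

lemma locally_bounded_Pair:
 "locally_bounded a \<Longrightarrow> locally_bounded (\<lambda>\<xi>. (1::real, a \<xi> :: 'b::euclidean_space))"
 unfolding locally_bounded_def
proof (intro conjI allI, goal_cases)
 case 1
 then show ?case by (auto intro: borel_measurable_Pair)
next
 case (2 R)
 then obtain L where "\<forall>\<xi>. \<bar>\<xi>\<bar> \<le> R \<longrightarrow> norm (a \<xi>) \<le> L" by blast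
 then have "norm (1::real, a \<xi>) \<le> 1 + L" if "\<bar>\<xi>\<bar> \<le> R" for \<xi>
  using norm_Pair_le[of "1::real" "a \<xi>"] that by force
 then show ?case by blast
qed

lemma integral_kchi_diff: "(LBINT \<xi>. \<bar>kchi \<xi> u - kchi \<xi> v\<bar>) = \<bar>u - v\<bar>"
 "lintegrable (\<lambda>\<xi>. kchi \<xi> u - kchi \<xi> v)"
proof -
 show i: "lintegrable (\<lambda>\<xi>. kchi \<xi> u - kchi \<xi> v)"
  by (subst integrable_iff_nn_abs) (auto simp: nn_integral_kchi_diff)
 have "ennreal (LBINT \<xi>. \<bar>kchi \<xi> u - kchi \<xi> v\<bar>) = nabs (u - v)"
  using i by (subst nn_integral_eq_integral[symmetric]) (auto simp: nn_integral_kchi_diff)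
 then show "(LBINT \<xi>. \<bar>kchi \<xi> u - kchi \<xi> v\<bar>) = \<bar>u - v\<bar>"
  by (subst (asm) ennreal_inj) auto
qed

lemma integral_kchi: "(LBINT \<xi>. kchi \<xi> u) = u"
proof (cases "u \<ge> 0")
 case True
 then have "(LBINT \<xi>. kchi \<xi> u) = (LBINT \<xi>. \<bar>kchi \<xi> u - kchi \<xi> 0\<bar>)"
  by (intro LBINT_cong) (auto simp: kchi_def step_def)
 with True show ?thesis using integral_kchi_diff(1)[of u 0] by simp
next
 case False
 then have "(LBINT \<xi>. - kchi \<xi> u) = (LBINT \<xi>. \<bar>kchi \<xi> u - kchi \<xi> 0\<bar>)"
  by (intro LBINT_cong) (auto simp: kchi_def step_def)
 with False show ?thesis using integral_kchi_diff(1)[of u 0] by simp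
qed

lemma integrable_mult_bounded:
 fixes f :: "'m \<Rightarrow> real"
 assumes f: "integrable M f" and \<phi>: "\<phi> \<in> borel_measurable M" "\<And>x. \<bar>\<phi> x\<bar> \<le> C"
 shows "integrable M (\<lambda>q. f q * \<phi> q)"
proof (rule Bochner_Integration.integrable_bound)
 show "integrable M (\<lambda>q. C * f q)" using f by simp
 show "AE x in M. norm (f x * \<phi> x) \<le> norm (C * f x)"
 proof (rule AE_I2)
  fix x
  have "\<bar>f x\<bar> * \<bar>\<phi> x\<bar> \<le> \<bar>f x\<bar> * \<bar>C\<bar>" using \<phi>(2)[of x] by (intro mult_left_mono) auto
  then show "norm (f x * \<phi> x) \<le> norm (C * f x)" by (simp add: abs_mult mult.commute)
 qed
qed (use f \<phi> in auto)

text \<open>Letting the cutoffs in \<open>x\<close> and \<open>\<xi>\<close> tend to \<open>1\<close>. The cutoff radius in \<open>x\<close> has to grow faster than the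
 maximal speed on the support of the cutoff in \<open>\<xi>\<close>.\<close>

lemma cutoff_limit:
 fixes a :: "real \<Rightarrow> 'b::euclidean_space" and W :: "(real \<times> 'b) \<times> real \<Rightarrow> real"
 assumes a: "locally_bounded a" and W: "lintegrable W"
  and \<theta>: "test_function {0<..<T} \<theta>" "\<And>t. 0 \<le> \<theta> t" "\<And>t. \<theta> t \<le> C\<theta>"
  and ineq: "\<And>\<psi> \<Theta> c. test_function UNIV \<psi> \<Longrightarrow> (\<And>\<xi>. 0 \<le> \<psi> \<xi>) \<Longrightarrow> test_function ({0<..<T} \<times> UNIV) \<Theta> \<Longrightarrow>
   (\<And>q. 0 \<le> \<Theta> q) \<Longrightarrow> (\<And>q. \<Theta> q \<le> C\<theta>) \<Longrightarrow> (\<And>q. \<Theta> q \<noteq> 0 \<Longrightarrow> \<theta> (fst q) \<noteq> 0) \<Longrightarrow>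
   (\<And>\<xi>. \<bar>deriv \<psi> \<xi>\<bar> \<le> c) \<Longrightarrow> - (B * c) \<le> (LBINT p. W p * flux (\<lambda>\<xi>. (1, a \<xi>)) \<psi> \<Theta> p)"
 shows "0 \<le> (LBINT p. W p * deriv \<theta> (fst (fst p)))"
proof -
 have [measurable]: "W \<in> Bor" using W by auto
 have \<theta>_smooth: "smooth_fun \<theta>" by (rule test_function_smooth[OF \<theta>(1)])
 have [measurable]: "deriv \<theta> \<in> Bor" by (rule smooth_fun_borel[OF smooth_fun_deriv[OF \<theta>_smooth]])
 obtain C1 where C1: "C1 > 0" "\<And>R (x::real) v. R > 0 \<Longrightarrow> \<bar>Fd (cutoff R) x v\<bar> \<le> C1 / R * norm v"
  by (rule cutoff_derivative_bound[where 'a=real]) blast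
 obtain C2 where C2: "C2 > 0" "\<And>R (x::'b) v. R > 0 \<Longrightarrow> \<bar>Fd (cutoff R) x v\<bar> \<le> C2 / R * norm v"
  by (rule cutoff_derivative_bound[where 'a='b]) blast
 obtain C3 where C3: "C3 > 0" "\<And>t. \<bar>\<theta> t\<bar> \<le> C3" "\<And>t. \<bar>deriv \<theta> t\<bar> \<le> C3"
  using test_function_deriv_bound[OF \<theta>(1)] by metis
 have "\<exists>L\<ge>0. \<forall>\<xi>. \<bar>\<xi>\<bar> \<le> 2 * real (Suc n) \<longrightarrow> norm (a \<xi>) \<le> L" for n
 proof -
  obtain L where L: "\<forall>\<xi>. \<bar>\<xi>\<bar> \<le> 2 * real (Suc n) \<longrightarrow> norm (a \<xi>) \<le> L"
   using a unfolding locally_bounded_def by blast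
  then have "norm (a 0) \<le> L" by simp
  then have "0 \<le> L" using norm_ge_zero order_trans by blast
  with L show ?thesis by blast
 qed
 then obtain L where L: "\<And>n. 0 \<le> L n" "\<And>n \<xi>. \<bar>\<xi>\<bar> \<le> 2 * real (Suc n) \<Longrightarrow> norm (a \<xi>) \<le> L n" by metis
 \<comment> \<open>The gradient of the cutoff is of order 1 / R n and the speed is at most L n where
   the cutoff in \<xi> is nonzero, so the spatial error is of order 1 / (n + 1).\<close>
 define R where "R n = real (Suc n) * (L n + 1)" for n
 have R: "R n > 0" "R n \<ge> real (Suc n)" for n
  using L(1)[of n] mult_left_mono[of 1 "L n + 1" "real (Suc n)"] by (auto simp: R_def simp del: of_nat_Suc)
 define \<Psi> :: "nat \<Rightarrow> real \<Rightarrow> real" where "\<Psi> n = cutoff (real (Suc n))" for n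
 define \<Theta> :: "nat \<Rightarrow> real \<times> 'b \<Rightarrow> real" where "\<Theta> n q = \<theta> (fst q) * cutoff (R n) (snd q)" for n q
 have \<Psi>: "test_function UNIV (\<Psi> n)" "0 \<le> \<Psi> n \<xi>" "\<Psi> n \<xi> \<le> 1" for n \<xi>
  unfolding \<Psi>_def by (auto intro!: test_function_cutoff cutoff_nonneg cutoff_le_1)
 have d\<Psi>: "\<bar>deriv (\<Psi> n) \<xi>\<bar> \<le> C1 * inverse (real (Suc n))" for n \<xi>
  using C1(2)[of "real (Suc n)" \<xi> 1] smooth_fun_real_frechet[OF test_function_smooth[OF \<Psi>(1)], of n \<xi> 1]
  by (simp add: \<Psi>_def divide_inverse)
 have \<Theta>_test: "test_function ({0<..<T} \<times> UNIV) (\<Theta> n)" for n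
  unfolding \<Theta>_def[abs_def] by (rule test_function_tensor[OF \<theta>(1) test_function_cutoff[OF R(1)]])
 have flux_eq: "flux (\<lambda>\<xi>. (1, a \<xi>)) (\<Psi> n) (\<Theta> n) p = \<Psi> n (snd p) *
  (\<theta> (fst (fst p)) * Fd (cutoff (R n)) (snd (fst p)) (a (snd p)) + deriv \<theta> (fst (fst p)) * cutoff (R n) (snd (fst p)))" for n p
  unfolding \<Theta>_def[abs_def] by (rule flux_tensor[OF \<theta>_smooth smooth_fun_cutoff])
 have small: "\<bar>\<theta> (fst (fst p)) * Fd (cutoff (R n)) (snd (fst p)) (a (snd p))\<bar> \<le> C3 * C2 * inverse (real (Suc n))"
  if "\<bar>snd p\<bar> \<le> 2 * real (Suc n)" for n p
 proof -
  have "\<bar>Fd (cutoff (R n)) (snd (fst p)) (a (snd p))\<bar> \<le> C2 / R n * norm (a (snd p))"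
   by (rule C2(2)[OF R(1)])
  also have "\<dots> \<le> C2 / R n * (L n + 1)"
   using L(2)[OF that] C2 R(1)[of n] by (intro mult_left_mono) auto
  also have "\<dots> = C2 * inverse (real (Suc n))"
   using L(1)[of n] by (simp add: R_def divide_inverse del: of_nat_Suc)
  finally show ?thesis
   unfolding abs_mult using C3 by (simp add: mult.assoc mult_mono del: of_nat_Suc)
 qed
 have inv1: "inverse (real (Suc n)) \<le> 1" for n by (simp add: field_simps)
 have "(\<lambda>n. LBINT p. W p * flux (\<lambda>\<xi>. (1, a \<xi>)) (\<Psi> n) (\<Theta> n) p) \<longlonglongrightarrow> (LBINT p. W p * deriv \<theta> (fst (fst p)))"
 proof (rule integral_dominated_convergence[where w="\<lambda>p. \<bar>W p\<bar> * (C3 * C2 + C3)"])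
  show "lintegrable (\<lambda>p. \<bar>W p\<bar> * (C3 * C2 + C3))" using W by simp
  show "(\<lambda>p. W p * flux (\<lambda>\<xi>. (1, a \<xi>)) (\<Psi> n) (\<Theta> n) p) \<in> BorL" for n
   by (intro borel_measurable_times flux_borel locally_bounded_Pair a test_function_smooth[OF \<Psi>(1)] test_function_smooth[OF \<Theta>_test]) measurable
  show "AEL p. norm (W p * flux (\<lambda>\<xi>. (1, a \<xi>)) (\<Psi> n) (\<Theta> n) p) \<le> \<bar>W p\<bar> * (C3 * C2 + C3)" for n
  proof (rule AE_I2)
   fix p :: "(real \<times> 'b) \<times> real"
   have "\<bar>flux (\<lambda>\<xi>. (1, a \<xi>)) (\<Psi> n) (\<Theta> n) p\<bar> \<le> C3 * C2 + C3"
   proof (cases "\<bar>snd p\<bar> \<le> 2 * real (Suc n)")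
    case True
    have "C3 * C2 * inverse (real (Suc n)) \<le> C3 * C2 * 1"
     using C2 C3 inv1 by (intro mult_left_mono) auto
    moreover have "\<bar>deriv \<theta> (fst (fst p)) * cutoff (R n) (snd (fst p))\<bar> \<le> C3 * 1"
     unfolding abs_mult using C3 cutoff_nonneg[of "R n" "snd (fst p)"] cutoff_le_1[of "R n" "snd (fst p)"] by (intro mult_mono) auto
    ultimately have le: "\<bar>\<theta> (fst (fst p)) * Fd (cutoff (R n)) (snd (fst p)) (a (snd p)) + deriv \<theta> (fst (fst p)) * cutoff (R n) (snd (fst p))\<bar> \<le> C3 * C2 + C3"
     using small[OF True] by linarith
    have "\<bar>flux (\<lambda>\<xi>. (1, a \<xi>)) (\<Psi> n) (\<Theta> n) p\<bar> \<le> 1 * (C3 * C2 + C3)"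
     unfolding flux_eq abs_mult[of "\<Psi> n (snd p)"] using \<Psi>(2,3)[of n "snd p"] by (intro mult_mono le) auto
    then show ?thesis by simp
   next
    case False
    then have "\<Psi> n (snd p) = 0" unfolding \<Psi>_def by (intro cutoff_eq_0) auto
    then show ?thesis unfolding flux_eq using C2 C3 by simp
   qed
   then show "norm (W p * flux (\<lambda>\<xi>. (1, a \<xi>)) (\<Psi> n) (\<Theta> n) p) \<le> \<bar>W p\<bar> * (C3 * C2 + C3)"
    unfolding real_norm_def abs_mult by (intro mult_left_mono) auto
  qed
  show "AEL p. (\<lambda>n. W p * flux (\<lambda>\<xi>. (1, a \<xi>)) (\<Psi> n) (\<Theta> n) p) \<longlonglongrightarrow> W p * deriv \<theta> (fst (fst p))"
  proof (intro AE_I2 tendsto_mult tendsto_const)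
   fix p :: "(real \<times> 'b) \<times> real"
   obtain N where N: "\<bar>snd p\<bar> + norm (snd (fst p)) \<le> real N" using real_arch_simple by blast
   have "(\<lambda>n. flux (\<lambda>\<xi>. (1, a \<xi>)) (\<Psi> n) (\<Theta> n) p - deriv \<theta> (fst (fst p))) \<longlonglongrightarrow> 0"
   proof (rule Lim_null_comparison)
    show "(\<lambda>n. C3 * C2 * inverse (real (Suc n))) \<longlonglongrightarrow> 0"
     by (rule tendsto_mult_right_zero[OF LIMSEQ_inverse_real_of_nat])
    show "eventually (\<lambda>n. norm (flux (\<lambda>\<xi>. (1, a \<xi>)) (\<Psi> n) (\<Theta> n) p - deriv \<theta> (fst (fst p))) \<le> C3 * C2 * inverse (real (Suc n))) sequentially"
     using eventually_ge_at_top[of N]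
    proof eventually_elim
     case (elim n)
     have n: "\<bar>snd p\<bar> \<le> real (Suc n)" "norm (snd (fst p)) \<le> real (Suc n)"
      using N elim norm_ge_zero[of "snd (fst p)"] abs_ge_zero[of "snd p"] by linarith+
     have "\<Psi> n (snd p) = 1" unfolding \<Psi>_def using n by (intro cutoff_eq_1) auto
     moreover have "cutoff (R n) (snd (fst p)) = 1"
      using n(2) R[of n] by (intro cutoff_eq_1) linarith+
     ultimately show ?case
      unfolding flux_eq using small[of p n] n(1) by simp
    qed
   qed
   then show "(\<lambda>n. flux (\<lambda>\<xi>. (1, a \<xi>)) (\<Psi> n) (\<Theta> n) p) \<longlonglongrightarrow> deriv \<theta> (fst (fst p))"
    by (simp add: LIM_zero_iff)
  qed
 qed measurable
 moreover have "(\<lambda>n. - (B * (C1 * inverse (real (Suc n))))) \<longlonglongrightarrow> - (B * (C1 * 0))"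
  by (intro tendsto_intros LIMSEQ_inverse_real_of_nat)
 moreover have "- (B * (C1 * inverse (real (Suc n)))) \<le> (LBINT p. W p * flux (\<lambda>\<xi>. (1, a \<xi>)) (\<Psi> n) (\<Theta> n) p)" for n
 proof (rule ineq[OF \<Psi>(1,2) \<Theta>_test])
  show "0 \<le> \<Theta> n q" for q unfolding \<Theta>_def by (intro mult_nonneg_nonneg \<theta> cutoff_nonneg)
  show "\<Theta> n q \<le> C\<theta>" for q
   using mult_mono[OF \<theta>(3)[of "fst q"] cutoff_le_1[of "R n" "snd q"]] \<theta>(2)[of "fst q"] \<theta>(3)[of "fst q"] cutoff_nonneg[of "R n" "snd q"]
   by (simp add: \<Theta>_def)
  show "\<Theta> n q \<noteq> 0 \<Longrightarrow> \<theta> (fst q) \<noteq> 0" for q by (auto simp: \<Theta>_def)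
 qed (rule d\<Psi>)
 ultimately have "- (B * (C1 * 0)) \<le> (LBINT p. W p * deriv \<theta> (fst (fst p)))"
  by (intro LIMSEQ_le) blast+
 then show ?thesis by simp
qed

lemma integral_time_weight:
 fixes W :: "(real \<times> 'b::euclidean_space) \<times> real \<Rightarrow> real"
 assumes W: "lintegrable W" and \<theta>: "test_function I \<theta>"
  and D: "\<And>q. (LBINT \<xi>. W (q, \<xi>)) = V q"
 shows "(LBINT p. W p * deriv \<theta> (fst (fst p))) = (LBINT t. deriv \<theta> t * (LBINT x. V (t, x)))"
proof -
 have [measurable]: "deriv \<theta> \<in> Bor"
  by (rule smooth_fun_borel[OF smooth_fun_deriv[OF test_function_smooth[OF \<theta>]]])
 obtain C where C: "\<And>t. \<bar>deriv \<theta> t\<bar> \<le> C" using test_function_deriv_bound[OF \<theta>] by metis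
 have i: "lintegrable (\<lambda>p. W p * deriv \<theta> (fst (fst p)))"
  by (rule integrable_mult_bounded[OF W _ C]) measurable
 have "(LBINT p. W p * deriv \<theta> (fst (fst p))) = (LBINT q. LBINT \<xi>. W (q, \<xi>) * deriv \<theta> (fst q))"
  using lborel_integral_prod_fst[OF i] by simp
 also have "\<dots> = (LBINT q. deriv \<theta> (fst q) * V q)" by (simp add: D mult.commute)
 also have "\<dots> = (LBINT t. LBINT x. deriv \<theta> t * V (t, x))"
 proof -
  have "lintegrable (\<lambda>q. deriv \<theta> (fst q) * V q)"
   using lborel_integrable_fst[OF i] by (simp add: D mult.commute)
  from lborel_integral_prod_fst[OF this] show ?thesis by simp
 qed
 finally show ?thesis by simp
qed

lemma test_function_margin:
 assumes "test_function {0<..<T} \<theta>"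
 obtains r where "r > 0" "\<And>t s. \<theta> t \<noteq> 0 \<Longrightarrow> \<bar>s\<bar> \<le> r \<Longrightarrow> t + s \<in> {0<..<T::real}"
proof -
 define K where "K = closure {t. \<theta> t \<noteq> 0}"
 have K: "compact K" "K \<subseteq> {0<..<T}" using assms by (auto simp: test_function_iff K_def)
 obtain r where r: "r > 0" "(\<Union>x\<in>K. ball x r) \<subseteq> {0<..<T}"
  using compact_subset_open_imp_ball_epsilon_subset[OF K(1) _ K(2)] by auto
 show ?thesis
 proof (rule that[of "r / 2"])
  fix t s assume "\<theta> t \<noteq> 0" "\<bar>s\<bar> \<le> r / 2"
  then have "t \<in> K" "t + s \<in> ball t r"
   using r(1) closure_subset[of "{t. \<theta> t \<noteq> 0}"] by (auto simp: K_def dist_real_def)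
  then show "t + s \<in> {0<..<T}" using r(2) by blast
 qed (use r in auto)
qed

lemma slab_flow_shift_dist_continuous:
 fixes U1 U2 :: "real \<times> 'b::euclidean_space \<Rightarrow> real"
 assumes U1: "slab_flow T U1" and U2: "slab_flow T U2"
 shows "continuous_on {0..T} (\<lambda>t. LBINT x. \<bar>U1 (t, x) - U2 (t, x + y)\<bar>)"
 unfolding continuous_on_def
proof
 fix t assume t: "t \<in> {0..T}"
 define D where "D t = (LBINT x. \<bar>U1 (t, x) - U2 (t, x + y)\<bar>)" for t
 note i1 = slab_flow_integrable(2)[OF U1] and i2 = slab_flow_integrable(2)[OF U2]
 have [measurable]: "U2 \<in> Bor" using U2 by (auto simp: slab_flow_def)
 have "((\<lambda>s. D s - D t) \<longlongrightarrow> 0) (at t within {0..T})"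
 proof (rule Lim_null_comparison)
  have c: "((\<lambda>s. LBINT x. \<bar>U1 (s, x) - U1 (t, x)\<bar>) \<longlongrightarrow> 0) (at t within {0..T})"
   "((\<lambda>s. LBINT x. \<bar>U2 (s, x) - U2 (t, x)\<bar>) \<longlongrightarrow> 0) (at t within {0..T})"
   using U1 U2 t by (auto simp: slab_flow_def)
  show "((\<lambda>s. (LBINT x. \<bar>U1 (s, x) - U1 (t, x)\<bar>) + (LBINT x. \<bar>U2 (s, x) - U2 (t, x)\<bar>)) \<longlongrightarrow> 0) (at t within {0..T})"
   using tendsto_add[OF c] by simp
  have "\<bar>D s - D t\<bar> \<le> (LBINT x. \<bar>U1 (s, x) - U1 (t, x)\<bar>) + (LBINT x. \<bar>U2 (s, x) - U2 (t, x)\<bar>)" for s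
  proof -
   have "(LBINT x. \<bar>U2 (s, x + y) - U2 (t, x + y)\<bar>) = (LBINT x. \<bar>U2 (s, x) - U2 (t, x)\<bar>)"
    by (rule integral_shift[where f="\<lambda>x. \<bar>U2 (s, x) - U2 (t, x)\<bar>"]) measurable
   then show ?thesis
    using abs_L1_dist_diff[OF i1 integrable_shift[OF i2] i1 integrable_shift[OF i2], of s s y t t y]
    unfolding D_def by simp
  qed
  then show "eventually (\<lambda>s. norm (D s - D t) \<le> (LBINT x. \<bar>U1 (s, x) - U1 (t, x)\<bar>) + (LBINT x. \<bar>U2 (s, x) - U2 (t, x)\<bar>)) (at t within {0..T})"
   by simp
 qed
 then show "((\<lambda>t. LBINT x. \<bar>U1 (t, x) - U2 (t, x + y)\<bar>) \<longlongrightarrow> (LBINT x. \<bar>U1 (t, x) - U2 (t, x + y)\<bar>)) (at t within {0..T})"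
  by (simp add: LIM_zero_iff D_def)
qed

lemma integral_deriv_bound:
 fixes \<mu> :: "('a::euclidean_space \<times> real) measure"
 assumes fin: "finite_measure \<mu>" and sets: "sets \<mu> = sets borel"
  and \<psi>: "test_function UNIV \<psi>" "\<And>\<xi>. \<bar>deriv \<psi> \<xi>\<bar> \<le> c"
 shows "(LINT p|\<mu>. \<bar>deriv \<psi> (snd p)\<bar>) \<le> c * measure \<mu> (space \<mu>)"
proof -
 interpret M: finite_measure \<mu> by (rule fin)
 note [measurable_cong] = sets
 have [measurable]: "deriv \<psi> \<in> Bor"
  by (rule smooth_fun_borel[OF smooth_fun_deriv[OF test_function_smooth[OF \<psi>(1)]]])
 have "(LINT p|\<mu>. \<bar>deriv \<psi> (snd p)\<bar>) \<le> (LINT p|\<mu>. c)"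
 proof (rule integral_mono)
  show "integrable \<mu> (\<lambda>p. \<bar>deriv \<psi> (snd p)\<bar>)"
   by (rule integrable_finite_measure_bounded[OF fin, of _ c]) (measurable, simp add: \<psi>(2))
 qed (use \<psi>(2) in auto)
 then show ?thesis by (simp add: mult.commute)
qed

text \<open>The shift has no time component, so both solutions stay inside the slab. The error of
  the cutoff in \<xi> is a multiple of the masses of \<mu>1 and \<mu>2 times the bound on the
  derivative of the cutoff, the form that \<open>cutoff_limit\<close> removes; the remaining weak
  inequality has right-hand side 0.\<close>

theorem kinetic_contraction:
 fixes a :: "real \<Rightarrow> 'b::euclidean_space"
 assumes a: "locally_bounded a"
  and U1: "slab_flow T U1" "weak_kinetic ({0<..<T} \<times> UNIV) (\<lambda>\<xi>. (1, a \<xi>)) U1 \<mu>1"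
  and U2: "slab_flow T U2" "weak_kinetic ({0<..<T} \<times> UNIV) (\<lambda>\<xi>. (1, a \<xi>)) U2 \<mu>2"
  and st: "0 \<le> s" "s \<le> t" "t \<le> T"
 shows "(LBINT x. \<bar>U1 (t, x) - U2 (t, x + y)\<bar>) \<le> (LBINT x. \<bar>U1 (s, x) - U2 (s, x + y)\<bar>)"
proof -
 define h where "h = (0::real, y)"
 define W where "W p = \<bar>kp U1 p - kchi (snd p) (U2 (fst p + h))\<bar>" for p
 have W: "lintegrable W"
  unfolding W_def[abs_def]
  using kchi_prod_L1(1)[OF slab_flow_integrable(1)[OF U1(1)] integrable_shift[OF slab_flow_integrable(1)[OF U2(1)], of h]]
  by simp
 have V: "(LBINT \<xi>. W (q, \<xi>)) = \<bar>U1 q - U2 (q + h)\<bar>" for q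
  by (simp add: W_def integral_kchi_diff)
 have fin: "finite_measure \<mu>1" "finite_measure \<mu>2" and sets: "sets \<mu>1 = sets borel" "sets \<mu>2 = sets borel"
  using U1(2) U2(2) by (auto simp: weak_kinetic_def)
 have "(LBINT x. \<bar>U1 (t, x) - U2 (t, x + y)\<bar>) - (LBINT x. \<bar>U1 (s, x) - U2 (s, x + y)\<bar>) \<le> 0 * (t - s)"
 proof (rule weak_derivative_bound[OF slab_flow_shift_dist_continuous[OF U1(1) U2(1)] order_refl _ st])
  fix \<theta> assume \<theta>: "test_function {0<..<T} \<theta>" "\<And>t. 0 \<le> \<theta> t"
  obtain C where C: "C > 0" "\<And>t. \<bar>\<theta> t\<bar> \<le> C" using test_function_deriv_bound[OF \<theta>(1)] by metis
  obtain r where r: "r > 0" "\<And>t s. \<theta> t \<noteq> 0 \<Longrightarrow> \<bar>s\<bar> \<le> r \<Longrightarrow> t + s \<in> {0<..<T}"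
   by (rule test_function_margin[OF \<theta>(1)]) blast
  have "0 \<le> (LBINT p. W p * deriv \<theta> (fst (fst p)))"
  proof (rule cutoff_limit[OF a W \<theta>])
   show "\<theta> t \<le> C" for t using C(2)[of t] by simp
   fix \<psi> and \<Theta> :: "real \<times> 'b \<Rightarrow> real" and c :: real
   assume A: "test_function UNIV \<psi>" "\<And>\<xi>. 0 \<le> \<psi> \<xi>" "test_function ({0<..<T} \<times> UNIV) \<Theta>" "\<And>q. 0 \<le> \<Theta> q" "\<And>q. \<Theta> q \<le> C"
    "\<And>q. \<Theta> q \<noteq> 0 \<Longrightarrow> \<theta> (fst q) \<noteq> 0" "\<And>\<xi>. \<bar>deriv \<psi> \<xi>\<bar> \<le> c"
   interpret kinetic_doubling "{0<..<T} \<times> UNIV" "\<lambda>\<xi>. (1, a \<xi>)" U1 U2 \<mu>1 \<mu>2 \<Theta> \<psi> h C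
    by unfold_locales (use U1 U2 A locally_bounded_Pair[OF a] in auto)
   have "- (C * (LINT p|\<mu>1. \<bar>deriv \<psi> (snd p)\<bar>) + C * (LINT p|\<mu>2. \<bar>deriv \<psi> (snd p)\<bar>)) \<le> (LBINT p. W p * flux (\<lambda>\<xi>. (1, a \<xi>)) \<psi> \<Theta> p)"
    unfolding W_def
   proof (rule kinetic_comparison[OF slab_flow_integrable(1)[OF U2(1)] r(1)])
    fix q w assume "\<Theta> q \<noteq> 0" "norm (w :: real \<times> 'b) \<le> r"
    then have "\<theta> (fst q) \<noteq> 0" "\<bar>fst w\<bar> \<le> r" using A(6) norm_fst_le[of "fst w" "snd w"] by auto
    from r(2)[OF this] show "q + h + w \<in> {0<..<T} \<times> UNIV" by (auto simp: h_def mem_Times_iff)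
   qed
   moreover note integral_deriv_bound[OF fin(1) sets(1) A(1,7)] integral_deriv_bound[OF fin(2) sets(2) A(1,7)]
   then have "C * (LINT p|\<mu>1. \<bar>deriv \<psi> (snd p)\<bar>) + C * (LINT p|\<mu>2. \<bar>deriv \<psi> (snd p)\<bar>) \<le> (C * (measure \<mu>1 (space \<mu>1) + measure \<mu>2 (space \<mu>2))) * c"
    using C(1) mult_left_mono[of _ _ C] by (simp add: algebra_simps add_mono)
   ultimately show "- ((C * (measure \<mu>1 (space \<mu>1) + measure \<mu>2 (space \<mu>2))) * c) \<le> (LBINT p. W p * flux (\<lambda>\<xi>. (1, a \<xi>)) \<psi> \<Theta> p)"
    by linarith
  qed
  then show "- 0 * (LBINT t. \<theta> t) \<le> (LBINT t. deriv \<theta> t * (LBINT x. \<bar>U1 (t, x) - U2 (t, x + y)\<bar>))"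
   by (subst (asm) integral_time_weight[OF W \<theta>(1) V]) (simp add: h_def)
 qed
 then show ?thesis by simp
qed

subsection \<open>Sup bound and the kinetic solution as a flow\<close>

lemma abs_half_step: "\<bar>\<sigma>\<bar> \<le> (1::real) \<Longrightarrow> \<bar>(step k \<xi> + \<sigma>) / 2\<bar> \<le> 1"
 by (auto simp: step_def abs_le_iff)

text \<open>For \<sigma> = 1 the weight is the indicator of \<xi> \<ge> k, for \<sigma> = -1 minus
  the indicator of \<xi> < k. The step is handled by the entropy inequality; the constant part is
  the equation itself, which may be used with either sign.\<close>

lemma half_step_dissipation:
 fixes a :: "real \<Rightarrow> 'b::euclidean_space" and k \<sigma> :: real
 assumes a: "locally_bounded a"
  and U: "slab_flow T U" and kin: "weak_kinetic ({0<..<T} \<times> UNIV) (\<lambda>\<xi>. (1, a \<xi>)) U \<mu>"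
  and \<sigma>: "\<bar>\<sigma>\<bar> = (1::real)" and t: "0 \<le> t" "t \<le> T"
 defines "Q \<equiv> (\<lambda>u. LBINT \<xi>. kchi \<xi> u * ((step k \<xi> + \<sigma>) / 2))"
 shows "(LBINT x. Q (U (t, x))) \<le> (LBINT x. Q (U (0, x)))"
  and "lintegrable (\<lambda>x. Q (U (t, x)))"
proof -
 note [measurable] = borel_measurable_integrable[OF slab_flow_integrable(1)[OF U]]
 have mU[measurable]: "U \<in> Bor" using U by (simp add: slab_flow_def)
 have h1: "\<bar>(step k \<xi> + \<sigma>) / 2\<bar> \<le> 1" for \<xi> using \<sigma> by (intro abs_half_step) simp
 have i0: "lintegrable (\<lambda>\<xi>. (kchi \<xi> u - kchi \<xi> v) * ((step k \<xi> + \<sigma>) / 2))" for u v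
  by (rule integrable_mult_bounded[OF integral_kchi_diff(2) _ h1]) measurable
 have i1: "lintegrable (\<lambda>\<xi>. kchi \<xi> u * ((step k \<xi> + \<sigma>) / 2))" for u
  using i0[of u 0] by simp
 have Q_lip: "\<bar>Q u - Q v\<bar> \<le> \<bar>u - v\<bar>" for u v
 proof -
  have "Q u - Q v = (LBINT \<xi>. (kchi \<xi> u - kchi \<xi> v) * ((step k \<xi> + \<sigma>) / 2))"
   unfolding Q_def Bochner_Integration.integral_diff[OF i1 i1, symmetric] left_diff_distrib ..
  also have "\<bar>\<dots>\<bar> \<le> (LBINT \<xi>. \<bar>(kchi \<xi> u - kchi \<xi> v) * ((step k \<xi> + \<sigma>) / 2)\<bar>)"
   by (rule integral_abs_bound)
  also have "\<dots> \<le> (LBINT \<xi>. \<bar>kchi \<xi> u - kchi \<xi> v\<bar>)"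
  proof (rule integral_mono)
   fix \<xi>
   show "\<bar>(kchi \<xi> u - kchi \<xi> v) * ((step k \<xi> + \<sigma>) / 2)\<bar> \<le> \<bar>kchi \<xi> u - kchi \<xi> v\<bar>"
    unfolding abs_mult using mult_left_mono[OF h1[of \<xi>], of "\<bar>kchi \<xi> u - kchi \<xi> v\<bar>"] by simp
  qed (intro integrable_abs i0 integral_kchi_diff(2))+
  finally show ?thesis by (simp add: integral_kchi_diff)
 qed
 have Q0: "Q 0 = 0" by (simp add: Q_def)
 have Qm[measurable]: "Q \<in> Bor"
  unfolding Q_def by (rule lborel.borel_measurable_lebesgue_integral) measurable
 have iQ: "lintegrable (\<lambda>x. Q (U (t, x)))" for t
 proof (rule Bochner_Integration.integrable_bound[OF slab_flow_integrable(2)[OF U, of t]])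
  show "AEL x. norm (Q (U (t, x))) \<le> norm (U (t, x))"
   using Q_lip[of _ 0] by (auto simp: Q0)
 qed measurable
 then show "lintegrable (\<lambda>x. Q (U (t, x)))" .
 define W where "W p = kp U p * ((step k (snd p) + \<sigma>) / 2)" for p
 have W: "lintegrable W" unfolding W_def[abs_def]
  by (rule integrable_mult_bounded[OF kchi_prod_L1(3)[OF slab_flow_integrable(1)[OF U] slab_flow_integrable(1)[OF U]] _ h1]) measurable
 have V: "(LBINT \<xi>. W (q, \<xi>)) = Q (U q)" for q by (simp add: W_def Q_def)
 have fin: "finite_measure \<mu>" and sets: "sets \<mu> = sets borel" using kin by (auto simp: weak_kinetic_def)
 note [measurable_cong] = sets
 have cont: "continuous_on {0..T} (\<lambda>t. LBINT x. Q (U (t, x)))"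
 proof (rule L1_norm_continuous[where C=1 and g="\<lambda>t x. U (t, x)" and M=lborel])
  fix s t assume "s \<in> {0..T}" "t \<in> {0..T}"
  have "(LBINT x. Q (U (s, x))) - (LBINT x. Q (U (t, x))) = (LBINT x. Q (U (s, x)) - Q (U (t, x)))"
   using iQ by (simp add: Bochner_Integration.integral_diff)
  also have "\<bar>\<dots>\<bar> \<le> (LBINT x. \<bar>Q (U (s, x)) - Q (U (t, x))\<bar>)" by (rule integral_abs_bound)
  also have "\<dots> \<le> (LBINT x. \<bar>U (s, x) - U (t, x)\<bar>)"
   by (rule integral_mono) (use iQ slab_flow_integrable(2)[OF U] Q_lip in auto)
  finally show "\<bar>(LBINT x. Q (U (s, x))) - (LBINT x. Q (U (t, x)))\<bar> \<le> 1 * (LBINT x. \<bar>U (s, x) - U (t, x)\<bar>)" by simp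
 qed (use U in \<open>auto simp: slab_flow_def\<close>)
 have "(LBINT x. Q (U (t, x))) - (LBINT x. Q (U (0, x))) \<le> 0 * (t - 0)"
 proof (rule weak_derivative_bound[OF cont order_refl _ order_refl t])
  fix \<theta> assume \<theta>: "test_function {0<..<T} \<theta>" "\<And>t. 0 \<le> \<theta> t"
  obtain C where C: "C > 0" "\<And>t. \<bar>\<theta> t\<bar> \<le> C" using test_function_deriv_bound[OF \<theta>(1)] by metis
  have "0 \<le> (LBINT p. W p * deriv \<theta> (fst (fst p)))"
  proof (rule cutoff_limit[OF a W \<theta>])
   show "\<theta> t \<le> C" for t using C(2)[of t] by simp
   fix \<psi> and \<Theta> :: "real \<times> 'b \<Rightarrow> real" and c :: real
   assume A: "test_function UNIV \<psi>" "\<And>\<xi>. 0 \<le> \<psi> \<xi>" "test_function ({0<..<T} \<times> UNIV) \<Theta>" "\<And>q. 0 \<le> \<Theta> q" "\<And>q. \<Theta> q \<le> C"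
    "\<And>q. \<Theta> q \<noteq> 0 \<Longrightarrow> \<theta> (fst q) \<noteq> 0" "\<And>\<xi>. \<bar>deriv \<psi> \<xi>\<bar> \<le> c"
   note lb = locally_bounded_Pair[OF a]
   define F where "F p = flux (\<lambda>\<xi>. (1::real, a \<xi>)) \<psi> \<Theta> p" for p
   have [measurable]: "\<Theta> \<in> Bor" "deriv \<psi> \<in> Bor"
    using smooth_fun_borel[OF test_function_smooth[OF A(3)]] smooth_fun_borel[OF smooth_fun_deriv[OF test_function_smooth[OF A(1)]]] by auto
   have le: "\<bar>\<Theta> (fst p) * \<bar>deriv \<psi> (snd p)\<bar>\<bar> \<le> C * c" "\<bar>\<Theta> (fst p) * deriv \<psi> (snd p)\<bar> \<le> C * c" for p
    using mult_mono[OF A(5) A(7)[of "snd p"], of "fst p"] A(4)[of "fst p"] C(1) by (auto simp: abs_mult)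
   have ii: "integrable \<mu> (\<lambda>p. \<Theta> (fst p) * \<bar>deriv \<psi> (snd p)\<bar>)" "integrable \<mu> (\<lambda>p. \<Theta> (fst p) * deriv \<psi> (snd p))"
    by (rule integrable_finite_measure_bounded[OF fin _ le(1)], measurable)
     (rule integrable_finite_measure_bounded[OF fin _ le(2)], measurable)
   have 1: "- (LINT p|\<mu>. \<Theta> (fst p) * \<bar>deriv \<psi> (snd p)\<bar>) \<le> (LBINT p. kp U p * step k (snd p) * F p)"
    unfolding F_def by (rule kinetic_entropy_inequality[OF kin lb A(3,4,1,2)])
   have "(LBINT p. kp U p * F p) = (LINT p|\<mu>. \<Theta> (fst p) * deriv \<psi> (snd p))"
    using kin A(1,3) unfolding F_def weak_kinetic_def by blast
   also have "\<bar>\<dots>\<bar> \<le> (LINT p|\<mu>. \<bar>\<Theta> (fst p) * deriv \<psi> (snd p)\<bar>)" by (rule integral_abs_bound)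
   also have "\<dots> = (LINT p|\<mu>. \<Theta> (fst p) * \<bar>deriv \<psi> (snd p)\<bar>)"
    by (intro LBINT_cong) (auto simp: abs_mult A(4))
   finally have 2: "- (LINT p|\<mu>. \<Theta> (fst p) * \<bar>deriv \<psi> (snd p)\<bar>) \<le> \<sigma> * (LBINT p. kp U p * F p)"
    using \<sigma> by (auto simp: abs_if split: if_splits)
   have j1: "lintegrable (\<lambda>p. kp U p * step k (snd p) * F p)"
    unfolding F_def by (rule integrable_flux[OF lb A(1,3), of _ 1]) (measurable, simp add: abs_mult abs_kchi_le)
   have j2: "lintegrable (\<lambda>p. kp U p * F p)"
    unfolding F_def by (rule integrable_flux[OF lb A(1,3), of _ 1]) (measurable, simp add: abs_kchi_le)
   have "(LBINT p. W p * F p) = (LBINT p. (kp U p * step k (snd p) * F p + \<sigma> * (kp U p * F p)) / 2)"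
    by (intro LBINT_cong) (auto simp: W_def field_simps)
   also have "\<dots> = ((LBINT p. kp U p * step k (snd p) * F p) + \<sigma> * (LBINT p. kp U p * F p)) / 2"
    using j1 j2 by simp
   finally have 3: "- (LINT p|\<mu>. \<Theta> (fst p) * \<bar>deriv \<psi> (snd p)\<bar>) \<le> (LBINT p. W p * F p)"
    using 1 2 by simp
   have "(LINT p|\<mu>. \<Theta> (fst p) * \<bar>deriv \<psi> (snd p)\<bar>) \<le> (LINT p|\<mu>. C * \<bar>deriv \<psi> (snd p)\<bar>)"
   proof (rule integral_mono)
    have "\<bar>C * \<bar>deriv \<psi> (snd p)\<bar>\<bar> \<le> C * c" for p :: "(real \<times> 'b) \<times> real"
     using C(1) A(7) by (simp add: abs_mult)
    then show "integrable \<mu> (\<lambda>p. C * \<bar>deriv \<psi> (snd p)\<bar>)"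
     by (rule integrable_finite_measure_bounded[OF fin, rotated]) measurable
   qed (use ii A(5) in \<open>auto intro: mult_right_mono\<close>)
   also have "\<dots> \<le> C * (c * measure \<mu> (space \<mu>))"
    using mult_left_mono[OF integral_deriv_bound[OF fin sets A(1,7)], of C] C(1) by simp
   finally show "- ((C * measure \<mu> (space \<mu>)) * c) \<le> (LBINT p. W p * flux (\<lambda>\<xi>. (1, a \<xi>)) \<psi> \<Theta> p)"
    using 3 unfolding F_def by (simp add: algebra_simps)
  qed
  then show "- 0 * (LBINT t. \<theta> t) \<le> (LBINT t. deriv \<theta> t * (LBINT x. Q (U (t, x))))"
   by (subst (asm) integral_time_weight[OF W \<theta>(1) V]) simp
 qed
 then show "(LBINT x. Q (U (t, x))) \<le> (LBINT x. Q (U (0, x)))" by simp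
qed

lemma integral_kchi_upper:
 assumes "0 \<le> K" shows "(LBINT \<xi>. kchi \<xi> u * ((step K \<xi> + 1) / 2)) = max 0 (u - K)"
proof -
 have "(LBINT \<xi>. kchi \<xi> u * ((step K \<xi> + 1) / 2)) = (LBINT \<xi>. indicator {K..<max K u} \<xi>)"
  using assms by (intro LBINT_cong) (auto simp: kchi_def step_def indicator_def)
 then show ?thesis by (simp add: max_def)
qed

lemma integral_kchi_lower:
 assumes "0 \<le> K" shows "(LBINT \<xi>. kchi \<xi> u * ((step (- K) \<xi> + - 1) / 2)) = max 0 (- K - u)"
proof -
 have "(LBINT \<xi>. kchi \<xi> u * ((step (- K) \<xi> + - 1) / 2)) = (LBINT \<xi>. indicator {min (-K) u..<-K} \<xi>)"
  using assms by (intro LBINT_cong) (auto simp: kchi_def step_def indicator_def)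
 then show ?thesis by (simp add: max_def min_def)
qed

text \<open>The excess over K, above or below, has a nonnegative integral that is 0 initially and
  cannot increase.\<close>

theorem kinetic_sup_bound:
 fixes a :: "real \<Rightarrow> 'b::euclidean_space"
 assumes a: "locally_bounded a"
  and U: "slab_flow T U" and kin: "weak_kinetic ({0<..<T} \<times> UNIV) (\<lambda>\<xi>. (1, a \<xi>)) U \<mu>"
  and K: "0 \<le> K" "AEL x. \<bar>U (0, x)\<bar> \<le> K" and t: "0 \<le> t" "t \<le> T"
 shows "AEL x. \<bar>U (t, x)\<bar> \<le> K"
proof -
 have z: "AEL x. Q (U (t, x)) = 0"
  if le: "(LBINT x. Q (U (t, x))) \<le> (LBINT x. Q (U (0, x)))"
   and i: "lintegrable (\<lambda>x. Q (U (t, x)))" and Q: "\<And>u. 0 \<le> Q u" "\<And>u. \<bar>u\<bar> \<le> K \<Longrightarrow> Q u = 0" for Q :: "real \<Rightarrow> real"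
 proof -
  have "(LBINT x. Q (U (0, x))) = 0"
   using K(2) Q(2) by (intro integral_eq_zero_AE) auto
  then have "(LBINT x. Q (U (t, x))) = 0"
   using le Q(1) by (intro antisym integral_nonneg_AE) auto
  then show ?thesis
   using integral_nonneg_eq_0_iff_AE[OF i] Q(1) by auto
 qed
 have 1: "AEL x. max 0 (U (t, x) - K) = 0"
  using half_step_dissipation[OF a U kin, where \<sigma>=1 and t=t and k=K] t unfolding integral_kchi_upper[OF K(1)]
  by (intro z[of "\<lambda>u. max 0 (u - K)"]) auto
 have 2: "AEL x. max 0 (- K - U (t, x)) = 0"
  using half_step_dissipation[OF a U kin, where \<sigma>="- 1" and t=t and k="- K"] t unfolding integral_kchi_lower[OF K(1)]
  by (intro z[of "\<lambda>u. max 0 (- K - u)"]) auto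
 from 1 2 show ?thesis
  by eventually_elim (auto simp: max_def abs_le_iff split: if_splits)
qed

lemma AE_lborel_pairD:
 fixes P :: "'a::euclidean_space \<times> 'b::euclidean_space \<Rightarrow> bool"
 assumes "AEL z. P z"
 shows "AEL x. AEL y. P (x, y)"
 by (rule lborel_pair.AE_pair) (unfold lborel_prod, rule assms)

lemma AE_lborel_pairI:
 fixes P :: "'a::euclidean_space \<times> 'b::euclidean_space \<Rightarrow> bool"
 assumes "{z. P z} \<in> sets borel" "AEL x. AEL y. P (x, y)"
 shows "AEL z. P z"
proof -
 have "sets (lborel \<Otimes>\<^sub>M lborel) = sets (borel :: ('a \<times> 'b) measure)"
  unfolding lborel_prod by simp
 then have "{z \<in> space ((lborel :: 'a measure) \<Otimes>\<^sub>M (lborel :: 'b measure)). P z} \<in> sets (lborel \<Otimes>\<^sub>M lborel)"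
  using assms(1) by (simp only: space_pair_measure space_lborel space_borel UNIV_Times_UNIV UNIV_I simp_thms)
 from lborel_pair.AE_pair_measure[OF this assms(2)]
 have "AE z in (lborel :: 'a measure) \<Otimes>\<^sub>M (lborel :: 'b measure). P z" .
 then show ?thesis unfolding lborel_prod .
qed

subsection \<open>Convolutions and duality\<close>

lemma test_function_derivative:
 assumes "test_function U \<phi>"
 shows "test_function U (\<lambda>x. Fd \<phi> x v)"
proof (rule test_functionI[of _ "closure {x. \<phi> x \<noteq> 0}"])
 show "smooth_fun (\<lambda>x. Fd \<phi> x v)"
  by (rule smooth_fun_derivative[OF test_function_smooth[OF assms]])
qed (use assms in \<open>auto simp: test_function_iff intro: frechet_derivative_zero_outside\<close>)

lemma smooth_fun_derivative_sum:
 assumes "smooth_fun \<phi>"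
 shows "Fd \<phi> x v = (\<Sum>i\<in>Basis. (v \<bullet> i) * Fd \<phi> x i)"
proof -
 interpret bounded_linear "Fd \<phi> x"
  by (rule smooth_fun_linear[OF assms])
 show ?thesis
  by (subst euclidean_representation[of v, symmetric]) (simp add: sum scaleR)
qed

text \<open>A quadratic remainder uniform in x is what allows differentiating a convolution under
  the integral when the other factor is merely integrable.\<close>

lemma test_function_taylor:
 assumes \<phi>: "test_function U (\<phi> :: 'a::euclidean_space \<Rightarrow> real)"
 obtains C where "C > 0" "\<And>x h. \<bar>\<phi> (x + h) - \<phi> x - Fd \<phi> x h\<bar> \<le> C * (norm h)\<^sup>2"
proof -
 have sm: "smooth_fun \<phi>" using \<phi> by (rule test_function_smooth)
 have "\<forall>i. \<exists>C>0. \<forall>x y. \<bar>Fd \<phi> y i - Fd \<phi> x i\<bar> \<le> C * norm (y - x)"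
  using test_function_lipschitz[OF test_function_derivative[OF \<phi>]] by metis
 then obtain c where c: "\<And>i. c i > 0" "\<And>i x y. \<bar>Fd \<phi> y i - Fd \<phi> x i\<bar> \<le> c i * norm (y - x)"
  by metis
 define C where "C = (\<Sum>i\<in>Basis. c (i::'a))"
 have C0: "0 \<le> C" unfolding C_def using c(1) by (intro sum_nonneg) (auto intro: less_imp_le)
 have D: "\<bar>Fd \<phi> y v - Fd \<phi> x v\<bar> \<le> C * norm (y - x) * norm v" for x y v
 proof -
  have "Fd \<phi> y v - Fd \<phi> x v = (\<Sum>i\<in>Basis. (v \<bullet> i) * (Fd \<phi> y i - Fd \<phi> x i))"
   by (subst (1 2) smooth_fun_derivative_sum[OF sm]) (simp add: sum_subtractf right_diff_distrib)
  also have "\<bar>\<dots>\<bar> \<le> (\<Sum>i\<in>Basis. norm v * (c i * norm (y - x)))"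
   by (rule order_trans[OF sum_abs], rule sum_mono)
    (auto simp: abs_mult intro!: mult_mono c Basis_le_norm)
  finally show ?thesis by (simp add: C_def sum_distrib_left sum_distrib_right algebra_simps)
 qed
 have "\<bar>\<phi> (x + h) - \<phi> x - Fd \<phi> x h\<bar> \<le> (C + 1) * (norm h)\<^sup>2" for x h
 proof -
  let ?f = "\<lambda>y. \<phi> y - Fd \<phi> x y"
  have lin: "bounded_linear (Fd \<phi> x)" by (rule smooth_fun_linear[OF sm])
  have "norm (?f (x + h) - ?f x) \<le> (C * norm h) * norm (x + h - x)"
  proof (rule differentiable_bound[where S="closed_segment x (x + h)" and f'="\<lambda>y v. Fd \<phi> y v - Fd \<phi> x v"])
   fix y assume y: "y \<in> closed_segment x (x + h)"
   show "(?f has_derivative (\<lambda>v. Fd \<phi> y v - Fd \<phi> x v)) (at y within closed_segment x (x + h))"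
    by (intro has_derivative_diff has_derivative_at_withinI[OF smooth_fun_has_derivative[OF sm]] bounded_linear_imp_has_derivative lin)
   have "norm (y - x) \<le> norm h"
    using segment_bound(1)[OF y] by simp
   then have "C * norm (y - x) \<le> C * norm h" using C0 by (rule mult_left_mono)
   then show "onorm (\<lambda>v. Fd \<phi> y v - Fd \<phi> x v) \<le> C * norm h"
    using D[of y _ x] by (intro onorm_bound) (auto intro!: order_trans[OF D] mult_right_mono mult_nonneg_nonneg C0)
  qed auto
  moreover have "Fd \<phi> x (x + h) = Fd \<phi> x x + Fd \<phi> x h"
   by (rule linear_add[OF bounded_linear.linear[OF lin]])
  ultimately have "\<bar>\<phi> (x + h) - \<phi> x - Fd \<phi> x h\<bar> \<le> C * (norm h)\<^sup>2"
   by (simp add: power2_eq_square algebra_simps)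
  then show ?thesis by (simp add: algebra_simps) (smt (verit) zero_le_power2)
 qed
 with C0 show ?thesis by (intro that[of "C + 1"]) auto
qed

lemma convolve_has_derivative:
 fixes f :: "'a::euclidean_space \<Rightarrow> real"
 assumes f: "lintegrable f" and \<phi>: "test_function U \<phi>"
 shows "(convolve f \<phi> has_derivative (\<lambda>v. convolve f (\<lambda>x. Fd \<phi> x v) p)) (at p)"
proof -
 have sm: "smooth_fun \<phi>" using \<phi> by (rule test_function_smooth)
 obtain C where C: "C > 0" "\<And>x h. \<bar>\<phi> (x + h) - \<phi> x - Fd \<phi> x h\<bar> \<le> C * (norm h)\<^sup>2"
  by (rule test_function_taylor[OF \<phi>]) blast
 obtain B where B: "B > 0" "\<And>x. \<bar>\<phi> x\<bar> \<le> B" "\<And>x v. \<bar>Fd \<phi> x v\<bar> \<le> B * norm v"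
  using test_function_bounds[OF \<phi>] by metis
 have [measurable]: "\<phi> \<in> Bor" "\<And>v. (\<lambda>x. Fd \<phi> x v) \<in> Bor"
  using smooth_fun_borel[OF sm] smooth_fun_borel[OF smooth_fun_derivative[OF sm]] by auto
 have i1: "lintegrable (\<lambda>q. f q * \<phi> (p - q))" for p
  by (rule integrable_mult_bounded[OF f _ B(2)]) measurable
 have i2: "lintegrable (\<lambda>q. f q * Fd \<phi> (p - q) v)" for p v
  by (rule integrable_mult_bounded[OF f _ B(3)]) measurable
 have bl: "bounded_linear (\<lambda>v. convolve f (\<lambda>x. Fd \<phi> x v) p)"
 proof (rule bounded_linear_intro[where K="(LBINT q. \<bar>f q\<bar>) * B"])
  note lin = bounded_linear.linear[OF smooth_fun_linear[OF sm]]
  show "convolve f (\<lambda>x. Fd \<phi> x (v + w)) p = convolve f (\<lambda>x. Fd \<phi> x v) p + convolve f (\<lambda>x. Fd \<phi> x w) p" for v w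
   unfolding convolve_def using i2 by (simp add: linear_add[OF lin] distrib_left)
  show "convolve f (\<lambda>x. Fd \<phi> x (r *\<^sub>R v)) p = r *\<^sub>R convolve f (\<lambda>x. Fd \<phi> x v) p" for r v
   unfolding convolve_def by (simp add: linear_scale[OF lin] mult.left_commute)
  show "norm (convolve f (\<lambda>x. Fd \<phi> x v) p) \<le> norm v * ((LBINT q. \<bar>f q\<bar>) * B)" for v
  proof -
   have "norm (convolve f (\<lambda>x. Fd \<phi> x v) p) \<le> (LBINT q. \<bar>f q * Fd \<phi> (p - q) v\<bar>)"
    unfolding convolve_def real_norm_def by (rule integral_abs_bound)
   also have "\<dots> \<le> (LBINT q. \<bar>f q\<bar> * (B * norm v))"
   proof (rule integral_mono)
    show "lintegrable (\<lambda>q. \<bar>f q * Fd \<phi> (p - q) v\<bar>)" by (rule integrable_abs[OF i2])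
    show "lintegrable (\<lambda>q. \<bar>f q\<bar> * (B * norm v))" using f by simp
    show "\<bar>f q * Fd \<phi> (p - q) v\<bar> \<le> \<bar>f q\<bar> * (B * norm v)" for q
     unfolding abs_mult by (intro mult_left_mono B(3)) auto
   qed
   finally show ?thesis by (simp add: algebra_simps)
  qed
 qed
 define K where "K = C * (LBINT q. \<bar>f q\<bar>)"
 have est: "\<bar>convolve f \<phi> (p + h) - convolve f \<phi> p - convolve f (\<lambda>x. Fd \<phi> x h) p\<bar> \<le> K * (norm h)\<^sup>2" for h
 proof -
  have eq: "convolve f \<phi> (p + h) - convolve f \<phi> p - convolve f (\<lambda>x. Fd \<phi> x h) p =
   (LBINT q. f q * \<phi> (p + h - q) - f q * \<phi> (p - q) - f q * Fd \<phi> (p - q) h)"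
   unfolding convolve_def using i1 i2 by simp
  have "\<bar>LBINT q. f q * \<phi> (p + h - q) - f q * \<phi> (p - q) - f q * Fd \<phi> (p - q) h\<bar> \<le>
   (LBINT q. \<bar>f q * \<phi> (p + h - q) - f q * \<phi> (p - q) - f q * Fd \<phi> (p - q) h\<bar>)"
   by (rule integral_abs_bound)
  also have "\<dots> \<le> (LBINT q. \<bar>f q\<bar> * (C * (norm h)\<^sup>2))"
  proof (rule integral_mono)
   show "lintegrable (\<lambda>q. \<bar>f q * \<phi> (p + h - q) - f q * \<phi> (p - q) - f q * Fd \<phi> (p - q) h\<bar>)"
    by (intro integrable_abs Bochner_Integration.integrable_diff i1 i2)
   show "lintegrable (\<lambda>q. \<bar>f q\<bar> * (C * (norm h)\<^sup>2))" using f by simp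
   fix q
   have "f q * \<phi> (p + h - q) - f q * \<phi> (p - q) - f q * Fd \<phi> (p - q) h =
    f q * (\<phi> (p - q + h) - \<phi> (p - q) - Fd \<phi> (p - q) h)"
    by (simp add: algebra_simps)
   then show "\<bar>f q * \<phi> (p + h - q) - f q * \<phi> (p - q) - f q * Fd \<phi> (p - q) h\<bar> \<le> \<bar>f q\<bar> * (C * (norm h)\<^sup>2)"
    using mult_left_mono[OF C(2)[of "p - q" h] abs_ge_zero[of "f q"]] by (simp add: abs_mult)
  qed
  also have "\<dots> = K * (norm h)\<^sup>2" by (subst integral_mult_left_zero) (simp add: K_def)
  finally show ?thesis unfolding eq .
 qed
 have K0: "0 \<le> K" unfolding K_def using C(1) by (intro mult_nonneg_nonneg integral_nonneg) auto
 show ?thesis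
  unfolding has_derivative_at_alt
 proof (intro conjI allI impI bl)
  fix e :: real assume e: "e > 0"
  show "\<exists>d>0. \<forall>y. norm (y - p) < d \<longrightarrow> norm (convolve f \<phi> y - convolve f \<phi> p - convolve f (\<lambda>x. Fd \<phi> x (y - p)) p) \<le> e * norm (y - p)"
  proof (intro exI[of _ "e / (K + 1)"] conjI allI impI)
   fix y assume y: "norm (y - p) < e / (K + 1)"
   have "K * norm (y - p) \<le> e"
   proof -
    have "(K + 1) * norm (y - p) \<le> e" using y K0 by (simp add: field_simps)
    then show ?thesis using norm_ge_zero[of "y - p"] unfolding distrib_right by linarith
   qed
   then have "K * norm (y - p) * norm (y - p) \<le> e * norm (y - p)" by (intro mult_right_mono) auto
   then show "norm (convolve f \<phi> y - convolve f \<phi> p - convolve f (\<lambda>x. Fd \<phi> x (y - p)) p) \<le> e * norm (y - p)"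
    using est[of "y - p"] by (simp add: power2_eq_square)
  qed (use e K0 in auto)
 qed
qed

lemma smooth_fun_convolve:
 fixes f :: "'a::euclidean_space \<Rightarrow> real"
 assumes f: "lintegrable f" and \<phi>: "test_function UNIV \<phi>"
 shows "smooth_fun (convolve f \<phi>)"
proof (rule smooth_fun_coinduct[where S="{convolve f \<phi> | \<phi>. test_function UNIV \<phi>}"])
 fix g assume "g \<in> {convolve f \<phi> | \<phi>. test_function UNIV \<phi>}"
 then obtain \<phi> where \<phi>: "test_function UNIV \<phi>" and g: "g = convolve f \<phi>" by blast
 have d: "(g has_derivative (\<lambda>v. convolve f (\<lambda>x. Fd \<phi> x v) p)) (at p)" for p
  unfolding g by (rule convolve_has_derivative[OF f \<phi>])
 have "(\<lambda>p. Fd g p v) = convolve f (\<lambda>x. Fd \<phi> x v)" for v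
 proof
  fix p
  show "Fd g p v = convolve f (\<lambda>x. Fd \<phi> x v) p"
   using frechet_derivative_at[OF d[of p]] by metis
 qed
 moreover have "g differentiable (at p)" for p using d by (rule differentiableI)
 ultimately show "(\<forall>x. g differentiable at x) \<and> (\<forall>v. (\<lambda>x. Fd g x v) \<in> {convolve f \<phi> | \<phi>. test_function UNIV \<phi>})"
  using test_function_derivative[OF \<phi>] by blast
qed (use \<phi> in blast)

lemma integrableI_nn_abs:
 fixes f :: "'a \<Rightarrow> real"
 shows "f \<in> borel_measurable M \<Longrightarrow> (\<integral>\<^sup>+x. nabs (f x) \<partial>M) < \<infinity> \<Longrightarrow> integrable M f"
 by (simp add: integrable_iff_nn_abs)

text \<open>The test functions are mollifications of \<open>sgn w\<close> restricted to a ball.\<close>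

lemma L1_norm_duality:
 fixes w :: "'a::euclidean_space \<Rightarrow> real"
 assumes w: "lintegrable w"
  and le: "\<And>g. test_function UNIV g \<Longrightarrow> (\<And>x. \<bar>g x\<bar> \<le> 1) \<Longrightarrow> (LBINT x. w x * g x) \<le> B"
 shows "(LBINT x. \<bar>w x\<bar>) \<le> B"
proof -
 have [measurable]: "w \<in> Bor" using w by auto
 have ball: "(LBINT x. indicator (cball 0 (real n)) x * \<bar>w x\<bar>) \<le> B" for n
 proof (rule field_le_epsilon)
  fix r :: real assume r: "r > 0"
  define K where "K x = indicator (cball 0 (real n)) x * sgn (w x)" for x
  have cb[measurable]: "cball (0::'a) (real n) \<in> sets borel" by simp
  have [measurable]: "K \<in> Bor" unfolding K_def[abs_def] by measurable
  have K1: "\<bar>K x\<bar> \<le> 1" for x by (auto simp: K_def indicator_def abs_sgn_eq)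
  have K: "lintegrable K"
   by (rule integrable_bounded_support[of _ 1 "real n"]) (auto simp: K1, auto simp: K_def)
  obtain d where d: "d > 0" "\<And>e. 0 < e \<Longrightarrow> e < d \<Longrightarrow> (NINT p. nabs (convolve w (mollifier e) p - w p)) \<le> ennreal r"
   by (rule convolve_mollifier_L1[OF w r]) blast
  define e where "e = d / 2"
  have e: "e > 0" "e < d" using d(1) by (auto simp: e_def)
  note [measurable] = mollifier_borel[OF e(1)]
  obtain Cm where Cm: "\<And>x::'a. \<bar>mollifier e x\<bar> \<le> Cm" using test_function_bounds[OF test_function_mollifier[OF e(1)]] by metis
  define g where "g = convolve K (mollifier e)"
  have g_test: "test_function UNIV g"
  proof (rule test_functionI[of _ "cball 0 (real n + e)"])
   show "smooth_fun g" unfolding g_def by (rule smooth_fun_convolve[OF K test_function_mollifier[OF e(1)]])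
   show "g x = 0" if "x \<notin> cball 0 (real n + e)" for x
   proof -
    have "K q * mollifier e (x - q) = 0" for q
    proof (cases "norm q \<le> real n")
     case True
     have "norm x \<le> norm (x - q) + norm q" by (metis norm_triangle_sub add.commute)
     then have "norm (x - q) \<ge> e" using True that by auto
     then show ?thesis using mollifier_eq_0[OF e(1), of "x - q"] by simp
    qed (simp add: K_def)
    then have "(\<lambda>q. K q * mollifier e (x - q)) = (\<lambda>q. 0)" by blast
    then show ?thesis unfolding g_def convolve_def by simp
   qed
  qed auto
  have iK: "lintegrable (\<lambda>q. K q * mollifier e (x - q))" for x
   by (rule integrable_mult_bounded[OF K _ Cm]) measurable
  have im: "lintegrable (\<lambda>q. mollifier e (x - q))" for x :: 'a
   by (rule integrable_reflect_shift[OF integrable_mollifier[OF e(1)]])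
  have g1: "\<bar>g x\<bar> \<le> 1" for x
  proof -
   have "\<bar>g x\<bar> \<le> (LBINT q. \<bar>K q * mollifier e (x - q)\<bar>)"
    unfolding g_def convolve_def by (rule integral_abs_bound)
   also have "\<dots> \<le> (LBINT q. mollifier e (x - q))"
   proof (rule integral_mono)
    show "\<bar>K q * mollifier e (x - q)\<bar> \<le> mollifier e (x - q)" for q
     using mult_right_mono[OF K1[of q] mollifier_nonneg[OF e(1), of "x - q"]] mollifier_nonneg[OF e(1), of "x - q"]
     by (simp add: abs_mult)
   qed (use im integrable_abs[OF iK] in auto)
   also have "\<dots> = 1"
    using integral_reflect_shift[of "mollifier e" x] integral_mollifier[OF e(1), where 'a='a] by simp
   finally show ?thesis .
  qed
  \<comment> \<open>By the symmetry of the mollifier, the mollification moves from the sign function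
    to \<open>w\<close>, where it costs only the L^1 error \<open>r\<close>.\<close>
  have "(LBINT x. w x * g x) = (LBINT q. K q * convolve w (mollifier e) q)"
  proof -
   have borel_measurable_integrand: "(\<lambda>z. w (fst z) * (K (snd z) * mollifier e (fst z - snd z))) \<in> BorL"
    by measurable
   have bs: "lintegrable (\<lambda>z. w (fst z) * (K (snd z) * mollifier e (fst z - snd z)))"
   proof -
    have "(NINT z. nabs (w (fst z) * (K (snd z) * mollifier e (fst z - snd z)))) =
     (NINT x. NINT q. nabs (w x) * nabs (K q * mollifier e (x - q)))"
     by (subst nn_integral_lborel_prod) (simp_all add: abs_mult[of "w _"] ennreal_mult)
    also have "\<dots> \<le> (NINT x. nabs (w x) * 1)"
    proof (rule nn_integral_mono)
     fix x
     have "(NINT q. nabs (K q * mollifier e (x - q))) \<le> (NINT q. ennreal (mollifier e (x - q)))"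
     proof (intro nn_integral_mono ennreal_leI)
      fix q
      show "\<bar>K q * mollifier e (x - q)\<bar> \<le> mollifier e (x - q)"
       using mult_right_mono[OF K1[of q] mollifier_nonneg[OF e(1), of "x - q"]] mollifier_nonneg[OF e(1), of "x - q"]
       by (simp add: abs_mult)
     qed
     also have "\<dots> = 1"
      using nn_integral_reflect_shift[of "\<lambda>x. ennreal (mollifier e x)" x] nn_integral_mollifier[OF e(1), where 'a='a] by simp
     finally show "(NINT q. nabs (w x) * nabs (K q * mollifier e (x - q))) \<le> nabs (w x) * 1"
      using mult_left_mono[of "NINT q. nabs (K q * mollifier e (x - q))" 1 "nabs (w x)"]
      by (subst nn_integral_cmult) simp_all
    qed
    also have "\<dots> < \<infinity>" using w by (auto simp: integrable_iff_bounded)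
    finally show ?thesis by (rule integrableI_nn_abs[rotated]) (rule borel_measurable_integrand)
   qed
   have "(LBINT x. w x * g x) = (LBINT x. LBINT q. w x * (K q * mollifier e (x - q)))"
    by (simp add: g_def convolve_def)
   also have "\<dots> = (LBINT q. LBINT x. w x * (K q * mollifier e (x - q)))"
    using lborel_integral_swap[OF bs] by simp
   also have "\<dots> = (LBINT q. K q * convolve w (mollifier e) q)"
   proof (intro LBINT_cong refl)
    fix q
    have "mollifier e (x - q) = mollifier e (q - x)" for x :: 'a
     using mollifier_minus[of e "x - q"] by simp
    then have "(LBINT x. w x * (K q * mollifier e (x - q))) = (LBINT x. K q * (w x * mollifier e (q - x)))"
     by (intro LBINT_cong) (auto simp: algebra_simps)
    then show "(LBINT x. w x * (K q * mollifier e (x - q))) = K q * convolve w (mollifier e) q"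
     by (simp add: convolve_def)
   qed
   finally show ?thesis .
  qed
  have iw: "lintegrable (convolve w (mollifier e))"
  proof -
   have "(NINT p. nabs (convolve w (mollifier e) p - 0)) \<le> (NINT p. nabs (convolve w (mollifier e) p - w p)) + (NINT p. nabs (w p - 0))"
    by (rule nn_integral_diff_triangle) measurable
   also have "\<dots> < \<infinity>" using d(2)[OF e] w by (auto simp: integrable_iff_bounded intro: le_less_trans)
   finally show ?thesis using integrableI_nn_abs[of "convolve w (mollifier e)" lborel] by simp
  qed
  have iKw: "lintegrable (\<lambda>x. K x * w x)" "lintegrable (\<lambda>x. K x * convolve w (mollifier e) x)"
  proof -
   have "lintegrable (\<lambda>x. w x * K x)" by (rule integrable_mult_bounded[OF w _ K1]) measurable
   moreover have "lintegrable (\<lambda>x. convolve w (mollifier e) x * K x)" by (rule integrable_mult_bounded[OF iw _ K1]) measurable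
   ultimately show "lintegrable (\<lambda>x. K x * w x)" "lintegrable (\<lambda>x. K x * convolve w (mollifier e) x)"
    by (simp_all add: mult.commute)
  qed
  have "(LBINT x. indicator (cball 0 (real n)) x * \<bar>w x\<bar>) = (LBINT x. K x * w x)"
   by (intro LBINT_cong) (auto simp: K_def abs_sgn mult.commute)
  also have "\<dots> = (LBINT x. K x * convolve w (mollifier e) x) + (LBINT x. K x * w x - K x * convolve w (mollifier e) x)"
   using iKw by simp
  also have "(LBINT x. K x * w x - K x * convolve w (mollifier e) x) \<le> (LBINT x. \<bar>convolve w (mollifier e) x - w x\<bar>)"
  proof (rule integral_mono)
   show "K x * w x - K x * convolve w (mollifier e) x \<le> \<bar>convolve w (mollifier e) x - w x\<bar>" for x
   proof -
    have "K x * (w x - convolve w (mollifier e) x) \<le> \<bar>K x\<bar> * \<bar>w x - convolve w (mollifier e) x\<bar>"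
     by (metis abs_ge_self abs_mult)
    also have "\<dots> \<le> 1 * \<bar>w x - convolve w (mollifier e) x\<bar>" by (intro mult_right_mono K1) auto
    finally show ?thesis by (simp add: right_diff_distrib abs_minus_commute)
   qed
  qed (use iKw iw w in auto)
  also have "(LBINT x. \<bar>convolve w (mollifier e) x - w x\<bar>) \<le> r"
  proof -
   have "ennreal (LBINT x. \<bar>convolve w (mollifier e) x - w x\<bar>) = (NINT p. nabs (convolve w (mollifier e) p - w p))"
    by (rule nn_integral_eq_integral[symmetric]) (use iw w in auto)
   then have "ennreal (LBINT x. \<bar>convolve w (mollifier e) x - w x\<bar>) \<le> ennreal r" using d(2)[OF e] by simp
   then show ?thesis using r ennreal_le_iff less_imp_le by blast
  qed
  also have "(LBINT x. K x * convolve w (mollifier e) x) \<le> B"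
   using le[OF g_test g1] \<open>(LBINT x. w x * g x) = (LBINT q. K q * convolve w (mollifier e) q)\<close> by simp
  finally show "(LBINT x. indicator (cball 0 (real n)) x * \<bar>w x\<bar>) \<le> B + r" by simp
 qed
 have "(\<lambda>n. LBINT x. indicator (cball 0 (real n)) x * \<bar>w x\<bar>) \<longlonglongrightarrow> (LBINT x. \<bar>w x\<bar>)"
 proof (rule integral_dominated_convergence[where w="\<lambda>x. \<bar>w x\<bar>"])
  show "AEL x. (\<lambda>n. indicator (cball 0 (real n)) x * \<bar>w x\<bar>) \<longlonglongrightarrow> \<bar>w x\<bar>"
  proof (rule AE_I2)
   fix x :: 'a
   obtain N where N: "norm x \<le> real N" using real_arch_simple by blast
   have "eventually (\<lambda>n. indicator (cball 0 (real n)) x * \<bar>w x\<bar> = \<bar>w x\<bar>) sequentially"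
    using eventually_ge_at_top[of N] by eventually_elim (use N in \<open>auto simp: indicator_def\<close>)
   then show "(\<lambda>n. indicator (cball 0 (real n)) x * \<bar>w x\<bar>) \<longlonglongrightarrow> \<bar>w x\<bar>" by (rule tendsto_eventually)
  qed
  show "(\<lambda>x. indicator (cball 0 (real n)) x * \<bar>w x\<bar>) \<in> BorL" for n
  proof -
   have [measurable]: "cball (0::'a) (real n) \<in> sets borel" by simp
   show ?thesis by measurable
  qed
  show "AEL x. norm (indicator (cball 0 (real n)) x * \<bar>w x\<bar>) \<le> \<bar>w x\<bar>" for n
   by (rule AE_I2) (auto simp: indicator_def)
 qed (use w in auto)
 then show ?thesis by (rule LIMSEQ_le_const2) (use ball in blast)
qed

subsection \<open>Functions of bounded variation\<close>

lemma frechet_derivative_scaleR_const: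
 assumes "smooth_fun g"
 shows "((\<lambda>x. g x *\<^sub>R e) has_derivative (\<lambda>v. Fd g x v *\<^sub>R e)) (at x)"
 by (rule has_derivative_scaleR_left[OF smooth_fun_has_derivative[OF assms]])

lemma total_variation_bound:
 fixes v :: "real^'n::finite \<Rightarrow> real" and e :: "real^'n"
 assumes v: "v \<in> BV" and g: "test_function UNIV g" "\<And>x. \<bar>g x\<bar> \<le> 1" and e: "norm e \<le> 1"
 shows "(LBINT x. v x * Fd g x e) \<le> enn2real (total_variation v)"
proof -
 have sm: "smooth_fun g" using g(1) by (rule test_function_smooth)
 define \<phi> where "\<phi> x = g x *\<^sub>R e" for x
 have der: "(\<phi> has_derivative (\<lambda>v. Fd g x v *\<^sub>R e)) (at x)" for x
  unfolding \<phi>_def[abs_def] by (rule frechet_derivative_scaleR_const[OF sm])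
 then have fd: "Fd \<phi> x = (\<lambda>v. Fd g x v *\<^sub>R e)" for x
  using frechet_derivative_at by metis
 have "\<phi> \<in> C1c"
  unfolding C1c_def
 proof (intro CollectI conjI allI)
  show "\<phi> differentiable at x" for x using der by (rule differentiableI)
  show "continuous_on UNIV (\<lambda>x. Fd \<phi> x v)" for v
   unfolding fd by (intro continuous_intros smooth_fun_continuous_on[OF smooth_fun_derivative[OF sm]])
  have "closure {x. \<phi> x \<noteq> 0} \<subseteq> closure {x. g x \<noteq> 0}"
   by (rule closure_mono) (auto simp: \<phi>_def)
  then show "compact (closure {x. \<phi> x \<noteq> 0})"
   using g(1) closed_Int_compact[OF closed_closure, of "closure {x. g x \<noteq> 0}" "{x. \<phi> x \<noteq> 0}"]
   by (auto simp: test_function_iff Int_absorb2)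
 qed
 moreover have "norm (\<phi> x) \<le> 1" for x
  using mult_mono[OF g(2)[of x] e] by (simp add: \<phi>_def)
 moreover have "divergence \<phi> x = Fd g x e" for x
 proof -
  interpret bounded_linear "Fd g x" by (rule smooth_fun_linear[OF sm])
  have "Fd g x e = Fd g x (\<Sum>i\<in>UNIV. (e $ i) *\<^sub>R axis i 1)"
   by (simp add: basis_expansion[of e, unfolded scalar_mult_eq_scaleR])
  also have "\<dots> = (\<Sum>i\<in>UNIV. (e $ i) * Fd g x (axis i 1))"
   by (simp add: sum scaleR)
  finally show ?thesis unfolding divergence_def fd by (simp add: mult.commute)
 qed
 ultimately have "ennreal (LBINT x. v x * Fd g x e) \<le> total_variation v"
  unfolding total_variation_def by (intro SUP_upper2[of \<phi>]) auto
 moreover have "total_variation v < \<infinity>" using v by (simp add: BV_def)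
 ultimately have "ennreal (LBINT x. v x * Fd g x e) \<le> ennreal (enn2real (total_variation v))"
  by (simp add: ennreal_enn2real_if less_top)
 then show ?thesis by (subst (asm) ennreal_le_iff) auto
qed

lemma test_function_reflect_shift:
 assumes g: "test_function UNIV (g :: 'a::euclidean_space \<Rightarrow> real)"
 shows "test_function UNIV (\<lambda>x. g (c - x))"
proof (rule test_functionI[of _ "(\<lambda>x. c - x) ` closure {x. g x \<noteq> 0}"])
 show "smooth_fun (\<lambda>x. g (c - x))" by (rule smooth_fun_reflect[OF test_function_smooth[OF g]])
 show "compact ((\<lambda>x. c - x) ` closure {x. g x \<noteq> 0})"
  using g by (intro compact_continuous_image continuous_intros) (auto simp: test_function_iff)
 show "g (c - x) = 0" if x: "x \<notin> (\<lambda>x. c - x) ` closure {x. g x \<noteq> 0}" for x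
 proof (rule ccontr)
  assume "g (c - x) \<noteq> 0"
  then have "c - x \<in> closure {x. g x \<noteq> 0}" using closure_subset[of "{x. g x \<noteq> 0}"] by auto
  then have "c - (c - x) \<in> (\<lambda>x. c - x) ` closure {x. g x \<noteq> 0}" by (rule imageI)
  with x show False by simp
 qed
qed auto

text \<open>By duality: testing the difference with g gives the increment over y of the convolution
  with the reflected g. The mean value theorem turns it into a derivative along y, which falls on
  the test function and thus is a pairing bounded by the total variation.\<close>

theorem BV_shift_bound:
 fixes v :: "real^'n::finite \<Rightarrow> real"
 assumes v: "v \<in> BV"
 shows "(LBINT x. \<bar>v (x + y) - v x\<bar>) \<le> norm y * enn2real (total_variation v)"
proof (rule L1_norm_duality)
 have vi: "lintegrable v" using v by (simp add: BV_def)
 note [measurable] = borel_measurable_integrable[OF vi]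
 show "lintegrable (\<lambda>x. v (x + y) - v x)"
  by (intro Bochner_Integration.integrable_diff integrable_shift vi)
 fix g :: "real^'n \<Rightarrow> real" assume g: "test_function UNIV g" "\<And>x. \<bar>g x\<bar> \<le> 1"
 have [measurable]: "g \<in> Bor" by (rule smooth_fun_borel[OF test_function_smooth[OF g(1)]])
 define g' where "g' x = g (- x)" for x
 have g': "test_function UNIV g'"
  using test_function_reflect_shift[OF g(1), of 0] unfolding g'_def[abs_def] by simp
 have g'1: "\<bar>g' x\<bar> \<le> 1" for x by (simp add: g'_def g(2))
 have i: "lintegrable (\<lambda>x. v (x + y) * g x)" "lintegrable (\<lambda>x. v x * g x)"
  by (rule integrable_mult_bounded[OF integrable_shift[OF vi] _ g(2)], measurable)
   (rule integrable_mult_bounded[OF vi _ g(2)], measurable)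
 have "(LBINT x. (v (x + y) - v x) * g x) = (LBINT x. v (x + y) * g x) - (LBINT x. v x * g x)"
  using i by (simp add: left_diff_distrib)
 also have "(LBINT x. v (x + y) * g x) = convolve v g' y"
  using integral_shift[of "\<lambda>x. v x * g (x - y)" y] by (simp add: convolve_def g'_def)
 also have "(LBINT x. v x * g x) = convolve v g' 0"
  by (simp add: convolve_def g'_def)
 finally have eq: "(LBINT x. (v (x + y) - v x) * g x) = convolve v g' y - convolve v g' 0" .
 define D where "D z = convolve v (\<lambda>x. Fd g' x y) z" for z
 have "((\<lambda>t. convolve v g' (t *\<^sub>R y)) has_derivative (\<lambda>t. convolve v (\<lambda>x. Fd g' x (t *\<^sub>R y)) (s *\<^sub>R y))) (at s)" for s :: real
  by (rule has_derivative_compose[where f="\<lambda>t. t *\<^sub>R y", OF _ convolve_has_derivative[OF vi g']])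
   (auto intro!: derivative_eq_intros)
 moreover have "(\<lambda>t. convolve v (\<lambda>x. Fd g' x (t *\<^sub>R y)) z) = (*) (D z)" for z
 proof
  fix t
  show "convolve v (\<lambda>x. Fd g' x (t *\<^sub>R y)) z = D z * t"
   unfolding D_def convolve_def
   by (simp add: linear_scale[OF bounded_linear.linear[OF smooth_fun_linear[OF test_function_smooth[OF g']]]] mult.left_commute mult.commute)
 qed
 ultimately have d: "((\<lambda>t. convolve v g' (t *\<^sub>R y)) has_real_derivative D (s *\<^sub>R y)) (at s)" for s
  by (simp add: has_field_derivative_def)
 obtain s where "convolve v g' (1 *\<^sub>R y) - convolve v g' (0 *\<^sub>R y) = (1 - 0) * D (s *\<^sub>R y)"
  using MVT2[OF zero_less_one, of "\<lambda>t. convolve v g' (t *\<^sub>R y)" "\<lambda>s. D (s *\<^sub>R y)"] d by blast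
 then have "(LBINT x. (v (x + y) - v x) * g x) = D (s *\<^sub>R y)" using eq by simp
 also have "\<dots> \<le> norm y * enn2real (total_variation v)"
 proof (cases "y = 0")
  case True
  have "Fd g' x 0 = 0" for x
   by (rule linear_0[OF bounded_linear.linear[OF smooth_fun_linear[OF test_function_smooth[OF g']]]])
  then show ?thesis using True by (simp add: D_def convolve_def)
 next
  case False
  \<comment> \<open>The minus sign offsets the one produced by reflecting the test function.\<close>
  define e where "e = - (y /\<^sub>R norm y)"
  define k where "k x = g' (s *\<^sub>R y - x)" for x
  have k: "test_function UNIV k" unfolding k_def[abs_def] by (rule test_function_reflect_shift[OF g'])
  have kd: "Fd k x w = - Fd g' (s *\<^sub>R y - x) w" for x w
   unfolding k_def[abs_def] by (rule frechet_derivative_reflect[OF test_function_smooth[OF g']])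
  have "norm y * Fd k x e = Fd g' (s *\<^sub>R y - x) y" for x
  proof -
   note lin = bounded_linear.linear[OF smooth_fun_linear[OF test_function_smooth[OF g']]]
   have y: "- (norm y *\<^sub>R e) = y" using False by (simp add: e_def)
   have "Fd g' w (- (norm y *\<^sub>R e)) = - (norm y * Fd g' w e)" for w
    by (simp only: linear_neg[OF lin] linear_scale[OF lin] real_scaleR_def)
   from this[of "s *\<^sub>R y - x"] have "Fd g' (s *\<^sub>R y - x) y = - (norm y * Fd g' (s *\<^sub>R y - x) e)"
    unfolding y .
   then show ?thesis by (simp add: kd)
  qed
  then have "v x * Fd g' (s *\<^sub>R y - x) y = norm y * (v x * Fd k x e)" for x
   by (metis mult.left_commute)
  then have "D (s *\<^sub>R y) = norm y * (LBINT x. v x * Fd k x e)"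
   unfolding D_def convolve_def by (simp only: integral_mult_right_zero)
  also have "\<dots> \<le> norm y * enn2real (total_variation v)"
   by (intro mult_left_mono total_variation_bound[OF v k]) (use False in \<open>auto simp: k_def g'1 e_def\<close>)
  finally show ?thesis .
 qed
 finally show "(LBINT x. (v (x + y) - v x) * g x) \<le> norm y * enn2real (total_variation v)" .
qed

text \<open>The L^1 modulus of a single level of v. For a shift y independent of \<xi>, integrating
  over \<xi> recovers the L^1 modulus of v itself.\<close>

definition shift_modulus :: "('a::euclidean_space \<Rightarrow> real) \<Rightarrow> real \<Rightarrow> 'a \<Rightarrow> ennreal"
 where "shift_modulus v \<xi> y = (NINT x. nabs (kchi \<xi> (v (x + y)) - kchi \<xi> (v x)))"

lemma shift_modulus_triangle:
 assumes [measurable]: "v \<in> Bor"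
 shows "shift_modulus v \<xi> y \<le> shift_modulus v \<xi> z + shift_modulus v \<xi> (y - z)"
proof -
 have "shift_modulus v \<xi> y \<le> (NINT x. nabs (kchi \<xi> (v (x + y)) - kchi \<xi> (v (x + z)))) + shift_modulus v \<xi> z"
  unfolding shift_modulus_def by (rule nn_integral_diff_triangle) measurable
 also have "(NINT x. nabs (kchi \<xi> (v (x + y)) - kchi \<xi> (v (x + z)))) = shift_modulus v \<xi> (y - z)"
  unfolding shift_modulus_def
  using nn_integral_shift[of "\<lambda>x. nabs (kchi \<xi> (v (x + (y - z))) - kchi \<xi> (v x))" z] by (simp add: algebra_simps)
 finally show ?thesis by (simp add: add.commute)
qed

text \<open>A shift by \<open>y\<close> is compared with the average of all shifts of the ball of radius \<open>2 S\<close>. This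
 allows the shift to depend on \<open>\<xi>\<close>.\<close>

lemma averaged_shift_bound:
 fixes v :: "'a::euclidean_space \<Rightarrow> real" and c :: "real \<Rightarrow> 'a"
 assumes v: "lintegrable v" and K: "AEL x. \<bar>v x\<bar> \<le> K"
  and V: "0 \<le> V" "\<And>y. (LBINT x. \<bar>v (x + y) - v x\<bar>) \<le> norm y * V"
  and c[measurable]: "c \<in> Bor" and S: "0 \<le> S" "AEL \<xi>. \<bar>\<xi>\<bar> \<le> K \<longrightarrow> norm (c \<xi>) \<le> S"
 shows "(NINT \<xi>. shift_modulus v \<xi> (c \<xi>)) \<le> ennreal (2 ^ (DIM('a) + 2) * S * V)"
proof -
 have [measurable]: "v \<in> Bor" using v by auto
 have [measurable]: "(\<lambda>p. shift_modulus v (fst p) (snd p)) \<in> borel_measurable (borel :: (real \<times> 'a) measure)"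
  unfolding shift_modulus_def by (rule lborel.borel_measurable_nn_integral) measurable
 \<comment> \<open>Levels of modulus above K are not reached, so a bound on \<open>c\<close> is
   asked for only below.\<close>
 have out: "shift_modulus v \<xi> y = 0" if \<xi>: "\<bar>\<xi>\<bar> > K" for \<xi> y
 proof -
  have k0: "kchi \<xi> u = 0" if "\<bar>u\<bar> \<le> K" for u
   using that \<xi> by (auto simp: kchi_def step_def)
  have "AEL x. \<bar>v (x + y)\<bar> \<le> K"
  proof -
   have "AE x in distr lborel borel ((+) y). \<bar>v x\<bar> \<le> K" by (subst lborel_distr_plus) (rule K)
   then have "AEL x. \<bar>v (y + x)\<bar> \<le> K" by (subst (asm) AE_distr_iff) auto
   then show ?thesis by (simp add: add.commute)
  qed
  with K have "AEL x. nabs (kchi \<xi> (v (x + y)) - kchi \<xi> (v x)) = 0"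
   by eventually_elim (simp add: k0)
  then show ?thesis unfolding shift_modulus_def by (subst nn_integral_0_iff_AE) auto
 qed
 have zero: "shift_modulus v \<xi> 0 = 0" for \<xi> by (simp add: shift_modulus_def)
 show ?thesis
 \<comment> \<open>The averaging divides by the volume of the ball, so S = 0 is treated apart; there
   \<open>c\<close> vanishes almost everywhere on the levels that matter.\<close>
 proof (cases "S = 0")
  case True
  have "AEL \<xi>. shift_modulus v \<xi> (c \<xi>) = 0"
   using S(2) by eventually_elim (metis True zero out norm_le_zero_iff not_le)
  then have "(NINT \<xi>. shift_modulus v \<xi> (c \<xi>)) = (\<integral>\<^sup>+\<xi>. 0 \<partial>(lborel :: real measure))"
   by (rule nn_integral_cong_AE)
  then show ?thesis by simp
 next
  case False
  then have S0: "S > 0" using S by simp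
  define mS where "mS r = emeasure lborel (cball (0::'a) r)" for r
  have mS: "mS r = ennreal (unit_ball_vol DIM('a) * r ^ DIM('a))" if "r \<ge> 0" for r
   using emeasure_cball[OF that, of "0::'a"] by (simp add: mS_def)
  have pos: "0 < unit_ball_vol (real DIM('a))" by simp
  have cb[measurable]: "cball (0::'a) r \<in> sets borel" for r by simp
  \<comment> \<open>The triangle inequality for y = z + (y - z) is averaged over z in the ball of
    radius S. Since norm y \<le> S, both z and y - z stay in the ball of radius 2 * S.\<close>
  have pt: "mS S * shift_modulus v \<xi> y \<le> 2 * (NINT z. indicator (cball 0 (2 * S)) z * shift_modulus v \<xi> z)"
   if y: "norm y \<le> S" for \<xi> y
  proof -
   have [measurable]: "shift_modulus v \<xi> \<in> Bor"
    using measurable_compose[of "\<lambda>y. (\<xi>, y)" borel borel "\<lambda>p. shift_modulus v (fst p) (snd p)" borel] by simp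
   have "mS S * shift_modulus v \<xi> y = (NINT z. indicator (cball 0 S) (z::'a) * shift_modulus v \<xi> y)"
    by (simp add: nn_integral_multc mS_def)
   also have "\<dots> \<le> (NINT z. indicator (cball 0 S) z * shift_modulus v \<xi> z + indicator (cball 0 S) z * shift_modulus v \<xi> (y - z))"
    using shift_modulus_triangle[of v \<xi> y] by (intro nn_integral_mono) (auto simp: indicator_def)
   also have "\<dots> = (NINT z. indicator (cball 0 S) z * shift_modulus v \<xi> z) + (NINT z. indicator (cball 0 S) z * shift_modulus v \<xi> (y - z))"
    by (rule nn_integral_add) measurable
   also have "(NINT z. indicator (cball 0 S) z * shift_modulus v \<xi> (y - z)) = (NINT z. indicator (cball 0 S) (y - z) * shift_modulus v \<xi> z)"
    using nn_integral_reflect_shift[of "\<lambda>z. indicator (cball 0 S) (y - z) * shift_modulus v \<xi> z" y] by simp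
   also have "(NINT z. indicator (cball 0 S) z * shift_modulus v \<xi> z) \<le> (NINT z. indicator (cball 0 (2 * S)) z * shift_modulus v \<xi> z)"
    using S0 by (intro nn_integral_mono) (auto simp: indicator_def)
   also have "(NINT z. indicator (cball 0 S) (y - z) * shift_modulus v \<xi> z) \<le> (NINT z. indicator (cball 0 (2 * S)) z * shift_modulus v \<xi> z)"
   proof (rule nn_integral_mono)
    fix z :: 'a
    have "norm z \<le> 2 * S" if "norm (y - z) \<le> S"
     using that y norm_triangle_ineq2[of z y] by (simp add: norm_minus_commute)
    then show "indicator (cball 0 S) (y - z) * shift_modulus v \<xi> z \<le> indicator (cball 0 (2 * S)) z * shift_modulus v \<xi> z"
     by (auto simp: indicator_def)
   qed
   finally show ?thesis unfolding mult_2 by (meson add_left_mono add_right_mono order_trans)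
  qed
  have "mS S * (NINT \<xi>. shift_modulus v \<xi> (c \<xi>)) = (NINT \<xi>. mS S * shift_modulus v \<xi> (c \<xi>))"
  proof (rule nn_integral_cmult[symmetric])
   have "(\<lambda>\<xi>. (\<xi>, c \<xi>)) \<in> Bor" by measurable
   from measurable_compose[OF this, of "\<lambda>p. shift_modulus v (fst p) (snd p)" borel]
   show "(\<lambda>\<xi>. shift_modulus v \<xi> (c \<xi>)) \<in> BorL" by simp
  qed
  also have "\<dots> \<le> (NINT \<xi>. 2 * (NINT z. indicator (cball 0 (2 * S)) z * shift_modulus v \<xi> z))"
  proof (rule nn_integral_mono_AE)
   show "AEL \<xi>. mS S * shift_modulus v \<xi> (c \<xi>) \<le> 2 * (NINT z. indicator (cball 0 (2 * S)) z * shift_modulus v \<xi> z)"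
    using S(2)
   proof eventually_elim
    case (elim \<xi>)
    then show ?case using pt[of "c \<xi>" \<xi>] out[of \<xi> "c \<xi>"] by (cases "\<bar>\<xi>\<bar> \<le> K") auto
   qed
  qed
  also have "\<dots> = 2 * (NINT z. NINT \<xi>. indicator (cball 0 (2 * S)) z * shift_modulus v \<xi> z)"
  proof -
   have m: "(\<lambda>p. indicator (cball 0 (2 * S)) (snd p) * shift_modulus v (fst p) (snd p)) \<in> borel_measurable (lborel \<Otimes>\<^sub>M (lborel :: 'a measure))"
    unfolding lborel_prod by measurable
   from lborel_pair.Fubini'[OF m[unfolded case_prod_beta'[symmetric, of "\<lambda>\<xi> z. indicator (cball 0 (2 * S)) z * shift_modulus v \<xi> z"]]] have "(NINT \<xi>. NINT z. indicator (cball 0 (2 * S)) z * shift_modulus v \<xi> z) =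
    (NINT z. NINT \<xi>. indicator (cball 0 (2 * S)) z * shift_modulus v \<xi> z)" by simp
   moreover have "(NINT \<xi>. 2 * (NINT z. indicator (cball 0 (2 * S)) z * shift_modulus v \<xi> z)) =
    2 * (NINT \<xi>. NINT z. indicator (cball 0 (2 * S)) z * shift_modulus v \<xi> z)"
    by (rule nn_integral_cmult) (use lborel.borel_measurable_nn_integral_fst[OF m] in simp)
   ultimately show ?thesis by simp
  qed
  also have "\<dots> \<le> 2 * (\<integral>\<^sup>+z. indicator (cball 0 (2 * S)) z * ennreal (2 * S * V) \<partial>(lborel :: 'a measure))"
  proof (intro mult_left_mono nn_integral_mono)
   fix z :: 'a
   show "(NINT \<xi>. indicator (cball 0 (2 * S)) z * shift_modulus v \<xi> z) \<le> indicator (cball 0 (2 * S)) z * ennreal (2 * S * V)"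
   proof (cases "z \<in> cball 0 (2 * S)")
    case True
    have "(NINT \<xi>. shift_modulus v \<xi> z) = (NINT x. NINT \<xi>. nabs (kchi \<xi> (v (x + z)) - kchi \<xi> (v x)))"
     unfolding shift_modulus_def by (rule lborel_pair.Fubini') measurable
    also have "\<dots> = ennreal (LBINT x. \<bar>v (x + z) - v x\<bar>)"
     using v integrable_shift[OF v] by (simp add: nn_integral_kchi_diff nn_integral_eq_integral)
    also have "\<dots> \<le> ennreal (2 * S * V)"
     using True V(1) by (intro ennreal_leI order_trans[OF V(2)] mult_right_mono) auto
    finally show ?thesis using True by simp
   qed simp
  qed auto
  also have "\<dots> = 2 * (mS (2 * S) * ennreal (2 * S * V))"
   by (simp add: nn_integral_multc mS_def)
  \<comment> \<open>The two balls have volume ratio 2^d; the two integrals of the triangle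
    inequality and the shift length 2 * S contribute the remaining factor 4.\<close>
  also have "\<dots> = mS S * ennreal (2 ^ (DIM('a) + 2) * S * V)"
   using S0 V(1) pos mS[of S] mS[of "2 * S"]
   by (simp add: ennreal_mult[symmetric] power_mult_distrib flip: ennreal_numeral)
  finally have le: "mS S * (NINT \<xi>. shift_modulus v \<xi> (c \<xi>)) \<le> mS S * ennreal (2 ^ (DIM('a) + 2) * S * V)" .
  have "0 < unit_ball_vol (real DIM('a)) * S ^ DIM('a)" using S0 pos by (intro mult_pos_pos zero_less_power)
  then have "mS S \<noteq> 0" "mS S \<noteq> top" by (simp_all add: mS[OF S(1)] ennreal_eq_0_iff not_le)
  with le show ?thesis by (subst (asm) ennreal_mult_le_mult_iff) auto
 qed
qed

section \<open>Shears along a velocity that depends on \<xi>\<close>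

lemma nn_integral_shift_prod:
 fixes v :: "'a::euclidean_space \<Rightarrow> real" and c :: "real \<Rightarrow> 'a"
 assumes [measurable]: "v \<in> Bor" "c \<in> Bor"
 shows "(NINT z. nabs (kchi (snd z) (v (fst z + c (snd z))) - kp v z)) =
  (NINT \<xi>. shift_modulus v \<xi> (c \<xi>))"
proof -
 have "(NINT z. nabs (kchi (snd z) (v (fst z + c (snd z))) - kp v z)) =
  (NINT x. NINT \<xi>. nabs (kchi \<xi> (v (x + c \<xi>)) - kchi \<xi> (v x)))"
  by (subst nn_integral_lborel_prod) simp_all
 also have "\<dots> = (NINT \<xi>. NINT x. nabs (kchi \<xi> (v (x + c \<xi>)) - kchi \<xi> (v x)))"
  by (rule lborel_pair.Fubini'[symmetric]) measurable
 finally show ?thesis by (simp add: shift_modulus_def)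
qed

lemma nn_integral_lborel_prod_snd:
 fixes g :: "'x::euclidean_space \<times> 'y::euclidean_space \<Rightarrow> ennreal"
 assumes [measurable]: "g \<in> Bor"
 shows "(NINT p. g p) = (NINT y. NINT x. g (x, y))"
proof -
 have "(\<lambda>(x, y). g (x, y)) \<in> borel_measurable (lborel \<Otimes>\<^sub>M (lborel :: 'y measure))"
  unfolding lborel_prod by simp
 from lborel_pair.Fubini'[OF this] show ?thesis
  by (simp add: nn_integral_lborel_prod[OF assms])
qed

lemma nn_integral_shear:
 fixes f :: "'a::euclidean_space \<times> 'b::euclidean_space \<Rightarrow> ennreal" and c :: "'b \<Rightarrow> 'a"
 assumes f[measurable]: "f \<in> Bor" and c[measurable]: "c \<in> Bor"
 shows "(NINT z. f (fst z + c (snd z), snd z)) = (NINT z. f z)"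
proof -
 have "(NINT z. f (fst z + c (snd z), snd z)) = (NINT y. NINT x. f (x + c y, y))"
  by (subst nn_integral_lborel_prod_snd) simp_all
 also have "\<dots> = (NINT y. NINT x. f (x, y))"
  by (intro nn_integral_cong nn_integral_shift[where f="\<lambda>x. f (x, _)"]) measurable
 finally show ?thesis by (simp add: nn_integral_lborel_prod_snd)
qed

lemma lborel_distr_shear:
 fixes c :: "'b::euclidean_space \<Rightarrow> 'a::euclidean_space"
 assumes c[measurable]: "c \<in> Bor"
 shows "distr lborel borel (\<lambda>z. (fst z + c (snd z), snd z)) = lborel"
proof (rule measure_eqI)
 fix A assume "A \<in> sets (distr lborel borel (\<lambda>z. (fst z + c (snd z), snd z)))"
 then have [measurable]: "A \<in> sets borel" by simp
 have "emeasure (distr lborel borel (\<lambda>z. (fst z + c (snd z), snd z))) A = (\<integral>\<^sup>+z. indicator A z \<partial>distr lborel borel (\<lambda>z. (fst z + c (snd z), snd z)))"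
  by simp
 also have "\<dots> = (NINT z. indicator A (fst z + c (snd z), snd z))"
  by (rule nn_integral_distr) measurable
 also have "\<dots> = (NINT z. indicator A z)" by (rule nn_integral_shear) auto
 finally show "emeasure (distr lborel borel (\<lambda>z. (fst z + c (snd z), snd z))) A = emeasure lborel A" by simp
qed simp

lemma integral_shear:
 fixes f :: "'a::euclidean_space \<times> 'b::euclidean_space \<Rightarrow> real" and c :: "'b \<Rightarrow> 'a"
 assumes f[measurable]: "f \<in> Bor" and c[measurable]: "c \<in> Bor"
 shows "(LBINT z. f (fst z + c (snd z), snd z)) = (LBINT z. f z)"
  and "lintegrable (\<lambda>z. f (fst z + c (snd z), snd z)) \<longleftrightarrow> lintegrable f"
proof -
 have m: "(\<lambda>z. (fst z + c (snd z), snd z)) \<in> BorL" by measurable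
 show "(LBINT z. f (fst z + c (snd z), snd z)) = (LBINT z. f z)"
  using integral_distr[OF m f] by (simp only: lborel_distr_shear[OF c])
 show "lintegrable (\<lambda>z. f (fst z + c (snd z), snd z)) \<longleftrightarrow> lintegrable f"
  using integrable_distr_eq[OF m f] by (simp only: lborel_distr_shear[OF c])
qed

text \<open>The derivative of \<open>g\<close> is replaced by difference quotients, which are moved to \<open>v\<close>.\<close>

lemma transport_term_bound:
 fixes v :: "'a::euclidean_space \<Rightarrow> real" and a :: "real \<Rightarrow> 'a"
 assumes v: "lintegrable v" and K: "AEL x. \<bar>v x\<bar> \<le> K"
  and V: "0 \<le> V" "\<And>y. (LBINT x. \<bar>v (x + y) - v x\<bar>) \<le> norm y * V"
  and a: "locally_bounded a" and S: "0 \<le> S" "AEL \<xi>. \<bar>\<xi>\<bar> \<le> K \<longrightarrow> norm (a \<xi>) \<le> S"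
  and \<psi>: "test_function UNIV \<psi>" "\<And>\<xi>. \<bar>\<psi> \<xi>\<bar> \<le> 1"
  and g: "test_function UNIV g" "\<And>x. \<bar>g x\<bar> \<le> 1"
 shows "\<bar>LBINT z. kp v z * (\<psi> (snd z) * Fd g (fst z) (a (snd z)))\<bar>
  \<le> 2 ^ (DIM('a) + 2) * S * V"
proof -
 have sm: "smooth_fun g" "smooth_fun \<psi>" using g \<psi> test_function_smooth by auto
 have [measurable]: "v \<in> Bor" "a \<in> Bor" "g \<in> Bor" "\<psi> \<in> Bor"
  using v a sm smooth_fun_borel by (auto simp: locally_bounded_def)
 have kv: "lintegrable (\<lambda>z. kp v z)" by (rule kchi_prod_L1(3)[OF v v])
 obtain Lg where Lg: "Lg > 0" "\<And>x y. \<bar>g y - g x\<bar> \<le> Lg * norm (y - x)"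
  by (rule test_function_lipschitz[OF g(1)]) blast
 obtain R where R: "R > 0" "\<And>\<xi>. norm \<xi> > R \<Longrightarrow> \<psi> \<xi> = 0"
  using test_function_bounds[OF \<psi>(1)] by metis
 obtain L where L: "\<And>\<xi>. \<bar>\<xi>\<bar> \<le> R \<Longrightarrow> norm (a \<xi>) \<le> L" using a unfolding locally_bounded_def by blast
 have L0: "0 \<le> L" using L[of 0] R(1) norm_ge_zero[of "a 0"] by linarith
 define m where "m n = real (Suc n)" for n
 have m: "m n > 0" for n by (simp add: m_def)
 define X where "X n z = kp v z * (\<psi> (snd z) * (m n * (g (fst z + inverse (m n) *\<^sub>R a (snd z)) - g (fst z))))" for n z
 have "(\<lambda>n. LBINT z. X n z) \<longlonglongrightarrow> (LBINT z. kp v z * (\<psi> (snd z) * Fd g (fst z) (a (snd z))))"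
 proof (rule integral_dominated_convergence[where w="\<lambda>z. \<bar>kp v z\<bar> * (Lg * L)"])
  show "lintegrable (\<lambda>z. \<bar>kp v z\<bar> * (Lg * L))" using kv by simp
  show "(\<lambda>z. kp v z * (\<psi> (snd z) * Fd g (fst z) (a (snd z)))) \<in> BorL"
   by (intro borel_measurable_times borel_measurable_frechet_smooth sm) measurable
  show "X n \<in> BorL" for n unfolding X_def[abs_def] by measurable
  show "AEL z. (\<lambda>n. X n z) \<longlonglongrightarrow> kp v z * (\<psi> (snd z) * Fd g (fst z) (a (snd z)))"
   unfolding X_def m_def by (intro AE_I2 tendsto_mult tendsto_const smooth_fun_difference_quotient[OF sm(1)])
  show "AEL z. norm (X n z) \<le> \<bar>kp v z\<bar> * (Lg * L)" for n
  proof (rule AE_I2)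
   fix z :: "'a \<times> real"
   have "\<bar>\<psi> (snd z) * (m n * (g (fst z + inverse (m n) *\<^sub>R a (snd z)) - g (fst z)))\<bar> \<le> Lg * L"
   proof (cases "\<bar>snd z\<bar> \<le> R")
    case True
    have "\<bar>m n * (g (fst z + inverse (m n) *\<^sub>R a (snd z)) - g (fst z))\<bar> = m n * \<bar>g (fst z + inverse (m n) *\<^sub>R a (snd z)) - g (fst z)\<bar>"
     using m[of n] by (simp add: abs_mult)
    also have "\<dots> \<le> m n * (Lg * norm (fst z + inverse (m n) *\<^sub>R a (snd z) - fst z))"
     using m[of n] by (intro mult_left_mono Lg) auto
    also have "\<dots> = Lg * norm (a (snd z))" using m[of n] by simp
    also have "\<dots> \<le> Lg * L" using Lg(1) L[OF True] by (intro mult_left_mono) auto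
    finally have "\<bar>\<psi> (snd z)\<bar> * \<bar>m n * (g (fst z + inverse (m n) *\<^sub>R a (snd z)) - g (fst z))\<bar> \<le> 1 * (Lg * L)"
     by (intro mult_mono \<psi>) auto
    then show ?thesis by (simp add: abs_mult)
   next
    case False
    then show ?thesis using R(2)[of "snd z"] Lg(1) L0 by simp
   qed
   then show "norm (X n z) \<le> \<bar>kp v z\<bar> * (Lg * L)"
    unfolding X_def real_norm_def abs_mult[of "kchi _ _"] by (rule mult_left_mono) simp
  qed
 qed
 moreover have "\<bar>LBINT z. X n z\<bar> \<le> 2 ^ (DIM('a) + 2) * S * V" for n
 proof -
  \<comment> \<open>Moving the shift from g to v reverses its direction. The bound S / m n on its
    length cancels the factor m n of the difference quotient.\<close>
  define c where "c \<xi> = - (inverse (m n) *\<^sub>R a \<xi>)" for \<xi>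
  have [measurable]: "c \<in> Bor" unfolding c_def[abs_def] by measurable
  define Y where "Y z = kp v z * (\<psi> (snd z) * g (fst z - c (snd z)))" for z
  define Y' where "Y' z = kchi (snd z) (v (fst z + c (snd z))) * (\<psi> (snd z) * g (fst z))" for z
  define Y0 where "Y0 z = kp v z * (\<psi> (snd z) * g (fst z))" for z
  have [measurable]: "Y \<in> Bor" unfolding Y_def[abs_def] by measurable
  have pg: "\<bar>\<psi> \<xi> * g x\<bar> \<le> 1" for \<xi> x using mult_mono[OF \<psi>(2)[of \<xi>] g(2)[of x]] by (simp add: abs_mult)
  have iY: "lintegrable Y" "lintegrable Y0"
   unfolding Y_def[abs_def] Y0_def[abs_def] by (rule integrable_mult_bounded[OF kv _ pg], measurable)+
  have YY': "Y' z = Y (fst z + c (snd z), snd z)" for z by (simp add: Y_def Y'_def)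
  have iY': "lintegrable Y'" using integral_shear(2)[of Y c] iY ext[of Y' "\<lambda>z. Y (fst z + c (snd z), snd z)", OF YY'] by simp
  have bound: "(NINT z. nabs (kchi (snd z) (v (fst z + c (snd z))) - kp v z)) \<le>
   ennreal (2 ^ (DIM('a) + 2) * (S / m n) * V)"
   unfolding nn_integral_shift_prod[OF \<open>v \<in> Bor\<close> \<open>c \<in> Bor\<close>]
  proof (rule averaged_shift_bound[OF v K V])
   show "0 \<le> S / m n" using S m[of n] by simp
   show "AEL \<xi>. \<bar>\<xi>\<bar> \<le> K \<longrightarrow> norm (c \<xi>) \<le> S / m n"
    using S(2) by eventually_elim (use m[of n] in \<open>auto simp: c_def divide_inverse mult.commute intro: mult_left_mono\<close>)
  qed measurable
  have "(LBINT z. X n z) = (LBINT z. m n * (Y z - Y0 z))"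
   by (intro LBINT_cong) (auto simp: X_def Y_def Y0_def c_def algebra_simps)
  also have "\<dots> = m n * ((LBINT z. Y z) - (LBINT z. Y0 z))" using iY by simp
  also have "(LBINT z. Y z) = (LBINT z. Y' z)" using integral_shear(1)[of Y c] by (simp add: YY')
  also have "(LBINT z. Y' z) - (LBINT z. Y0 z) = (LBINT z. Y' z - Y0 z)" using iY iY' by simp
  finally have eq: "(LBINT z. X n z) = m n * (LBINT z. Y' z - Y0 z)" .
  have "nabs (LBINT z. Y' z - Y0 z) \<le> (NINT z. nabs (Y' z - Y0 z))"
   using integral_norm_bound_ennreal[of lborel "\<lambda>z. Y' z - Y0 z"] iY iY' by simp
  also have "\<dots> \<le> (NINT z. nabs (kchi (snd z) (v (fst z + c (snd z))) - kp v z))"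
  proof (intro nn_integral_mono ennreal_leI)
   fix z :: "'a \<times> real"
   have "Y' z - Y0 z = (kchi (snd z) (v (fst z + c (snd z))) - kp v z) * (\<psi> (snd z) * g (fst z))"
    by (simp add: Y'_def Y0_def algebra_simps)
   then show "\<bar>Y' z - Y0 z\<bar> \<le> \<bar>kchi (snd z) (v (fst z + c (snd z))) - kp v z\<bar>"
    using mult_left_mono[OF pg[of "snd z" "fst z"] abs_ge_zero[of "kchi (snd z) (v (fst z + c (snd z))) - kp v z"]]
    by (simp add: abs_mult)
  qed
  finally have "nabs (LBINT z. Y' z - Y0 z) \<le> ennreal (2 ^ (DIM('a) + 2) * (S / m n) * V)"
   using bound by (rule order_trans)
  then have "\<bar>LBINT z. Y' z - Y0 z\<bar> \<le> 2 ^ (DIM('a) + 2) * (S / m n) * V"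
   using S V m[of n] by (subst (asm) ennreal_le_iff) auto
  then have "m n * \<bar>LBINT z. Y' z - Y0 z\<bar> \<le> m n * (2 ^ (DIM('a) + 2) * (S / m n) * V)"
   using m[of n] by (intro mult_left_mono) auto
  then show ?thesis unfolding eq using m[of n] by (simp add: abs_mult)
 qed
 ultimately show ?thesis
  by (intro LIMSEQ_le_const2[OF tendsto_rabs]) auto
qed

text \<open>By duality it suffices to test with \<theta>(t) g(x) and a cutoff in \<xi>. The
  transport term is controlled by \<open>transport_term_bound\<close>, and the measure contributes
  nothing: as |u| \<le> K, the left-hand side is the same for all wide cutoffs, while the measure
  term tends to 0 as the cutoff widens.\<close>

theorem kinetic_time_lipschitz:
 fixes a :: "real \<Rightarrow> 'b::euclidean_space"
 assumes a: "locally_bounded a"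
  and U: "slab_flow T U" and kin: "weak_kinetic ({0<..<T} \<times> UNIV) (\<lambda>\<xi>. (1, a \<xi>)) U \<mu>"
  and K: "\<And>t. t \<in> {0..T} \<Longrightarrow> AEL x. \<bar>U (t, x)\<bar> \<le> K" "0 \<le> K"
  and V: "0 \<le> V" "\<And>t y. t \<in> {0..T} \<Longrightarrow> (LBINT x. \<bar>U (t, x + y) - U (t, x)\<bar>) \<le> norm y * V"
  and S: "0 \<le> S" "AEL \<xi>. \<bar>\<xi>\<bar> \<le> K \<longrightarrow> norm (a \<xi>) \<le> S"
  and st: "0 \<le> s" "s \<le> t" "t \<le> T"
 shows "(LBINT x. \<bar>U (t, x) - U (s, x)\<bar>) \<le> 2 ^ (DIM('b) + 2) * S * V * (t - s)"
proof (rule L1_norm_duality)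
 note iU = slab_flow_integrable[OF U]
 have [measurable]: "U \<in> Bor" using U by (simp add: slab_flow_def)
 have Uout: "U (t, x) = 0" if "t \<notin> {0..T}" for t x using U that by (auto simp: slab_flow_def)
 show "lintegrable (\<lambda>x. U (t, x) - U (s, x))" using iU by simp
 define B where "B = 2 ^ (DIM('b) + 2) * S * V"
 have B0: "0 \<le> B" using S V by (simp add: B_def)
 fix g :: "'b \<Rightarrow> real" assume g: "test_function UNIV g" "\<And>x. \<bar>g x\<bar> \<le> 1"
 have smg: "smooth_fun g" by (rule test_function_smooth[OF g(1)])
 have [measurable]: "g \<in> Bor" by (rule smooth_fun_borel[OF smg])
 define J where "J r = (LBINT x. U (r, x) * g x)" for r
 have iJ: "lintegrable (\<lambda>x. U (r, x) * g x)" for r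
  by (rule integrable_mult_bounded[OF iU(2) _ g(2)]) measurable
 have J_diff: "J r - J r' = (LBINT x. (U (r, x) - U (r', x)) * g x)" for r r'
  unfolding J_def using iJ by (simp add: left_diff_distrib)
 have "J t - J s \<le> B * (t - s)"
 proof (rule weak_derivative_bound[OF _ B0 _ st])
  show "continuous_on {0..T} J"
  proof (rule L1_norm_continuous[where C=1 and g="\<lambda>t x. U (t, x)" and M=lborel])
   fix r r'
   have "\<bar>J r - J r'\<bar> \<le> (LBINT x. \<bar>(U (r, x) - U (r', x)) * g x\<bar>)"
    unfolding J_diff by (rule integral_abs_bound)
   also have "\<dots> \<le> (LBINT x. \<bar>U (r, x) - U (r', x)\<bar>)"
   proof (rule integral_mono)
    show "lintegrable (\<lambda>x. \<bar>(U (r, x) - U (r', x)) * g x\<bar>)"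
     using iJ by (simp add: left_diff_distrib)
    show "\<bar>(U (r, x) - U (r', x)) * g x\<bar> \<le> \<bar>U (r, x) - U (r', x)\<bar>" for x
     using mult_left_mono[OF g(2)[of x] abs_ge_zero[of "U (r, x) - U (r', x)"]] by (simp add: abs_mult)
   qed (use iU in auto)
   finally show "\<bar>J r - J r'\<bar> \<le> 1 * (LBINT x. \<bar>U (r, x) - U (r', x)\<bar>)" by simp
  qed (use U in \<open>auto simp: slab_flow_def\<close>)
  fix \<theta> assume \<theta>: "test_function {0<..<T} \<theta>" "\<And>t. 0 \<le> \<theta> t"
  have sm\<theta>: "smooth_fun \<theta>" by (rule test_function_smooth[OF \<theta>(1)])
  have [measurable]: "\<theta> \<in> Bor" "deriv \<theta> \<in> Bor"
   using smooth_fun_borel[OF sm\<theta>] smooth_fun_borel[OF smooth_fun_deriv[OF sm\<theta>]] by auto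
  obtain C where C: "C > 0" "\<And>t. \<bar>\<theta> t\<bar> \<le> C" "\<And>t. \<bar>deriv \<theta> t\<bar> \<le> C" using test_function_deriv_bound[OF \<theta>(1)] by metis
  obtain C1 where C1: "C1 > 0" "\<And>R (x::real) v. R > 0 \<Longrightarrow> \<bar>Fd (cutoff R) x v\<bar> \<le> C1 / R * norm v"
   by (rule cutoff_derivative_bound[where 'a=real]) blast
  define \<Psi> :: "nat \<Rightarrow> real \<Rightarrow> real" where "\<Psi> n = cutoff (real (Suc n))" for n
  have \<Psi>: "test_function UNIV (\<Psi> n)" "\<bar>\<Psi> n \<xi>\<bar> \<le> 1" for n \<xi>
   unfolding \<Psi>_def using cutoff_nonneg[of "real (Suc n)" \<xi>] cutoff_le_1[of "real (Suc n)" \<xi>]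
   by (auto intro!: test_function_cutoff)
  have d\<Psi>: "\<bar>deriv (\<Psi> n) \<xi>\<bar> \<le> C1 * inverse (real (Suc n))" for n \<xi>
   using C1(2)[of "real (Suc n)" \<xi> 1] smooth_fun_real_frechet[OF test_function_smooth[OF \<Psi>(1)], of n \<xi> 1]
   by (simp add: \<Psi>_def divide_inverse)
  define \<Theta> where "\<Theta> q = \<theta> (fst q) * g (snd q)" for q
  have \<Theta>: "test_function ({0<..<T} \<times> UNIV) \<Theta>" unfolding \<Theta>_def[abs_def] by (rule test_function_tensor[OF \<theta>(1) g(1)])
  have [measurable]: "\<Theta> \<in> Bor" by (rule smooth_fun_borel[OF test_function_smooth[OF \<Theta>]])
  have fin: "finite_measure \<mu>" and sets: "sets \<mu> = sets borel" using kin by (auto simp: weak_kinetic_def)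
  note [measurable_cong] = sets
  define I where "I n = (LBINT p. kp U p * flux (\<lambda>\<xi>. (1, a \<xi>)) (\<Psi> n) \<Theta> p)" for n
  have I_small: "\<bar>I n\<bar> \<le> C * (C1 * measure \<mu> (space \<mu>)) * inverse (real (Suc n))" for n
  proof -
   have [measurable]: "deriv (\<Psi> n) \<in> Bor"
    by (rule smooth_fun_borel[OF smooth_fun_deriv[OF test_function_smooth[OF \<Psi>(1)]]])
   have "I n = (LINT p|\<mu>. \<Theta> (fst p) * deriv (\<Psi> n) (snd p))"
    using kin \<Theta> \<Psi>(1) unfolding I_def weak_kinetic_def by blast
   also have "\<bar>\<dots>\<bar> \<le> (LINT p|\<mu>. \<bar>\<Theta> (fst p) * deriv (\<Psi> n) (snd p)\<bar>)" by (rule integral_abs_bound)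
   also have "\<dots> \<le> (LINT p|\<mu>. C * (C1 * inverse (real (Suc n))))"
   proof (rule integral_mono)
    have le: "\<bar>\<Theta> (fst p) * deriv (\<Psi> n) (snd p)\<bar> \<le> C * (C1 * inverse (real (Suc n)))" for p
    proof -
     have "\<bar>\<Theta> (fst p)\<bar> \<le> C * 1" unfolding \<Theta>_def abs_mult by (intro mult_mono C g) (use C in auto)
     then show ?thesis unfolding abs_mult by (intro mult_mono d\<Psi>) (use C in auto)
    qed
    then show "\<And>p. \<bar>\<Theta> (fst p) * deriv (\<Psi> n) (snd p)\<bar> \<le> C * (C1 * inverse (real (Suc n)))" .
    show "integrable \<mu> (\<lambda>p. \<bar>\<Theta> (fst p) * deriv (\<Psi> n) (snd p)\<bar>)"
     by (intro integrable_abs integrable_finite_measure_bounded[OF fin _ le]) measurable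
    show "integrable \<mu> (\<lambda>p. C * (C1 * inverse (real (Suc n))))"
     using fin by (simp add: finite_measure.integrable_const)
   qed
   also have "\<dots> = C * (C1 * measure \<mu> (space \<mu>)) * inverse (real (Suc n))" by (simp add: mult_ac)
   finally show ?thesis .
  qed
  obtain N where N: "K \<le> real N" using real_arch_simple by blast
  have AEU: "AEL q. \<bar>U q\<bar> \<le> K"
  proof (rule AE_lborel_pairI)
   have "{q \<in> space borel. \<bar>U q\<bar> \<le> K} \<in> sets borel" by measurable
   then show "{q. \<bar>U q\<bar> \<le> K} \<in> sets borel" by simp
   show "AEL t. AEL x. \<bar>U (t, x)\<bar> \<le> K"
   proof (rule AE_I2)
    fix t
    show "AEL x. \<bar>U (t, x)\<bar> \<le> K"
    proof (cases "t \<in> {0..T}")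
     case True
     then show ?thesis by (rule K(1))
    next
     case False
     then show ?thesis using K(2) by (simp add: Uout)
    qed
   qed
  qed
  have AEU': "AE p :: (real \<times> 'b) \<times> real in lborel. \<bar>U (fst p)\<bar> \<le> K"
  proof (rule AE_lborel_pairI)
   have "{p \<in> space borel. \<bar>U (fst p)\<bar> \<le> K} \<in> sets (borel :: ((real \<times> 'b) \<times> real) measure)" by measurable
   then show "{p. \<bar>U (fst p)\<bar> \<le> K} \<in> sets (borel :: ((real \<times> 'b) \<times> real) measure)" by simp
   show "AEL q. AEL \<xi>. \<bar>U (fst (q, \<xi> :: real))\<bar> \<le> K" using AEU by eventually_elim simp
  qed
  have k\<Psi>: "kchi \<xi> u * \<Psi> n \<xi> = kchi \<xi> u" if "\<bar>u\<bar> \<le> K" "N \<le> n" for \<xi> u n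
  proof (cases "\<bar>\<xi>\<bar> \<le> real (Suc n)")
   case True
   then have "\<Psi> n \<xi> = 1" unfolding \<Psi>_def by (intro cutoff_eq_1) auto
   then show ?thesis by simp
  next
   case False
   then have "\<bar>u\<bar> < \<bar>\<xi>\<bar>" using that N by simp
   then have "kchi \<xi> u = 0" by (auto simp: kchi_def step_def)
   then show ?thesis by simp
  qed
  have lb: "locally_bounded (\<lambda>\<xi>. (1::real, a \<xi>))" by (rule locally_bounded_Pair[OF a])
  have km[measurable]: "(\<lambda>p. kp U p) \<in> borel_measurable (borel :: ((real \<times> 'b) \<times> real) measure)" by measurable
  have I_const: "I n = I N" if n: "N \<le> n" for n
   unfolding I_def
  proof (rule integral_cong_AE)
   show "(\<lambda>p. kp U p * flux (\<lambda>\<xi>. (1, a \<xi>)) (\<Psi> k) \<Theta> p) \<in> BorL" for k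
    by (intro borel_measurable_times flux_borel lb test_function_smooth[OF \<Psi>(1)] test_function_smooth[OF \<Theta>]) measurable
   then show "(\<lambda>p. kp U p * flux (\<lambda>\<xi>. (1, a \<xi>)) (\<Psi> N) \<Theta> p) \<in> BorL" .
   show "AEL p. kp U p * flux (\<lambda>\<xi>. (1, a \<xi>)) (\<Psi> n) \<Theta> p = kp U p * flux (\<lambda>\<xi>. (1, a \<xi>)) (\<Psi> N) \<Theta> p"
    using AEU' by eventually_elim (simp add: flux_def mult.assoc[symmetric] k\<Psi> n)
  qed
  have "I N = 0"
  proof -
   have "(\<lambda>n. C * (C1 * measure \<mu> (space \<mu>)) * inverse (real (Suc n))) \<longlonglongrightarrow> 0"
    by (rule tendsto_mult_right_zero[OF LIMSEQ_inverse_real_of_nat])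
   then have "\<bar>I N\<bar> \<le> 0"
   proof (rule LIMSEQ_le_const)
    show "\<exists>M. \<forall>n\<ge>M. \<bar>I N\<bar> \<le> C * (C1 * measure \<mu> (space \<mu>)) * inverse (real (Suc n))"
     using I_small I_const by (intro exI[of _ N]) metis
   qed
   then show ?thesis by simp
  qed
  define Z where "Z p = kp U p * \<Psi> N (snd p)" for p
  have kU: "lintegrable (\<lambda>p. kp U p)" by (rule kchi_prod_L1(3)[OF iU(1) iU(1)])
  have [measurable]: "\<Psi> N \<in> Bor" by (rule smooth_fun_borel[OF test_function_smooth[OF \<Psi>(1)]])
  have Z: "lintegrable Z" unfolding Z_def[abs_def] by (rule integrable_mult_bounded[OF kU _ \<Psi>(2)]) measurable
  \<comment> \<open>\<open>P1\<close> carries the derivative of the test function in space,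
    \<open>P2\<close> the one in time; the latter integrates to the pairing of \<open>J\<close> with
    the derivative of \<theta>.\<close>
  define P1 where "P1 p = kp U p * (\<theta> (fst (fst p)) * (\<Psi> N (snd p) * Fd g (snd (fst p)) (a (snd p))))" for p
  define P2 where "P2 p = Z p * g (snd (fst p)) * deriv \<theta> (fst (fst p))" for p
  have gd: "\<bar>g x * deriv \<theta> t\<bar> \<le> C" for x t using mult_mono[OF g(2)[of x] C(3)[of t]] by (simp add: abs_mult)
  have iP2: "lintegrable P2"
   using integrable_mult_bounded[OF Z _ gd, of "\<lambda>p. snd (fst p)" "\<lambda>p. fst (fst p)"] unfolding P2_def[abs_def] by (simp add: mult.assoc)
  have split: "kp U p * flux (\<lambda>\<xi>. (1, a \<xi>)) (\<Psi> N) \<Theta> p = P1 p + P2 p" for p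
   unfolding \<Theta>_def[abs_def] flux_tensor[OF sm\<theta> smg] P1_def P2_def Z_def by (simp add: algebra_simps)
  have iI: "lintegrable (\<lambda>p. P1 p + P2 p)"
   unfolding split[symmetric] by (rule integrable_flux[OF lb \<Psi>(1) \<Theta>, of _ 1]) (measurable, simp add: abs_kchi_le)
  have iP1: "lintegrable P1" using Bochner_Integration.integrable_diff[OF iI iP2] by simp
  have sum0: "(LBINT p. P1 p) + (LBINT p. P2 p) = 0"
   using \<open>I N = 0\<close> iP1 iP2 unfolding I_def split by simp
  have P2eq: "(LBINT p. P2 p) = (LBINT t. deriv \<theta> t * J t)"
  proof -
   have iZg: "lintegrable (\<lambda>p. Z p * g (snd (fst p)))" by (rule integrable_mult_bounded[OF Z _ g(2)]) measurable
   have "(LBINT p. P2 p) = (LBINT t. deriv \<theta> t * (LBINT x. (LBINT \<xi>. Z ((t, x), \<xi>)) * g x))"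
    using integral_time_weight[OF iZg \<theta>(1), of "\<lambda>q. (LBINT \<xi>. Z (q, \<xi>)) * g (snd q)"] unfolding P2_def by simp
   also have "\<dots> = (LBINT t. deriv \<theta> t * J t)"
   proof (intro LBINT_cong refl arg_cong[of _ _ "\<lambda>x. _ * x"])
    fix t
    show "(LBINT x. (LBINT \<xi>. Z ((t, x), \<xi>)) * g x) = J t"
     unfolding J_def
    proof (rule integral_cong_AE)
     have "(\<lambda>p. LBINT \<xi>. Z ((t, p), \<xi>)) \<in> Bor"
      unfolding Z_def by (rule lborel.borel_measurable_lebesgue_integral) measurable
     then show "(\<lambda>x. (LBINT \<xi>. Z ((t, x), \<xi>)) * g x) \<in> BorL" by simp
     have "AEL x. \<bar>U (t, x)\<bar> \<le> K"
     proof (cases "t \<in> {0..T}")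
      case True
      then show ?thesis by (rule K(1))
     next
      case False
      then show ?thesis using K(2) by (simp add: Uout)
     qed
     then show "AEL x. (LBINT \<xi>. Z ((t, x), \<xi>)) * g x = U (t, x) * g x"
      by eventually_elim (simp add: Z_def k\<Psi> integral_kchi)
    qed measurable
   qed
   finally show ?thesis .
  qed
  have P1eq: "\<bar>LBINT p. P1 p\<bar> \<le> B * (LBINT t. \<theta> t)"
  proof -
   define F where "F z = P1 ((fst z, fst (snd z)), snd (snd z))" for z
   have Fm: "F \<in> Bor"
   proof -
    have "P1 \<in> Bor" using iP1 by auto
    then show ?thesis unfolding F_def[abs_def]
     by (rule measurable_compose[OF borel_measurable_continuous_onI, rotated]) (intro continuous_intros)
   qed
   have FP: "F (fst (fst p), snd (fst p), snd p) = P1 p" for p by (simp add: F_def)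
   have iF: "lintegrable F" and eqF: "(LBINT p. P1 p) = (LBINT z. F z)"
    using integral_lborel_assoc[OF Fm] iP1 by (simp_all add: FP)
   have inner: "\<bar>LBINT z. F (t, z)\<bar> \<le> B * \<theta> t" for t
   proof (cases "t \<in> {0..T}")
    case True
    have "(LBINT z. F (t, z)) = (LBINT z. \<theta> t * (kchi (snd z) (U (t, fst z)) * (\<Psi> N (snd z) * Fd g (fst z) (a (snd z)))))"
     by (intro LBINT_cong) (auto simp: F_def P1_def)
    also have "\<dots> = \<theta> t * (LBINT z. kchi (snd z) (U (t, fst z)) * (\<Psi> N (snd z) * Fd g (fst z) (a (snd z))))"
     by (rule integral_mult_right_zero)
    also have "\<bar>\<dots>\<bar> \<le> \<theta> t * B"
     unfolding abs_mult abs_of_nonneg[OF \<theta>(2)] B_def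
     by (intro mult_left_mono transport_term_bound[OF iU(2) K(1)[OF True] V(1) V(2)[OF True] a S \<Psi> g] \<theta>(2))
    finally show ?thesis by (simp add: mult.commute)
   next
    case False
    then have "F (t, z) = 0" for z using Uout[OF False] by (simp add: F_def P1_def)
    then show ?thesis using B0 \<theta>(2)[of t] by simp
   qed
   have "\<bar>LBINT z. F z\<bar> = \<bar>LBINT t. LBINT z. F (t, z)\<bar>"
    using lborel_integral_prod_fst[OF iF] by simp
   also have "\<dots> \<le> (LBINT t. \<bar>LBINT z. F (t, z)\<bar>)" by (rule integral_abs_bound)
   also have "\<dots> \<le> (LBINT t. B * \<theta> t)"
    by (rule integral_mono) (use inner lborel_integrable_fst[OF iF] integrable_test_function[OF \<theta>(1)] in auto)
   finally show ?thesis using eqF by simp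
  qed
  show "- B * (LBINT t. \<theta> t) \<le> (LBINT t. deriv \<theta> t * J t)"
   using sum0 P1eq P2eq by (simp add: abs_le_iff)
 qed
 then show "(LBINT x. (U (t, x) - U (s, x)) * g x) \<le> 2 ^ (DIM('b) + 2) * S * V * (t - s)"
  unfolding J_diff B_def .
qed

subsection \<open>Transport along characteristics\<close>

lemma test_function_convolve_continuous:
 fixes f :: "'a::euclidean_space \<Rightarrow> real"
 assumes "lintegrable f" "test_function UNIV \<phi>"
 shows "continuous_on UNIV (convolve f \<phi>)"
 by (rule smooth_fun_continuous_on[OF smooth_fun_convolve[OF assms]])

lemma integral_segment_convolve:
 fixes f :: "'a::euclidean_space \<Rightarrow> real" and b :: 'a
 assumes f: "lintegrable f" and \<phi>: "test_function UNIV \<phi>" and \<tau>: "0 \<le> \<tau>"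
 shows "(LBINT s. convolve f (\<lambda>x. Fd \<phi> x b) (p + s *\<^sub>R b) * indicator {0..\<tau>} s) =
  convolve f \<phi> (p + \<tau> *\<^sub>R b) - convolve f \<phi> p"
proof -
 let ?g = "convolve f (\<lambda>x. Fd \<phi> x b)"
 have der: "((\<lambda>s. convolve f \<phi> (p + s *\<^sub>R b)) has_real_derivative ?g (p + s *\<^sub>R b)) (at s)" for s
 proof -
  have "((\<lambda>s. convolve f \<phi> (p + s *\<^sub>R b)) has_derivative (\<lambda>t. convolve f (\<lambda>x. Fd \<phi> x (t *\<^sub>R b)) (p + s *\<^sub>R b))) (at s)"
   by (rule has_derivative_compose[where f="\<lambda>s. p + s *\<^sub>R b", OF _ convolve_has_derivative[OF f \<phi>]])
    (auto intro!: derivative_eq_intros)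
  moreover have "(\<lambda>t. convolve f (\<lambda>x. Fd \<phi> x (t *\<^sub>R b)) (p + s *\<^sub>R b)) = (*) (?g (p + s *\<^sub>R b))"
  proof
   fix t
   show "convolve f (\<lambda>x. Fd \<phi> x (t *\<^sub>R b)) (p + s *\<^sub>R b) = ?g (p + s *\<^sub>R b) * t"
    unfolding convolve_def
    by (simp add: linear_scale[OF bounded_linear.linear[OF smooth_fun_linear[OF test_function_smooth[OF \<phi>]]]] mult.left_commute mult.commute)
  qed
  ultimately show ?thesis by (simp add: has_field_derivative_def)
 qed
 have cont: "continuous_on UNIV (\<lambda>s. ?g (p + s *\<^sub>R b))"
  by (rule continuous_on_compose2[OF test_function_convolve_continuous[OF f test_function_derivative[OF \<phi>]]])
   (auto intro!: continuous_intros)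
 have "has_bochner_integral lborel (\<lambda>s. ?g (p + s *\<^sub>R b) * indicator {0..\<tau>} s) (convolve f \<phi> (p + \<tau> *\<^sub>R b) - convolve f \<phi> (p + 0 *\<^sub>R b))"
  by (rule has_bochner_integral_FTC_Icc_real[OF \<tau> der]) (use cont in \<open>auto simp: continuous_on_eq_continuous_at\<close>)
 then show ?thesis by (simp add: has_bochner_integral_iff)
qed

lemma integrable_convolve_mollifier:
 fixes f :: "'a::euclidean_space \<Rightarrow> real"
 assumes f: "lintegrable f" and e: "e > 0"
 shows "(NINT p. nabs (convolve f (mollifier e) p)) < \<infinity>" and "lintegrable (convolve f (mollifier e))"
proof -
 note [measurable] = mollifier_borel[OF e]
 have [measurable]: "f \<in> Bor" using f by auto
 have "(NINT p. nabs (convolve f (mollifier e) p)) \<le> (NINT p. NINT q. nabs (f q * mollifier e (p - q)))"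
 proof (rule nn_integral_mono)
  fix p
  obtain C where C: "\<And>x::'a. \<bar>mollifier e x\<bar> \<le> C" using test_function_bounds[OF test_function_mollifier[OF e]] by metis
  have "lintegrable (\<lambda>q. f q * mollifier e (p - q))" by (rule integrable_mult_bounded[OF f _ C]) measurable
  from integral_norm_bound_ennreal[OF this]
  show "nabs (convolve f (mollifier e) p) \<le> (NINT q. nabs (f q * mollifier e (p - q)))"
   unfolding convolve_def by simp
 qed
 also have "\<dots> = (NINT q. NINT p. nabs (f q * mollifier e (p - q)))"
  by (rule lborel_pair.Fubini'[symmetric]) measurable
 also have "\<dots> = (NINT q. nabs (f q))"
 proof (rule nn_integral_cong)
  fix q
  have "(NINT p. nabs (f q * mollifier e (p - q))) = (NINT p. nabs (f q) * ennreal (mollifier e (p + - q)))"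
   by (intro nn_integral_cong) (simp add: abs_mult ennreal_mult mollifier_nonneg[OF e])
  also have "\<dots> = nabs (f q) * (NINT p. ennreal (mollifier e (p + - q)))" by (rule nn_integral_cmult) measurable
  also have "(NINT p. ennreal (mollifier e (p + - q))) = 1"
   using nn_integral_shift[of "\<lambda>p. ennreal (mollifier e p)" "- q"] nn_integral_mollifier[OF e, where 'a='a] by simp
  finally show "(NINT p. nabs (f q * mollifier e (p - q))) = nabs (f q)" by simp
 qed
 also have "\<dots> < \<infinity>" using f by (auto simp: integrable_iff_bounded)
 finally show *: "(NINT p. nabs (convolve f (mollifier e) p)) < \<infinity>" .
 have "convolve f (mollifier e) \<in> BorL" by measurable
 from integrableI_nn_abs[OF this *] show "lintegrable (convolve f (mollifier e))" .
qed

text \<open>The identity is known pointwise for mollifications. Integrals over segments of time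
  \<tau> are bounded in L^1 by \<tau> times the norm, so it survives the L^1 limit. The index
  \<open>m\<close> delays the hypothesis until the mollifiers fit into the domain around points of
  \<open>A\<close>.\<close>

lemma segment_identity_L1:
 fixes f g :: "'a::euclidean_space \<Rightarrow> real" and b :: 'a
 assumes f: "lintegrable f" and g: "lintegrable g" and \<tau>: "0 \<le> \<tau>"
  and moll: "\<And>n p. m \<le> n \<Longrightarrow> p \<in> A \<Longrightarrow> convolve f (mollifier (inverse (real (Suc n)))) (p + \<tau> *\<^sub>R b) - convolve f (mollifier (inverse (real (Suc n)))) p =
   (LBINT s. convolve g (mollifier (inverse (real (Suc n)))) (p + s *\<^sub>R b) * indicator {0..\<tau>} s)"
 shows "AEL p. p \<in> A \<longrightarrow> f (p + \<tau> *\<^sub>R b) - f p = (LBINT s. g (p + s *\<^sub>R b) * indicator {0..\<tau>} s)"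
proof -
 have [measurable]: "f \<in> Bor" "g \<in> Bor" using f g by auto
 have nn_seg: "(NINT p. NINT s. nabs (k (p + s *\<^sub>R b)) * indicator {0..\<tau>} s) = ennreal \<tau> * (NINT p. nabs (k p))"
  if [measurable]: "k \<in> Bor" for k :: "'a \<Rightarrow> real"
 proof -
  have "(NINT p. NINT s. nabs (k (p + s *\<^sub>R b)) * indicator {0..\<tau>} s) = (NINT s. NINT p. nabs (k (p + s *\<^sub>R b)) * indicator {0..\<tau>} s)"
   by (rule lborel_pair.Fubini'[symmetric]) measurable
  also have "\<dots> = (NINT s. (NINT p. nabs (k p)) * indicator {0..\<tau>} s)"
   by (intro nn_integral_cong) (simp add: nn_integral_multc nn_integral_shift[where f="\<lambda>p. nabs (k p)"])
  also have "\<dots> = (NINT p. nabs (k p)) * ennreal \<tau>" using \<tau> by (simp add: nn_integral_cmult_indicator)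
  finally show ?thesis by (simp add: mult.commute)
 qed
 have int_seg: "AEL p. lintegrable (\<lambda>s. k (p + s *\<^sub>R b) * indicator {0..\<tau>} s)"
  if k: "lintegrable k" for k :: "'a \<Rightarrow> real"
 proof -
  have [measurable]: "k \<in> Bor" using k by auto
  have "(NINT p. NINT s. nabs (k (p + s *\<^sub>R b)) * indicator {0..\<tau>} s) < \<infinity>"
   unfolding nn_seg[OF \<open>k \<in> Bor\<close>] using k by (auto simp: integrable_iff_bounded ennreal_mult_less_top)
  then have "AEL p. (NINT s. nabs (k (p + s *\<^sub>R b)) * indicator {0..\<tau>} s) \<noteq> \<infinity>"
   by (intro nn_integral_PInf_AE) auto
  then show ?thesis
  proof eventually_elim
   case (elim p)
   have "(NINT s. nabs (k (p + s *\<^sub>R b) * indicator {0..\<tau>} s)) = (NINT s. nabs (k (p + s *\<^sub>R b)) * indicator {0..\<tau>} s)"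
    by (intro nn_integral_cong) (auto simp: indicator_def)
   then show ?case using elim by (intro integrableI_nn_abs) (auto simp: less_top)
  qed
 qed
 have ennreal3: "ennreal x \<le> ennreal u + (ennreal v + ennreal w)" if "x \<le> u + (v + w)" "0 \<le> u" "0 \<le> v" "0 \<le> w" for x u v w :: real
  using ennreal_leI[OF that(1)] that(2-4) by simp
 define X where "X p = f (p + \<tau> *\<^sub>R b) - f p - (LBINT s. g (p + s *\<^sub>R b) * indicator {0..\<tau>} s)" for p
 have [measurable]: "X \<in> Bor"
 proof -
  have "(\<lambda>p. LBINT s. g (p + s *\<^sub>R b) * indicator {0..\<tau>} s) \<in> Bor"
   by (rule lborel.borel_measurable_lebesgue_integral) measurable
  then show ?thesis unfolding X_def[abs_def] by measurable
 qed
 have small: "\<exists>Y. Y \<in> Bor \<and> (AEL p. p \<in> A \<longrightarrow> nabs (X p) \<le> Y p) \<and> (NINT p. Y p) \<le> ennreal (r * (2 + \<tau>))"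
  if r: "r > 0" for r
 proof -
  obtain d1 where d1: "d1 > 0" "\<And>e. 0 < e \<Longrightarrow> e < d1 \<Longrightarrow> (NINT p. nabs (convolve f (mollifier e) p - f p)) \<le> ennreal r"
   by (rule convolve_mollifier_L1[OF f r]) blast
  obtain d2 where d2: "d2 > 0" "\<And>e. 0 < e \<Longrightarrow> e < d2 \<Longrightarrow> (NINT p. nabs (convolve g (mollifier e) p - g p)) \<le> ennreal r"
   by (rule convolve_mollifier_L1[OF g r]) blast
  obtain n where n: "inverse (real (Suc n)) < min d1 d2" using reals_Archimedean[of "min d1 d2"] d1(1) d2(1) by auto
  define e where "e = inverse (real (Suc (max m n)))"
  have "e \<le> inverse (real (Suc n))" unfolding e_def by (intro le_imp_inverse_le) auto
  then have e: "e < d1" "e < d2" using n by linarith+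
  have e0: "e > 0" by (simp add: e_def)
  note [measurable] = mollifier_borel[OF e0]
  define fe where "fe = convolve f (mollifier e)"
  define ge where "ge = convolve g (mollifier e)"
  have [measurable]: "fe \<in> Bor" "ge \<in> Bor" unfolding fe_def ge_def by measurable
  have ige: "lintegrable ge" unfolding ge_def by (rule integrable_convolve_mollifier(2)[OF g e0])
  define Y where "Y p = nabs (fe (p + \<tau> *\<^sub>R b) - f (p + \<tau> *\<^sub>R b)) + (nabs (fe p - f p) +
   (NINT s. nabs (ge (p + s *\<^sub>R b) - g (p + s *\<^sub>R b)) * indicator {0..\<tau>} s))" for p
  have Ym: "Y \<in> Bor"
  proof -
   have [measurable]: "(\<lambda>p. NINT s. nabs (ge (p + s *\<^sub>R b) - g (p + s *\<^sub>R b)) * indicator {0..\<tau>} s) \<in> Bor"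
    by (rule lborel.borel_measurable_nn_integral) measurable
   show ?thesis unfolding Y_def[abs_def] by measurable
  qed
  have "AEL p. p \<in> A \<longrightarrow> nabs (X p) \<le> Y p"
   using int_seg[OF g] int_seg[OF ige]
  proof eventually_elim
   case (elim p)
   show ?case
   proof
    assume p: "p \<in> A"
    let ?I = "LBINT s. ge (p + s *\<^sub>R b) * indicator {0..\<tau>} s"
    let ?J = "LBINT s. g (p + s *\<^sub>R b) * indicator {0..\<tau>} s"
    have eq: "fe (p + \<tau> *\<^sub>R b) - fe p = ?I" using moll[OF max.cobounded1 p, of n] by (simp only: fe_def ge_def e_def)
    have "X p = - (fe (p + \<tau> *\<^sub>R b) - f (p + \<tau> *\<^sub>R b)) + ((fe p - f p) + (?I - ?J))" using eq by (simp add: X_def)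
    then have "\<bar>X p\<bar> \<le> \<bar>fe (p + \<tau> *\<^sub>R b) - f (p + \<tau> *\<^sub>R b)\<bar> + (\<bar>fe p - f p\<bar> + \<bar>?I - ?J\<bar>)" by linarith
    then have "nabs (X p) \<le> nabs (fe (p + \<tau> *\<^sub>R b) - f (p + \<tau> *\<^sub>R b)) + (nabs (fe p - f p) + nabs (?I - ?J))"
     by (rule ennreal3) auto
    also have "nabs (?I - ?J) \<le> (NINT s. nabs (ge (p + s *\<^sub>R b) - g (p + s *\<^sub>R b)) * indicator {0..\<tau>} s)"
    proof -
     have eq2: "?I - ?J = (LBINT s. (ge (p + s *\<^sub>R b) - g (p + s *\<^sub>R b)) * indicator {0..\<tau>} s)"
      using elim by (simp add: left_diff_distrib)
     have "nabs (?I - ?J) \<le> (NINT s. nabs ((ge (p + s *\<^sub>R b) - g (p + s *\<^sub>R b)) * indicator {0..\<tau>} s))"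
      unfolding eq2 using integral_norm_bound_ennreal[of lborel "\<lambda>s. (ge (p + s *\<^sub>R b) - g (p + s *\<^sub>R b)) * indicator {0..\<tau>} s"] elim
      by (simp add: left_diff_distrib)
     also have "\<dots> = (NINT s. nabs (ge (p + s *\<^sub>R b) - g (p + s *\<^sub>R b)) * indicator {0..\<tau>} s)"
      by (intro nn_integral_cong) (auto simp: indicator_def)
     finally show ?thesis .
    qed
    finally show "nabs (X p) \<le> Y p" unfolding Y_def by (simp add: add_left_mono)
   qed
  qed
  moreover have "(NINT p. Y p) \<le> ennreal (r * (2 + \<tau>))"
  proof -
   have "(NINT p. Y p) = (NINT p. nabs (fe (p + \<tau> *\<^sub>R b) - f (p + \<tau> *\<^sub>R b))) + ((NINT p. nabs (fe p - f p)) +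
    (NINT p. NINT s. nabs (ge (p + s *\<^sub>R b) - g (p + s *\<^sub>R b)) * indicator {0..\<tau>} s))"
   proof -
    have [measurable]: "(\<lambda>p. NINT s. nabs (ge (p + s *\<^sub>R b) - g (p + s *\<^sub>R b)) * indicator {0..\<tau>} s) \<in> Bor"
     by (rule lborel.borel_measurable_nn_integral) measurable
    show ?thesis unfolding Y_def by (simp add: nn_integral_add)
   qed
   also have "(NINT p. nabs (fe (p + \<tau> *\<^sub>R b) - f (p + \<tau> *\<^sub>R b))) = (NINT p. nabs (fe p - f p))"
    by (rule nn_integral_shift[where f="\<lambda>p. nabs (fe p - f p)"]) measurable
   also have "(NINT p. NINT s. nabs (ge (p + s *\<^sub>R b) - g (p + s *\<^sub>R b)) * indicator {0..\<tau>} s) =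
    ennreal \<tau> * (NINT p. nabs (ge p - g p))"
    by (rule nn_seg[where k="\<lambda>p. ge p - g p"]) measurable
   also have "(NINT p. nabs (fe p - f p)) + ((NINT p. nabs (fe p - f p)) + ennreal \<tau> * (NINT p. nabs (ge p - g p)))
    \<le> ennreal r + (ennreal r + ennreal \<tau> * ennreal r)"
    unfolding fe_def ge_def by (intro add_mono mult_left_mono d1(2) d2(2) e e0) auto
   also have "\<dots> = ennreal (r * (2 + \<tau>))"
    using r \<tau> by (simp add: ennreal_mult[symmetric] ennreal_plus[symmetric] algebra_simps del: ennreal_plus)
   finally show ?thesis .
  qed
  ultimately show ?thesis using Ym by blast
 qed
 have "\<forall>n. \<exists>Y. Y \<in> Bor \<and> (AEL p. p \<in> A \<longrightarrow> nabs (X p) \<le> Y p) \<and> (NINT p. Y p) \<le> ennreal (inverse (real (Suc n)) * (2 + \<tau>))"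
  using small by simp
 then obtain Y where Y: "\<And>n. Y n \<in> Bor" "\<And>n. AEL p. p \<in> A \<longrightarrow> nabs (X p) \<le> Y n p"
  "\<And>n. (NINT p. Y n p) \<le> ennreal (inverse (real (Suc n)) * (2 + \<tau>))" by metis
 have [measurable]: "Y n \<in> Bor" for n by (rule Y)
 \<comment> \<open>On A the defect lies below every \<open>Y n\<close>, hence below their infimum,
   whose integral is 0.\<close>
 have "(NINT p. (INF n. Y n p)) \<le> 0"
 proof (rule ennreal_le_epsilon)
  fix r :: real assume r: "0 < r"
  obtain n where n: "inverse (real (Suc n)) < r / (2 + \<tau>)" using reals_Archimedean[of "r / (2 + \<tau>)"] r \<tau> by auto
  have "(NINT p. (INF n. Y n p)) \<le> (NINT p. Y n p)" by (intro nn_integral_mono INF_lower) auto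
  also have "\<dots> \<le> ennreal r"
   using n \<tau> by (intro order_trans[OF Y(3)] ennreal_leI) (simp add: field_simps)
  finally show "(NINT p. (INF n. Y n p)) \<le> 0 + ennreal r" by simp
 qed
 then have "AEL p. (INF n. Y n p) = 0"
  using nn_integral_0_iff_AE[of "\<lambda>p. INF n. Y n p" lborel] by simp
 moreover have "AEL p. \<forall>n. p \<in> A \<longrightarrow> nabs (X p) \<le> Y n p"
  by (subst AE_all_countable) (intro allI Y(2))
 ultimately show ?thesis
 proof eventually_elim
  case (elim p)
  show ?case
  proof
   assume "p \<in> A"
   then have "nabs (X p) \<le> (INF n. Y n p)" using elim(2) by (intro INF_greatest) auto
   then have "X p = 0" using elim(1) by simp
   then show "f (p + \<tau> *\<^sub>R b) - f p = (LBINT s. g (p + s *\<^sub>R b) * indicator {0..\<tau>} s)" by (simp add: X_def)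
  qed
 qed
qed

text \<open>Tested with a mollifier in q times an arbitrary \<eta>(\<xi>), the equation holds in
  mollified form for almost every \<xi>, with a null set depending on the centre p and the radius.
  Countably many centres and radii and continuity in p give one null set for all. Then \<xi> is
  fixed, and the mollified equation is integrated along the line of direction (1, a \<xi>).\<close>

theorem weak_transport_characteristics:
 fixes a :: "real \<Rightarrow> 'b::euclidean_space" and F N :: "(real \<times> 'b) \<times> real \<Rightarrow> real"
 assumes a: "locally_bounded a" and F: "lintegrable F" and N: "lintegrable N"
  and weak: "\<And>\<Phi> \<eta>. test_function ({0<..<T} \<times> UNIV) \<Phi> \<Longrightarrow> test_function UNIV \<eta> \<Longrightarrow>
   (LBINT p. F p * flux (\<lambda>\<xi>. (1, a \<xi>)) \<eta> \<Phi> p) = - (LBINT p. N p * (\<eta> (snd p) * \<Phi> (fst p)))"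
  and \<tau>: "0 \<le> \<tau>"
 shows "AEL \<xi>. AEL q. 0 < fst q \<and> fst q + \<tau> < T \<longrightarrow>
  F (q + \<tau> *\<^sub>R (1, a \<xi>), \<xi>) - F (q, \<xi>) = (LBINT s. N (q + s *\<^sub>R (1, a \<xi>), \<xi>) * indicator {0..\<tau>} s)"
proof -
 define b where "b \<xi> = (1::real, a \<xi>)" for \<xi>
 have b: "locally_bounded b" unfolding b_def[abs_def] by (rule locally_bounded_Pair[OF a])
 have [measurable]: "F \<in> Bor" "N \<in> Bor" "b \<in> Bor"
  using F N b by (auto simp: locally_bounded_def)
 define e where "e n = inverse (real (Suc n))" for n
 have e: "e n > 0" for n by (simp add: e_def)
 \<comment> \<open>The residual at p of the equation mollified at scale e n, for a single
   \<xi>.\<close>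
 define H where "H n p \<xi> = (LBINT q. F (q, \<xi>) * Fd (mollifier (e n)) (p - q) (b \<xi>)) -
  (LBINT q. N (q, \<xi>) * mollifier (e n) (p - q))" for n p \<xi>
 have slice: "AEL \<xi>. lintegrable (\<lambda>q. G (q, \<xi>))" if "lintegrable G" for G :: "(real \<times> 'b) \<times> real \<Rightarrow> real"
  using lborel_pair.AE_integrable_snd[of "\<lambda>q \<xi>. G (q, \<xi>)"] that by (simp add: lborel_prod)
 have slices: "AEL \<xi>. lintegrable (\<lambda>q. F (q, \<xi>)) \<and> lintegrable (\<lambda>q. N (q, \<xi>))"
  using slice[OF F] slice[OF N] by eventually_elim simp
 have Hzero: "AEL \<xi>. H n p \<xi> = 0" if p: "e n < fst p" "fst p < T - e n" for n p
 proof (rule fundamental_lemma_variations)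
  note [measurable] = mollifier_borel[OF e[of n]]
  have sm: "smooth_fun (mollifier (e n) :: real \<times> 'b \<Rightarrow> real)" by (rule smooth_fun_mollifier[OF e])
  obtain C where C: "\<And>x::real \<times> 'b. \<bar>mollifier (e n) x\<bar> \<le> C" "\<And>(x::real \<times> 'b) v. \<bar>Fd (mollifier (e n)) x v\<bar> \<le> C * norm v"
   "C > 0"
   using test_function_bounds[OF test_function_mollifier[OF e]] by metis
  define k1 where "k1 z = Fd (mollifier (e n)) (p - fst z) (b (snd z))" for z :: "(real \<times> 'b) \<times> real"
  define k2 where "k2 z = mollifier (e n) (p - fst z)" for z :: "(real \<times> 'b) \<times> real"
  have [measurable]: "k1 \<in> Bor" unfolding k1_def[abs_def]
   by (rule borel_measurable_frechet_smooth[OF sm]) measurable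
  have [measurable]: "k2 \<in> Bor" unfolding k2_def[abs_def] by measurable
  have i: "lintegrable (\<lambda>z. F z * (\<eta> (snd z) * k1 z) - N z * (\<eta> (snd z) * k2 z))"
   "(LBINT z. F z * (\<eta> (snd z) * k1 z) - N z * (\<eta> (snd z) * k2 z)) = (LBINT z. F z * (\<eta> (snd z) * k1 z)) - (LBINT z. N z * (\<eta> (snd z) * k2 z))"
   if [measurable]: "\<eta> \<in> Bor" and \<eta>: "\<And>x. \<bar>\<eta> x\<bar> \<le> B" "\<And>x. \<bar>x\<bar> > R \<Longrightarrow> \<eta> x = 0" for \<eta> B R
  proof -
   obtain L where L: "\<And>\<xi>. \<bar>\<xi>\<bar> \<le> R \<Longrightarrow> norm (b \<xi>) \<le> L" using b unfolding locally_bounded_def by blast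
   have B0: "0 \<le> B" using \<eta>(1)[of 0] by linarith
   have "\<bar>\<eta> (snd z) * k1 z\<bar> \<le> B * (C * \<bar>L\<bar>)" for z
   proof (cases "\<bar>snd z\<bar> \<le> R")
    case True
    have "\<bar>k1 z\<bar> \<le> C * norm (b (snd z))" unfolding k1_def by (rule C)
    also have "\<dots> \<le> C * \<bar>L\<bar>" using L[OF True] C(3) by (intro mult_left_mono) auto
    finally show ?thesis unfolding abs_mult by (intro mult_mono \<eta>) (use B0 in auto)
   next
    case False
    then show ?thesis using \<eta>(2) B0 C(3) by simp
   qed
   then have i1: "lintegrable (\<lambda>z. F z * (\<eta> (snd z) * k1 z))"
    by (rule integrable_mult_bounded[OF F, rotated]) measurable
   have "\<bar>\<eta> (snd z) * k2 z\<bar> \<le> B * C" for z unfolding abs_mult k2_def by (intro mult_mono \<eta> C B0) auto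
   then have i2: "lintegrable (\<lambda>z. N z * (\<eta> (snd z) * k2 z))"
    by (rule integrable_mult_bounded[OF N, rotated]) measurable
   show "lintegrable (\<lambda>z. F z * (\<eta> (snd z) * k1 z) - N z * (\<eta> (snd z) * k2 z))" using i1 i2 by simp
   show "(LBINT z. F z * (\<eta> (snd z) * k1 z) - N z * (\<eta> (snd z) * k2 z)) = (LBINT z. F z * (\<eta> (snd z) * k1 z)) - (LBINT z. N z * (\<eta> (snd z) * k2 z))"
    using i1 i2 by simp
  qed
  have H_eq: "AEL \<xi>. (LBINT q. F (q, \<xi>) * (\<eta> \<xi> * k1 (q, \<xi>)) - N (q, \<xi>) * (\<eta> \<xi> * k2 (q, \<xi>))) = H n p \<xi> * \<eta> \<xi>" for \<eta> :: "real \<Rightarrow> real"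
   using slices
  proof eventually_elim
   case (elim \<xi>)
   have k1m: "(\<lambda>q. k1 (q, \<xi>)) \<in> BorL" by simp
   have "lintegrable (\<lambda>q. F (q, \<xi>) * k1 (q, \<xi>))"
    by (rule integrable_mult_bounded[OF _ k1m, of _ "C * norm (b \<xi>)"]) (use elim in simp, simp only: k1_def C(2) fst_conv snd_conv)
   moreover have "lintegrable (\<lambda>q. N (q, \<xi>) * k2 (q, \<xi>))"
    by (intro integrable_mult_bounded[where C=C]) (use elim C(1) in \<open>simp_all add: k2_def\<close>)
   ultimately have "(LBINT q. \<eta> \<xi> * (F (q, \<xi>) * k1 (q, \<xi>)) - \<eta> \<xi> * (N (q, \<xi>) * k2 (q, \<xi>))) = \<eta> \<xi> * H n p \<xi>"
    unfolding H_def by (simp add: k1_def k2_def right_diff_distrib)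
   then show ?case by (simp add: mult_ac)
  qed
  show Hm: "H n p \<in> Bor"
  proof -
   have "(\<lambda>\<xi>. LBINT q. F (q, \<xi>) * k1 (q, \<xi>)) \<in> Bor" "(\<lambda>\<xi>. LBINT q. N (q, \<xi>) * k2 (q, \<xi>)) \<in> Bor"
    by (rule lborel.borel_measurable_lebesgue_integral, measurable)+
   then show ?thesis unfolding H_def[abs_def] k1_def k2_def by simp
  qed
  note [measurable] = Hm
  show "lintegrable (\<lambda>\<xi>. indicator (cball 0 R) \<xi> * H n p \<xi>)" for R
  proof -
   have cb: "cball (0::real) R \<in> sets borel" by simp
   have im: "(indicator (cball 0 R) :: real \<Rightarrow> real) \<in> Bor" using cb by measurable
   have "lintegrable (\<lambda>\<xi>. LBINT q. F (q, \<xi>) * (indicator (cball 0 R) \<xi> * k1 (q, \<xi>)) - N (q, \<xi>) * (indicator (cball 0 R) \<xi> * k2 (q, \<xi>)))"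
    using lborel_integrable_snd[OF i(1)[OF im, of 1 R]] by (auto simp: indicator_def)
   then show ?thesis
   proof (rule integrable_cong_AE_imp)
    show "(\<lambda>\<xi>. indicator (cball 0 R) \<xi> * H n p \<xi>) \<in> BorL" using im by measurable
    show "AEL \<xi>. (LBINT q. F (q, \<xi>) * (indicator (cball 0 R) \<xi> * k1 (q, \<xi>)) - N (q, \<xi>) * (indicator (cball 0 R) \<xi> * k2 (q, \<xi>))) = indicator (cball 0 R) \<xi> * H n p \<xi>"
     using H_eq[of "indicator (cball 0 R)"] by eventually_elim (simp only: mult.commute)
   qed
  qed
  fix \<eta> :: "real \<Rightarrow> real" assume \<eta>: "test_function UNIV \<eta>"
  have \<eta>m[measurable]: "\<eta> \<in> Bor" by (rule smooth_fun_borel[OF test_function_smooth[OF \<eta>]])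
  obtain B R where BR: "\<And>x. \<bar>\<eta> x\<bar> \<le> B" "\<And>x. norm x > R \<Longrightarrow> \<eta> x = 0" using test_function_bounds[OF \<eta>] by metis
  note i' = i[OF \<eta>m BR[unfolded real_norm_def]]
  define \<Phi> where "\<Phi> q = mollifier (e n) (p - q)" for q
  have \<Phi>: "test_function ({0<..<T} \<times> UNIV) \<Phi>"
  proof (rule test_functionI[of _ "cball p (e n)"])
   show "smooth_fun \<Phi>" unfolding \<Phi>_def[abs_def] by (rule smooth_fun_reflect[OF sm])
   show "cball p (e n) \<subseteq> {0<..<T} \<times> UNIV"
   proof
    fix q assume "q \<in> cball p (e n)"
    then have "dist (fst p) (fst q) \<le> e n" using dist_fst_le[of p q] by simp
    then show "q \<in> {0<..<T} \<times> UNIV" using p by (cases q) (auto simp: dist_real_def)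
   qed
   show "\<Phi> q = 0" if "q \<notin> cball p (e n)" for q
    unfolding \<Phi>_def using that by (intro mollifier_eq_0[OF e]) (simp add: dist_norm)
  qed auto
  have d\<Phi>: "Fd \<Phi> q v = - Fd (mollifier (e n)) (p - q) v" for q v
   unfolding \<Phi>_def[abs_def] by (rule frechet_derivative_reflect[OF sm])
  have "(LBINT z. F z * (\<eta> (snd z) * k1 z)) = (LBINT z. N z * (\<eta> (snd z) * k2 z))"
   using weak[OF \<Phi> \<eta>] unfolding flux_def d\<Phi> by (simp add: k1_def k2_def \<Phi>_def b_def)
  then have "0 = (LBINT z. F z * (\<eta> (snd z) * k1 z) - N z * (\<eta> (snd z) * k2 z))" using i'(2) by simp
  also have "\<dots> = (LBINT \<xi>. LBINT q. F (q, \<xi>) * (\<eta> \<xi> * k1 (q, \<xi>)) - N (q, \<xi>) * (\<eta> \<xi> * k2 (q, \<xi>)))"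
   using lborel_integral_prod_snd[OF i'(1)] by simp
  also have "\<dots> = (LBINT \<xi>. H n p \<xi> * \<eta> \<xi>)"
  proof (rule integral_cong_AE)
   show "(\<lambda>\<xi>. LBINT q. F (q, \<xi>) * (\<eta> \<xi> * k1 (q, \<xi>)) - N (q, \<xi>) * (\<eta> \<xi> * k2 (q, \<xi>))) \<in> BorL"
    using lborel_integrable_snd[OF i'(1)] by auto
  qed (use H_eq in auto)
  finally show "(LBINT \<xi>. H n p \<xi> * \<eta> \<xi>) = 0" by simp
 qed
 obtain D :: "(real \<times> 'b) set" where D: "countable D" "\<And>X. open X \<Longrightarrow> X \<noteq> {} \<Longrightarrow> \<exists>d\<in>D. d \<in> X"
  by (rule countable_dense_setE) blast
 \<comment> \<open>Centres at which the mollifier of radius e n is supported inside the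
   slab.\<close>
 define Om where "Om n = {p :: real \<times> 'b. e n < fst p \<and> fst p < T - e n}" for n
 have Om_open: "open (Om n)" for n unfolding Om_def by (intro open_Collect_conj open_Collect_less continuous_intros)
 have "AEL \<xi>. \<forall>n. \<forall>p\<in>D. p \<in> Om n \<longrightarrow> H n p \<xi> = 0"
 proof (subst AE_all_countable, intro allI)
  fix n
  show "AEL \<xi>. \<forall>p\<in>D. p \<in> Om n \<longrightarrow> H n p \<xi> = 0"
   unfolding AE_ball_countable[OF D(1)]
  proof
   fix p assume "p \<in> D"
   show "AEL \<xi>. p \<in> Om n \<longrightarrow> H n p \<xi> = 0"
    by (cases "p \<in> Om n") (use Hzero[of n p] in \<open>auto simp: Om_def\<close>)
  qed
 qed
 with slices show ?thesis
 proof eventually_elim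
  case (elim \<xi>)
  define f where "f q = F (q, \<xi>)" for q
  define g where "g q = N (q, \<xi>)" for q
  have fg: "lintegrable f" "lintegrable g" using elim(1) by (auto simp: f_def[abs_def] g_def[abs_def])
  define f' where "f' n = convolve f (\<lambda>x. Fd (mollifier (e n)) x (b \<xi>))" for n
  define g' where "g' n = convolve g (mollifier (e n))" for n
  have H_eq: "H n p \<xi> = f' n p - g' n p" for n p
   by (simp add: H_def f'_def g'_def convolve_def f_def g_def)
  have eq: "f' n p = g' n p" if p: "p \<in> Om n" for n p
  proof (rule ccontr)
   assume ne: "f' n p \<noteq> g' n p"
   have c: "continuous_on UNIV (f' n)" "continuous_on UNIV (g' n)"
    unfolding f'_def g'_def
    by (intro test_function_convolve_continuous fg test_function_derivative test_function_mollifier e)+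
   have "open (Om n \<inter> {p. f' n p \<noteq> g' n p})" by (intro open_Int Om_open open_Collect_neq c)
   then obtain d where "d \<in> D" "d \<in> Om n" "f' n d \<noteq> g' n d" using D(2)[of "Om n \<inter> {p. f' n p \<noteq> g' n p}"] ne p by blast
   then show False using elim(2) H_eq[of n d] by auto
  qed
  define A where "A m = {q :: real \<times> 'b. e m < fst q \<and> fst q + \<tau> < T - e m}" for m
  have "AEL q. q \<in> A m \<longrightarrow> f (q + \<tau> *\<^sub>R b \<xi>) - f q = (LBINT s. g (q + s *\<^sub>R b \<xi>) * indicator {0..\<tau>} s)" for m
  proof (rule segment_identity_L1[OF fg \<tau>, of m])
   fix n p assume n: "m \<le> n" and p: "p \<in> A m"
   have en: "e n \<le> e m" unfolding e_def using n by (intro le_imp_inverse_le) auto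
   have "(LBINT s. g' n (p + s *\<^sub>R b \<xi>) * indicator {0..\<tau>} s) = (LBINT s. f' n (p + s *\<^sub>R b \<xi>) * indicator {0..\<tau>} s)"
   proof (rule LBINT_cong[OF refl])
    fix s
    have "p + s *\<^sub>R b \<xi> \<in> Om n" if "s \<in> {0..\<tau>}"
     using that p en by (auto simp: Om_def A_def b_def)
    then show "g' n (p + s *\<^sub>R b \<xi>) * indicator {0..\<tau>} s = f' n (p + s *\<^sub>R b \<xi>) * indicator {0..\<tau>} s"
     using eq by (auto simp: indicator_def)
   qed
   also have "\<dots> = convolve f (mollifier (e n)) (p + \<tau> *\<^sub>R b \<xi>) - convolve f (mollifier (e n)) p"
    unfolding f'_def by (rule integral_segment_convolve[OF fg(1) test_function_mollifier[OF e] \<tau>])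
   finally show "convolve f (mollifier (inverse (real (Suc n)))) (p + \<tau> *\<^sub>R b \<xi>) - convolve f (mollifier (inverse (real (Suc n)))) p =
    (LBINT s. convolve g (mollifier (inverse (real (Suc n)))) (p + s *\<^sub>R b \<xi>) * indicator {0..\<tau>} s)"
    by (simp only: e_def g'_def)
  qed
  then have "AEL q. \<forall>m. q \<in> A m \<longrightarrow> f (q + \<tau> *\<^sub>R b \<xi>) - f q = (LBINT s. g (q + s *\<^sub>R b \<xi>) * indicator {0..\<tau>} s)"
   by (subst AE_all_countable) blast
  then show ?case
  proof eventually_elim
   case (elim q)
   show ?case
   proof
    assume q: "0 < fst q \<and> fst q + \<tau> < T"
    obtain m where "inverse (real (Suc m)) < min (fst q) (T - (fst q + \<tau>))"
     using reals_Archimedean[of "min (fst q) (T - (fst q + \<tau>))"] q by auto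
    then have "q \<in> A m" by (auto simp: A_def e_def)
    then have "f (q + \<tau> *\<^sub>R b \<xi>) - f q = (LBINT s. g (q + s *\<^sub>R b \<xi>) * indicator {0..\<tau>} s)"
     using elim by blast
    then show "F (q + \<tau> *\<^sub>R (1, a \<xi>), \<xi>) - F (q, \<xi>) = (LBINT s. N (q + s *\<^sub>R (1, a \<xi>), \<xi>) * indicator {0..\<tau>} s)"
     unfolding f_def g_def b_def .
   qed
  qed
 qed
qed

subsection \<open>The relaxation equation\<close>

lemma slab_flow_assoc_integrable:
 fixes F :: "real \<times> ('b::euclidean_space \<times> real) \<Rightarrow> real"
 assumes "slab_flow T F"
 shows "lintegrable (\<lambda>p. F (fst (fst p), snd (fst p), snd p))"
proof -
 have "F \<in> Bor" using assms by (simp add: slab_flow_def)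
 then show ?thesis using integral_lborel_assoc(2) slab_flow_integrable(1)[OF assms] by blast
qed

lemma measurable_assoc: "(\<lambda>p. (fst (fst p), snd (fst p), snd p)) \<in> measurable borel
  (borel :: ('a::euclidean_space \<times> 'b::euclidean_space \<times> 'c::euclidean_space) measure)"
 by (intro borel_measurable_continuous_onI continuous_intros)

text \<open>The integrating factor: with this weight in the test function, the damping term -lam * f
  is absorbed and only the source lam * M remains.\<close>

lemma frechet_derivative_exp_weight:
 fixes \<Phi> :: "real \<times> 'b::euclidean_space \<Rightarrow> real"
 assumes "test_function (I \<times> UNIV) \<Phi>"
 shows "test_function (I \<times> UNIV) (\<lambda>q. exp (lam * fst q) * \<Phi> q)"
  and "Fd (\<lambda>q. exp (lam * fst q) * \<Phi> q) q v =
   exp (lam * fst q) * (Fd \<Phi> q v + lam * fst v * \<Phi> q)"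
proof -
 have sm: "smooth_fun \<Phi>" by (rule test_function_smooth[OF assms])
 let ?E = "\<lambda>q :: real \<times> 'b. exp (lam * fst q)"
 have der: "((\<lambda>q. c * ?E q) has_derivative (\<lambda>v. c * lam * fst v * ?E q)) (at q)" for c q
  by (rule has_derivative_eq_rhs, (rule derivative_intros)+) (auto simp: mult_ac)
 have fd: "Fd (\<lambda>q. c * ?E q) q = (\<lambda>v. c * lam * fst v * ?E q)" for c q
  using frechet_derivative_at[OF der] by metis
 have "smooth_fun (\<lambda>q. 1 * ?E q)"
 proof (rule smooth_fun_coinduct[where S="range (\<lambda>c q. c * ?E q)"])
  fix f assume "f \<in> range (\<lambda>c q. c * ?E q)"
  then obtain c where f: "f = (\<lambda>q. c * ?E q)" by blast
  show "(\<forall>x. f differentiable at x) \<and> (\<forall>v. (\<lambda>x. Fd f x v) \<in> range (\<lambda>c q. c * ?E q))"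
   unfolding f fd using der by (auto simp: differentiable_def)
 qed (rule range_eqI[of _ _ 1], simp)
 then have sme: "smooth_fun ?E" by simp
 have eq: "Fd (\<lambda>q. exp (lam * fst q) * \<Phi> q) q v =
   exp (lam * fst q) * Fd \<Phi> q v + Fd (\<lambda>q :: real \<times> 'b. exp (lam * fst q)) q v * \<Phi> q" for q v
  by (rule frechet_derivative_mult_smooth[OF sme sm])
 then show "Fd (\<lambda>q. exp (lam * fst q) * \<Phi> q) q v =
   exp (lam * fst q) * (Fd \<Phi> q v + lam * fst v * \<Phi> q)"
  using fd[of 1 q] by (simp add: algebra_simps)
 show "test_function (I \<times> UNIV) (\<lambda>q. exp (lam * fst q) * \<Phi> q)"
  using test_function_mult_smooth[OF assms sme] by (simp add: mult.commute)
qed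

text \<open>Characteristics are obtained for almost every \<xi>, whereas estimates in V1 need almost
  every t first; measurability of the predicate allows the order to be changed.\<close>

lemma AE_lborel_assoc:
 fixes P :: "'a::euclidean_space \<times> 'b::euclidean_space \<times> 'c::euclidean_space \<Rightarrow> bool"
 assumes P: "{z. P z} \<in> sets borel" and ae: "AEL y. AEL q. P (fst q, snd q, y)"
 shows "AEL x. AEL z. P (x, z)"
proof -
 have m: "(\<lambda>p. (fst (fst p), snd (fst p), snd p)) \<in> measurable (lborel :: (('a \<times> 'b) \<times> 'c) measure) (borel :: ('a \<times> 'b \<times> 'c) measure)"
  using measurable_assoc by simp
 define Q where "Q p \<longleftrightarrow> P (fst (fst p), snd (fst p), snd p)" for p
 have Qm: "{p. Q p} \<in> sets borel"
  using measurable_sets[OF measurable_assoc P] by (simp add: Q_def vimage_def)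
 have "AEL p. Q (snd p, fst p)"
 proof (rule AE_lborel_pairI)
  have "(\<lambda>p. (snd p, fst p)) \<in> measurable borel (borel :: (('a \<times> 'b) \<times> 'c) measure)"
   by (intro borel_measurable_continuous_onI continuous_intros)
  from measurable_sets[OF this Qm] show "{p. Q (snd p, fst p)} \<in> sets borel" by (simp add: vimage_def)
  show "AEL y. AEL q. Q (snd (y, q), fst (y, q))" using ae by (simp add: Q_def)
 qed
 then have "AE p in distr lborel borel (\<lambda>p. (snd p, fst p)). Q p"
  by (subst AE_distr_iff) (use Qm in \<open>auto simp: Q_def intro!: measurable_Pair\<close>)
 moreover have "distr lborel borel (\<lambda>p. (snd p, fst p)) = (lborel :: (('a \<times> 'b) \<times> 'c) measure)"
 proof -
  have "distr (lborel \<Otimes>\<^sub>M lborel) (lborel \<Otimes>\<^sub>M lborel) (\<lambda>(x, y). (y, x)) = (lborel \<Otimes>\<^sub>M lborel :: (('a \<times> 'b) \<times> 'c) measure)"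
   by (rule lborel_pair.distr_pair_swap[symmetric])
  then show ?thesis unfolding lborel_prod by (simp add: case_prod_beta' distr_def)
 qed
 ultimately have "AEL p. Q p" by (simp only:)
 then have "AE z in distr lborel borel (\<lambda>p. (fst (fst p), snd (fst p), snd p)). P z"
  by (subst AE_distr_iff[OF m]) (use P in \<open>auto simp: Q_def\<close>)
 then have "AEL z. P z" by (simp only: lborel_distr_assoc)
 then show ?thesis by (rule AE_lborel_pairD)
qed

text \<open>Duhamel's formula on [t, t + \<tau>], obtained from
  \<open>weak_transport_characteristics\<close> for f multiplied by exp (lam * t). It holds for
  almost every t only, with both ends strictly inside the slab; the endpoints are recovered in
  \<open>relaxation_estimate\<close> by continuity.\<close>

theorem relaxation_characteristics:
 fixes a :: "real \<Rightarrow> 'b::euclidean_space" and F :: "real \<times> ('b \<times> real) \<Rightarrow> real"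
 assumes a: "locally_bounded a" and F: "slab_flow T F" and U: "slab_flow T U" and lam: "0 < lam"
  and weak: "\<And>\<Phi> \<eta>. test_function ({0<..<T} \<times> UNIV) \<Phi> \<Longrightarrow> test_function UNIV \<eta> \<Longrightarrow>
   (LBINT p. F (fst (fst p), snd (fst p), snd p) * flux (\<lambda>\<xi>. (1, a \<xi>)) \<eta> \<Phi> p) =
   - (LBINT p. lam * (kp U p - F (fst (fst p), snd (fst p), snd p)) * (\<eta> (snd p) * \<Phi> (fst p)))"
  and \<tau>: "0 \<le> \<tau>"
 shows "AEL t. 0 < t \<and> t + \<tau> < T \<longrightarrow> (AE z in lborel.
  F (t + \<tau>, fst z + \<tau> *\<^sub>R a (snd z), snd z) = exp (- lam * \<tau>) * F (t, z) +
   (LBINT s. lam * exp (- lam * (\<tau> - s)) * indicator {0..\<tau>} s * kchi (snd z) (U (t + s, fst z + s *\<^sub>R a (snd z)))))"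
proof -
 have [measurable]: "F \<in> Bor" "U \<in> Bor" "a \<in> Bor"
  using F U a by (auto simp: slab_flow_def locally_bounded_def)
 note [measurable] = measurable_assoc
 have b: "locally_bounded (\<lambda>\<xi>. (1::real, a \<xi>))" by (rule locally_bounded_Pair[OF a])
 define Fp where "Fp p = F (fst (fst p), snd (fst p), snd p)" for p
 define Mp where "Mp p = kp U p" for p
 define E where "E p = exp (lam * fst (fst p))" for p :: "(real \<times> 'b) \<times> real"
 have Fi: "lintegrable Fp" unfolding Fp_def[abs_def] by (rule slab_flow_assoc_integrable[OF F])
 have Mi: "lintegrable Mp" unfolding Mp_def[abs_def] by (rule kchi_prod_L1(3)) (rule slab_flow_integrable(1)[OF U])+
 have [measurable]: "E \<in> Bor" unfolding E_def[abs_def] by measurable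
 have weighted: "lintegrable (\<lambda>p. G p * E p)"
  if G: "lintegrable G" "\<And>p. fst (fst p) \<notin> {0..T} \<Longrightarrow> G p = 0" for G :: "(real \<times> 'b) \<times> real \<Rightarrow> real"
 proof -
  \<comment> \<open>The weight is unbounded over all times; capping the time at T changes nothing
    because \<open>G\<close> vanishes outside the slab.\<close>
  have "lintegrable (\<lambda>p. G p * exp (lam * min T (fst (fst p))))"
   by (rule integrable_mult_bounded[OF G(1), where C="exp (lam * T)"]) (use lam in auto)
  moreover have "G p * exp (lam * min T (fst (fst p))) = G p * E p" for p
   using G(2)[of p] by (cases "fst (fst p) \<in> {0..T}") (auto simp: E_def min_def)
  ultimately show ?thesis by simp
 qed
 have out: "Fp p = 0" "Mp p = 0" if "fst (fst p) \<notin> {0..T}" for p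
  using that F U by (cases "fst p"; auto simp: Fp_def Mp_def slab_flow_def)+
 define N where "N p = lam * (Mp p * E p)" for p
 have FE: "lintegrable (\<lambda>p. Fp p * E p)" and ME: "lintegrable (\<lambda>p. Mp p * E p)"
  using weighted[OF Fi out(1)] weighted[OF Mi out(2)] by auto
 then have N: "lintegrable N" unfolding N_def[abs_def] by simp
 have "AEL \<xi>. AEL q. 0 < fst q \<and> fst q + \<tau> < T \<longrightarrow>
  Fp (q + \<tau> *\<^sub>R (1, a \<xi>), \<xi>) * E (q + \<tau> *\<^sub>R (1, a \<xi>), \<xi>) - Fp (q, \<xi>) * E (q, \<xi>) =
  (LBINT s. N (q + s *\<^sub>R (1, a \<xi>), \<xi>) * indicator {0..\<tau>} s)"
 proof (rule weak_transport_characteristics[OF a FE N _ \<tau>])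
  fix \<Phi> :: "real \<times> 'b \<Rightarrow> real" and \<eta> :: "real \<Rightarrow> real"
  assume \<Phi>: "test_function ({0<..<T} \<times> UNIV) \<Phi>" and \<eta>: "test_function UNIV \<eta>"
  have sm: "smooth_fun \<Phi>" "smooth_fun \<eta>" using \<Phi> \<eta> test_function_smooth by auto
  have [measurable]: "\<Phi> \<in> Bor" "\<eta> \<in> Bor" using sm smooth_fun_borel by auto
  note w = frechet_derivative_exp_weight[OF \<Phi>, of lam]
  define J where "J p = \<eta> (snd p) * \<Phi> (fst p)" for p
  define L where "L p = flux (\<lambda>\<xi>. (1, a \<xi>)) \<eta> \<Phi> p" for p
  obtain C1 where C1: "C1 > 0" "\<And>p. \<bar>L p\<bar> \<le> C1" unfolding L_def using flux_bounds[OF b \<eta> \<Phi>] by metis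
  have Lm: "L \<in> BorL" unfolding L_def[abs_def] by (rule flux_borel[OF b sm(2,1)]) simp
  obtain B1 B2 where B: "\<And>x. \<bar>\<eta> x\<bar> \<le> B1" "\<And>x. \<bar>\<Phi> x\<bar> \<le> B2" using test_function_bounds[OF \<eta>] test_function_bounds[OF \<Phi>] by metis
  have B1: "0 \<le> B1" using B(1)[of 0] by linarith
  have J: "\<bar>J p\<bar> \<le> B1 * B2" for p unfolding J_def abs_mult by (intro mult_mono B B1) auto
  have Jm: "J \<in> BorL" unfolding J_def[abs_def] by measurable
  have i: "lintegrable (\<lambda>p. Fp p * E p * L p)" "lintegrable (\<lambda>p. Fp p * E p * J p)" "lintegrable (\<lambda>p. Mp p * E p * J p)"
   by (rule integrable_mult_bounded[OF FE Lm C1(2)] integrable_mult_bounded[OF FE Jm J] integrable_mult_bounded[OF ME Jm J])+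
  have "(LBINT p. Fp p * E p * L p + lam * (Fp p * E p * J p)) = (LBINT p. Fp p * flux (\<lambda>\<xi>. (1, a \<xi>)) \<eta> (\<lambda>q. exp (lam * fst q) * \<Phi> q) p)"
   by (intro LBINT_cong) (simp_all only: flux_def w(2) L_def J_def E_def fst_conv mult_1_right, simp add: algebra_simps)
  also have "\<dots> = - (LBINT p. lam * (Mp p - Fp p) * (\<eta> (snd p) * (exp (lam * fst (fst p)) * \<Phi> (fst p))))"
   using weak[OF w(1) \<eta>] unfolding Fp_def Mp_def .
  also have "\<dots> = - (LBINT p. lam * (Mp p * E p * J p) - lam * (Fp p * E p * J p))"
   by (intro arg_cong[of _ _ uminus] LBINT_cong) (auto simp: J_def E_def algebra_simps)
  finally have "(LBINT p. Fp p * E p * L p) = - (lam * (LBINT p. Mp p * E p * J p))"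
   using i by simp
  then show "(LBINT p. Fp p * E p * flux (\<lambda>\<xi>. (1, a \<xi>)) \<eta> \<Phi> p) = - (LBINT p. N p * (\<eta> (snd p) * \<Phi> (fst p)))"
   by (simp add: L_def N_def J_def mult.assoc)
 qed
 then have ae: "AEL \<xi>. AEL q. 0 < fst q \<and> fst q + \<tau> < T \<longrightarrow>
   F (fst q + \<tau>, snd q + \<tau> *\<^sub>R a \<xi>, \<xi>) = exp (- lam * \<tau>) * F (fst q, snd q, \<xi>) +
   (LBINT s. lam * exp (- lam * (\<tau> - s)) * indicator {0..\<tau>} s * kchi \<xi> (U (fst q + s, snd q + s *\<^sub>R a \<xi>)))"
 proof eventually_elim
  case (elim \<xi>)
  then show ?case
  proof eventually_elim
   case (elim q)
   show ?case
   proof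
  assume q: "0 < fst q \<and> fst q + \<tau> < T"
  note id = elim
  obtain t x where qx: "q = (t, x)" by (cases q)
  define I where "I = (LBINT s. lam * exp (- lam * (\<tau> - s)) * indicator {0..\<tau>} s * kchi \<xi> (U (t + s, x + s *\<^sub>R a \<xi>)))"
  have "(LBINT s. N (q + s *\<^sub>R (1, a \<xi>), \<xi>) * indicator {0..\<tau>} s) =
   (LBINT s. exp (lam * (t + \<tau>)) * (lam * exp (- lam * (\<tau> - s)) * indicator {0..\<tau>} s * kchi \<xi> (U (t + s, x + s *\<^sub>R a \<xi>))))"
  proof (rule LBINT_cong[OF refl])
   fix s
   have eq1: "exp (lam * (t + s)) = exp (lam * (t + \<tau>)) * exp (- lam * (\<tau> - s))"
    by (subst exp_add[symmetric]) (simp add: algebra_simps)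
   have eq2: "N (q + s *\<^sub>R (1, a \<xi>), \<xi>) = lam * (kchi \<xi> (U (t + s, x + s *\<^sub>R a \<xi>)) * exp (lam * (t + s)))"
    by (simp add: N_def Mp_def E_def qx)
   show "N (q + s *\<^sub>R (1, a \<xi>), \<xi>) * indicator {0..\<tau>} s =
    exp (lam * (t + \<tau>)) * (lam * exp (- lam * (\<tau> - s)) * indicator {0..\<tau>} s * kchi \<xi> (U (t + s, x + s *\<^sub>R a \<xi>)))"
    unfolding eq2 eq1 by (simp only: mult_ac)
  qed
  also have "\<dots> = exp (lam * (t + \<tau>)) * I" unfolding I_def by (rule integral_mult_right_zero)
  finally have "F (t + \<tau>, x + \<tau> *\<^sub>R a \<xi>, \<xi>) * exp (lam * (t + \<tau>)) = F (t, x, \<xi>) * exp (lam * t) + exp (lam * (t + \<tau>)) * I"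
   using id q by (simp add: qx Fp_def E_def)
  moreover have "exp (lam * t) = exp (lam * (t + \<tau>)) * exp (- lam * \<tau>)"
   by (subst exp_add[symmetric]) (simp add: algebra_simps)
  ultimately have "exp (lam * (t + \<tau>)) * F (t + \<tau>, x + \<tau> *\<^sub>R a \<xi>, \<xi>) = exp (lam * (t + \<tau>)) * (exp (- lam * \<tau>) * F (t, x, \<xi>) + I)"
   by (simp add: algebra_simps)
  then show "F (fst q + \<tau>, snd q + \<tau> *\<^sub>R a \<xi>, \<xi>) = exp (- lam * \<tau>) * F (fst q, snd q, \<xi>) +
   (LBINT s. lam * exp (- lam * (\<tau> - s)) * indicator {0..\<tau>} s * kchi \<xi> (U (fst q + s, snd q + s *\<^sub>R a \<xi>)))"
   unfolding qx fst_conv snd_conv I_def[symmetric] by (subst (asm) mult_left_cancel) simp_all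
   qed
  qed
 qed
 \<comment> \<open>Recast as one measurable predicate of (t, x, \<xi>), to which
   \<open>AE_lborel_assoc\<close> applies.\<close>
 define A where "A z = F (fst z + \<tau>, fst (snd z) + \<tau> *\<^sub>R a (snd (snd z)), snd (snd z))" for z
 define B where "B z = (LBINT s. lam * exp (- lam * (\<tau> - s)) * indicator {0..\<tau>} s * kchi (snd (snd z)) (U (fst z + s, fst (snd z) + s *\<^sub>R a (snd (snd z)))))" for z
 define P where "P z \<longleftrightarrow> (0 < fst z \<and> fst z + \<tau> < T \<longrightarrow> A z = exp (- lam * \<tau>) * F z + B z)" for z
 have "AEL \<xi>. AEL q. P (fst q, snd q, \<xi>)"
  unfolding P_def A_def B_def fst_conv snd_conv using ae .
 moreover have "{z. P z} \<in> sets borel"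
 proof -
  have [measurable]: "B \<in> Bor" unfolding B_def[abs_def]
   by (rule lborel.borel_measurable_lebesgue_integral) measurable
  have [measurable]: "A \<in> Bor" unfolding A_def[abs_def] by measurable
  have "{z \<in> space borel. P z} \<in> sets borel" unfolding P_def by measurable
  then show ?thesis by simp
 qed
 ultimately have "AEL t. AEL z. P (t, z)" by (intro AE_lborel_assoc)
 then show ?thesis
 proof eventually_elim
  case (elim t)
  show ?case
  proof
   assume "0 < t \<and> t + \<tau> < T"
   with elim show "AEL z. F (t + \<tau>, fst z + \<tau> *\<^sub>R a (snd z), snd z) = exp (- lam * \<tau>) * F (t, z) +
    (LBINT s. lam * exp (- lam * (\<tau> - s)) * indicator {0..\<tau>} s * kchi (snd z) (U (t + s, fst z + s *\<^sub>R a (snd z))))"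
    unfolding P_def A_def B_def fst_conv snd_conv by simp
  qed
 qed
qed

section \<open>Exponential weights and the defect from free transport\<close>

lemma exp_weight:
 fixes lam \<tau> :: real
 assumes "0 \<le> \<tau>"
 shows "has_bochner_integral lborel (\<lambda>s. lam * exp (- lam * s) * indicator {0..\<tau>} s) (1 - exp (- lam * \<tau>))"
proof -
 have "has_bochner_integral lborel (\<lambda>s. lam * exp (- lam * s) * indicator {0..\<tau>} s) (- exp (- lam * \<tau>) - - exp (- lam * 0))"
  by (rule has_bochner_integral_FTC_Icc_real[where F="\<lambda>s. - exp (- lam * s)"])
   (use assms in \<open>auto intro!: derivative_eq_intros continuous_intros\<close>)
 then show ?thesis by simp
qed

text \<open>The defect in V1 of M from free transport over a time \<sigma> ending at r.\<close>

definition char_modulus :: "(real \<Rightarrow> 'b::euclidean_space) \<Rightarrow> (real \<times> 'b \<Rightarrow> real) \<Rightarrow> real \<Rightarrow> real \<Rightarrow> ennreal"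
 where "char_modulus a U r \<sigma> =
  (NINT z. nabs (kchi (snd z) (U (r - \<sigma>, fst z - \<sigma> *\<^sub>R a (snd z))) - kchi (snd z) (U (r, fst z))))"

lemma char_modulus_shear:
 fixes a :: "real \<Rightarrow> 'b::euclidean_space"
 assumes [measurable]: "a \<in> Bor" "U \<in> Bor"
 shows "(NINT z. nabs (kchi (snd z) (U (t + s, fst z + s *\<^sub>R a (snd z))) - kchi (snd z) (U (t + \<tau>, fst z + \<tau> *\<^sub>R a (snd z))))) =
  char_modulus a U (t + \<tau>) (\<tau> - s)"
proof -
 have [measurable]: "(\<lambda>z. nabs (kchi (snd z) (U (t + \<tau> - (\<tau> - s), fst z - (\<tau> - s) *\<^sub>R a (snd z))) - kchi (snd z) (U (t + \<tau>, fst z)))) \<in> Bor"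
  "(\<lambda>\<xi>. \<tau> *\<^sub>R a \<xi>) \<in> Bor" by measurable
 show ?thesis
  unfolding char_modulus_def
  by (subst nn_integral_shear[where c="\<lambda>\<xi>. \<tau> *\<^sub>R a \<xi>", symmetric], measurable)
   (simp add: algebra_simps)
qed

text \<open>The weights exp (- lam * \<tau>) and \<open>w\<close> have total mass 1, so M(t +
  \<tau>) can be subtracted inside Duhamel's formula. All terms are compared at the end of the
  characteristic; the shear back to (x, \<xi>) preserves L^1 norms.\<close>

lemma relaxation_step_estimate:
 fixes a :: "real \<Rightarrow> 'b::euclidean_space" and F :: "real \<times> ('b \<times> real) \<Rightarrow> real"
 assumes a[measurable]: "a \<in> Bor" and F[measurable]: "F \<in> Bor"
  and U[measurable]: "U \<in> Bor" and lam: "0 < lam" and \<tau>: "0 \<le> \<tau>"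
  and char: "AEL z. F (t + \<tau>, fst z + \<tau> *\<^sub>R a (snd z), snd z) = exp (- lam * \<tau>) * F (t, z) +
   (LBINT s. lam * exp (- lam * (\<tau> - s)) * indicator {0..\<tau>} s * kchi (snd z) (U (t + s, fst z + s *\<^sub>R a (snd z))))"
 shows "(NINT z. nabs (F (t + \<tau>, z) - kchi (snd z) (U (t + \<tau>, fst z)))) \<le>
  ennreal (exp (- lam * \<tau>)) * ((NINT z. nabs (F (t, z) - kchi (snd z) (U (t, fst z)))) + char_modulus a U (t + \<tau>) \<tau>) +
  (NINT s. ennreal (lam * exp (- lam * (\<tau> - s)) * indicator {0..\<tau>} s) * char_modulus a U (t + \<tau>) (\<tau> - s))"
proof -
 define w where "w s = lam * exp (- lam * (\<tau> - s)) * indicator {0..\<tau>} s" for s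
 have [measurable]: "w \<in> Bor" unfolding w_def[abs_def] by measurable
 have w0: "0 \<le> w s" for s using lam by (simp add: w_def)
 have w1: "has_bochner_integral lborel w (1 - exp (- lam * \<tau>))"
 proof -
  have "w = (\<lambda>s. lam * exp (- lam * (\<tau> - s)) * indicator {0..\<tau>} (\<tau> - s))" by (auto simp: w_def indicator_def)
  moreover have "(LBINT s. lam * exp (- lam * (\<tau> - s)) * indicator {0..\<tau>} (\<tau> - s)) = 1 - exp (- lam * \<tau>)"
   using integral_reflect_shift[of "\<lambda>s. lam * exp (- lam * s) * indicator {0..\<tau>} s" \<tau>] exp_weight[OF \<tau>, of lam]
   by (simp add: has_bochner_integral_iff)
  moreover have "lintegrable (\<lambda>s. lam * exp (- lam * (\<tau> - s)) * indicator {0..\<tau>} (\<tau> - s))"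
   using integrable_reflect_shift[of "\<lambda>s. lam * exp (- lam * s) * indicator {0..\<tau>} s" \<tau>] exp_weight[OF \<tau>, of lam]
   by (simp add: has_bochner_integral_iff)
  ultimately show ?thesis by (simp add: has_bochner_integral_iff)
 qed
 define E where "E = exp (- lam * \<tau>)"
 have ennreal_E: "ennreal (E * (x + y) + v) = ennreal E * (ennreal x + ennreal y) + ennreal v" if "0 \<le> x" "0 \<le> y" "0 \<le> v" for x y v
  using that by (simp add: E_def ennreal_mult)
 define k where "k s z = kchi (snd z) (U (t + s, fst z + s *\<^sub>R a (snd z)))" for s and z :: "'b \<times> real"
 have km: "(\<lambda>p. k (fst p) (snd p)) \<in> Bor" unfolding k_def by measurable
 have [measurable]: "(\<lambda>s. k s z) \<in> Bor" "(\<lambda>z. k s z) \<in> Bor" for s z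
  unfolding k_def by measurable
 have \<gamma>: "(NINT z. nabs (k s z - k \<tau> z)) = char_modulus a U (t + \<tau>) (\<tau> - s)" for s
  unfolding k_def by (rule char_modulus_shear[OF a U])
 have k0: "k 0 z = kchi (snd z) (U (t, fst z))" for z by (simp add: k_def)
 have "(NINT z. nabs (F (t + \<tau>, z) - kchi (snd z) (U (t + \<tau>, fst z)))) =
  (NINT z. nabs (F (t + \<tau>, fst z + \<tau> *\<^sub>R a (snd z), snd z) - k \<tau> z))"
 proof -
  have m: "(\<lambda>z. nabs (F (t + \<tau>, z) - kchi (snd z) (U (t + \<tau>, fst z)))) \<in> Bor"
   "(\<lambda>\<xi>. \<tau> *\<^sub>R a \<xi>) \<in> Bor" by measurable
  show ?thesis using nn_integral_shear[OF m] by (simp add: k_def)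
 qed
 also have "\<dots> \<le> (NINT z. ennreal E * (nabs (F (t, z) - k 0 z) + nabs (k 0 z - k \<tau> z)) +
  (NINT s. ennreal (w s) * nabs (k s z - k \<tau> z)))"
 proof (rule nn_integral_mono_AE, use char in eventually_elim)
  fix z assume id: "F (t + \<tau>, fst z + \<tau> *\<^sub>R a (snd z), snd z) = exp (- lam * \<tau>) * F (t, z) +
   (LBINT s. lam * exp (- lam * (\<tau> - s)) * indicator {0..\<tau>} s * kchi (snd z) (U (t + s, fst z + s *\<^sub>R a (snd z))))"
  have wk: "lintegrable (\<lambda>s. w s * k s z)"
   using w1 by (intro integrable_mult_bounded[where C=1]) (auto simp: has_bochner_integral_iff k_def abs_kchi_le)
  have wc: "lintegrable (\<lambda>s. w s * k \<tau> z)" using w1 by (simp add: has_bochner_integral_iff)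
  define I where "I = (LBINT s. w s * (k s z - k \<tau> z))"
  have wi: "lintegrable (\<lambda>s. w s * (k s z - k \<tau> z))" using wk wc by (simp add: right_diff_distrib)
  have "I = (LBINT s. w s * k s z) - (1 - E) * k \<tau> z"
   unfolding I_def right_diff_distrib using wk wc w1 by (simp add: has_bochner_integral_iff E_def)
  moreover have "F (t + \<tau>, fst z + \<tau> *\<^sub>R a (snd z), snd z) = E * F (t, z) + (LBINT s. w s * k s z)"
   using id unfolding E_def w_def k_def .
  ultimately have "F (t + \<tau>, fst z + \<tau> *\<^sub>R a (snd z), snd z) - k \<tau> z = E * ((F (t, z) - k 0 z) + (k 0 z - k \<tau> z)) + I"
   by (simp add: algebra_simps)
  moreover have "E * \<bar>(F (t, z) - k 0 z) + (k 0 z - k \<tau> z)\<bar> \<le> E * (\<bar>F (t, z) - k 0 z\<bar> + \<bar>k 0 z - k \<tau> z\<bar>)"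
   by (intro mult_left_mono abs_triangle_ineq) (simp add: E_def)
  moreover have "\<bar>E * ((F (t, z) - k 0 z) + (k 0 z - k \<tau> z))\<bar> = E * \<bar>(F (t, z) - k 0 z) + (k 0 z - k \<tau> z)\<bar>"
   unfolding abs_mult by (simp add: E_def)
  ultimately have "\<bar>F (t + \<tau>, fst z + \<tau> *\<^sub>R a (snd z), snd z) - k \<tau> z\<bar> \<le> E * (\<bar>F (t, z) - k 0 z\<bar> + \<bar>k 0 z - k \<tau> z\<bar>) + \<bar>I\<bar>"
   by linarith
  then have le1: "nabs (F (t + \<tau>, fst z + \<tau> *\<^sub>R a (snd z), snd z) - k \<tau> z) \<le> ennreal (E * (\<bar>F (t, z) - k 0 z\<bar> + \<bar>k 0 z - k \<tau> z\<bar>) + \<bar>I\<bar>)"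
   by (rule ennreal_leI)
  have le2: "ennreal (E * (\<bar>F (t, z) - k 0 z\<bar> + \<bar>k 0 z - k \<tau> z\<bar>) + \<bar>I\<bar>) = ennreal E * (nabs (F (t, z) - k 0 z) + nabs (k 0 z - k \<tau> z)) + nabs I"
   by (rule ennreal_E) auto
  have "nabs I \<le> (NINT s. ennreal (w s) * nabs (k s z - k \<tau> z))"
  proof -
   have "nabs I \<le> (NINT s. nabs (w s * (k s z - k \<tau> z)))"
    unfolding I_def using integral_norm_bound_ennreal[OF wi] by simp
   then show ?thesis using w0 by (simp add: abs_mult ennreal_mult)
  qed
  from order_trans[OF le1[unfolded le2] add_left_mono[OF this]]
  show "nabs (F (t + \<tau>, fst z + \<tau> *\<^sub>R a (snd z), snd z) - k \<tau> z) \<le>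
   ennreal E * (nabs (F (t, z) - k 0 z) + nabs (k 0 z - k \<tau> z)) + (NINT s. ennreal (w s) * nabs (k s z - k \<tau> z))"
   .
 qed
 also have "\<dots> = ennreal E * ((NINT z. nabs (F (t, z) - k 0 z)) + (NINT z. nabs (k 0 z - k \<tau> z))) +
  (NINT z. NINT s. ennreal (w s) * nabs (k s z - k \<tau> z))"
 proof -
  have [measurable]: "(\<lambda>z. NINT s. ennreal (w s) * nabs (k s z - k \<tau> z)) \<in> Bor"
   unfolding k_def by (rule lborel.borel_measurable_nn_integral) measurable
  show ?thesis by (simp add: nn_integral_add nn_integral_cmult)
 qed
 also have "(NINT z. NINT s. ennreal (w s) * nabs (k s z - k \<tau> z)) =
  (NINT s. NINT z. ennreal (w s) * nabs (k s z - k \<tau> z))"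
  unfolding k_def by (rule lborel_pair.Fubini') measurable
 also have "\<dots> = (NINT s. ennreal (w s) * char_modulus a U (t + \<tau>) (\<tau> - s))"
  by (intro nn_integral_cong) (simp add: nn_integral_cmult \<gamma>)
 finally show ?thesis using \<gamma>[of 0] by (simp add: k0 E_def w_def)
qed

lemma AE_lborel_real_interval:
 assumes "AE x::real in lborel. P x" "a < b"
 shows "\<exists>x. a < x \<and> x < b \<and> P x"
proof (rule ccontr)
 assume "\<not> ?thesis"
 then have "AEL x. x \<notin> {a<..<b}" using assms(1) by (auto elim!: eventually_mono)
 then have "{a<..<b} \<in> null_sets lborel" by (subst AE_iff_null_sets) auto
 then show False using assms(2) by (auto simp: null_sets_def)
qed

lemma ennreal_LINT_abs: "integrable M f \<Longrightarrow> (\<integral>\<^sup>+x. nabs (f x) \<partial>M) = ennreal (LINT x|M. \<bar>f x :: real\<bar>)"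
 by (rule nn_integral_eq_integral) auto

lemma slab_flow_kchi_dist_continuous:
 assumes F: "slab_flow T F" and U: "slab_flow T U"
 shows "continuous_on {0..T} (\<lambda>t. LBINT z. \<bar>F (t, z) - kchi (snd z) (U (t, fst z))\<bar>)"
 unfolding continuous_on_def
proof
 fix t assume t: "t \<in> {0..T}"
 define D where "D t = (LBINT z. \<bar>F (t, z) - kchi (snd z) (U (t, fst z))\<bar>)" for t
 note iF = slab_flow_integrable(2)[OF F] and iU = slab_flow_integrable(2)[OF U]
 have "((\<lambda>s. D s - D t) \<longlongrightarrow> 0) (at t within {0..T})"
 proof (rule Lim_null_comparison)
  show "eventually (\<lambda>s. norm (D s - D t) \<le> (LBINT z. \<bar>F (s, z) - F (t, z)\<bar>) + (LBINT x. \<bar>U (s, x) - U (t, x)\<bar>)) (at t within {0..T})"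
  proof (intro always_eventually allI)
   fix s
   have "\<bar>D s - D t\<bar> \<le> (LBINT z. \<bar>F (s, z) - F (t, z)\<bar>) + (LBINT z. \<bar>kchi (snd z) (U (s, fst z)) - kchi (snd z) (U (t, fst z))\<bar>)"
    unfolding D_def by (rule abs_L1_dist_diff) (rule iF kchi_prod_L1(3)[OF iU iU])+
   then show "norm (D s - D t) \<le> (LBINT z. \<bar>F (s, z) - F (t, z)\<bar>) + (LBINT x. \<bar>U (s, x) - U (t, x)\<bar>)"
    using kchi_prod_L1(2)[OF iU[of s] iU[of t]] by simp
  qed
  have "((\<lambda>s. (LBINT z. \<bar>F (s, z) - F (t, z)\<bar>) + (LBINT x. \<bar>U (s, x) - U (t, x)\<bar>)) \<longlongrightarrow> 0 + 0) (at t within {0..T})"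
   using F U t by (intro tendsto_add) (auto simp: slab_flow_def)
  then show "((\<lambda>s. (LBINT z. \<bar>F (s, z) - F (t, z)\<bar>) + (LBINT x. \<bar>U (s, x) - U (t, x)\<bar>)) \<longlongrightarrow> 0) (at t within {0..T})"
   by simp
 qed
 then show "((\<lambda>t. LBINT z. \<bar>F (t, z) - kchi (snd z) (U (t, fst z))\<bar>) \<longlongrightarrow> (LBINT z. \<bar>F (t, z) - kchi (snd z) (U (t, fst z))\<bar>)) (at t within {0..T})"
  unfolding D_def[symmetric] by (rule LIM_zero_cancel)
qed

definition relaxation_weight :: "real \<Rightarrow> real \<Rightarrow> (real \<Rightarrow> real) \<Rightarrow> real"
 where "relaxation_weight lam T g = (LBINT s. lam * exp (- lam * s) * indicator {0..T} s * g s)"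

lemma integrable_exp_weight:
 fixes g :: "real \<Rightarrow> real"
 assumes g: "g \<in> Bor" and g0: "\<And>s. 0 \<le> s \<Longrightarrow> s \<le> T \<Longrightarrow> 0 \<le> g s \<and> g s \<le> P"
  and T: "0 \<le> T" and lam: "0 < lam"
 shows "lintegrable (\<lambda>s. lam * exp (- lam * s) * indicator {0..T} s * g s)"
proof -
 have "lintegrable (\<lambda>s. lam * exp (- lam * s) * indicator {0..T} s * (indicator {0..T} s * g s))"
 proof (rule integrable_mult_bounded[where C="\<bar>P\<bar>"])
  show "lintegrable (\<lambda>s. lam * exp (- lam * s) * indicator {0..T} s)"
   using exp_weight[OF T, of lam] by (simp add: has_bochner_integral_iff)
  show "(\<lambda>s. indicator {0..T} s * g s) \<in> BorL" using g by measurable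
  show "\<bar>indicator {0..T} s * g s\<bar> \<le> \<bar>P\<bar>" for s
   using g0[of s] by (auto simp: indicator_def)
 qed
 moreover have "lam * exp (- lam * s) * indicator {0..T} s * (indicator {0..T} s * g s) = lam * exp (- lam * s) * indicator {0..T} s * g s" for s
  by (simp add: indicator_def)
 ultimately show ?thesis by (simp only:)
qed

text \<open>The step estimate is available for almost every starting time only, so starting times t
  k \<rightarrow> 0 and lengths \<tau> k \<rightarrow> T are chosen and the limit is taken by
  continuity in V1. The term P bounds the defect of transporting the initial state over the whole
  time, hence its factor exp (- lam * T).\<close>

theorem relaxation_estimate:
 fixes a :: "real \<Rightarrow> 'b::euclidean_space" and F :: "real \<times> ('b \<times> real) \<Rightarrow> real"
 assumes a: "locally_bounded a" and F: "slab_flow T F" and U: "slab_flow T U" and lam: "0 < lam"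
  and weak: "\<And>\<Phi> \<eta>. test_function ({0<..<T} \<times> UNIV) \<Phi> \<Longrightarrow> test_function UNIV \<eta> \<Longrightarrow>
   (LBINT p. F (fst (fst p), snd (fst p), snd p) * flux (\<lambda>\<xi>. (1, a \<xi>)) \<eta> \<Phi> p) =
   - (LBINT p. lam * (kp U p - F (fst (fst p), snd (fst p), snd p)) * (\<eta> (snd p) * \<Phi> (fst p)))"
  and g: "g \<in> Bor" and g0: "\<And>s. 0 \<le> s \<Longrightarrow> s \<le> T \<Longrightarrow> 0 \<le> g s \<and> g s \<le> P"
  and mod: "\<And>e. 0 < e \<Longrightarrow> \<exists>d>0. \<forall>r s. T - d < r \<longrightarrow> r < T \<longrightarrow> 0 \<le> s \<longrightarrow> s \<le> r \<longrightarrow> char_modulus a U r s \<le> ennreal (g s + e)"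
 shows "(LBINT z. \<bar>F (T, z) - kchi (snd z) (U (T, fst z))\<bar>) \<le>
  exp (- lam * T) * ((LBINT z. \<bar>F (0, z) - kchi (snd z) (U (0, fst z))\<bar>) + P) + relaxation_weight lam T g"
proof -
 have T: "0 < T" using U by (simp add: slab_flow_def)
 have [measurable]: "F \<in> Bor" "U \<in> Bor" "a \<in> Bor"
  using F U a by (auto simp: slab_flow_def locally_bounded_def)
 note [measurable] = g
 have P0: "0 \<le> P" using g0[of 0] T by auto
 define D where "D t = (LBINT z. \<bar>F (t, z) - kchi (snd z) (U (t, fst z))\<bar>)" for t
 define I where "I = relaxation_weight lam T g"
 have D_eq: "(NINT z. nabs (F (t, z) - kchi (snd z) (U (t, fst z)))) = ennreal (D t)" for t
  unfolding D_def using slab_flow_integrable(2)[OF F, of t] kchi_prod_L1(3)[OF slab_flow_integrable(2)[OF U, of t] slab_flow_integrable(2)[OF U, of t]]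
  by (intro ennreal_LINT_abs) simp
 have D0: "0 \<le> D t" for t by (simp add: D_def)
 have D_cont: "continuous_on {0..T} D" unfolding D_def[abs_def] by (rule slab_flow_kchi_dist_continuous[OF F U])
 define \<tau> where "\<tau> k = T - T / real (k + 2)" for k
 have \<tau>: "0 \<le> \<tau> k" "\<tau> k < T" for k using T by (auto simp: \<tau>_def field_simps)
 define char where "char k t \<longleftrightarrow> (AEL z. F (t + \<tau> k, fst z + \<tau> k *\<^sub>R a (snd z), snd z) = exp (- lam * \<tau> k) * F (t, z) +
   (LBINT s. lam * exp (- lam * (\<tau> k - s)) * indicator {0..\<tau> k} s * kchi (snd z) (U (t + s, fst z + s *\<^sub>R a (snd z)))))" for k t
 have "\<exists>t>0. t < T - \<tau> k \<and> char k t" for k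
 proof -
  have "AEL t. 0 < t \<and> t + \<tau> k < T \<longrightarrow> char k t"
   unfolding char_def by (rule relaxation_characteristics[OF a F U lam weak \<tau>(1)])
  from AE_lborel_real_interval[OF this, of 0 "T - \<tau> k"] \<tau>(2)[of k]
  obtain t where "0 < t" "t < T - \<tau> k" "0 < t \<and> t + \<tau> k < T \<longrightarrow> char k t" by auto
  then show ?thesis by (intro exI[of _ t]) (simp add: less_diff_eq)
 qed
 then obtain t where t: "\<And>k. 0 < t k" "\<And>k. t k < T - \<tau> k" and char: "\<And>k. char k (t k)" by metis
 define r where "r k = t k + \<tau> k" for k
 have lim0: "(\<lambda>k. T / real (k + 2)) \<longlonglongrightarrow> 0"
  using LIMSEQ_ignore_initial_segment[OF lim_const_over_n[of T], of 2] by simp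
 have lim\<tau>: "\<tau> \<longlonglongrightarrow> T" unfolding \<tau>_def[abs_def] using tendsto_diff[OF tendsto_const[of T] lim0] by simp
 have limt: "t \<longlonglongrightarrow> 0"
 proof (rule real_tendsto_sandwich[OF _ _ tendsto_const lim0])
  show "eventually (\<lambda>k. 0 \<le> t k) sequentially" using t(1) by (intro always_eventually allI less_imp_le)
  show "eventually (\<lambda>k. t k \<le> T / real (k + 2)) sequentially"
   using t(2) by (intro always_eventually allI less_imp_le) (simp add: \<tau>_def)
 qed
 have limr: "r \<longlonglongrightarrow> T" unfolding r_def[abs_def] using tendsto_add[OF limt lim\<tau>] by simp
 have Dt: "(\<lambda>k. D (t k)) \<longlonglongrightarrow> D 0"
 proof (rule continuous_on_tendsto_compose[OF D_cont limt])
  show "eventually (\<lambda>k. t k \<in> {0..T}) sequentially"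
  proof (intro always_eventually allI)
   fix k show "t k \<in> {0..T}" using t(1)[of k] t(2)[of k] \<tau>(1)[of k] by auto
  qed
 qed (use T in auto)
 have Dr: "(\<lambda>k. D (r k)) \<longlonglongrightarrow> D T"
 proof (rule continuous_on_tendsto_compose[OF D_cont limr])
  show "eventually (\<lambda>k. r k \<in> {0..T}) sequentially"
  proof (intro always_eventually allI)
   fix k show "r k \<in> {0..T}" using t(1)[of k] t(2)[of k] \<tau>(1)[of k] by (auto simp: r_def)
  qed
 qed (use T in auto)
 have Ii: "lintegrable (\<lambda>s. lam * exp (- lam * s) * indicator {0..T} s * g s)"
  by (rule integrable_exp_weight[OF g g0 _ lam]) (use T in auto)
 have pos: "0 \<le> lam * exp (- lam * s) * indicator {0..T} s * g s" for s
  using g0[of s] lam by (cases "s \<in> {0..T}") auto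
 have step: "D (r k) \<le> exp (- lam * \<tau> k) * (D (t k) + (P + e)) + (I + e)"
  if e: "0 < e" and m: "\<And>s. 0 \<le> s \<Longrightarrow> s \<le> r k \<Longrightarrow> char_modulus a U (r k) s \<le> ennreal (g s + e)" for e k
 proof -
  have \<tau>r: "\<tau> k \<le> r k" using t(1)[of k] by (simp add: r_def)
  define h where "h s = lam * exp (- lam * s) * indicator {0..\<tau> k} s" for s
  have [measurable]: "h \<in> Bor" unfolding h_def[abs_def] by measurable
  have h0: "0 \<le> h s" for s using lam by (simp add: h_def)
  have "(NINT s. ennreal (lam * exp (- lam * (\<tau> k - s)) * indicator {0..\<tau> k} s) * char_modulus a U (r k) (\<tau> k - s))
   \<le> (NINT s. ennreal (h (\<tau> k - s) * (g (\<tau> k - s) + e)))"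
  proof (rule nn_integral_mono)
   fix s
   show "ennreal (lam * exp (- lam * (\<tau> k - s)) * indicator {0..\<tau> k} s) * char_modulus a U (r k) (\<tau> k - s) \<le> ennreal (h (\<tau> k - s) * (g (\<tau> k - s) + e))"
   proof (cases "s \<in> {0..\<tau> k}")
    case True
    have "char_modulus a U (r k) (\<tau> k - s) \<le> ennreal (g (\<tau> k - s) + e)" using True \<tau>r by (intro m) auto
    then have "ennreal (h (\<tau> k - s)) * char_modulus a U (r k) (\<tau> k - s) \<le> ennreal (h (\<tau> k - s)) * ennreal (g (\<tau> k - s) + e)"
     by (intro mult_left_mono) auto
    also have "\<dots> = ennreal (h (\<tau> k - s) * (g (\<tau> k - s) + e))"
     using h0 by (simp add: ennreal_mult')
    finally show ?thesis using True by (simp add: h_def)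
   qed simp
  qed
  also have "\<dots> = (NINT s. ennreal (h s * (g s + e)))"
   by (rule nn_integral_reflect_shift[where f="\<lambda>s. ennreal (h s * (g s + e))"]) measurable
  \<comment> \<open>Since g is nonnegative, enlarging the range from [0, \<tau> k] to [0, T] only
    increases the integral and removes the dependence on k.\<close>
  also have "\<dots> \<le> (NINT s. ennreal (lam * exp (- lam * s) * indicator {0..T} s * g s) + ennreal e * ennreal (h s))"
  proof (rule nn_integral_mono)
   fix s
   have "h s * (g s + e) \<le> lam * exp (- lam * s) * indicator {0..T} s * g s + e * h s"
   proof (cases "s \<in> {0..\<tau> k}")
    case True
    then show ?thesis using \<tau>(2)[of k] by (simp add: h_def algebra_simps)
   next
    case False
    then show ?thesis using pos[of s] by (simp add: h_def)
   qed
   then have "ennreal (h s * (g s + e)) \<le> ennreal (lam * exp (- lam * s) * indicator {0..T} s * g s + e * h s)" by (rule ennreal_leI)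
   also have "\<dots> = ennreal (lam * exp (- lam * s) * indicator {0..T} s * g s) + ennreal (e * h s)"
    by (rule ennreal_plus[OF pos]) (use e h0 in simp)
   also have "ennreal (e * h s) = ennreal e * ennreal (h s)" by (rule ennreal_mult) (use e h0 in auto)
   finally show "ennreal (h s * (g s + e)) \<le> ennreal (lam * exp (- lam * s) * indicator {0..T} s * g s) + ennreal e * ennreal (h s)" .
  qed
  also have "\<dots> = (NINT s. ennreal (lam * exp (- lam * s) * indicator {0..T} s * g s)) + ennreal e * (NINT s. ennreal (h s))"
   by (simp add: nn_integral_add nn_integral_cmult)
  also have "(NINT s. ennreal (lam * exp (- lam * s) * indicator {0..T} s * g s)) = ennreal I"
   unfolding I_def relaxation_weight_def
   by (rule nn_integral_eq_integral[OF Ii AE_I2[OF pos]])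
  also have "(NINT s. ennreal (h s)) = ennreal (1 - exp (- lam * \<tau> k))"
   using exp_weight[OF \<tau>(1)[of k], of lam] h0 unfolding h_def[symmetric]
   by (subst nn_integral_eq_integral) (auto simp: has_bochner_integral_iff)
  also have "ennreal e * \<dots> \<le> ennreal e * 1"
   by (intro mult_left_mono) (auto simp: ennreal_le_1)
  finally have int: "(NINT s. ennreal (lam * exp (- lam * (\<tau> k - s)) * indicator {0..\<tau> k} s) * char_modulus a U (r k) (\<tau> k - s)) \<le> ennreal I + ennreal e"
   by (simp add: add_left_mono)
  have I0: "0 \<le> I" unfolding I_def relaxation_weight_def
   by (rule integral_nonneg_AE[OF AE_I2[OF pos]])
  have "char_modulus a U (r k) (\<tau> k) \<le> ennreal (g (\<tau> k) + e)" by (rule m[OF \<tau>(1) \<tau>r])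
  also have "\<dots> \<le> ennreal (P + e)" using g0[OF \<tau>(1)[of k]] \<tau>(2)[of k] by (intro ennreal_leI) auto
  finally have cm: "char_modulus a U (r k) (\<tau> k) \<le> ennreal (P + e)" .
  have "ennreal (D (r k)) \<le> ennreal (exp (- lam * \<tau> k)) * (ennreal (D (t k)) + char_modulus a U (r k) (\<tau> k)) +
   (NINT s. ennreal (lam * exp (- lam * (\<tau> k - s)) * indicator {0..\<tau> k} s) * char_modulus a U (r k) (\<tau> k - s))"
   using relaxation_step_estimate[OF _ _ _ lam \<tau>(1) char[unfolded char_def], of k] unfolding D_eq r_def[symmetric] by simp
  also have "\<dots> \<le> ennreal (exp (- lam * \<tau> k)) * (ennreal (D (t k)) + ennreal (P + e)) + (ennreal I + ennreal e)"
   by (intro add_mono mult_left_mono int cm order_refl) auto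
  also have "\<dots> = ennreal (exp (- lam * \<tau> k) * (D (t k) + (P + e)) + (I + e))"
   using e P0 I0 D0[of "t k"] by (simp add: ennreal_mult)
  finally show ?thesis
   using e P0 I0 D0[of "t k"] by (subst (asm) ennreal_le_iff) auto
 qed
 have eps: "D T \<le> exp (- lam * T) * (D 0 + (P + e)) + (I + e)" if e: "0 < e" for e
 proof (rule LIMSEQ_le[OF Dr])
  show "(\<lambda>k. exp (- lam * \<tau> k) * (D (t k) + (P + e)) + (I + e)) \<longlonglongrightarrow> exp (- lam * T) * (D 0 + (P + e)) + (I + e)"
   by (intro tendsto_intros lim\<tau> Dt)
  obtain d where d: "d > 0" "\<And>r s. T - d < r \<Longrightarrow> r < T \<Longrightarrow> 0 \<le> s \<Longrightarrow> s \<le> r \<Longrightarrow> char_modulus a U r s \<le> ennreal (g s + e)"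
   using mod[OF e] by blast
  have "eventually (\<lambda>k. T - d < r k) sequentially" by (rule order_tendstoD(1)[OF limr]) (use d in simp)
  then obtain n where "\<And>k. k \<ge> n \<Longrightarrow> T - d < r k" by (auto simp: eventually_sequentially)
  moreover have "r k < T" for k using t(2)[of k] by (simp add: r_def)
  ultimately show "\<exists>n. \<forall>k\<ge>n. D (r k) \<le> exp (- lam * \<tau> k) * (D (t k) + (P + e)) + (I + e)"
   using step[OF e] d(2) by blast
 qed
 have "D T \<le> exp (- lam * T) * (D 0 + P) + I"
 proof (rule field_le_epsilon)
  fix e :: real assume e: "0 < e"
  have "exp (- lam * T) * (e / 2) \<le> 1 * (e / 2)" using e lam T by (intro mult_right_mono) auto
  moreover have "exp (- lam * T) * (D 0 + (P + e / 2)) = exp (- lam * T) * (D 0 + P) + exp (- lam * T) * (e / 2)"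
   by (simp add: algebra_simps)
  moreover have "D T \<le> exp (- lam * T) * (D 0 + (P + e / 2)) + (I + e / 2)" by (rule eps) (use e in simp)
  ultimately show "D T \<le> exp (- lam * T) * (D 0 + P) + I + e" by linarith
 qed
 then show ?thesis by (simp add: D_def I_def)
qed

section \<open>From the equations of the statement to flows on a slab\<close>

definition tensor_test :: "(real \<times> 'b::euclidean_space \<Rightarrow> real) \<Rightarrow> (real \<Rightarrow> real) \<Rightarrow> real \<times> 'b \<times> real \<Rightarrow> real"
 where "tensor_test \<Phi> \<eta> z = \<Phi> (fst z, fst (snd z)) * \<eta> (snd (snd z))"

lemma tensor_test:
 fixes \<Phi> :: "real \<times> 'b::euclidean_space \<Rightarrow> real"
 assumes \<Phi>: "test_function (I \<times> UNIV) \<Phi>" and \<eta>: "test_function UNIV \<eta>"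
 shows "test_function (I \<times> UNIV \<times> UNIV) (tensor_test \<Phi> \<eta>)"
  and "Fd (tensor_test \<Phi> \<eta>) z v = \<Phi> (fst z, fst (snd z)) * (deriv \<eta> (snd (snd z)) * snd (snd v)) +
   Fd \<Phi> (fst z, fst (snd z)) (fst v, fst (snd v)) * \<eta> (snd (snd z))"
proof -
 have sm: "smooth_fun \<Phi>" "smooth_fun \<eta>" using \<Phi> \<eta> test_function_smooth by auto
 define L1 where "L1 z = (fst z, fst (snd z))" for z :: "real \<times> 'b \<times> real"
 define L2 where "L2 z = snd (snd z)" for z :: "real \<times> 'b \<times> real"
 have L: "bounded_linear L1" "bounded_linear L2" unfolding L1_def[abs_def] L2_def[abs_def]
  by (intro bounded_linear_Pair bounded_linear_fst bounded_linear_compose[OF bounded_linear_fst bounded_linear_snd]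
   bounded_linear_compose[OF bounded_linear_snd bounded_linear_snd])+
 have \<phi>_def: "tensor_test \<Phi> \<eta> = (\<lambda>z. \<Phi> (L1 z) * \<eta> (L2 z))" by (auto simp: tensor_test_def L1_def L2_def)
 have "Fd (tensor_test \<Phi> \<eta>) z v = \<Phi> (L1 z) * (deriv \<eta> (L2 z) * L2 v) + Fd \<Phi> (L1 z) (L1 v) * \<eta> (L2 z)"
  unfolding \<phi>_def
  using frechet_derivative_mult_smooth[OF smooth_fun_linear_compose(1)[OF sm(1) L(1)] smooth_fun_linear_compose(1)[OF sm(2) L(2)], of z v]
  by (simp add: smooth_fun_linear_compose(2)[OF sm(1) L(1)] smooth_fun_linear_compose(2)[OF sm(2) L(2)] smooth_fun_real_frechet[OF sm(2)])
 then show "Fd (tensor_test \<Phi> \<eta>) z v = \<Phi> (fst z, fst (snd z)) * (deriv \<eta> (snd (snd z)) * snd (snd v)) +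
   Fd \<Phi> (fst z, fst (snd z)) (fst v, fst (snd v)) * \<eta> (snd (snd z))"
  by (simp add: L1_def L2_def)
 show "test_function (I \<times> UNIV \<times> UNIV) (tensor_test \<Phi> \<eta>)"
 proof (rule test_functionI)
  show "smooth_fun (tensor_test \<Phi> \<eta>)"
   unfolding \<phi>_def by (rule smooth_fun_mult[OF smooth_fun_linear_compose(1)[OF sm(1) L(1)] smooth_fun_linear_compose(1)[OF sm(2) L(2)]])
  let ?K = "closure {q. \<Phi> q \<noteq> 0}" and ?J = "closure {\<xi>. \<eta> \<xi> \<noteq> 0}"
  have "compact (?K \<times> ?J)" using \<Phi> \<eta> by (auto simp: test_function_iff intro: compact_Times)
  then show "compact ((\<lambda>p. (fst (fst p), snd (fst p), snd p)) ` (?K \<times> ?J))"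
   by (intro compact_continuous_image continuous_intros)
  show "(\<lambda>p. (fst (fst p), snd (fst p), snd p)) ` (?K \<times> ?J) \<subseteq> I \<times> UNIV \<times> UNIV"
   using \<Phi> by (auto simp: test_function_iff)
  show "tensor_test \<Phi> \<eta> z = 0" if z: "z \<notin> (\<lambda>p. (fst (fst p), snd (fst p), snd p)) ` (?K \<times> ?J)" for z
  proof (rule ccontr)
   assume "tensor_test \<Phi> \<eta> z \<noteq> 0"
   then have "(L1 z, L2 z) \<in> ?K \<times> ?J"
    using closure_subset[of "{q. \<Phi> q \<noteq> 0}"] closure_subset[of "{\<xi>. \<eta> \<xi> \<noteq> 0}"] by (auto simp: \<phi>_def)
   then have "z \<in> (\<lambda>p. (fst (fst p), snd (fst p), snd p)) ` (?K \<times> ?J)"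
    by (intro image_eqI[of _ _ "(L1 z, L2 z)"]) (auto simp: L1_def L2_def)
   with z show False by blast
  qed
 qed
qed

lemma set_integral_slab:
 fixes h :: "real \<times> 'z::euclidean_space \<Rightarrow> real"
 assumes h: "lintegrable h" and out: "\<And>t z. t \<notin> {0..T} \<Longrightarrow> h (t, z) = 0"
 shows "(LINT t:{0..T}|lborel. (LBINT z. h (t, z))) = (LBINT z. h z)"
proof -
 have "(LINT t:{0..T}|lborel. (LBINT z. h (t, z))) = (LBINT t. LBINT z. h (t, z))"
  unfolding set_lebesgue_integral_def
 proof (intro LBINT_cong refl)
  fix t
  show "indicator {0..T} t *\<^sub>R (LBINT z. h (t, z)) = (LBINT z. h (t, z))"
   using out[of t] by (cases "t \<in> {0..T}") auto
 qed
 also have "\<dots> = (LBINT z. h z)" by (rule lborel_integral_prod_fst[OF h])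
 finally show ?thesis .
qed

text \<open>In the pairing of the statement, \<open>a\<close> is replaced by its representative and
  the time slices of \<open>g\<close> by a jointly measurable function; both change the inner
  integrands on null sets only.\<close>

lemma transport_pairing_tensor:
 fixes a a' :: "real \<Rightarrow> real^'n::finite" and G :: "real \<times> (real^'n) \<times> real \<Rightarrow> real"
 assumes a': "locally_bounded a'" and aa': "AEL \<xi>. a' \<xi> = a \<xi>" and a[measurable]: "a \<in> Bor"
  and \<Phi>: "test_function (I \<times> UNIV) \<Phi>" and \<eta>: "test_function UNIV \<eta>"
  and G[measurable]: "G \<in> Bor" and out: "\<And>t z. t \<notin> {0..T} \<Longrightarrow> G (t, z) = 0"
  and Gg: "\<And>t. t \<in> {0..T} \<Longrightarrow> AEL z. g t z = G (t, z)" and gi: "\<And>t. t \<in> {0..T} \<Longrightarrow> lintegrable (g t)"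
  and i: "lintegrable (\<lambda>p. G (fst (fst p), snd (fst p), snd p) * flux (\<lambda>\<xi>. (1, a' \<xi>)) \<eta> \<Phi> p)"
 shows "transport_pairing T a g (tensor_test \<Phi> \<eta>) =
  - (LBINT p. G (fst (fst p), snd (fst p), snd p) * flux (\<lambda>\<xi>. (1, a' \<xi>)) \<eta> \<Phi> p)"
proof -
 have sm: "smooth_fun \<Phi>" "smooth_fun \<eta>" using \<Phi> \<eta> test_function_smooth by auto
 have [measurable]: "\<eta> \<in> Bor" "a' \<in> Bor"
  using smooth_fun_borel[OF sm(2)] a' by (auto simp: locally_bounded_def)
 define h where "h z = G z * flux (\<lambda>\<xi>. (1, a' \<xi>)) \<eta> \<Phi> ((fst z, fst (snd z)), snd (snd z))" for z
 have hm[measurable]: "h \<in> Bor" unfolding h_def[abs_def]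
  by (intro borel_measurable_times flux_borel[OF locally_bounded_Pair[OF a'] sm(2,1)]) measurable
 have h: "(LBINT p. G (fst (fst p), snd (fst p), snd p) * flux (\<lambda>\<xi>. (1, a' \<xi>)) \<eta> \<Phi> p) = (LBINT z. h z)" "lintegrable h"
  using integral_lborel_assoc[OF hm] i by (simp_all add: h_def)
 have inner: "(LINT (x, \<xi>)|lborel. g t (x, \<xi>) * (Fd (tensor_test \<Phi> \<eta>) (t, x, \<xi>) (1, 0, 0) +
   Fd (tensor_test \<Phi> \<eta>) (t, x, \<xi>) (0, a \<xi>, 0))) = (LBINT z. h (t, z))" if t: "t \<in> {0..T}" for t
 proof -
  have eq: "Fd (tensor_test \<Phi> \<eta>) (t, z) (1, 0, 0) + Fd (tensor_test \<Phi> \<eta>) (t, z) (0, v, 0) =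
   \<eta> (snd z) * Fd \<Phi> (t, fst z) (1, v)" for z v
  proof -
   have "Fd \<Phi> (t, fst z) ((1, 0) + (0, v)) = Fd \<Phi> (t, fst z) (1, 0) + Fd \<Phi> (t, fst z) (0, v)"
    by (rule linear_add[OF bounded_linear.linear[OF smooth_fun_linear[OF sm(1)]]])
   then show ?thesis by (simp add: tensor_test(2)[OF \<Phi> \<eta>] algebra_simps)
  qed
  have aeS: "AEL z. a' (snd z) = a (snd z)" for z :: "(real^'n) \<times> real"
  proof -
   have "{z \<in> space borel. a' (snd z) = a (snd z)} \<in> sets (borel :: ((real^'n) \<times> real) measure)" by measurable
   then show ?thesis using aa' by (intro AE_lborel_pairI) auto
  qed
  have [measurable]: "g t \<in> Bor" using gi[OF t] by auto
  have "(LINT (x, \<xi>)|lborel. g t (x, \<xi>) * (Fd (tensor_test \<Phi> \<eta>) (t, x, \<xi>) (1, 0, 0) + Fd (tensor_test \<Phi> \<eta>) (t, x, \<xi>) (0, a \<xi>, 0)))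
   = (LBINT z. g t z * (\<eta> (snd z) * Fd \<Phi> (t, fst z) (1, a (snd z))))"
   by (intro LBINT_cong) (auto simp: eq)
  also have "\<dots> = (LBINT z. h (t, z))"
  proof (rule integral_cong_AE)
   show "(\<lambda>z. g t z * (\<eta> (snd z) * Fd \<Phi> (t, fst z) (1, a (snd z)))) \<in> BorL"
    by (intro borel_measurable_times borel_measurable_frechet_smooth sm) measurable
   show "(\<lambda>z. h (t, z)) \<in> BorL" by measurable
   show "AEL z. g t z * (\<eta> (snd z) * Fd \<Phi> (t, fst z) (1, a (snd z))) = h (t, z)"
    using Gg[OF t] aeS by eventually_elim (simp add: h_def flux_def)
  qed
  finally show ?thesis .
 qed
 have "transport_pairing T a g (tensor_test \<Phi> \<eta>) = - (LINT t:{0..T}|lborel. (LBINT z. h (t, z)))"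
  unfolding transport_pairing_def
  by (intro arg_cong[of _ _ uminus] set_lebesgue_integral_cong) (auto simp: inner)
 also have "(LINT t:{0..T}|lborel. (LBINT z. h (t, z))) = (LBINT z. h z)"
  by (rule set_integral_slab[OF h(2)]) (simp add: h_def out)
 finally show ?thesis using h(1) by simp
qed

text \<open>Nothing is assumed on the measurability of \<open>u\<close>. Hence U is recovered as the
  integral over \<xi> of a jointly measurable version of M, and \<open>m\<close> is pushed forward
  by regrouping the coordinates.\<close>

theorem kinetic_solution_slab:
 fixes a a' :: "real \<Rightarrow> real^'n::finite"
 assumes sol: "kinetic_solution T a u0 M u m" and T: "0 < T" and a': "locally_bounded a'"
  and aa': "AEL \<xi>. a' \<xi> = a \<xi>" and a[measurable]: "a \<in> Bor"
  and u0[measurable]: "u0 \<in> Bor"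
 obtains U \<mu> where "slab_flow T U" "weak_kinetic ({0<..<T} \<times> UNIV) (\<lambda>\<xi>. (1, a' \<xi>)) U \<mu>"
  "\<And>t. t \<in> {0..T} \<Longrightarrow> AEL z. M t z = kchi (snd z) (U (t, fst z))"
  "AEL x. U (0, x) = u0 x"
proof -
 have Mi: "\<And>t. t \<in> {0..T} \<Longrightarrow> lintegrable (M t)"
  and Mc: "\<And>t. t \<in> {0..T} \<Longrightarrow> ((\<lambda>s. LBINT z. \<bar>M s z - M t z\<bar>) \<longlongrightarrow> 0) (at t within {0..T})"
  and Mu: "\<And>t. t \<in> {0..T} \<Longrightarrow> AEL z. M t z = chi (snd z) (u t (fst z))"
  and M0: "AEL z. M 0 z = chi (snd z) (u0 (fst z))"
  and ms: "sets m = sets borel" and mf: "finite_measure m"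
  and weak: "\<And>\<phi>. test_function ({0<..<T} \<times> UNIV \<times> UNIV) \<phi> \<Longrightarrow>
   transport_pairing T a M \<phi> = - (LINT p|m. Fd \<phi> p (0, 0, 1))"
  using sol by (auto simp: kinetic_solution_def continuous_V1_def V1_def V1_norm_def case_prod_beta')
 obtain G where G[measurable]: "G \<in> Bor" and Gt: "\<And>t. t \<in> {0..T} \<Longrightarrow> AEL z. G (t, z) = M t z"
  and Gout: "\<And>t z. t \<notin> {0..T} \<Longrightarrow> G (t, z) = 0"
  by (rule joint_modification[of T M, OF Mi Mc]) blast+
 define U where "U q = (LBINT \<xi>. G (fst q, snd q, \<xi>))" for q
 have mU[measurable]: "U \<in> Bor"
  unfolding U_def[abs_def] by (rule lborel.borel_measurable_lebesgue_integral) measurable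
 have Uout: "U (t, x) = 0" if "t \<notin> {0..T}" for t x using Gout[OF that] by (simp add: U_def)
 \<comment> \<open>Applied with v = u t at every time, and with v = u0 at time 0.\<close>
 have trace: "AEL x. U (t, x) = v x \<and> (AEL \<xi>. G (t, x, \<xi>) = kchi \<xi> (v x))"
  if t: "t \<in> {0..T}" and v: "AEL z. M t z = chi (snd z) (v (fst z))" for t v
 proof -
  have "AEL z. G (t, z) = chi (snd z) (v (fst z))"
   using Gt[OF t] v by eventually_elim simp
  then have "AEL x. AEL \<xi>. G (t, x, \<xi>) = chi \<xi> (v x)"
   using AE_lborel_pairD[of "\<lambda>z. G (t, z) = chi (snd z) (v (fst z))"] by simp
  then show ?thesis
  proof eventually_elim
   case (elim x)
   have ae: "AEL \<xi>. G (t, x, \<xi>) = kchi \<xi> (v x)"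
    using elim AE_kchi_eq_chi[of "v x"] by eventually_elim simp
   have "U (t, x) = (LBINT \<xi>. kchi \<xi> (v x))"
    unfolding U_def by (rule integral_cong_AE) (use ae in \<open>auto simp: fst_conv\<close>)
   with ae show ?case by (simp add: integral_kchi)
  qed
 qed
 have MU: "AEL z. M t z = kchi (snd z) (U (t, fst z))" if t: "t \<in> {0..T}" for t
 proof -
  have "AEL x. AEL \<xi>. G (t, x, \<xi>) = kchi \<xi> (U (t, x))"
   using trace[OF t Mu[OF t]] by eventually_elim auto
  moreover have "{z \<in> space borel. G (t, z) = kchi (snd z) (U (t, fst z))} \<in> sets borel" by measurable
  ultimately have "AEL z. G (t, z) = kchi (snd z) (U (t, fst z))"
   by (intro AE_lborel_pairI) auto
  with Gt[OF t] show ?thesis by eventually_elim simp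
 qed
 have Ui: "lintegrable (\<lambda>x. U (t, x))" if t: "t \<in> {0..T}" for t
 proof -
  have "(NINT x. nabs (U (t, x) - 0)) = (NINT z. nabs (kchi (snd z) (U (t, fst z)) - kchi (snd z) 0))"
   by (rule nn_integral_kchi_prod[symmetric]) measurable
  also have "\<dots> = (NINT z. nabs (M t z))"
   by (rule nn_integral_cong_AE) (use MU[OF t] in eventually_elim, simp)
  also have "\<dots> < \<infinity>" using Mi[OF t] by (auto simp: integrable_iff_bounded)
  finally have "(NINT x. nabs (U (t, x))) < \<infinity>" by simp
  moreover have "(\<lambda>x. U (t, x)) \<in> BorL" by measurable
  ultimately show ?thesis using integrable_iff_nn_abs by blast
 qed
 have dist: "(LBINT z. \<bar>M s z - M t z\<bar>) = (LBINT x. \<bar>U (s, x) - U (t, x)\<bar>)" if st: "s \<in> {0..T}" "t \<in> {0..T}" for s t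
 proof -
  have "(LBINT z. \<bar>M s z - M t z\<bar>) = (LBINT z. \<bar>kchi (snd z) (U (s, fst z)) - kchi (snd z) (U (t, fst z))\<bar>)"
  proof (rule integral_cong_AE)
   show "AEL z. \<bar>M s z - M t z\<bar> = \<bar>kchi (snd z) (U (s, fst z)) - kchi (snd z) (U (t, fst z))\<bar>"
    using MU[OF st(1)] MU[OF st(2)] by eventually_elim simp
  qed (use Mi[OF st(1)] Mi[OF st(2)] in measurable)
  then show ?thesis using kchi_prod_L1(2)[OF Ui[OF st(1)] Ui[OF st(2)]] by simp
 qed
 have flow: "slab_flow T U"
  unfolding slab_flow_def
 proof (intro conjI allI impI ballI)
  fix t assume t: "t \<in> {0..T}"
  show "((\<lambda>s. LBINT x. \<bar>U (s, x) - U (t, x)\<bar>) \<longlongrightarrow> 0) (at t within {0..T})"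
  proof (rule Lim_transform_eventually[OF Mc[OF t]])
   show "eventually (\<lambda>s. (LBINT z. \<bar>M s z - M t z\<bar>) = (LBINT x. \<bar>U (s, x) - U (t, x)\<bar>)) (at t within {0..T})"
    unfolding eventually_at_filter using dist[OF _ t] by (intro always_eventually) blast
  qed
 qed (use T mU Uout Ui in auto)
 define r where "r z = ((fst z, fst (snd z)), snd (snd z))" for z :: "real \<times> (real^'n) \<times> real"
 have r[measurable]: "r \<in> measurable borel borel"
  unfolding r_def[abs_def] by (intro borel_measurable_continuous_onI continuous_intros)
 have rm: "r \<in> measurable m borel" using r ms by (simp add: measurable_cong_sets[of m borel])
 define \<mu> where "\<mu> = distr m borel r"
 have "weak_kinetic ({0<..<T} \<times> UNIV) (\<lambda>\<xi>. (1, a' \<xi>)) U \<mu>"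
  unfolding weak_kinetic_def
 proof (intro conjI allI impI)
  show "finite_measure \<mu>" unfolding \<mu>_def by (rule finite_measure.finite_measure_distr[OF mf rm])
  show "sets \<mu> = sets borel" by (simp add: \<mu>_def)
  fix \<Phi> :: "real \<times> (real^'n) \<Rightarrow> real" and \<eta> :: "real \<Rightarrow> real"
  assume \<Phi>: "test_function ({0<..<T} \<times> UNIV) \<Phi>" and \<eta>: "test_function UNIV \<eta>"
  have sm: "smooth_fun \<Phi>" "smooth_fun \<eta>" using \<Phi> \<eta> test_function_smooth by auto
  have [measurable]: "\<Phi> \<in> Bor" "deriv \<eta> \<in> Bor"
   using sm smooth_fun_deriv smooth_fun_borel by blast+
  have gi: "lintegrable (\<lambda>p. kp U p * flux (\<lambda>\<xi>. (1, a' \<xi>)) \<eta> \<Phi> p)"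
   by (rule integrable_flux[OF locally_bounded_Pair[OF a'] \<eta> \<Phi>, of _ 1]) (measurable, simp add: abs_kchi_le)
  have tp: "transport_pairing T a M (tensor_test \<Phi> \<eta>) = - (LBINT p. kp U p * flux (\<lambda>\<xi>. (1, a' \<xi>)) \<eta> \<Phi> p)"
   using transport_pairing_tensor[OF a' aa' a \<Phi> \<eta>, of "\<lambda>z. kchi (snd (snd z)) (U (fst z, fst (snd z)))" T M] MU Mi Uout gi
   by simp
  have "(LINT p|\<mu>. \<Phi> (fst p) * deriv \<eta> (snd p)) = (LINT z|m. \<Phi> (fst (r z)) * deriv \<eta> (snd (r z)))"
   unfolding \<mu>_def by (rule integral_distr[OF rm]) measurable
  also have "\<dots> = (LINT z|m. Fd (tensor_test \<Phi> \<eta>) z (0, 0, 1))"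
  proof (intro LBINT_cong refl)
   fix z :: "real \<times> (real^'n) \<times> real"
   have "Fd \<Phi> (fst z, fst (snd z)) 0 = 0"
    by (rule linear_0[OF bounded_linear.linear[OF smooth_fun_linear[OF sm(1)]]])
   then show "\<Phi> (fst (r z)) * deriv \<eta> (snd (r z)) = Fd (tensor_test \<Phi> \<eta>) z (0, 0, 1)"
    by (simp add: tensor_test(2)[OF \<Phi> \<eta>] r_def zero_prod_def)
  qed
  finally show "(LBINT p. kp U p * flux (\<lambda>\<xi>. (1, a' \<xi>)) \<eta> \<Phi> p) = (LINT p|\<mu>. \<Phi> (fst p) * deriv \<eta> (snd p))"
   using tp weak[OF tensor_test(1)[OF \<Phi> \<eta>]] by simp
 qed (rule mU)
 moreover have "AEL x. U (0, x) = u0 x"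
  using trace[of 0 u0] M0 T by auto
 ultimately show ?thesis using that flow MU by blast
qed


text \<open>The source M is replaced by its version through U, so that source and solution are both
  jointly measurable on the same slab.\<close>

theorem relaxation_solution_slab:
 fixes a a' :: "real \<Rightarrow> real^'n::finite"
 assumes sol: "relaxation_solution T a lam M f0 f" and T: "0 < T" and a': "locally_bounded a'"
  and aa': "AEL \<xi>. a' \<xi> = a \<xi>" and a[measurable]: "a \<in> Bor"
  and U: "slab_flow T U" and MU: "\<And>t. t \<in> {0..T} \<Longrightarrow> AEL z. M t z = kchi (snd z) (U (t, fst z))"
  and Mi: "\<And>t. t \<in> {0..T} \<Longrightarrow> lintegrable (M t)"
 obtains F where "slab_flow T F" "\<And>t. t \<in> {0..T} \<Longrightarrow> AEL z. F (t, z) = f t z" "AEL z. F (0, z) = f0 z"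
  "\<And>\<Phi> \<eta>. test_function ({0<..<T} \<times> UNIV) \<Phi> \<Longrightarrow> test_function UNIV \<eta> \<Longrightarrow>
   (LBINT p. F (fst (fst p), snd (fst p), snd p) * flux (\<lambda>\<xi>. (1, a' \<xi>)) \<eta> \<Phi> p) =
   - (LBINT p. lam * (kp U p - F (fst (fst p), snd (fst p), snd p)) * (\<eta> (snd p) * \<Phi> (fst p)))"
proof -
 have fi: "\<And>t. t \<in> {0..T} \<Longrightarrow> lintegrable (f t)"
  and fc: "\<And>t. t \<in> {0..T} \<Longrightarrow> ((\<lambda>s. LBINT z. \<bar>f s z - f t z\<bar>) \<longlongrightarrow> 0) (at t within {0..T})"
  and f0: "AEL z. f 0 z = f0 z"
  and weak: "\<And>\<phi>. test_function ({0<..<T} \<times> UNIV \<times> UNIV) \<phi> \<Longrightarrow>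
   transport_pairing T a f \<phi> = (LINT t:{0..T}|lborel. (LBINT z. lam * (M t z - f t z) * \<phi> (t, z)))"
  using sol by (auto simp: relaxation_solution_def continuous_V1_def V1_def V1_norm_def intro: tendsto_within_subset)
 obtain F where F[measurable]: "F \<in> Bor" and Ft: "\<And>t. t \<in> {0..T} \<Longrightarrow> AEL z. F (t, z) = f t z"
  and Fout: "\<And>t z. t \<notin> {0..T} \<Longrightarrow> F (t, z) = 0"
  by (rule joint_modification[of T f, OF fi fc]) blast+
 have [measurable]: "U \<in> Bor" and Uout: "\<And>t x. t \<notin> {0..T} \<Longrightarrow> U (t, x) = 0"
  using U by (auto simp: slab_flow_def)
 have Fi: "lintegrable (\<lambda>z. F (t, z))" if t: "t \<in> {0..T}" for t
  by (rule integrable_cong_AE_imp[OF fi[OF t]]) (use Ft[OF t] in \<open>measurable, auto\<close>)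
 have flow: "slab_flow T F"
  unfolding slab_flow_def
 proof (intro conjI allI impI ballI)
  fix t assume t: "t \<in> {0..T}"
  have eq: "(LBINT z. \<bar>f s z - f t z\<bar>) = (LBINT z. \<bar>F (s, z) - F (t, z)\<bar>)" if s: "s \<in> {0..T}" for s
  proof (rule integral_cong_AE)
   show "AEL z. \<bar>f s z - f t z\<bar> = \<bar>F (s, z) - F (t, z)\<bar>"
    using Ft[OF s] Ft[OF t] by eventually_elim simp
  qed (use fi[OF s] fi[OF t] in measurable)
  show "((\<lambda>s. LBINT z. \<bar>F (s, z) - F (t, z)\<bar>) \<longlongrightarrow> 0) (at t within {0..T})"
  proof (rule Lim_transform_eventually[OF fc[OF t]])
   show "eventually (\<lambda>s. (LBINT z. \<bar>f s z - f t z\<bar>) = (LBINT z. \<bar>F (s, z) - F (t, z)\<bar>)) (at t within {0..T})"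
    unfolding eventually_at_filter using eq by (intro always_eventually) blast
  qed
 qed (use T F Fout Fi in auto)
 define Fp where "Fp p = F (fst (fst p), snd (fst p), snd p)" for p
 have Fpi: "lintegrable Fp" unfolding Fp_def[abs_def] by (rule slab_flow_assoc_integrable[OF flow])
 have kU: "lintegrable (\<lambda>p. kp U p)"
  by (rule kchi_prod_L1(3)) (rule slab_flow_integrable(1)[OF U])+
 have "(LBINT p. Fp p * flux (\<lambda>\<xi>. (1, a' \<xi>)) \<eta> \<Phi> p) =
   - (LBINT p. lam * (kp U p - Fp p) * (\<eta> (snd p) * \<Phi> (fst p)))"
  if \<Phi>: "test_function ({0<..<T} \<times> UNIV) \<Phi>" and \<eta>: "test_function UNIV \<eta>" for \<Phi> \<eta>
 proof -
  have sm: "smooth_fun \<Phi>" "smooth_fun \<eta>" using \<Phi> \<eta> test_function_smooth by auto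
  have [measurable]: "\<Phi> \<in> Bor" "\<eta> \<in> Bor" using sm smooth_fun_borel by auto
  obtain C where C: "\<And>p. \<bar>flux (\<lambda>\<xi>. (1::real, a' \<xi>)) \<eta> \<Phi> p\<bar> \<le> C"
   using flux_bounds[OF locally_bounded_Pair[OF a'] \<eta> \<Phi>] by metis
  have i: "lintegrable (\<lambda>p. Fp p * flux (\<lambda>\<xi>. (1, a' \<xi>)) \<eta> \<Phi> p)"
   by (rule integrable_mult_bounded[OF Fpi flux_borel[OF locally_bounded_Pair[OF a'] sm(2,1)] C]) simp
  have fF: "AEL z. f t z = F (t, z)" if "t \<in> {0..T}" for t using Ft[OF that] by eventually_elim simp
  have tp: "transport_pairing T a f (tensor_test \<Phi> \<eta>) = - (LBINT p. Fp p * flux (\<lambda>\<xi>. (1, a' \<xi>)) \<eta> \<Phi> p)"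
   unfolding Fp_def by (rule transport_pairing_tensor[OF a' aa' a \<Phi> \<eta> F Fout fF fi i[unfolded Fp_def]])
  define J where "J p = \<eta> (snd p) * \<Phi> (fst p)" for p
  obtain B1 B2 where B: "\<And>x. \<bar>\<eta> x\<bar> \<le> B1" "\<And>x. \<bar>\<Phi> x\<bar> \<le> B2" using test_function_bounds[OF \<eta>] test_function_bounds[OF \<Phi>] by metis
  have B1: "0 \<le> B1" using B(1)[of 0] by linarith
  have J: "\<bar>J p\<bar> \<le> B1 * B2" for p unfolding J_def abs_mult by (intro mult_mono B B1) auto
  have Jm: "J \<in> BorL" unfolding J_def[abs_def] by measurable
  define h where "h z = lam * (kchi (snd (snd z)) (U (fst z, fst (snd z))) - F z) * tensor_test \<Phi> \<eta> z" for z
  have hm: "h \<in> Bor" unfolding h_def[abs_def] tensor_test_def by measurable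
  have hp: "h (fst (fst p), snd (fst p), snd p) = lam * (kp U p - Fp p) * J p" for p
   by (simp add: h_def Fp_def J_def tensor_test_def)
  have "lintegrable (\<lambda>p. lam * (kp U p - Fp p) * J p)"
   by (rule integrable_mult_bounded[OF _ Jm J]) (use kU Fpi in simp)
  then have h: "(LBINT p. lam * (kp U p - Fp p) * J p) = (LBINT z. h z)" "lintegrable h"
   using integral_lborel_assoc[OF hm] by (simp_all only: hp)
  have "(LINT t:{0..T}|lborel. (LBINT z. lam * (M t z - f t z) * tensor_test \<Phi> \<eta> (t, z))) = (LINT t:{0..T}|lborel. (LBINT z. h (t, z)))"
  proof (rule set_lebesgue_integral_cong, simp, intro allI impI)
   fix t assume t: "t \<in> {0..T}"
   have [measurable]: "M t \<in> Bor" "f t \<in> Bor" using Mi[OF t] fi[OF t] by auto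
   show "(LBINT z. lam * (M t z - f t z) * tensor_test \<Phi> \<eta> (t, z)) = (LBINT z. h (t, z))"
   proof (rule integral_cong_AE)
    show "(\<lambda>z. lam * (M t z - f t z) * tensor_test \<Phi> \<eta> (t, z)) \<in> BorL"
     unfolding tensor_test_def by measurable
    show "(\<lambda>z. h (t, z)) \<in> BorL" using hm by measurable
    show "AEL z. lam * (M t z - f t z) * tensor_test \<Phi> \<eta> (t, z) = h (t, z)"
     using MU[OF t] Ft[OF t] by eventually_elim (simp add: h_def)
   qed
  qed
  also have "\<dots> = (LBINT z. h z)"
   by (rule set_integral_slab[OF h(2)]) (simp add: h_def Uout Fout)
  finally show ?thesis using weak[OF tensor_test(1)[OF \<Phi> \<eta>]] tp h(1) by (simp add: J_def)
 qed
 moreover have "AEL z. F (0, z) = f0 z"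
  using Ft[of 0] f0 T by (auto elim: eventually_elim2)
 ultimately show ?thesis using that flow Ft unfolding Fp_def by blast
qed

subsection \<open>The modulus along characteristics\<close>

lemma nn_integral_kchi_shear:
 fixes v w :: "'a::euclidean_space \<Rightarrow> real" and c :: "real \<Rightarrow> 'a"
 assumes [measurable]: "v \<in> Bor" "w \<in> Bor" and c: "c \<in> Bor"
 shows "(NINT z. nabs (kchi (snd z) (v (fst z + c (snd z))) - kchi (snd z) (w (fst z + c (snd z))))) = (NINT x. nabs (v x - w x))"
proof -
 have "(\<lambda>z. nabs (kp v z - kp w z)) \<in> Bor" by measurable
 from nn_integral_shear[OF this c] show ?thesis by (simp add: nn_integral_kchi_prod)
qed

context
 fixes a :: "real \<Rightarrow> 'b::euclidean_space" and U :: "real \<times> 'b \<Rightarrow> real" and T :: real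
 assumes a: "a \<in> Bor" and U: "slab_flow T U"
begin

lemma slab_flow_slice_borel: "(\<lambda>x. U (t, x)) \<in> Bor"
 using slab_flow_integrable(2)[OF U, of t] by auto

lemma char_modulus_shift_before:
 "char_modulus a U r s \<le> (NINT \<xi>. shift_modulus (\<lambda>x. U (r - s, x)) \<xi> (- (s *\<^sub>R a \<xi>))) + (NINT x. nabs (U (r - s, x) - U (r, x)))"
proof -
 note [measurable] = slab_flow_slice_borel a
 have c[measurable]: "(\<lambda>\<xi>. - (s *\<^sub>R a \<xi>)) \<in> Bor" by measurable
 have "char_modulus a U r s \<le> (NINT z. nabs (kchi (snd z) (U (r - s, fst z + - (s *\<^sub>R a (snd z)))) - kchi (snd z) (U (r - s, fst z)))) +
  (NINT z. nabs (kchi (snd z) (U (r - s, fst z)) - kchi (snd z) (U (r, fst z))))"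
  unfolding char_modulus_def diff_conv_add_uminus[of _ "s *\<^sub>R _"]
  by (rule nn_integral_diff_triangle) measurable
 then show ?thesis
  by (simp only: nn_integral_shift_prod[OF slab_flow_slice_borel c] nn_integral_kchi_prod[OF slab_flow_slice_borel slab_flow_slice_borel])
qed

text \<open>The shift is made at the later time, so that for r = T it acts on one fixed function, to
  which continuity of translations applies. The variant \<open>char_modulus_shift_before\<close>
  serves for BV data, where the shift bound is uniform in time.\<close>

lemma char_modulus_shift_after:
 "char_modulus a U r s \<le> (NINT x. nabs (U (r - s, x) - U (r, x))) + (NINT \<xi>. shift_modulus (\<lambda>x. U (r, x)) \<xi> (- (s *\<^sub>R a \<xi>)))"
proof -
 note [measurable] = slab_flow_slice_borel a
 have c[measurable]: "(\<lambda>\<xi>. - (s *\<^sub>R a \<xi>)) \<in> Bor" by measurable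
 have "char_modulus a U r s \<le> (NINT z. nabs (kchi (snd z) (U (r - s, fst z + - (s *\<^sub>R a (snd z)))) - kchi (snd z) (U (r, fst z + - (s *\<^sub>R a (snd z)))))) +
  (NINT z. nabs (kchi (snd z) (U (r, fst z + - (s *\<^sub>R a (snd z)))) - kchi (snd z) (U (r, fst z))))"
  unfolding char_modulus_def diff_conv_add_uminus[of _ "s *\<^sub>R _"]
  by (rule nn_integral_diff_triangle) measurable
 then show ?thesis
  by (simp only: nn_integral_shift_prod[OF slab_flow_slice_borel c] nn_integral_kchi_shear[OF slab_flow_slice_borel slab_flow_slice_borel c])
qed

text \<open>Allows the end time r < T to be replaced by T, at a cost given by the continuity of u in
  time.\<close>

lemma char_modulus_time_shift:
 "char_modulus a U r s \<le> (NINT x. nabs (U (r - s, x) - U (r' - s, x))) + (char_modulus a U r' s + (NINT x. nabs (U (r', x) - U (r, x))))"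
proof -
 note [measurable] = slab_flow_slice_borel a
 have c[measurable]: "(\<lambda>\<xi>. - (s *\<^sub>R a \<xi>)) \<in> Bor" by measurable
 have "char_modulus a U r s \<le> (NINT z. nabs (kchi (snd z) (U (r - s, fst z + - (s *\<^sub>R a (snd z)))) - kchi (snd z) (U (r' - s, fst z + - (s *\<^sub>R a (snd z)))))) +
  (NINT z. nabs (kchi (snd z) (U (r' - s, fst z + - (s *\<^sub>R a (snd z)))) - kchi (snd z) (U (r, fst z))))"
  unfolding char_modulus_def diff_conv_add_uminus[of _ "s *\<^sub>R _"]
  by (rule nn_integral_diff_triangle) measurable
 also have "(NINT z. nabs (kchi (snd z) (U (r' - s, fst z + - (s *\<^sub>R a (snd z)))) - kchi (snd z) (U (r, fst z)))) \<le>
  char_modulus a U r' s + (NINT z. nabs (kchi (snd z) (U (r', fst z)) - kchi (snd z) (U (r, fst z))))"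
  unfolding char_modulus_def diff_conv_add_uminus[of _ "s *\<^sub>R _"]
  by (rule nn_integral_diff_triangle) measurable
 finally show ?thesis
  by (simp add: nn_integral_kchi_prod[OF slab_flow_slice_borel slab_flow_slice_borel] nn_integral_kchi_shear[OF slab_flow_slice_borel slab_flow_slice_borel c, simplified] add_left_mono)
qed

lemma char_modulus_crude:
 "char_modulus a U r s \<le> (NINT x. nabs (U (r - s, x))) + (NINT x. nabs (U (r, x)))"
proof -
 note [measurable] = slab_flow_slice_borel a
 have c[measurable]: "(\<lambda>\<xi>. - (s *\<^sub>R a \<xi>)) \<in> Bor" by measurable
 have "char_modulus a U r s \<le> (NINT z. nabs (kchi (snd z) (U (r - s, fst z + - (s *\<^sub>R a (snd z)))) - kchi (snd z) 0)) +
  (NINT z. nabs (kchi (snd z) 0 - kchi (snd z) (U (r, fst z))))"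
  unfolding char_modulus_def diff_conv_add_uminus[of _ "s *\<^sub>R _"]
  by (rule nn_integral_diff_triangle) measurable
 then show ?thesis
  using nn_integral_kchi_shear[OF slab_flow_slice_borel[of "r - s"] borel_measurable_const[of 0] c]
   nn_integral_kchi_prod[OF borel_measurable_const[of 0] slab_flow_slice_borel[of r]] by simp
qed

lemma char_modulus_borel: "(\<lambda>s. char_modulus a U r s) \<in> Bor"
proof -
 have [measurable]: "U \<in> Bor" using U by (simp add: slab_flow_def)
 note [measurable] = a
 show ?thesis unfolding char_modulus_def by (rule lborel.borel_measurable_nn_integral) measurable
qed

end

text \<open>\<open>a\<close> may be unbounded, so the shifts need not be uniformly small; but for
  each \<xi> they tend to 0, and almost every level is in L^1. Twice the norm of the level is a
  dominating function, integrable in \<xi>.\<close>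

lemma shift_modulus_integral_tendsto:
 fixes v :: "'b::euclidean_space \<Rightarrow> real"
 assumes v: "lintegrable v" and a[measurable]: "a \<in> Bor" and s: "s \<longlonglongrightarrow> 0"
 shows "(\<lambda>n. NINT \<xi>. shift_modulus v \<xi> (- (s n *\<^sub>R a \<xi>))) \<longlonglongrightarrow> 0"
proof -
 have [measurable]: "v \<in> Bor" using v by auto
 define w where "w \<xi> = (NINT x. nabs (kchi \<xi> (v x)))" for \<xi>
 have wm[measurable]: "w \<in> Bor" unfolding w_def[abs_def] by (rule lborel.borel_measurable_nn_integral) measurable
 have "(NINT \<xi>. w \<xi>) = (NINT z. nabs (kp v z))"
  unfolding w_def by (subst nn_integral_lborel_prod_snd) simp_all
 also have "\<dots> < \<infinity>" using kchi_prod_L1(3)[OF v v] by (auto simp: integrable_iff_bounded)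
 finally have w_fin: "(NINT \<xi>. w \<xi>) < \<infinity>" .
 have "(\<lambda>n. NINT \<xi>. shift_modulus v \<xi> (- (s n *\<^sub>R a \<xi>))) \<longlonglongrightarrow> (\<integral>\<^sup>+\<xi>. 0 \<partial>(lborel :: real measure))"
 proof (rule nn_integral_dominated_convergence[where w="\<lambda>\<xi>. w \<xi> + w \<xi>"])
  show "(\<lambda>\<xi>. shift_modulus v \<xi> (- (s n *\<^sub>R a \<xi>))) \<in> BorL" for n
   unfolding shift_modulus_def by measurable
  show "(NINT \<xi>. w \<xi> + w \<xi>) < \<infinity>" using w_fin by (simp add: nn_integral_add ennreal_add_eq_top less_top)
  show "AEL \<xi>. shift_modulus v \<xi> (- (s n *\<^sub>R a \<xi>)) \<le> w \<xi> + w \<xi>" for n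
  proof (rule AE_I2)
   fix \<xi>
   have "shift_modulus v \<xi> y \<le> (NINT x. nabs (kchi \<xi> (v (x + y)) - 0)) + (NINT x. nabs (0 - kchi \<xi> (v x)))" for y
    unfolding shift_modulus_def by (rule nn_integral_diff_triangle) measurable
   from this[of "- (s n *\<^sub>R a \<xi>)"] show "shift_modulus v \<xi> (- (s n *\<^sub>R a \<xi>)) \<le> w \<xi> + w \<xi>"
    using nn_integral_shift[of "\<lambda>x. nabs (kchi \<xi> (v x))" "- (s n *\<^sub>R a \<xi>)"] by (simp add: w_def)
  qed
  have "AEL \<xi>. w \<xi> \<noteq> \<infinity>" using w_fin by (intro nn_integral_PInf_AE) auto
  then show "AEL \<xi>. (\<lambda>n. shift_modulus v \<xi> (- (s n *\<^sub>R a \<xi>))) \<longlonglongrightarrow> 0"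
  proof eventually_elim
   case (elim \<xi>)
   have "lintegrable (\<lambda>x. kchi \<xi> (v x))"
    using elim by (intro integrableI_nn_abs) (auto simp: w_def less_top)
   then have L: "L1_shift_continuous (\<lambda>x. kchi \<xi> (v x))" by (rule L1_shift_continuous)
   have sn: "(\<lambda>n. norm (- (s n *\<^sub>R a \<xi>))) \<longlonglongrightarrow> 0"
    using tendsto_norm[OF tendsto_minus[OF tendsto_scaleR[OF s tendsto_const[of "a \<xi>"]]]] by simp
   show ?case
   proof (rule order_tendstoI)
    fix e :: ennreal assume e: "0 < e"
    obtain r where r: "0 < r" "ennreal r < e"
    proof -
     obtain x where x: "0 < x" "x < e" using dense[OF e] by blast
     then have "x \<noteq> top" by auto
     then show thesis using x that by (cases x) auto
    qed
    obtain d where d: "d > 0" "\<And>h. norm h < d \<Longrightarrow> shift_modulus v \<xi> h \<le> ennreal r"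
     using L r(1) unfolding L1_shift_continuous_def shift_modulus_def by blast
    have "eventually (\<lambda>n. norm (- (s n *\<^sub>R a \<xi>)) < d) sequentially" by (rule order_tendstoD(2)[OF sn d(1)])
    then show "eventually (\<lambda>n. shift_modulus v \<xi> (- (s n *\<^sub>R a \<xi>)) < e) sequentially"
     by eventually_elim (rule le_less_trans[OF d(2) r(2)])
   qed (simp add: not_less)
  qed
 qed (use wm in measurable)
 then show ?thesis by simp
qed

text \<open>Split at d: on [0,d] the weight has mass at most 1 and g is at most e; beyond d its mass
  is at most exp (- lam * d) and g is at most P.\<close>

lemma relaxation_weight_le:
 assumes g: "g \<in> Bor" and g0: "\<And>s. 0 \<le> s \<Longrightarrow> s \<le> T \<Longrightarrow> 0 \<le> g s \<and> g s \<le> P"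
  and lam: "0 < lam" and d: "0 \<le> d" "d \<le> T" and e: "\<And>s. 0 \<le> s \<Longrightarrow> s \<le> d \<Longrightarrow> g s \<le> e"
 shows "relaxation_weight lam T g \<le> e + P * exp (- lam * d)" "0 \<le> relaxation_weight lam T g"
proof -
 define h where "h d s = lam * exp (- lam * s) * indicator {0..d} s" for d s
 have h: "has_bochner_integral lborel (h T) (1 - exp (- lam * T))" "has_bochner_integral lborel (h d) (1 - exp (- lam * d))"
  unfolding h_def[abs_def] by (rule exp_weight, use d in simp)+
 have i: "lintegrable (\<lambda>s. h T s * g s)"
  unfolding h_def by (rule integrable_exp_weight[OF g g0 _ lam]) (use d in auto)
 have e0: "0 \<le> e" using e[of 0] g0[of 0] d by auto
 have P0: "0 \<le> P" using g0[of 0] d by auto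
 have rw: "relaxation_weight lam T g = (LBINT s. h T s * g s)" by (simp add: relaxation_weight_def h_def)
 also have "\<dots> \<le> (LBINT s. e * h T s + P * (h T s - h d s))"
 proof (rule integral_mono[OF i])
  show "lintegrable (\<lambda>s. e * h T s + P * (h T s - h d s))" using h by (simp add: has_bochner_integral_iff)
  fix s
  have hT: "0 \<le> h T s" using lam by (simp add: h_def)
  show "h T s * g s \<le> e * h T s + P * (h T s - h d s)"
  proof (cases "s \<in> {0..T}")
   case s: True
   show ?thesis
   proof (cases "s \<le> d")
    case True
    then have "h d s = h T s" using s d by (simp add: h_def)
    moreover have "h T s * g s \<le> h T s * e" using e[of s] True s hT by (intro mult_left_mono) auto
    ultimately show ?thesis by (simp add: mult.commute)
   next
    case False
    then have "h d s = 0" by (simp add: h_def)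
    moreover have "h T s * g s \<le> h T s * P" using g0[of s] s hT by (intro mult_left_mono) auto
    ultimately show ?thesis using mult_nonneg_nonneg[OF e0 hT] by (simp add: mult.commute)
   qed
  next
   case False
   then show ?thesis using d by (auto simp: h_def)
  qed
 qed
 also have "\<dots> = e * (1 - exp (- lam * T)) + P * (exp (- lam * d) - exp (- lam * T))"
  using h[THEN integrable.intros] by (simp add: h[THEN has_bochner_integral_integral_eq])
 also have "\<dots> \<le> e * 1 + P * exp (- lam * d)"
  by (intro add_mono mult_left_mono e0 P0) auto
 finally show "relaxation_weight lam T g \<le> e + P * exp (- lam * d)" by simp
 show "0 \<le> relaxation_weight lam T g" unfolding rw
  using g0 lam by (intro integral_nonneg_AE AE_I2) (auto simp: h_def indicator_def)
qed

text \<open>Integration by parts. The boundary term -B * T * exp (- lam * T) cancels the term exp (-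
  lam * T) * P of \<open>relaxation_error\<close>, where P = B * T in the BV case.\<close>

lemma relaxation_weight_linear:
 assumes lam: "0 < lam" and T: "0 < T"
 shows "relaxation_weight lam T (\<lambda>s. B * s) = B * ((1 - exp (- lam * T)) / lam - T * exp (- lam * T))"
proof -
 have "has_bochner_integral lborel (\<lambda>s. (lam * exp (- lam * s) * (B * s)) * indicator {0..T} s)
  (- B * exp (- lam * T) * (T + 1 / lam) - - B * exp (- lam * 0) * (0 + 1 / lam))"
  by (rule has_bochner_integral_FTC_Icc_real[where F="\<lambda>s. - B * exp (- lam * s) * (s + 1 / lam)"])
   (use T lam in \<open>auto intro!: derivative_eq_intros continuous_intros simp: field_simps\<close>)
 then show ?thesis
  unfolding relaxation_weight_def using lam by (simp add: has_bochner_integral_iff mult_ac) (simp add: field_simps)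
qed

subsection \<open>Rates of convergence\<close>

text \<open>Returns to the norms of the statement. The last bracket depends on M only through the
  modulus g and its bound P, and not on f0 at all, as the order of quantifiers in the claim
  demands.\<close>

lemma relaxation_error:
 fixes a a' :: "real \<Rightarrow> real^'n::finite"
 assumes a': "locally_bounded a'" and aa': "AEL \<xi>. a' \<xi> = a \<xi>" and a: "a \<in> Bor"
  and u0[measurable]: "u0 \<in> Bor" and T: "0 < T" and lam: "0 < lam"
  and kin: "kinetic_solution T a u0 M u m" and rel: "relaxation_solution T a lam M f0 f"
  and U: "slab_flow T U" and MU: "\<And>t. t \<in> {0..T} \<Longrightarrow> AEL z. M t z = kchi (snd z) (U (t, fst z))"
  and g: "g \<in> Bor" and g0: "\<And>s. 0 \<le> s \<Longrightarrow> s \<le> T \<Longrightarrow> 0 \<le> g s \<and> g s \<le> P"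
  and mod: "\<And>e. 0 < e \<Longrightarrow> \<exists>d>0. \<forall>r s. T - d < r \<longrightarrow> r < T \<longrightarrow> 0 \<le> s \<longrightarrow> s \<le> r \<longrightarrow> char_modulus a' U r s \<le> ennreal (g s + e)"
 shows "V1_norm (\<lambda>z. f T z - M T z) \<le> V1_norm (\<lambda>(x, \<xi>). f0 (x, \<xi>) - chi \<xi> (u0 x)) * exp (- lam * T) +
  (exp (- lam * T) * P + relaxation_weight lam T g)"
proof -
 have Mi: "lintegrable (M t)" if "t \<in> {0..T}" for t
  using kin that by (auto simp: kinetic_solution_def continuous_V1_def V1_def)
 have M0: "AEL z. M 0 z = chi (snd z) (u0 (fst z))"
  using kin by (simp add: kinetic_solution_def case_prod_beta')
 have [measurable]: "f0 \<in> Bor" "f T \<in> Bor" "M T \<in> Bor"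
  using rel Mi[of T] T by (auto simp: relaxation_solution_def continuous_V1_def V1_def intro!: borel_measurable_integrable[of lborel, simplified])
 have [measurable]: "U \<in> Bor" using U by (simp add: slab_flow_def)
 obtain F where F: "slab_flow T F" "\<And>t. t \<in> {0..T} \<Longrightarrow> AEL z. F (t, z) = f t z" "AEL z. F (0, z) = f0 z"
  and weak: "\<And>\<Phi> \<eta>. test_function ({0<..<T} \<times> UNIV) \<Phi> \<Longrightarrow> test_function UNIV \<eta> \<Longrightarrow>
   (LBINT p. F (fst (fst p), snd (fst p), snd p) * flux (\<lambda>\<xi>. (1, a' \<xi>)) \<eta> \<Phi> p) =
   - (LBINT p. lam * (kp U p - F (fst (fst p), snd (fst p), snd p)) * (\<eta> (snd p) * \<Phi> (fst p)))"
  by (rule relaxation_solution_slab[OF rel T a' aa' a U MU Mi]) blast+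
 have [measurable]: "F \<in> Bor" using F(1) by (simp add: slab_flow_def)
 have chi_m: "(\<lambda>z. chi (snd z) (u0 (fst z))) \<in> Bor"
  unfolding chi_def by measurable
 have T1: "V1_norm (\<lambda>z. f T z - M T z) = (LBINT z. \<bar>F (T, z) - kchi (snd z) (U (T, fst z))\<bar>)"
  unfolding V1_norm_def
 proof (rule integral_cong_AE)
  show "AEL z. \<bar>f T z - M T z\<bar> = \<bar>F (T, z) - kchi (snd z) (U (T, fst z))\<bar>"
   using F(2)[of T] MU[of T] T by (auto elim: eventually_elim2)
 qed measurable
 have T0: "V1_norm (\<lambda>(x, \<xi>). f0 (x, \<xi>) - chi \<xi> (u0 x)) = (LBINT z. \<bar>F (0, z) - kchi (snd z) (U (0, fst z))\<bar>)"
  unfolding V1_norm_def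
 proof (rule integral_cong_AE)
  have "AEL z. M 0 z = kchi (snd z) (U (0, fst z))" using MU[of 0] T by simp
  with F(3) M0 show "AEL z. \<bar>case z of (x, \<xi>) \<Rightarrow> f0 (x, \<xi>) - chi \<xi> (u0 x)\<bar> = \<bar>F (0, z) - kchi (snd z) (U (0, fst z))\<bar>"
   by eventually_elim (auto simp: case_prod_beta')
  show "(\<lambda>z. \<bar>case z of (x, \<xi>) \<Rightarrow> f0 (x, \<xi>) - chi \<xi> (u0 x)\<bar>) \<in> BorL"
   using chi_m by (simp add: case_prod_beta')
 qed measurable
 show ?thesis
  using relaxation_estimate[OF a' F(1) U lam weak g g0 mod] unfolding T1 T0 by (simp add: algebra_simps)
qed

lemma slab_flow_uniformly_continuous:
 assumes U: "slab_flow T U" and e: "0 < e"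
 obtains d where "d > 0" "\<And>s t. s \<in> {0..T} \<Longrightarrow> t \<in> {0..T} \<Longrightarrow> \<bar>s - t\<bar> < d \<Longrightarrow> (NINT x. nabs (U (s, x) - U (t, x))) \<le> ennreal e"
proof -
 obtain d where d: "d > 0" "\<And>s t. s \<in> {0..T} \<Longrightarrow> t \<in> {0..T} \<Longrightarrow> \<bar>s - t\<bar> < d \<Longrightarrow> (LBINT x. \<bar>U (s, x) - U (t, x)\<bar>) < e"
  by (rule L1_uniformly_continuous[of 0 T lborel "\<lambda>t x. U (t, x)" e]) (use U e in \<open>auto simp: slab_flow_def\<close>)
 show ?thesis
 proof (rule that[OF d(1)])
  fix s t assume "s \<in> {0..T}" "t \<in> {0..T}" "\<bar>s - t\<bar> < d"
  then show "(NINT x. nabs (U (s, x) - U (t, x))) \<le> ennreal e"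
   using d(2)[of s t] slab_flow_integrable(2)[OF U]
   by (subst ennreal_LINT_abs) (auto intro: ennreal_leI)
 qed
qed

text \<open>\<open>g\<close> is the defect ending at T. Uniform continuity in time bounds the
  defects ending at nearby r, and continuity of translations at time T makes g small near 0.\<close>

lemma char_modulus_terminal:
 fixes a :: "real \<Rightarrow> 'b::euclidean_space"
 assumes a: "a \<in> Bor" and U: "slab_flow T U"
 obtains g P where "g \<in> Bor" "\<And>s. 0 \<le> g s \<and> g s \<le> P"
  "\<And>e. 0 < e \<Longrightarrow> \<exists>d>0. \<forall>r s. T - d < r \<longrightarrow> r < T \<longrightarrow> 0 \<le> s \<longrightarrow> s \<le> r \<longrightarrow> char_modulus a U r s \<le> ennreal (g s + e)"
  "\<And>e. 0 < e \<Longrightarrow> \<exists>d>0. \<forall>s. 0 \<le> s \<longrightarrow> s \<le> d \<longrightarrow> g s \<le> e"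
proof -
 have T: "0 < T" using U by (simp add: slab_flow_def)
 define g where "g s = enn2real (char_modulus a U T s)" for s
 obtain B where B: "\<And>t. (LBINT x. \<bar>U (t, x)\<bar>) \<le> B" using slab_flow_integrable(3)[OF U] by blast
 have B0: "0 \<le> B" using order_trans[OF _ B[of 0]] by simp
 have UB: "(NINT x. nabs (U (t, x))) \<le> ennreal B" for t
  using B slab_flow_integrable(2)[OF U] by (subst ennreal_LINT_abs) (auto intro: ennreal_leI)
 have crude: "char_modulus a U T s \<le> ennreal (B + B)" for s
  using order_trans[OF char_modulus_crude[OF a U] add_mono[OF UB UB]] unfolding ennreal_plus[OF B0 B0] .
 have gc: "char_modulus a U T s = ennreal (g s)" for s
  unfolding g_def using le_less_trans[OF crude[of s]] by (intro ennreal_enn2real[symmetric]) simp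
 have "g \<in> Bor"
  unfolding g_def[abs_def] using char_modulus_borel[OF a U, of T] by measurable
 moreover have "0 \<le> g s \<and> g s \<le> B + B" for s
  using enn2real_leI[OF _ crude[of s]] B0 by (simp add: g_def)
 moreover have "\<exists>d>0. \<forall>r s. T - d < r \<longrightarrow> r < T \<longrightarrow> 0 \<le> s \<longrightarrow> s \<le> r \<longrightarrow> char_modulus a U r s \<le> ennreal (g s + e)" if e: "0 < e" for e
 proof -
  obtain d where d: "d > 0" "\<And>s t. s \<in> {0..T} \<Longrightarrow> t \<in> {0..T} \<Longrightarrow> \<bar>s - t\<bar> < d \<Longrightarrow> (NINT x. nabs (U (s, x) - U (t, x))) \<le> ennreal (e / 2)"
   by (rule slab_flow_uniformly_continuous[OF U, of "e / 2"]) (use e in auto)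
  show ?thesis
  proof (intro exI[of _ d] conjI allI impI d(1))
   fix r s assume rs: "T - d < r" "r < T" "0 \<le> s" "s \<le> r"
   have "char_modulus a U r s \<le> (NINT x. nabs (U (r - s, x) - U (T - s, x))) + (char_modulus a U T s + (NINT x. nabs (U (T, x) - U (r, x))))"
    by (rule char_modulus_time_shift[OF a U])
   also have "\<dots> \<le> ennreal (e / 2) + (ennreal (g s) + ennreal (e / 2))"
    unfolding gc using rs by (intro add_mono d(2) order_refl) auto
   also have "ennreal (g s) + ennreal (e / 2) = ennreal (g s + e / 2)"
    by (rule ennreal_plus[symmetric]) (use e in \<open>auto simp: g_def\<close>)
   also have "ennreal (e / 2) + ennreal (g s + e / 2) = ennreal (e / 2 + (g s + e / 2))"
    by (rule ennreal_plus[symmetric]) (use e in \<open>auto simp: g_def\<close>)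
   finally show "char_modulus a U r s \<le> ennreal (g s + e)" by (simp add: add.commute add.left_commute)
  qed
 qed
 moreover have "\<exists>d>0. \<forall>s. 0 \<le> s \<longrightarrow> s \<le> d \<longrightarrow> g s \<le> e" if e: "0 < e" for e
 \<comment> \<open>By contradiction along a sequence, since
   \<open>shift_modulus_integral_tendsto\<close> is sequential.\<close>
 proof (rule ccontr)
  assume "\<not> ?thesis"
  then have "\<forall>n. \<exists>s. 0 \<le> s \<and> s \<le> inverse (real (Suc n)) \<and> e < g s"
   by (metis inverse_positive_iff_positive not_le of_nat_0_less_iff zero_less_Suc)
  then obtain s where s: "\<And>n. 0 \<le> s n" "\<And>n. s n \<le> inverse (real (Suc n))" "\<And>n. e < g (s n)" by metis
  have s_lim: "s \<longlonglongrightarrow> 0"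
   by (rule real_tendsto_sandwich[OF _ _ tendsto_const LIMSEQ_inverse_real_of_nat]) (use s in auto)
  obtain d where d: "d > 0" "\<And>s t. s \<in> {0..T} \<Longrightarrow> t \<in> {0..T} \<Longrightarrow> \<bar>s - t\<bar> < d \<Longrightarrow> (NINT x. nabs (U (s, x) - U (t, x))) \<le> ennreal (e / 2)"
   by (rule slab_flow_uniformly_continuous[OF U, of "e / 2"]) (use e in auto)
  have "eventually (\<lambda>n. s n < min d T) sequentially"
   by (rule order_tendstoD(2)[OF s_lim]) (use d T in auto)
  moreover have "eventually (\<lambda>n. (NINT \<xi>. shift_modulus (\<lambda>x. U (T, x)) \<xi> (- (s n *\<^sub>R a \<xi>))) < ennreal (e / 2)) sequentially"
   by (rule order_tendstoD(2)[OF shift_modulus_integral_tendsto[OF slab_flow_integrable(2)[OF U] a s_lim]]) (use e in simp)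
  ultimately have "eventually (\<lambda>n. False) sequentially"
  proof eventually_elim
   case (elim n)
   have "ennreal (g (s n)) \<le> (NINT x. nabs (U (T - s n, x) - U (T, x))) + (NINT \<xi>. shift_modulus (\<lambda>x. U (T, x)) \<xi> (- (s n *\<^sub>R a \<xi>)))"
    unfolding gc[symmetric] by (rule char_modulus_shift_after[OF a U])
   also have "\<dots> \<le> ennreal (e / 2) + ennreal (e / 2)"
    using elim s(1)[of n] T by (intro add_mono d(2)) auto
   also have "\<dots> = ennreal (e / 2 + e / 2)" using e by (intro ennreal_plus[symmetric]) auto
   also have "\<dots> = ennreal e" by simp
   finally have "g (s n) \<le> e" using e by (simp add: ennreal_le_iff)
   then show False using s(3)[of n] by simp
  qed
  then show False by simp
 qed
 ultimately show ?thesis using that by blast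
qed

text \<open>The supremum over all l \<ge> 1 / \<delta> turns decay for large l into a monotone
  function of \<delta>. The value at \<delta> \<le> 0 is set to 0 by hand, as
  \<open>modulus_of_continuity\<close> prescribes it at 0.\<close>

lemma modulus_of_continuity_SUP:
 fixes W :: "real \<Rightarrow> real"
 assumes W: "\<And>l. 0 < l \<Longrightarrow> 0 \<le> W l \<and> W l \<le> B" and small: "\<And>e. 0 < e \<Longrightarrow> \<exists>L>0. \<forall>l\<ge>L. W l \<le> e"
 obtains w where "modulus_of_continuity w" "\<And>l. 0 < l \<Longrightarrow> W l \<le> w (1 / l)"
proof -
 define w where "w \<delta> = (if \<delta> \<le> 0 then 0 else SUP l\<in>{1 / \<delta>..}. W l)" for \<delta>
 have bdd: "bdd_above (W ` {1 / \<delta>..})" if "0 < \<delta>" for \<delta>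
 proof (rule bdd_aboveI2)
  fix l assume "l \<in> {1 / \<delta>..}"
  then have "0 < l" using that by (auto intro: less_le_trans[of 0 "1 / \<delta>"])
  then show "W l \<le> B" using W by blast
 qed
 have le: "W l \<le> w \<delta>" if "0 < \<delta>" "1 / \<delta> \<le> l" for l \<delta>
  using that by (auto simp: w_def intro!: cSUP_upper bdd)
 have w0: "0 \<le> w \<delta>" for \<delta>
  using le[of \<delta> "1 / \<delta>"] W[of "1 / \<delta>"] by (cases "\<delta> \<le> 0") (auto simp: w_def)
 have "modulus_of_continuity w"
  unfolding modulus_of_continuity_def
 proof (intro conjI)
  show "mono_on {0..} w"
  proof (rule mono_onI)
   fix r s :: real assume rs: "r \<in> {0..}" "s \<in> {0..}" "r \<le> s"
   show "w r \<le> w s"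
   proof (cases "r \<le> 0")
    case True
    then show ?thesis using w0[of s] by (simp add: w_def)
   next
    case False
    then have "w r = (SUP l\<in>{1 / r..}. W l)" "w s = (SUP l\<in>{1 / s..}. W l)" using rs by (auto simp: w_def)
    moreover have "(SUP l\<in>{1 / r..}. W l) \<le> (SUP l\<in>{1 / s..}. W l)"
     using False rs by (intro cSUP_subset_mono bdd) (auto simp: frac_le)
    ultimately show ?thesis by simp
   qed
  qed
  show "w 0 = 0" by (simp add: w_def)
  show "(w \<longlongrightarrow> 0) (at_right 0)"
  proof (rule order_tendstoI)
   fix e :: real assume e: "0 < e"
   obtain L where L: "L > 0" "\<And>l. L \<le> l \<Longrightarrow> W l \<le> e / 2" using small[of "e / 2"] e by auto
   have "w \<delta> < e" if "0 < \<delta>" "\<delta> < 1 / L" for \<delta>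
   proof -
    have "L \<le> 1 / \<delta>" using that L(1) by (simp add: field_simps)
    then have "(SUP l\<in>{1 / \<delta>..}. W l) \<le> e / 2" by (intro cSUP_least L(2)) auto
    then have "w \<delta> \<le> e / 2" using that by (simp add: w_def)
    then show ?thesis using e by simp
   qed
   then show "eventually (\<lambda>\<delta>. w \<delta> < e) (at_right 0)"
    unfolding eventually_at_right_field using L(1) by (intro exI[of _ "1 / L"]) auto
  qed (use w0 in \<open>auto intro!: always_eventually intro: less_le_trans\<close>)
 qed
 moreover have "W l \<le> w (1 / l)" if "0 < l" for l using le[of "1 / l" l] that by simp
 ultimately show ?thesis using that by blast
qed

lemma exp_minus_le_inverse:
 assumes "0 < (x::real)" shows "exp (- x) \<le> 1 / x"
proof -
 have "x \<le> exp x" using exp_ge_add_one_self[of x] by linarith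
 then show ?thesis unfolding exp_minus inverse_eq_divide using assms by (intro frac_le) auto
qed

lemma relaxation_modulus:
 assumes g: "g \<in> Bor" and g0: "\<And>s. 0 \<le> g s \<and> g s \<le> P" and T: "0 < T"
  and small: "\<And>e. 0 < e \<Longrightarrow> \<exists>d>0. \<forall>s. 0 \<le> s \<longrightarrow> s \<le> d \<longrightarrow> g s \<le> e"
 obtains w where "modulus_of_continuity w" "\<And>l. 0 < l \<Longrightarrow> exp (- l * T) * P + relaxation_weight l T g \<le> w (1 / l)"
proof -
 have P0: "0 \<le> P" using g0[of 0] by auto
 note rw = relaxation_weight_le[OF g, of T P]
 show ?thesis
 proof (rule modulus_of_continuity_SUP[where W="\<lambda>l. exp (- l * T) * P + relaxation_weight l T g" and B="3 * P"])
  fix l :: real assume l: "0 < l"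
  have "relaxation_weight l T g \<le> P + P * exp (- l * T)" "0 \<le> relaxation_weight l T g"
   using g0 l T by (intro rw[of l T P]; simp)+
  moreover have "exp (- l * T) * P \<le> 1 * P" using l T P0 by (intro mult_right_mono) auto
  moreover have "0 \<le> exp (- l * T) * P" using P0 by simp
  ultimately show "0 \<le> exp (- l * T) * P + relaxation_weight l T g \<and> exp (- l * T) * P + relaxation_weight l T g \<le> 3 * P"
   by (simp add: mult.commute)
 next
  fix e :: real assume e: "0 < e"
  obtain d0 where d0: "d0 > 0" "\<And>s. 0 \<le> s \<Longrightarrow> s \<le> d0 \<Longrightarrow> g s \<le> e / 2" using small[of "e / 2"] e by auto
  define d where "d = min d0 T"
  have d: "0 < d" "d \<le> T" "\<And>s. 0 \<le> s \<Longrightarrow> s \<le> d \<Longrightarrow> g s \<le> e / 2" using d0 T by (auto simp: d_def)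
  \<comment> \<open>By exp (-y) \<le> 1 / y, each of the two terms bounded by P * exp (- l * d) is
    at most e / 4; adding 1 keeps L positive when P = 0.\<close>
  define L where "L = 4 * P / (e * d) + 1"
  have L: "L > 0" using P0 e d by (auto simp: L_def intro!: add_nonneg_pos)
  show "\<exists>L>0. \<forall>l\<ge>L. exp (- l * T) * P + relaxation_weight l T g \<le> e"
  proof (intro exI[of _ L] conjI allI impI L)
   fix l assume lL: "L \<le> l"
   then have l: "0 < l" using L by simp
   have "relaxation_weight l T g \<le> e / 2 + P * exp (- l * d)"
    using g0 l d by (intro rw) auto
   moreover have "exp (- l * T) * P \<le> P * exp (- l * d)"
    using l d P0 by (subst mult.commute, intro mult_left_mono) auto
   moreover have "P * exp (- l * d) \<le> e / 4"
   proof -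
    have "P * exp (- l * d) \<le> P * (1 / (l * d))"
     using exp_minus_le_inverse[of "l * d"] l d P0 by (intro mult_left_mono) auto
    also have "\<dots> \<le> e / 4"
    proof -
     have "4 * P / (e * d) \<le> l" using lL by (simp add: L_def)
     then have "4 * P \<le> l * (e * d)" using e d by (simp add: pos_divide_le_eq)
     then show ?thesis using l d by (simp add: field_simps)
    qed
    finally show ?thesis .
   qed
   ultimately show "exp (- l * T) * P + relaxation_weight l T g \<le> e" by simp
  qed
 qed (rule that)
qed

lemma AE_lborel_fst:
 fixes P :: "'a::euclidean_space \<Rightarrow> bool"
 assumes P: "{x. P x} \<in> sets borel" and ae: "AEL x. P x"
 shows "AE z in (lborel :: ('a \<times> 'b::euclidean_space) measure). P (fst z)"
proof (rule AE_lborel_pairI)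
 have "(fst :: 'a \<times> 'b \<Rightarrow> 'a) \<in> measurable borel borel" by measurable
 from measurable_sets[OF this P] show "{z :: 'a \<times> 'b. P (fst z)} \<in> sets borel" by (simp add: vimage_def)
 show "AEL x. AE y in (lborel :: 'b measure). P (fst (x, y))" using ae by eventually_elim simp
qed

lemma kinetic_solution_unique:
 fixes a :: "real \<Rightarrow> real^'n::finite"
 assumes a: "locally_bounded a"
  and U1: "slab_flow T U1" "weak_kinetic ({0<..<T} \<times> UNIV) (\<lambda>\<xi>. (1, a \<xi>)) U1 \<mu>1"
  and U2: "slab_flow T U2" "weak_kinetic ({0<..<T} \<times> UNIV) (\<lambda>\<xi>. (1, a \<xi>)) U2 \<mu>2"
  and init: "AEL x. U1 (0, x) = U2 (0, x)" and t: "t \<in> {0..T}"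
 shows "AEL x. U1 (t, x) = U2 (t, x)"
proof -
 have "(LBINT x. \<bar>U1 (0, x) - U2 (0, x)\<bar>) = 0"
  by (rule integral_eq_zero_AE) (use init in eventually_elim, simp)
 then have "(LBINT x. \<bar>U1 (t, x) - U2 (t, x)\<bar>) \<le> 0"
  using kinetic_contraction[OF a U1 U2, of 0 t 0] t by simp
 moreover have "0 \<le> (LBINT x. \<bar>U1 (t, x) - U2 (t, x)\<bar>)" by simp
 ultimately have "(LBINT x. \<bar>U1 (t, x) - U2 (t, x)\<bar>) = 0" by linarith
 moreover have "lintegrable (\<lambda>x. \<bar>U1 (t, x) - U2 (t, x)\<bar>)"
  using slab_flow_integrable(2)[OF U1(1)] slab_flow_integrable(2)[OF U2(1)] by simp
 ultimately show ?thesis by (subst (asm) integral_nonneg_eq_0_iff_AE) auto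
qed

text \<open>The modulus has to be fixed before M, lam and f0. It is read off from one chosen
  solution; by uniqueness every other solution has the same M almost everywhere at each time. If
  there is none, the claim is empty and the zero modulus serves.\<close>

lemma relaxation_rate_modulus:
 fixes a :: "real \<Rightarrow> real^'n::finite"
 assumes fl: "flux_velocity A a" and u0: "lintegrable u0" and T: "0 < T"
 obtains w where "modulus_of_continuity w"
  "\<And>M u m lam f0 f. kinetic_solution T a u0 M u m \<Longrightarrow> 0 < lam \<Longrightarrow> relaxation_solution T a lam M f0 f \<Longrightarrow>
   V1_norm (\<lambda>z. f T z - M T z) \<le> V1_norm (\<lambda>(x, \<xi>). f0 (x, \<xi>) - chi \<xi> (u0 x)) * exp (- lam * T) + w (1 / lam)"
proof (cases "\<exists>M u m. kinetic_solution T a u0 M u m")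
 case False
 have "modulus_of_continuity (\<lambda>_. 0)" by (simp add: modulus_of_continuity_def mono_on_def)
 then show ?thesis using that False by blast
next
 case True
 then obtain M0 u00 m0 where sol0: "kinetic_solution T a u0 M0 u00 m0" by blast
 have am: "a \<in> Bor" using fl by (simp add: flux_velocity_def)
 have u0m: "u0 \<in> Bor" using u0 by auto
 obtain a' where a': "locally_bounded a'" "AEL \<xi>. a' \<xi> = a \<xi>" by (rule flux_velocity_representative[OF fl])
 obtain U \<mu> where U: "slab_flow T U" "weak_kinetic ({0<..<T} \<times> UNIV) (\<lambda>\<xi>. (1, a' \<xi>)) U \<mu>" "AEL x. U (0, x) = u0 x"
  by (rule kinetic_solution_slab[OF sol0 T a' am u0m]) blast
 have a'm: "a' \<in> Bor" using a'(1) by (simp add: locally_bounded_def)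
 obtain g P where g: "g \<in> Bor" "\<And>s. 0 \<le> g s \<and> g s \<le> P"
  "\<And>e. 0 < e \<Longrightarrow> \<exists>d>0. \<forall>r s. T - d < r \<longrightarrow> r < T \<longrightarrow> 0 \<le> s \<longrightarrow> s \<le> r \<longrightarrow> char_modulus a' U r s \<le> ennreal (g s + e)"
  "\<And>e. 0 < e \<Longrightarrow> \<exists>d>0. \<forall>s. 0 \<le> s \<longrightarrow> s \<le> d \<longrightarrow> g s \<le> e"
  by (rule char_modulus_terminal[OF a'm U(1)]) blast
 obtain w where w: "modulus_of_continuity w" "\<And>l. 0 < l \<Longrightarrow> exp (- l * T) * P + relaxation_weight l T g \<le> w (1 / l)"
  by (rule relaxation_modulus[OF g(1,2) T g(4)]) (assumption, rule that)
 show ?thesis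
 proof (rule that[OF w(1)])
  fix M u m lam f0 f
  assume sol: "kinetic_solution T a u0 M u m" and lam: "0 < lam" and rel: "relaxation_solution T a lam M f0 f"
  obtain U2 \<mu>2 where U2: "slab_flow T U2" "weak_kinetic ({0<..<T} \<times> UNIV) (\<lambda>\<xi>. (1, a' \<xi>)) U2 \<mu>2"
   "\<And>t. t \<in> {0..T} \<Longrightarrow> AEL z. M t z = kchi (snd z) (U2 (t, fst z))" "AEL x. U2 (0, x) = u0 x"
   by (rule kinetic_solution_slab[OF sol T a' am u0m]) blast
  have MU: "AEL z. M t z = kchi (snd z) (U (t, fst z))" if t: "t \<in> {0..T}" for t
  proof -
   have [measurable]: "(\<lambda>x. U (t, x)) \<in> Bor" "(\<lambda>x. U2 (t, x)) \<in> Bor"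
    using slab_flow_integrable(2)[OF U(1)] slab_flow_integrable(2)[OF U2(1)] by auto
   have "AEL x. U2 (0, x) = U (0, x)" using U(3) U2(4) by eventually_elim simp
   from kinetic_solution_unique[OF a'(1) U2(1,2) U(1,2) this t]
   have "AEL x. U2 (t, x) = U (t, x)" .
   moreover have "{x \<in> space borel. U2 (t, x) = U (t, x)} \<in> sets borel" by measurable
   ultimately have "AE z in (lborel :: ((real^'n) \<times> real) measure). U2 (t, fst z) = U (t, fst z)"
    by (intro AE_lborel_fst) auto
   with U2(3)[OF t] show ?thesis by eventually_elim simp
  qed
  have "V1_norm (\<lambda>z. f T z - M T z) \<le> V1_norm (\<lambda>(x, \<xi>). f0 (x, \<xi>) - chi \<xi> (u0 x)) * exp (- lam * T) +
   (exp (- lam * T) * P + relaxation_weight lam T g)"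
   by (rule relaxation_error[OF a' am u0m T lam sol rel U(1) MU g(1) _ g(3)]) (use g(2) in auto)
  then show "V1_norm (\<lambda>z. f T z - M T z) \<le> V1_norm (\<lambda>(x, \<xi>). f0 (x, \<xi>) - chi \<xi> (u0 x)) * exp (- lam * T) + w (1 / lam)"
   using w(2)[OF lam] by linarith
 qed
qed

text \<open>The shift in space and the change in time contribute the same bound, hence the exponent
  d + 3 in place of d + 2.\<close>

lemma BV_char_modulus:
 fixes a :: "real \<Rightarrow> 'b::euclidean_space"
 assumes a: "locally_bounded a"
  and U: "slab_flow T U" and kin: "weak_kinetic ({0<..<T} \<times> UNIV) (\<lambda>\<xi>. (1, a \<xi>)) U \<mu>"
  and K: "\<And>t. t \<in> {0..T} \<Longrightarrow> AEL x. \<bar>U (t, x)\<bar> \<le> K" "0 \<le> K"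
  and V: "0 \<le> V" "\<And>t y. t \<in> {0..T} \<Longrightarrow> (LBINT x. \<bar>U (t, x + y) - U (t, x)\<bar>) \<le> norm y * V"
  and S: "0 \<le> S" "AEL \<xi>. \<bar>\<xi>\<bar> \<le> K \<longrightarrow> norm (a \<xi>) \<le> S"
  and s: "0 \<le> s" "s \<le> r" "r \<le> T"
 shows "char_modulus a U r s \<le> ennreal (2 ^ (DIM('b) + 3) * S * V * s)"
proof -
 have am[measurable]: "a \<in> Bor" using a by (simp add: locally_bounded_def)
 have rs: "r - s \<in> {0..T}" using s by auto
 have 1: "(NINT \<xi>. shift_modulus (\<lambda>x. U (r - s, x)) \<xi> (- (s *\<^sub>R a \<xi>))) \<le> ennreal (2 ^ (DIM('b) + 2) * (s * S) * V)"
 proof (rule averaged_shift_bound[OF slab_flow_integrable(2)[OF U] K(1)[OF rs] V(1) V(2)[OF rs]])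
  show "AEL \<xi>. \<bar>\<xi>\<bar> \<le> K \<longrightarrow> norm (- (s *\<^sub>R a \<xi>)) \<le> s * S"
   using S(2) by eventually_elim (use s in \<open>auto intro: mult_left_mono\<close>)
 qed (use s S in auto)
 have 2: "(NINT x. nabs (U (r - s, x) - U (r, x))) \<le> ennreal (2 ^ (DIM('b) + 2) * S * V * s)"
  using kinetic_time_lipschitz[OF a U kin K V S, of "r - s" r] s slab_flow_integrable(2)[OF U]
  by (subst ennreal_LINT_abs) (auto simp: abs_minus_commute intro: ennreal_leI)
 have "char_modulus a U r s \<le> ennreal (2 ^ (DIM('b) + 2) * (s * S) * V) + ennreal (2 ^ (DIM('b) + 2) * S * V * s)"
  by (rule order_trans[OF char_modulus_shift_before[OF am U] add_mono[OF 1 2]])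
 also have "\<dots> = ennreal (2 ^ (DIM('b) + 2) * (s * S) * V + 2 ^ (DIM('b) + 2) * S * V * s)"
  by (rule ennreal_plus[symmetric]) (use s S V in auto)
 also have "2 ^ (DIM('b) + 2) * (s * S) * V + 2 ^ (DIM('b) + 2) * S * V * s = 2 ^ (DIM('b) + 3) * S * V * s"
  by (simp add: power_add)
 finally show ?thesis .
qed

lemma Linf_norm_AE:
 assumes "Linf_norm lborel u < \<infinity>"
 shows "AEL x. norm (u x) \<le> enn2real (Linf_norm lborel u)"
 using esssup_AE[of "\<lambda>x. ennreal (norm (u x))" lborel]
proof eventually_elim
 case (elim x)
 then have "enn2real (ennreal (norm (u x))) \<le> enn2real (Linf_norm lborel u)"
  unfolding Linf_norm_def[symmetric] by (intro enn2real_mono) (use assms in auto)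
 then show ?case by simp
qed

text \<open>The norm in the statement is over the open interval, the conclusion over the closed one;
  the endpoints are null. Finiteness of the essential supremum has to come first, because
  \<open>enn2real\<close> sends infinity to 0.\<close>

lemma Linf_norm_interval_AE:
 fixes a a' :: "real \<Rightarrow> 'b::euclidean_space"
 assumes a': "locally_bounded a'" and aa': "AEL \<xi>. a' \<xi> = a \<xi>" and a[measurable]: "a \<in> Bor"
 shows "AEL \<xi>. \<bar>\<xi>\<bar> \<le> K \<longrightarrow> norm (a' \<xi>) \<le> enn2real (Linf_norm (restrict_space lborel {-K<..<K}) a)"
proof -
 let ?R = "restrict_space lborel {-K<..<K}" and ?N = "Linf_norm (restrict_space lborel {-K<..<K}) a"
 have AE_R: "(AE \<xi> in ?R. P \<xi>) \<longleftrightarrow> (AEL \<xi>. \<xi> \<in> {-K<..<K} \<longrightarrow> P \<xi>)" for P :: "real \<Rightarrow> bool"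
  by (rule AE_restrict_space_iff) simp
 obtain L where L: "\<And>\<xi>. \<bar>\<xi>\<bar> \<le> K \<Longrightarrow> norm (a' \<xi>) \<le> L" using a' unfolding locally_bounded_def by blast
 have "?N \<le> ennreal L"
  unfolding Linf_norm_def
 proof (rule esssup_I)
  have "(\<lambda>\<xi>. ennreal (norm (a \<xi>))) \<in> BorL" by measurable
  then show "(\<lambda>\<xi>. ennreal (norm (a \<xi>))) \<in> borel_measurable ?R" by (rule measurable_restrict_space1)
  show "AE \<xi> in ?R. ennreal (norm (a \<xi>)) \<le> ennreal L"
   unfolding AE_R using aa'
  proof eventually_elim
   case (elim \<xi>)
   then show ?case using L[of \<xi>] by (auto intro!: ennreal_leI)
  qed
 qed
 then have fin: "?N < \<infinity>" using le_less_trans by fastforce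
 have "AEL \<xi>. \<xi> \<in> {-K<..<K} \<longrightarrow> ennreal (norm (a \<xi>)) \<le> ?N"
  unfolding AE_R[symmetric] Linf_norm_def by (rule esssup_AE)
 then show ?thesis
  using aa' AE_lborel_singleton[of K] AE_lborel_singleton[of "-K"]
 proof eventually_elim
  case (elim \<xi>)
  show ?case
  proof
   assume "\<bar>\<xi>\<bar> \<le> K"
   then have "ennreal (norm (a' \<xi>)) \<le> ?N" using elim by (auto simp: abs_le_iff)
   then have "enn2real (ennreal (norm (a' \<xi>))) \<le> enn2real ?N" by (intro enn2real_mono) (use fin in auto)
   then show "norm (a' \<xi>) \<le> enn2real ?N" by simp
  qed
 qed
qed

text \<open>With x = lam * T: 1 - exp (-x) is at most min x 1, hence at most sqrt x.\<close>

lemma one_minus_exp_le_sqrt: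
 assumes "0 < lam" "0 < T"
 shows "(1 - exp (- lam * T)) / lam \<le> sqrt (T / lam)"
proof -
 define x where "x = lam * T"
 have x: "0 < x" using assms by (simp add: x_def)
 have "1 - exp (- x) \<le> sqrt x"
 proof (cases "x \<le> 1")
  case True
  have "x * x \<le> x * 1" using x True by (intro mult_left_mono) auto
  then have "x \<le> sqrt x" by (intro real_le_rsqrt) (simp add: power2_eq_square)
  then show ?thesis using exp_ge_add_one_self[of "- x"] by linarith
 next
  case False
  then have "1 \<le> sqrt x" by simp
  then show ?thesis using exp_gt_zero[of "- x"] by linarith
 qed
 then have "(1 - exp (- lam * T)) / lam \<le> sqrt x / lam"
  using assms by (intro divide_right_mono) (auto simp: x_def)
 also have "sqrt x / lam = sqrt (T / lam)"
 proof -
  have "sqrt (lam * T) / sqrt (lam * lam) = sqrt (T / lam)"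
   using assms by (subst real_sqrt_divide[symmetric]) simp
  then show ?thesis using assms by (simp add: x_def)
 qed
 finally show ?thesis .
qed

text \<open>Contraction of the solution against its own translates propagates the shift bound of u0,
  and the sup bound limits the relevant speeds to |\<xi>| \<le> K. The defect over a time s is then
  at most B * s, which gives the error B * (1 - exp (- lam * T)) / lam with B linear in the
  variation.\<close>

lemma relaxation_rate_BV:
 fixes a :: "real \<Rightarrow> real^'n::finite"
 assumes fl: "flux_velocity A a" and u0: "lintegrable u0"
  and Linf: "Linf_norm lborel u0 < \<infinity>" and K: "K = enn2real (Linf_norm lborel u0)"
  and BV: "u0 \<in> BV" "BV_norm u0 \<le> R" and T: "0 < T" and sol: "kinetic_solution T a u0 M u m"
  and lam: "0 < lam" and rel: "relaxation_solution T a lam M f0 f"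
 shows "V1_norm (\<lambda>z. f T z - M T z) \<le> V1_norm (\<lambda>(x, \<xi>). f0 (x, \<xi>) - chi \<xi> (u0 x)) * exp (- lam * T) +
  2 ^ (CARD('n) + 3) * sqrt (max R 0) * enn2real (Linf_norm (restrict_space lborel {-K<..<K}) a) * sqrt (T * BV_norm u0 / lam)"
proof -
 have am: "a \<in> Bor" using fl by (simp add: flux_velocity_def)
 have u0m: "u0 \<in> Bor" using u0 by auto
 obtain a' where a': "locally_bounded a'" "AEL \<xi>. a' \<xi> = a \<xi>" by (rule flux_velocity_representative[OF fl])
 obtain U \<mu> where U: "slab_flow T U" "weak_kinetic ({0<..<T} \<times> UNIV) (\<lambda>\<xi>. (1, a' \<xi>)) U \<mu>"
  and MU: "\<And>t. t \<in> {0..T} \<Longrightarrow> AEL z. M t z = kchi (snd z) (U (t, fst z))" and U0: "AEL x. U (0, x) = u0 x"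
  by (rule kinetic_solution_slab[OF sol T a' am u0m]) blast
 define S where "S = enn2real (Linf_norm (restrict_space lborel {-K<..<K}) a)"
 define V where "V = enn2real (total_variation u0)"
 have S: "0 \<le> S" "AEL \<xi>. \<bar>\<xi>\<bar> \<le> K \<longrightarrow> norm (a' \<xi>) \<le> S"
  unfolding S_def using Linf_norm_interval_AE[OF a' am] by auto
 have V0: "0 \<le> V" by (simp add: V_def)
 have K0: "0 \<le> K" by (simp add: K)
 have "AEL x. \<bar>U (0, x)\<bar> \<le> K"
  using U0 Linf_norm_AE[OF Linf] by eventually_elim (simp add: K)
 then have UK: "AEL x. \<bar>U (t, x)\<bar> \<le> K" if "t \<in> {0..T}" for t
  using kinetic_sup_bound[OF a'(1) U K0, of t] that by simp
 have UV: "(LBINT x. \<bar>U (t, x + y) - U (t, x)\<bar>) \<le> norm y * V" if t: "t \<in> {0..T}" for t y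
 proof -
  have U0i: "lintegrable (\<lambda>x. U (0, x))" by (rule slab_flow_integrable(2)[OF U(1)])
  have "(LBINT x. \<bar>U (t, x) - U (t, x + y)\<bar>) \<le> (LBINT x. \<bar>U (0, x) - U (0, x + y)\<bar>)"
   by (rule kinetic_contraction[OF a'(1) U U]) (use t in auto)
  also have "\<dots> = (LBINT x. \<bar>u0 (x + y) - u0 x\<bar>)"
  proof (rule integral_cong_AE)
   have "AE x in distr lborel borel ((+) y). U (0, x) = u0 x"
    by (subst lborel_distr_plus) (rule U0)
   then have "AEL x. U (0, y + x) = u0 (y + x)"
    by (rule AE_distrD[rotated]) measurable
   with U0 show "AEL x. \<bar>U (0, x) - U (0, x + y)\<bar> = \<bar>u0 (x + y) - u0 x\<bar>"
    by eventually_elim (simp add: add.commute abs_minus_commute)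
   have [measurable]: "(\<lambda>x. U (0, x)) \<in> Bor" using U0i by auto
   note [measurable] = u0m
   show "(\<lambda>x. \<bar>U (0, x) - U (0, x + y)\<bar>) \<in> BorL" by measurable
   show "(\<lambda>x. \<bar>u0 (x + y) - u0 x\<bar>) \<in> BorL" by measurable
  qed
  also have "\<dots> \<le> norm y * V" unfolding V_def by (rule BV_shift_bound[OF BV(1)])
  finally show ?thesis by (simp add: abs_minus_commute)
 qed
 define B where "B = 2 ^ (CARD('n) + 3) * S * V"
 have B0: "0 \<le> B" using S V0 by (simp add: B_def)
 have err: "V1_norm (\<lambda>z. f T z - M T z) \<le> V1_norm (\<lambda>(x, \<xi>). f0 (x, \<xi>) - chi \<xi> (u0 x)) * exp (- lam * T) +
  (exp (- lam * T) * (B * T) + relaxation_weight lam T (\<lambda>s. B * s))"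
 proof (rule relaxation_error[OF a' am u0m T lam sol rel U(1) MU])
  show "0 \<le> B * s \<and> B * s \<le> B * T" if "0 \<le> s" "s \<le> T" for s using that B0 by (simp add: mult_left_mono)
  fix e :: real assume e: "0 < e"
  have "char_modulus a' U r s \<le> ennreal (B * s + e)" if "r < T" "0 \<le> s" "s \<le> r" for r s
  proof -
   have "char_modulus a' U r s \<le> ennreal (B * s)"
    using BV_char_modulus[OF a'(1) U UK K0 V0 UV S, of s r] that by (simp add: B_def)
   also have "\<dots> \<le> ennreal (B * s + e)" using e by (intro ennreal_leI) simp
   finally show ?thesis .
  qed
  then show "\<exists>d>0. \<forall>r s. T - d < r \<longrightarrow> r < T \<longrightarrow> 0 \<le> s \<longrightarrow> s \<le> r \<longrightarrow> char_modulus a' U r s \<le> ennreal (B * s + e)"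
   by (intro exI[of _ 1]) auto
 qed auto
 have w: "exp (- lam * T) * (B * T) + relaxation_weight lam T (\<lambda>s. B * s) = B * ((1 - exp (- lam * T)) / lam)"
  unfolding relaxation_weight_linear[OF lam T] by (simp add: algebra_simps)
 have b: "B * ((1 - exp (- lam * T)) / lam) \<le> B * sqrt (T / lam)" by (intro mult_left_mono one_minus_exp_le_sqrt lam T B0)
 have c: "B * sqrt (T / lam) \<le> 2 ^ (CARD('n) + 3) * sqrt (max R 0) * S * sqrt (T * BV_norm u0 / lam)"
 proof -
  have bv: "V \<le> BV_norm u0" "0 \<le> BV_norm u0" by (simp_all add: V_def BV_norm_def)
  \<comment> \<open>B is linear in V but the claim has only the root of the BV norm; the other root
    is absorbed into sqrt (max R 0).\<close>
  have "V \<le> sqrt (BV_norm u0) * sqrt (BV_norm u0)" using bv by simp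
  also have "\<dots> \<le> sqrt (max R 0) * sqrt (BV_norm u0)" using bv BV(2) by (intro mult_right_mono) auto
  finally have "V * sqrt (T / lam) \<le> sqrt (max R 0) * sqrt (BV_norm u0) * sqrt (T / lam)"
   using T lam by (intro mult_right_mono) auto
  also have "\<dots> = sqrt (max R 0) * sqrt (T * BV_norm u0 / lam)"
  proof -
   have "sqrt (BV_norm u0) * sqrt (T / lam) = sqrt (BV_norm u0 * (T / lam))" by (rule real_sqrt_mult[symmetric])
   also have "BV_norm u0 * (T / lam) = T * BV_norm u0 / lam" by simp
   finally show ?thesis by (simp only: mult.assoc)
  qed
  finally have "2 ^ (CARD('n) + 3) * S * (V * sqrt (T / lam)) \<le> 2 ^ (CARD('n) + 3) * S * (sqrt (max R 0) * sqrt (T * BV_norm u0 / lam))"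
   using S by (intro mult_left_mono) auto
  moreover have "B * sqrt (T / lam) = 2 ^ (CARD('n) + 3) * S * (V * sqrt (T / lam))" unfolding B_def by (simp only: mult.assoc)
  moreover have "2 ^ (CARD('n) + 3) * S * (sqrt (max R 0) * sqrt (T * BV_norm u0 / lam)) = 2 ^ (CARD('n) + 3) * sqrt (max R 0) * S * sqrt (T * BV_norm u0 / lam)"
   by (simp only: mult_ac)
  ultimately show ?thesis by (simp only:)
 qed
 show ?thesis
  unfolding S_def[symmetric] by (rule order_trans[OF err[unfolded w] add_left_mono[OF order_trans[OF b c]]])
qed

theorem theorem2p4:
  shows
    "(\<forall>(A :: real \<Rightarrow> real^'n::finite) a u0.
        flux_velocity A a \<and> integrable lborel u0 \<longrightarrow>
        (\<exists>\<omega> :: real \<Rightarrow> real \<Rightarrow> real. (\<forall>T>0. modulus_of_continuity (\<omega> T)) \<and>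
          (\<forall>T M u m lam f0 f.
            0 < T \<and> kinetic_solution T a u0 M u m \<and>
            0 < lam \<and> relaxation_solution T a lam M f0 f \<longrightarrow>
            V1_norm (\<lambda>z. f T z - M T z)
              \<le> V1_norm (\<lambda>(x, \<xi>). f0 (x, \<xi>) - chi \<xi> (u0 x)) * exp (- lam * T)
                + \<omega> T (1 / lam)))) \<and>
     (\<forall>R. \<exists>C.
        \<forall>(A :: real \<Rightarrow> real^'n::finite) a u0 K T M u m lam f0 f.
          flux_velocity A a \<and> integrable lborel u0 \<and>
          Linf_norm lborel u0 < \<infinity> \<and> K = enn2real (Linf_norm lborel u0) \<and>
          u0 \<in> BV \<and> BV_norm u0 \<le> R \<and>
          0 < T \<and> kinetic_solution T a u0 M u m \<and>
          0 < lam \<and> relaxation_solution T a lam M f0 f \<longrightarrow>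
          V1_norm (\<lambda>z. f T z - M T z)
            \<le> V1_norm (\<lambda>(x, \<xi>). f0 (x, \<xi>) - chi \<xi> (u0 x)) * exp (- lam * T)
              + C * enn2real (Linf_norm (restrict_space lborel {-K<..<K}) a)
                  * sqrt (T * BV_norm u0 / lam))"
proof (intro conjI allI impI)
 fix A a :: "real \<Rightarrow> real^'n" and u0 :: "real^'n \<Rightarrow> real"
 assume A: "flux_velocity A a \<and> lintegrable u0"
 \<comment> \<open>Times T \<le> 0 are included with an empty condition, so that a modulus can be
   chosen for every real T at once.\<close>
 define Q where "Q T w \<longleftrightarrow> (0 < T \<longrightarrow> modulus_of_continuity w \<and> (\<forall>M u m lam f0 f.
   kinetic_solution T a u0 M u m \<and> 0 < lam \<and> relaxation_solution T a lam M f0 f \<longrightarrow>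
   V1_norm (\<lambda>z. f T z - M T z) \<le> V1_norm (\<lambda>(x, \<xi>). f0 (x, \<xi>) - chi \<xi> (u0 x)) * exp (- lam * T) + w (1 / lam)))" for T w
 have "\<exists>w. Q T w" for T
 proof (cases "0 < T")
  case True
  show ?thesis
   by (rule relaxation_rate_modulus[of A a u0 T]) (use A True in \<open>auto simp: Q_def\<close>)
 qed (simp add: Q_def)
 then have "\<forall>T. \<exists>w. Q T w" by blast
 from choice[OF this] obtain \<omega> where \<omega>: "\<forall>T. Q T (\<omega> T)" by blast
 show "\<exists>\<omega> :: real \<Rightarrow> real \<Rightarrow> real. (\<forall>T>0. modulus_of_continuity (\<omega> T)) \<and>
   (\<forall>T M u m lam f0 f. 0 < T \<and> kinetic_solution T a u0 M u m \<and> 0 < lam \<and> relaxation_solution T a lam M f0 f \<longrightarrow>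
    V1_norm (\<lambda>z. f T z - M T z) \<le> V1_norm (\<lambda>(x, \<xi>). f0 (x, \<xi>) - chi \<xi> (u0 x)) * exp (- lam * T) + \<omega> T (1 / lam))"
  using \<omega> unfolding Q_def by (intro exI[of _ \<omega>]) blast
next
 fix R :: real
 show "\<exists>C. \<forall>(A :: real \<Rightarrow> real^'n) a u0 K T M u m lam f0 f.
     flux_velocity A a \<and> lintegrable u0 \<and>
     Linf_norm lborel u0 < \<infinity> \<and> K = enn2real (Linf_norm lborel u0) \<and>
     u0 \<in> BV \<and> BV_norm u0 \<le> R \<and>
     0 < T \<and> kinetic_solution T a u0 M u m \<and>
     0 < lam \<and> relaxation_solution T a lam M f0 f \<longrightarrow>
     V1_norm (\<lambda>z. f T z - M T z)
      \<le> V1_norm (\<lambda>(x, \<xi>). f0 (x, \<xi>) - chi \<xi> (u0 x)) * exp (- lam * T)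
       + C * enn2real (Linf_norm (restrict_space lborel {-K<..<K}) a) * sqrt (T * BV_norm u0 / lam)"
  by (intro exI[of _ "2 ^ (CARD('n) + 3) * sqrt (max R 0)"] allI impI) (elim conjE, rule relaxation_rate_BV)
qed

end
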